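(* Let $(M,H)$ be an $n$-dimensional Carnot manifold, $a\in M$, and $X=(X_1,\ldots,X_n)$ an $H$-frame near $a$. Let $(x_1,\ldots,x_n)$ be Carnot coordinates at $a$ adapted to the $H$-frame $(X_1,\ldots,X_n)$. Then, in these coordinates and near $(x,y)=(0,0)$, $$\varepsilon_y^X(x)=(-y)\cdot x+\mathrm{O}_w\left(\|(x,y)\|^{w+1}\right),$$ $$\left(\varepsilon_y^X\right)^{-1}(x)=y\cdot x+\mathrm{O}_w\left(\|(x,y)\|^{w+1}\right),$$ where $\cdot$ is the group law of $G(a)$ and $\varepsilon_y^X$ is the $\varepsilon$-Carnot coordinate map at $y$ associated with these coordinates and the frame $X$.
   Context: A Carnot manifold of step $r$ is an $n$-manifold $M$ with a filtration by subbundles $H_1\subset\cdots\subset H_r=TM$ such that the Lie bracket of local sections of $H_w$ and $H_{w'}$ is a section of $H_{w+w'}$ whenever $w+w'\le r$. Weights: $w_j=\min\{w: j\le\mathrm{rk}\,H_w\}$. An $H$-frame near $a$ is a tangent frame $(X_1,\ldots,X_n)$ near $a$ with each $X_j$ a section of $H_{w_j}$; then $[X_i,X_j]=\sum_{w_k\le w_i+w_j}L_{ij}^kX_k$ with smooth functions $L_{ij}^k$. For $\alpha\in\mathbb{N}_0^n$: $|\alpha|=\sum\alpha_j$, $\langle\alpha\rangle=\sum w_j\alpha_j$. Dilations: $\delta_t(x)=t\cdot x=(t^{w_1}x_1,\ldots,t^{w_n}x_n)$ on $\mathbb{R}^n$ and $t\cdot(x,y)=(t\cdot x,t\cdot y)$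 on $\mathbb{R}^n\times\mathbb{R}^n$; $\delta_t^*(\sum a_j(x)\partial_j)=\sum t^{-w_j}a_j(t\cdot x)\partial_j$. $\|\cdot\|$ on $\mathbb{R}^n\times\mathbb{R}^n$ is a continuous function, positive off $0$, with $\|t\cdot(x,y)\|=|t|\|(x,y)\|$, e.g. $\sum_j(|x_j|^{1/w_j}+|y_j|^{1/w_j})$. A smooth map $\Theta(x,y)\in\mathbb{R}^n$ near $(0,0)$ is $\mathrm{O}_w(\|(x,y)\|^{w+m})$ if $\Theta_j(x,y)=\mathrm{O}(\|(x,y)\|^{w_j+m})$ near $(0,0)$ for $j=1,\ldots,n$. Order and privileged coordinates: for $I=(i_1,\ldots,i_k)$, $k\ge0$: $X_I=X_{i_1}\cdots X_{i_k}$, $\langle I\rangle=\sum_l w_{i_l}$. A smooth $f$ has order $N$ at a point $p$ if $X_If(p)=0$ whenever $\langle I\rangle<N$ and $X_If(p)\neq0$ for some $I$ with $\langle I\rangle=N$. Coordinates centered at $p$ are linearly adapted if $X_j(0)=\partial_j$ for all $j$, and privileged at $p$ if moreover each $x_j$ has order $w_j$ at $p$. In privileged coordinates $t^{w_j}\delta_t^*X_j$ converges as $t\to0$ ($C^\infty$ on compact sets) to a polynomial vector field $X_j^{(p)}$ on $\mathbb{R}^n$ (model vector field). The group $G(a)$ is $\mathbb{R}^n$ with the Dynkin (Baker-Campbell-Hausdorff) product $x\cdot y=x+y+\frac12[x,y]+\frac1{12}([x,[x,y]]+[y,[y,x]])+\cdots$ (finite sum) for the nilpotent Lie bracket on $\mathbb{R}^n$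 with $[\epsilon_i,\epsilon_j]=\sum_{w_k=w_i+w_j}L_{ij}^k(a)\epsilon_k$ (zero if $w_i+w_j>r$) on the canonical basis. $X_j^a$ is the left-invariant vector field on $G(a)$ with $X_j^a(0)=\partial_j$. Carnot coordinates at $a$ are privileged coordinates at $a$ in which the model vector field of $X_j$ is $X_j^a$ for every $j$. The $\varepsilon$-Carnot coordinate map at a point $p$ in given local coordinates: $T_p$ is the unique affine map such that $x\mapsto T_p(x)$ gives coordinates centered at $p$ and linearly adapted; $\hat\psi_p$ is the unique polynomial map with components $\hat\psi_p(z)_k=z_k+\sum_{\langle\alpha\rangle<w_k,|\alpha|\ge2}a_{k\alpha}z^\alpha$ converting these coordinates into privileged coordinates at $p$ (known to exist); $\psi_p=\hat\psi_p\circ T_p$; $X_j^{(p)}$ are the model vector fields in the coordinates given by $\psi_p$; $\exp_{X^{(p)}}(x)$ is the time-one flow of $\sum x_jX_j^{(p)}$ starting at $0$, a diffeomorphism of $\mathbb{R}^n$. Then $\varepsilon_p^X=\exp_{X^{(p)}}^{-1}\circ\psi_p:\mathbb{R}^n\to\mathbb{R}^n$, a diffeomorphism. *)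

theory Defs
  imports "HOL-Analysis.Analysis"
begin

section \<open>Smooth maps and vector fields on open subsets of Euclidean space\<close>

text \<open>
  These notions are meant for open sets \<open>S\<close>. Only the values of \<open>f\<close> on \<open>S\<close> matter then.
\<close>

fun Ck_on :: "nat \<Rightarrow> 'a::real_normed_vector set \<Rightarrow> ('a \<Rightarrow> 'b::real_normed_vector) \<Rightarrow> bool" where
  "Ck_on 0 S f \<longleftrightarrow> continuous_on S f"
| "Ck_on (Suc k) S f \<longleftrightarrow>
     (\<forall>x\<in>S. f differentiable (at x)) \<and>
     (\<forall>v. Ck_on k S (\<lambda>x. frechet_derivative f (at x) v))"

definition smooth_on :: "'a::real_normed_vector set \<Rightarrow> ('a \<Rightarrow> 'b::real_normed_vector) \<Rightarrow> bool" where
  "smooth_on S f \<longleftrightarrow> (\<forall>k. Ck_on k S f)"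

definition lie_derivative :: "(real^'n \<Rightarrow> real^'n) \<Rightarrow> (real^'n \<Rightarrow> real) \<Rightarrow> real^'n \<Rightarrow> real" where
  "lie_derivative V f x = frechet_derivative f (at x) (V x)"

definition lie_bracket ::
    "(real^'n \<Rightarrow> real^'n) \<Rightarrow> (real^'n \<Rightarrow> real^'n) \<Rightarrow> real^'n \<Rightarrow> real^'n" where
  "lie_bracket V W x =
     frechet_derivative W (at x) (V x) - frechet_derivative V (at x) (W x)"


section \<open>Manifolds, vector fields and subbundles\<close>

text \<open>
  A chart is a domain together with a map into \<open>\<real>\<^sup>n\<close>, \<open>n = CARD('n)\<close>; the values of the map off the
  domain are irrelevant. A smooth manifold is a Hausdorff, second countable space (these are
  sort constraints on \<open>'m\<close> in the statements) with a maximal smooth atlas.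
\<close>

type_synonym ('m, 'n) chart = "'m set \<times> ('m \<Rightarrow> real^'n)"

definition chart_inv :: "('m, 'n) chart \<Rightarrow> real^'n \<Rightarrow> 'm" where
  "chart_inv c = inv_into (fst c) (snd c)"

definition is_chart :: "('m::topological_space, 'n::finite) chart \<Rightarrow> bool" where
  "is_chart c \<longleftrightarrow> open (fst c) \<and> open (snd c ` fst c) \<and>
     homeomorphism (fst c) (snd c ` fst c) (snd c) (chart_inv c)"

definition transition :: "('m, 'n) chart \<Rightarrow> ('m, 'n) chart \<Rightarrow> real^'n \<Rightarrow> real^'n" where
  "transition c c' = snd c' \<circ> chart_inv c"

definition compatible :: "('m, 'n::finite) chart \<Rightarrow> ('m, 'n) chart \<Rightarrow> bool" where
  "compatible c c' \<longleftrightarrow>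
     smooth_on (snd c ` (fst c \<inter> fst c')) (transition c c') \<and>
     smooth_on (snd c' ` (fst c \<inter> fst c')) (transition c' c)"

definition smooth_structure :: "('m::topological_space, 'n::finite) chart set \<Rightarrow> bool" where
  "smooth_structure A \<longleftrightarrow>
     (\<forall>c\<in>A. is_chart c) \<and> (\<Union>c\<in>A. fst c) = UNIV \<and>
     (\<forall>c\<in>A. \<forall>c'\<in>A. compatible c c') \<and>
     (\<forall>c. is_chart c \<and> (\<forall>c'\<in>A. compatible c c') \<longrightarrow> c \<in> A)"

text \<open>
  A tangent vector at \<open>p\<close> is represented by its component vectors in all charts around \<open>p\<close>, related
  by the differentials of the transition maps. Accordingly \<open>Y c p\<close> is the component vector, in the
  chart \<open>c\<close>, of the value at \<open>p\<close> of the vector field \<open>Y\<close>, and \<open>E c p\<close> is the set of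
  component vectors, in the chart \<open>c\<close>, of the elements of the fibre at \<open>p\<close> of the bundle \<open>E\<close>.
\<close>

type_synonym ('m, 'n) vfield = "('m, 'n) chart \<Rightarrow> 'm \<Rightarrow> real^'n"
type_synonym ('m, 'n) distribution = "('m, 'n) chart \<Rightarrow> 'm \<Rightarrow> (real^'n) set"

definition in_chart :: "('m, 'n) chart \<Rightarrow> ('m, 'n) vfield \<Rightarrow> real^'n \<Rightarrow> real^'n" where
  "in_chart c Y = (\<lambda>x. Y c (chart_inv c x))"

definition smooth_vfield ::
    "('m::topological_space, 'n::finite) chart set \<Rightarrow> 'm set \<Rightarrow> ('m, 'n) vfield \<Rightarrow> bool" where
  "smooth_vfield A V Y \<longleftrightarrow>
     (\<forall>c\<in>A. \<forall>c'\<in>A. \<forall>p\<in>V \<inter> fst c \<inter> fst c'.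
        Y c' p = frechet_derivative (transition c c') (at (snd c p)) (Y c p)) \<and>
     (\<forall>c\<in>A. smooth_on (snd c ` (V \<inter> fst c)) (in_chart c Y))"

definition vfield_bracket :: "('m, 'n::finite) vfield \<Rightarrow> ('m, 'n) vfield \<Rightarrow> ('m, 'n) vfield" where
  "vfield_bracket Y Z = (\<lambda>c p. lie_bracket (in_chart c Y) (in_chart c Z) (snd c p))"

definition subbundle ::
    "('m::topological_space, 'n::finite) chart set \<Rightarrow> nat \<Rightarrow> ('m, 'n) distribution \<Rightarrow> bool" where
  "subbundle A k E \<longleftrightarrow>
     (\<forall>c\<in>A. \<forall>p\<in>fst c. subspace (E c p) \<and> dim (E c p) = k) \<and>
     (\<forall>c\<in>A. \<forall>c'\<in>A. \<forall>p\<in>fst c \<inter> fst c'.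
        E c' p = frechet_derivative (transition c c') (at (snd c p)) ` E c p) \<and>
     (\<forall>p. \<exists>V Y. open V \<and> p \<in> V \<and> (\<forall>i<k. smooth_vfield A V (Y i)) \<and>
        (\<forall>c\<in>A. \<forall>q\<in>V \<inter> fst c. E c q = span ((\<lambda>i. Y i c q) ` {..<k})))"

definition bundle_rank ::
    "('m::topological_space, 'n::finite) chart set \<Rightarrow> ('m, 'n) distribution \<Rightarrow> nat" where
  "bundle_rank A E = (THE k. subbundle A k E)"

definition smooth_section ::
    "('m::topological_space, 'n::finite) chart set \<Rightarrow> ('m, 'n) distribution \<Rightarrow> 'm set
      \<Rightarrow> ('m, 'n) vfield \<Rightarrow> bool" where
  "smooth_section A E V Y \<longleftrightarrow>
     smooth_vfield A V Y \<and> (\<forall>c\<in>A. \<forall>p\<in>V \<inter> fst c. Y c p \<in> E c p)"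


section \<open>Carnot manifolds and \<open>H\<close>-frames\<close>

definition carnot_manifold ::
    "('m::topological_space, 'n::finite) chart set \<Rightarrow> nat \<Rightarrow> (nat \<Rightarrow> ('m, 'n) distribution) \<Rightarrow> bool" where
  "carnot_manifold A r H \<longleftrightarrow>
     smooth_structure A \<and> 1 \<le> r \<and>
     (\<forall>w\<in>{1..r}. \<exists>k. subbundle A k (H w)) \<and>
     (\<forall>w\<in>{1..<r}. \<forall>c\<in>A. \<forall>p\<in>fst c. H w c p \<subseteq> H (Suc w) c p) \<and>
     (\<forall>c\<in>A. \<forall>p\<in>fst c. H r c p = UNIV) \<and>
     (\<forall>w\<ge>1. \<forall>w'\<ge>1. \<forall>V Y Z. w + w' \<le> r \<and> open V \<and>
        smooth_section A (H w) V Y \<and> smooth_section A (H w') V Z \<longrightarrow>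
        smooth_section A (H (w + w')) V (vfield_bracket Y Z))"

text \<open>The linear order on \<open>'n\<close> plays the role of \<open>1 < \<dots> < n\<close>, so \<open>j\<close> has position \<open>card {..j}\<close>.\<close>

definition weight ::
    "('m::topological_space, 'n::{finite,linorder}) chart set \<Rightarrow> (nat \<Rightarrow> ('m, 'n) distribution)
      \<Rightarrow> 'n \<Rightarrow> nat" where
  "weight A H j = (LEAST w. 1 \<le> w \<and> card {..j} \<le> bundle_rank A (H w))"

definition H_frame ::
    "('m::topological_space, 'n::{finite,linorder}) chart set \<Rightarrow> (nat \<Rightarrow> ('m, 'n) distribution)
      \<Rightarrow> 'm set \<Rightarrow> ('n \<Rightarrow> ('m, 'n) vfield) \<Rightarrow> bool" where
  "H_frame A H V X \<longleftrightarrow>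
     (\<forall>j. smooth_section A (H (weight A H j)) V (X j)) \<and>
     (\<forall>c\<in>A. \<forall>p\<in>V \<inter> fst c. inj (\<lambda>j. X j c p) \<and> independent (range (\<lambda>j. X j c p)))"


section \<open>Dilations and weighted asymptotics\<close>

text \<open>From here on \<open>w :: 'n \<Rightarrow> nat\<close> is the family of weights.\<close>

definition dil :: "('n \<Rightarrow> nat) \<Rightarrow> real \<Rightarrow> real^'n \<Rightarrow> real^'n" where
  "dil w t x = (\<chi> j. t ^ w j * x $ j)"

definition dil_pullback ::
    "('n \<Rightarrow> nat) \<Rightarrow> real \<Rightarrow> (real^'n \<Rightarrow> real^'n) \<Rightarrow> real^'n \<Rightarrow> real^'n" where
  "dil_pullback w t V x = (\<chi> j. V (dil w t x) $ j / t ^ w j)"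

definition homogeneous_gauge :: "('n::finite \<Rightarrow> nat) \<Rightarrow> ((real^'n) \<times> (real^'n) \<Rightarrow> real) \<Rightarrow> bool" where
  "homogeneous_gauge w N \<longleftrightarrow>
     continuous_on UNIV N \<and> (\<forall>z. z \<noteq> 0 \<longrightarrow> N z > 0) \<and>
     (\<forall>t x y. N (dil w t x, dil w t y) = \<bar>t\<bar> * N (x, y))"

definition O_weighted ::
    "('n::finite \<Rightarrow> nat) \<Rightarrow> ((real^'n) \<times> (real^'n) \<Rightarrow> real) \<Rightarrow> nat
      \<Rightarrow> ((real^'n) \<times> (real^'n) \<Rightarrow> real^'n) \<Rightarrow> bool" where
  "O_weighted w N m \<Theta> \<longleftrightarrow>
     (\<exists>S. open S \<and> (0, 0) \<in> S \<and> smooth_on S \<Theta>) \<and>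
     (\<forall>j. (\<lambda>z. \<Theta> z $ j) \<in> O[nhds (0, 0)](\<lambda>z. N z ^ (w j + m)))"


section \<open>Order and privileged coordinates\<close>

text \<open>
  Let \<open>X\<close> be a frame of vector fields on an open set of \<open>\<real>\<^sup>n\<close>. The notions below depend only
  on the germ of \<open>X\<close> at the point \<open>p\<close> in question.
\<close>

definition iterated_derivative ::
    "('n \<Rightarrow> real^'n \<Rightarrow> real^'n) \<Rightarrow> 'n list \<Rightarrow> (real^'n \<Rightarrow> real) \<Rightarrow> real^'n \<Rightarrow> real" where
  "iterated_derivative X I f = foldr (\<lambda>i. lie_derivative (X i)) I f"

definition has_order ::
    "('n \<Rightarrow> nat) \<Rightarrow> ('n \<Rightarrow> real^'n \<Rightarrow> real^'n) \<Rightarrow> real^'n \<Rightarrow> nat \<Rightarrow> (real^'n \<Rightarrow> real) \<Rightarrow> bool" where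
  "has_order w X p N f \<longleftrightarrow>
     (\<forall>I. sum_list (map w I) < N \<longrightarrow> iterated_derivative X I f p = 0) \<and>
     (\<exists>I. sum_list (map w I) = N \<and> iterated_derivative X I f p \<noteq> 0)"

text \<open>
  Below, \<open>\<psi>\<close> is a change of coordinates near \<open>p\<close>. At the centre the new components of \<open>X j\<close> are
  \<open>D\<psi>(p) (X j p)\<close>, and the new coordinate functions are the components of \<open>\<psi>\<close>.
\<close>

definition linearly_adapted ::
    "('n::finite \<Rightarrow> real^'n \<Rightarrow> real^'n) \<Rightarrow> real^'n \<Rightarrow> (real^'n \<Rightarrow> real^'n) \<Rightarrow> bool" where
  "linearly_adapted X p \<psi> \<longleftrightarrow>
     \<psi> p = 0 \<and> (\<forall>j. frechet_derivative \<psi> (at p) (X j p) = axis j 1)"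

definition privileged ::
    "('n::finite \<Rightarrow> nat) \<Rightarrow> ('n \<Rightarrow> real^'n \<Rightarrow> real^'n) \<Rightarrow> real^'n \<Rightarrow> (real^'n \<Rightarrow> real^'n) \<Rightarrow> bool" where
  "privileged w X p \<psi> \<longleftrightarrow>
     linearly_adapted X p \<psi> \<and> (\<forall>j. has_order w X p (w j) (\<lambda>x. \<psi> x $ j))"

definition pushforward ::
    "(real^'n \<Rightarrow> real^'n) \<Rightarrow> (real^'n \<Rightarrow> real^'n) \<Rightarrow> real^'n \<Rightarrow> real^'n" where
  "pushforward \<psi> V z = frechet_derivative \<psi> (at (inv \<psi> z)) (V (inv \<psi> z))"

text \<open>
  The model vector field of \<open>X j\<close>, where \<open>V\<close> is the expression of \<open>X j\<close> in privileged coordinates.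
\<close>

definition model_field ::
    "('n::finite \<Rightarrow> nat) \<Rightarrow> 'n \<Rightarrow> (real^'n \<Rightarrow> real^'n) \<Rightarrow> real^'n \<Rightarrow> real^'n" where
  "model_field w j V z = Lim (at 0) (\<lambda>t::real. t ^ w j *\<^sub>R dil_pullback w t V z)"


section \<open>The group \<open>G(a)\<close> and Carnot coordinates\<close>

definition structure_fun ::
    "('n::finite \<Rightarrow> real^'n \<Rightarrow> real^'n) \<Rightarrow> real^'n \<Rightarrow> 'n \<Rightarrow> 'n \<Rightarrow> 'n \<Rightarrow> real" where
  "structure_fun X p i j =
     (THE L. lie_bracket (X i) (X j) p = (\<Sum>k\<in>UNIV. L k *\<^sub>R X k p))"

definition graded_bracket ::
    "('n::finite \<Rightarrow> nat) \<Rightarrow> ('n \<Rightarrow> real^'n \<Rightarrow> real^'n) \<Rightarrow> real^'n \<Rightarrow> real^'n \<Rightarrow> real^'n \<Rightarrow> real^'n" where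
  "graded_bracket w X p u v =
     (\<chi> k. \<Sum>i\<in>UNIV. \<Sum>j\<in>UNIV.
        if w i + w j = w k then structure_fun X p i j k * u $ i * v $ j else 0)"

text \<open>Right-nested brackets \<open>[u\<^sub>1, [u\<^sub>2, \<dots> [u\<^sub>m\<^sub>-\<^sub>1, u\<^sub>m] \<dots>]]\<close>.\<close>

fun nested_bracket :: "('a \<Rightarrow> 'a \<Rightarrow> 'a) \<Rightarrow> 'a::zero list \<Rightarrow> 'a" where
  "nested_bracket br [] = 0"
| "nested_bracket br [u] = u"
| "nested_bracket br (u # v # us) = br u (nested_bracket br (v # us))"

text \<open>
  Dynkin's formula
  \<open>x \<cdot> y = \<Sum> (-1)\<^sup>m\<^sup>-\<^sup>1 / m * [x\<^sup>r\<^sup>1 y\<^sup>s\<^sup>1 \<dots> x\<^sup>r\<^sup>m y\<^sup>s\<^sup>m] / ((\<Sum>(r\<^sub>i + s\<^sub>i)) * \<Prod>(r\<^sub>i! * s\<^sub>i!))\<close>,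
  the sum being over all \<open>m \<ge> 1\<close> and all lists \<open>[(r\<^sub>1, s\<^sub>1), \<dots>, (r\<^sub>m, s\<^sub>m)]\<close> of pairs different from \<open>(0, 0)\<close>.
  For a bracket that is nilpotent of step \<open>r\<close> the terms of degree \<open>\<Sum>(r\<^sub>i + s\<^sub>i) > r\<close> vanish;
  discarding them makes the sum finite. It begins with \<open>x + y + 1/2 [x, y]\<close>.
\<close>

definition dynkin_product ::
    "nat \<Rightarrow> ('a \<Rightarrow> 'a \<Rightarrow> 'a) \<Rightarrow> 'a::real_vector \<Rightarrow> 'a \<Rightarrow> 'a" where
  "dynkin_product r br x y =
     (\<Sum>ps\<in>{ps :: (nat \<times> nat) list. ps \<noteq> [] \<and> (0, 0) \<notin> set ps \<and> (\<Sum>(k, l)\<leftarrow>ps. k + l) \<le> r}.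
        ((-1) ^ (length ps - 1) / real (length ps) /
          (real (\<Sum>(k, l)\<leftarrow>ps. k + l) * (\<Prod>(k, l)\<leftarrow>ps. fact k * fact l))) *\<^sub>R
        nested_bracket br (concat (map (\<lambda>(k, l). replicate k x @ replicate l y) ps)))"

definition group_law ::
    "nat \<Rightarrow> ('n::finite \<Rightarrow> nat) \<Rightarrow> ('n \<Rightarrow> real^'n \<Rightarrow> real^'n) \<Rightarrow> real^'n \<Rightarrow> real^'n \<Rightarrow> real^'n \<Rightarrow> real^'n" where
  "group_law r w X p = dynkin_product r (graded_bracket w X p)"

definition left_invariant ::
    "(real^'n \<Rightarrow> real^'n \<Rightarrow> real^'n) \<Rightarrow> (real^'n \<Rightarrow> real^'n) \<Rightarrow> bool" where
  "left_invariant mul V \<longleftrightarrow>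
     (\<forall>x y. V (mul x y) = frechet_derivative (mul x) (at y) (V y))"

text \<open>
  The coordinates \<open>c\<close> are Carnot coordinates at \<open>a\<close>: they are privileged at \<open>a\<close>, and each model
  field is the left-invariant field on \<open>G(a)\<close> with value \<open>\<partial>\<^sub>j\<close> at \<open>0\<close>. The coordinate change relative
  to \<open>c\<close> itself is the identity.
\<close>

definition carnot_coordinates ::
    "('m::topological_space, 'n::{finite,linorder}) chart set \<Rightarrow> nat \<Rightarrow> (nat \<Rightarrow> ('m, 'n) distribution)
      \<Rightarrow> ('n \<Rightarrow> ('m, 'n) vfield) \<Rightarrow> 'm \<Rightarrow> ('m, 'n) chart \<Rightarrow> bool" where
  "carnot_coordinates A r H X a c \<longleftrightarrow>
     (let w = weight A H; Y = (\<lambda>j. in_chart c (X j)) in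
       c \<in> A \<and> a \<in> fst c \<and> snd c a = 0 \<and>
       privileged w Y 0 (\<lambda>x. x) \<and>
       (\<forall>j. left_invariant (group_law r w Y 0) (model_field w j (Y j)) \<and>
            model_field w j (Y j) 0 = axis j 1))"


section \<open>The \<open>\<epsilon>\<close>-Carnot coordinate map\<close>

definition affine_coords ::
    "('n::finite \<Rightarrow> real^'n \<Rightarrow> real^'n) \<Rightarrow> real^'n \<Rightarrow> real^'n \<Rightarrow> real^'n" where
  "affine_coords X p =
     (THE T. (\<exists>L b. linear L \<and> T = (\<lambda>x. L x + b)) \<and> linearly_adapted X p T)"

text \<open>The maps \<open>z\<^sub>k + \<Sum> a\<^sub>k\<^sub>\<alpha> z\<^sup>\<alpha>\<close>, the sum being over \<open>\<langle>\<alpha>\<rangle> < w\<^sub>k\<close>, \<open>\<bar>\<alpha>\<bar> \<ge> 2\<close>.\<close>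

definition lower_order_polynomial ::
    "('n::finite \<Rightarrow> nat) \<Rightarrow> (real^'n \<Rightarrow> real^'n) \<Rightarrow> bool" where
  "lower_order_polynomial w g \<longleftrightarrow>
     (\<exists>a :: 'n \<Rightarrow> ('n \<Rightarrow> nat) \<Rightarrow> real. \<forall>z k.
        g z $ k = z $ k +
          (\<Sum>\<alpha>\<in>{\<alpha>. (\<Sum>j\<in>UNIV. w j * \<alpha> j) < w k \<and> 2 \<le> (\<Sum>j\<in>UNIV. \<alpha> j)}.
             a k \<alpha> * (\<Prod>j\<in>UNIV. z $ j ^ \<alpha> j)))"

definition psi_hat ::
    "('n::finite \<Rightarrow> nat) \<Rightarrow> ('n \<Rightarrow> real^'n \<Rightarrow> real^'n) \<Rightarrow> real^'n \<Rightarrow> real^'n \<Rightarrow> real^'n" where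
  "psi_hat w X p =
     (THE g. lower_order_polynomial w g \<and> privileged w X p (g \<circ> affine_coords X p))"

definition psi ::
    "('n::finite \<Rightarrow> nat) \<Rightarrow> ('n \<Rightarrow> real^'n \<Rightarrow> real^'n) \<Rightarrow> real^'n \<Rightarrow> real^'n \<Rightarrow> real^'n" where
  "psi w X p = psi_hat w X p \<circ> affine_coords X p"

definition model_field_at ::
    "('n::finite \<Rightarrow> nat) \<Rightarrow> ('n \<Rightarrow> real^'n \<Rightarrow> real^'n) \<Rightarrow> real^'n \<Rightarrow> 'n \<Rightarrow> real^'n \<Rightarrow> real^'n" where
  "model_field_at w X p j = model_field w j (pushforward (psi w X p) (X j))"

definition time_one_flow :: "(real^'n \<Rightarrow> real^'n) \<Rightarrow> real^'n \<Rightarrow> real^'n" where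
  "time_one_flow V x0 =
     (THE y. \<exists>\<gamma>. \<gamma> 0 = x0 \<and> \<gamma> 1 = y \<and>
        (\<forall>t\<in>{0..1::real}. (\<gamma> has_vector_derivative V (\<gamma> t)) (at t within {0..1})))"

definition exp_model ::
    "('n::finite \<Rightarrow> nat) \<Rightarrow> ('n \<Rightarrow> real^'n \<Rightarrow> real^'n) \<Rightarrow> real^'n \<Rightarrow> real^'n \<Rightarrow> real^'n" where
  "exp_model w X p x = time_one_flow (\<lambda>z. \<Sum>j\<in>UNIV. x $ j *\<^sub>R model_field_at w X p j z) 0"

definition carnot_eps ::
    "('n::finite \<Rightarrow> nat) \<Rightarrow> ('n \<Rightarrow> real^'n \<Rightarrow> real^'n) \<Rightarrow> real^'n \<Rightarrow> real^'n \<Rightarrow> real^'n" where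
  "carnot_eps w X p = inv (exp_model w X p) \<circ> psi w X p"

end

theory Submission
  imports Defs
begin

text \<open>
  The map \<open>\<epsilon>\<^sub>y\<close> depends on the frame only through finitely many iterated derivatives of the coordinate
  functions along the frame at the base point, and this dependence is polynomial up to the inverse
  of the determinant of the frame: \<open>\<psi>\<^sub>y\<close> is obtained by solving triangular linear systems, and the
  exponential map of the model frame by solving a triangular polynomial differential equation.
  Hence the components of \<open>\<epsilon>\<^sub>y(x)\<close> and of its inverse belong to every algebra of functions of a parameter
  which contains these data. The algebra of smooth functions gives smoothness in \<open>(x, y)\<close>. For the
  estimate, the rescaled frames \<open>X\<^sub>j\<^sup>t = t\<^bsup>w\<^sub>j\<^esup> \<delta>\<^sub>t\<^sup>* X\<^sub>j\<close> have iterated derivatives which differ from those of the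
  left-invariant model frame by \<open>O(t)\<close>, and so the algebra of bounded functions \<open>h\<close> of \<open>t\<close> and further
  variables with \<open>h(t) - h(0) = O(t)\<close> applies. For the model frame \<open>\<epsilon>\<^sub>y(x)\<close> is \<open>(-y) \<cdot> x\<close>, and for \<open>X\<^sup>t\<close> it is
  \<open>t\<^sup>-\<^sup>1 \<cdot> \<epsilon>\<^bsub>t\<cdot>y\<^esub>(t \<cdot> x)\<close> in terms of the map of \<open>X\<close>; taking \<open>t = \<parallel>(x, y)\<parallel>\<close> turns the first-order error
  in \<open>t\<close> into the weighted error.
\<close>

section \<open>Calculus of smooth functions\<close>

text \<open>Jets are taken along the frame, not in coordinates, because they rescale exactly: the
  word \<open>I\<close> acquires the factor \<open>t ^ sum_list (map w I)\<close>. Order is a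
  condition on all words, whereas expansion coefficients are indexed by multi-indices. A reordering
  argument, based on [X_i, X_j] having no component of weight above w_i + w_j, leaves one word per
  multi-index, so that the linear systems become square; they are triangular for the length
  |\<alpha>|, with diagonal \<alpha>!. All other inversions (polynomial change, exponential map,
  differential equation) are finite recursions on the weights, so they stay inside any algebra of
  functions. At t = 0 the rescaled frames are continued by the model frame; its jets must therefore
  be the limits of the rescaled jets, and it must itself satisfy graded bracket relations. For the
  left-invariant frame, \<psi>_y after left translation by y has weighted degree at most w_k in
  component k by triangularity, and order at least w_k by privilege. It is thus homogeneous, which
  forces it to be the exponential map of the model fields at y.\<close>

lemma frechet_derivative_eqI: "(f has_derivative f') (at x) \<Longrightarrow> frechet_derivative f (at x) = f'"
  by (metis frechet_derivative_at)

lemma differentiableE_frechet: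
  "f differentiable (at x) \<Longrightarrow> (f has_derivative frechet_derivative f (at x)) (at x)"
  by (simp add: frechet_derivative_works)

lemma has_derivative_open_cong:
  assumes "open S" "x \<in> S" "\<And>y. y \<in> S \<Longrightarrow> f y = g y"
  shows "(f has_derivative D) (at x) \<longleftrightarrow> (g has_derivative D) (at x)"
  using has_derivative_transform_within_open[of f D x UNIV S g]
    has_derivative_transform_within_open[of g D x UNIV S f] assms by auto

lemma frechet_derivative_open_cong:
  assumes "open S" "x \<in> S" "\<And>y. y \<in> S \<Longrightarrow> f y = g y"
  shows "frechet_derivative f (at x) = frechet_derivative g (at x)"
  unfolding frechet_derivative_def using has_derivative_open_cong[OF assms] by simp

lemma differentiable_open_cong:
  assumes "open S" "x \<in> S" "\<And>y. y \<in> S \<Longrightarrow> f y = g y"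
  shows "f differentiable (at x) \<longleftrightarrow> g differentiable (at x)"
  unfolding differentiable_def using has_derivative_open_cong[OF assms] by simp

lemma Ck_on_cong:
  "open S \<Longrightarrow> (\<And>y. y \<in> S \<Longrightarrow> f y = g y) \<Longrightarrow> Ck_on k S f \<longleftrightarrow> Ck_on k S g"
proof (induction k arbitrary: f g)
  case 0
  then show ?case by (simp cong: continuous_on_cong)
next
  case (Suc k)
  have "Ck_on k S (\<lambda>x. frechet_derivative f (at x) v) \<longleftrightarrow> Ck_on k S (\<lambda>x. frechet_derivative g (at x) v)" for v
    using Suc.prems by (intro Suc.IH) (auto simp: frechet_derivative_open_cong[of S _ f g])
  then show ?case using Suc.prems by (auto simp: differentiable_open_cong[of S _ f g])
qed

lemma Ck_on_SucD: "Ck_on (Suc k) S f \<Longrightarrow> Ck_on k S f"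
proof (induction k arbitrary: f)
  case 0
  then show ?case
    by (auto intro!: continuous_at_imp_continuous_on differentiable_imp_continuous_within)
next
  case (Suc k)
  then show ?case by (metis Ck_on.simps(2))
qed

lemma Ck_on_const: "Ck_on k S (\<lambda>x. c)"
  by (induction k arbitrary: c) auto

lemma Ck_on_add:
  "open S \<Longrightarrow> Ck_on k S f \<Longrightarrow> Ck_on k S g \<Longrightarrow> Ck_on k S (\<lambda>x. f x + g x)"
proof (induction k arbitrary: f g)
  case 0
  then show ?case by (auto intro: continuous_intros)
next
  case (Suc k)
  have d: "((\<lambda>x. f x + g x) has_derivative
      (\<lambda>v. frechet_derivative f (at x) v + frechet_derivative g (at x) v)) (at x)" if "x \<in> S" for x
    using Suc.prems that by (intro has_derivative_add differentiableE_frechet) auto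
  have "Ck_on k S (\<lambda>x. frechet_derivative (\<lambda>x. f x + g x) (at x) v) \<longleftrightarrow>
     Ck_on k S (\<lambda>x. frechet_derivative f (at x) v + frechet_derivative g (at x) v)" for v
    using Suc.prems by (intro Ck_on_cong) (auto simp: frechet_derivative_eqI[OF d])
  moreover have "Ck_on k S (\<lambda>x. frechet_derivative f (at x) v + frechet_derivative g (at x) v)" for v
    using Suc.prems by (intro Suc.IH) auto
  ultimately show ?case using d unfolding Ck_on.simps differentiable_def by blast
qed

lemma Ck_on_bounded_linear_left:
  assumes "bounded_linear L"
  shows "open S \<Longrightarrow> Ck_on k S f \<Longrightarrow> Ck_on k S (\<lambda>x. L (f x))"
proof (induction k arbitrary: f)
  case 0
  then show ?case using bounded_linear.continuous_on[OF assms] by auto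
next
  case (Suc k)
  have d: "((\<lambda>x. L (f x)) has_derivative (\<lambda>v. L (frechet_derivative f (at x) v))) (at x)" if "x \<in> S" for x
    using Suc.prems that by (intro bounded_linear.has_derivative[OF assms] differentiableE_frechet) auto
  have "Ck_on k S (\<lambda>x. frechet_derivative (\<lambda>x. L (f x)) (at x) v) \<longleftrightarrow>
     Ck_on k S (\<lambda>x. L (frechet_derivative f (at x) v))" for v
    using Suc.prems by (intro Ck_on_cong) (auto simp: frechet_derivative_eqI[OF d])
  then show ?case using Suc d by (auto simp: differentiable_def)
qed

text \<open>For linear \<open>L\<close> the derivative in direction \<open>v\<close> is that of
  \<open>f\<close> in the constant direction \<open>L v\<close>, so the induction on the order
  closes. It is applied to dilations and projections.\<close>

lemma Ck_on_bounded_linear_right: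
  assumes "bounded_linear L"
  shows "open S \<Longrightarrow> Ck_on k S f \<Longrightarrow> Ck_on k (L -` S) (\<lambda>x. f (L x))"
proof (induction k arbitrary: f)
  case 0
  then show ?case using linear_continuous_on[OF assms]
    by (auto intro!: continuous_on_compose2[of S f])
next
  case (Suc k)
  have o: "open (L -` S)"
    using Suc.prems(1) continuous_open_vimage[of S L] linear_continuous_at[OF assms] by auto
  have d: "((\<lambda>x. f (L x)) has_derivative (\<lambda>v. frechet_derivative f (at (L x)) (L v))) (at x)"
    if "x \<in> L -` S" for x
    using Suc.prems that
    by (intro has_derivative_compose[OF bounded_linear_imp_has_derivative[OF assms]] differentiableE_frechet) auto
  have "Ck_on k (L -` S) (\<lambda>x. frechet_derivative (\<lambda>x. f (L x)) (at x) v) \<longleftrightarrow>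
     Ck_on k (L -` S) (\<lambda>x. frechet_derivative f (at (L x)) (L v))" for v
    using o by (intro Ck_on_cong) (auto simp: frechet_derivative_eqI[OF d])
  moreover have "Ck_on k (L -` S) (\<lambda>x. frechet_derivative f (at (L x)) (L v))" for v
    using Suc.IH[of "\<lambda>x. frechet_derivative f (at x) (L v)"] Suc.prems by simp
  ultimately show ?case using d by (auto simp: differentiable_def)
qed

lemma Ck_on_mult:
  fixes f g :: "'a::real_normed_vector \<Rightarrow> real"
  shows "open S \<Longrightarrow> Ck_on k S f \<Longrightarrow> Ck_on k S g \<Longrightarrow> Ck_on k S (\<lambda>x. f x * g x)"
proof (induction k arbitrary: f g)
  case 0
  then show ?case by (auto intro: continuous_intros)
next
  case (Suc k)
  have d: "((\<lambda>x. f x * g x) has_derivative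
      (\<lambda>v. f x * frechet_derivative g (at x) v + frechet_derivative f (at x) v * g x)) (at x)" if "x \<in> S" for x
    using Suc.prems that by (intro has_derivative_mult differentiableE_frechet) auto
  have "Ck_on k S (\<lambda>x. frechet_derivative (\<lambda>x. f x * g x) (at x) v) \<longleftrightarrow>
     Ck_on k S (\<lambda>x. f x * frechet_derivative g (at x) v + frechet_derivative f (at x) v * g x)" for v
    using Suc.prems by (intro Ck_on_cong) (auto simp: frechet_derivative_eqI[OF d])
  moreover have "Ck_on k S f" "Ck_on k S g" using Suc.prems Ck_on_SucD by blast+
  moreover have "Ck_on k S (\<lambda>x. f x * frechet_derivative g (at x) v + frechet_derivative f (at x) v * g x)" for v
    using Suc.prems calculation(2,3) by (intro Ck_on_add Suc.IH) auto
  ultimately show ?case using d by (auto simp: differentiable_def)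
qed

lemma Ck_on_inverse:
  fixes f :: "'a::real_normed_vector \<Rightarrow> real"
  shows "open S \<Longrightarrow> Ck_on k S f \<Longrightarrow> (\<And>x. x \<in> S \<Longrightarrow> f x \<noteq> 0) \<Longrightarrow> Ck_on k S (\<lambda>x. inverse (f x))"
proof (induction k)
  case 0
  then show ?case by (auto intro!: continuous_intros)
next
  case (Suc k)
  have d: "((\<lambda>x. inverse (f x)) has_derivative
      (\<lambda>v. - (inverse (f x) * frechet_derivative f (at x) v * inverse (f x)))) (at x)" if "x \<in> S" for x
    using Suc.prems that by (intro Deriv.has_derivative_inverse differentiableE_frechet) auto
  have "Ck_on k S (\<lambda>x. frechet_derivative (\<lambda>x. inverse (f x)) (at x) v) \<longleftrightarrow>
     Ck_on k S (\<lambda>x. - (inverse (f x) * frechet_derivative f (at x) v * inverse (f x)))" for v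
    using Suc.prems by (intro Ck_on_cong) (auto simp: frechet_derivative_eqI[OF d])
  moreover have "Ck_on k S f" using Suc.prems Ck_on_SucD by blast
  ultimately show ?case using Suc d
    by (auto simp: differentiable_def intro!: Ck_on_mult
        Ck_on_bounded_linear_left[OF bounded_linear_minus[OF bounded_linear_ident]])
qed

lemma smooth_on_cong:
  "open S \<Longrightarrow> (\<And>y. y \<in> S \<Longrightarrow> f y = g y) \<Longrightarrow> smooth_on S f \<longleftrightarrow> smooth_on S g"
  unfolding smooth_on_def using Ck_on_cong by blast

lemma smooth_on_const: "smooth_on S (\<lambda>x. c)"
  unfolding smooth_on_def using Ck_on_const by blast

lemma smooth_on_add:
  "open S \<Longrightarrow> smooth_on S f \<Longrightarrow> smooth_on S g \<Longrightarrow> smooth_on S (\<lambda>x. f x + g x)"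
  unfolding smooth_on_def using Ck_on_add by blast

lemma smooth_on_mult:
  fixes f g :: "'a::real_normed_vector \<Rightarrow> real"
  shows "open S \<Longrightarrow> smooth_on S f \<Longrightarrow> smooth_on S g \<Longrightarrow> smooth_on S (\<lambda>x. f x * g x)"
  unfolding smooth_on_def using Ck_on_mult by blast

lemma smooth_on_inverse:
  fixes f :: "'a::real_normed_vector \<Rightarrow> real"
  shows "open S \<Longrightarrow> smooth_on S f \<Longrightarrow> (\<And>x. x \<in> S \<Longrightarrow> f x \<noteq> 0) \<Longrightarrow> smooth_on S (\<lambda>x. inverse (f x))"
  unfolding smooth_on_def using Ck_on_inverse by blast

lemma smooth_on_bounded_linear_left:
  "bounded_linear L \<Longrightarrow> open S \<Longrightarrow> smooth_on S f \<Longrightarrow> smooth_on S (\<lambda>x. L (f x))"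
  unfolding smooth_on_def using Ck_on_bounded_linear_left by blast

lemma smooth_on_bounded_linear_right:
  "bounded_linear L \<Longrightarrow> open S \<Longrightarrow> smooth_on S f \<Longrightarrow> smooth_on (L -` S) (\<lambda>x. f (L x))"
  unfolding smooth_on_def using Ck_on_bounded_linear_right by blast

lemma smooth_on_ident: "open S \<Longrightarrow> smooth_on S (\<lambda>x. x)"
proof -
  have "Ck_on k S (\<lambda>x. x)" for k by (cases k) (auto simp: Ck_on_const)
  then show ?thesis by (simp add: smooth_on_def)
qed

lemma smooth_on_bounded_linear: "bounded_linear L \<Longrightarrow> open S \<Longrightarrow> smooth_on S L"
  using smooth_on_bounded_linear_left[OF _ _ smooth_on_ident, of L S] by simp

lemma smooth_on_component: "open S \<Longrightarrow> smooth_on S f \<Longrightarrow> smooth_on S (\<lambda>x. f x $ k)"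
  by (rule smooth_on_bounded_linear_left[OF bounded_linear_vec_nth])

lemma smooth_on_coord: "open S \<Longrightarrow> smooth_on S (\<lambda>x. x $ k)"
  by (rule smooth_on_component[OF _ smooth_on_ident])

lemma smooth_on_scale:
  fixes f :: "'a::real_normed_vector \<Rightarrow> real"
  shows "open S \<Longrightarrow> smooth_on S f \<Longrightarrow> smooth_on S (\<lambda>x. c * f x)"
  by (rule smooth_on_mult[OF _ smooth_on_const])

lemma smooth_on_minus:
  fixes f g :: "'a::real_normed_vector \<Rightarrow> 'b::real_normed_vector"
  assumes "open S" "smooth_on S f" "smooth_on S g" shows "smooth_on S (\<lambda>x. f x - g x)"
  using smooth_on_add[OF assms(1,2) smooth_on_bounded_linear_left
    [OF bounded_linear_minus[OF bounded_linear_ident] assms(1,3)]] by simp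

lemma smooth_on_sum:
  assumes "open S" "\<And>i. i \<in> I \<Longrightarrow> smooth_on S (f i)"
  shows "smooth_on S (\<lambda>x. \<Sum>i\<in>I. f i x)"
  using assms(2) by (induction I rule: infinite_finite_induct)
    (auto simp: smooth_on_const intro: smooth_on_add[OF assms(1)])

lemma smooth_on_prod:
  fixes f :: "'i \<Rightarrow> 'a::real_normed_vector \<Rightarrow> real"
  assumes "open S" "\<And>i. i \<in> I \<Longrightarrow> smooth_on S (f i)"
  shows "smooth_on S (\<lambda>x. \<Prod>i\<in>I. f i x)"
  using assms(2) by (induction I rule: infinite_finite_induct)
    (auto simp: smooth_on_const intro: smooth_on_mult[OF assms(1)])

lemma smooth_on_power:
  fixes f :: "'a::real_normed_vector \<Rightarrow> real"
  assumes "open S" "smooth_on S f" shows "smooth_on S (\<lambda>x. f x ^ m)"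
  by (induction m) (auto simp: smooth_on_const intro: smooth_on_mult[OF assms(1)] assms)

lemma smooth_on_vec:
  fixes f :: "'a::real_normed_vector \<Rightarrow> real^'n"
  assumes "open S" "\<And>k. smooth_on S (\<lambda>x. f x $ k)" shows "smooth_on S f"
proof -
  have b: "bounded_linear (\<lambda>r. r *\<^sub>R (axis k 1 :: real^'n))" for k
    by (rule bounded_linear_scaleR_left)
  have "smooth_on S (\<lambda>x. \<Sum>k\<in>UNIV. f x $ k *\<^sub>R (axis k 1 :: real^'n))"
    by (intro smooth_on_sum assms(1) smooth_on_bounded_linear_left[OF b] assms(2))
  moreover have "(\<lambda>x. \<Sum>k\<in>UNIV. f x $ k *\<^sub>R (axis k 1 :: real^'n)) = f"
    by (auto simp: fun_eq_iff vec_eq_iff axis_def sum.delta' if_distrib cong: if_cong)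
  ultimately show ?thesis by simp
qed

lemma smooth_on_differentiable: "smooth_on S f \<Longrightarrow> x \<in> S \<Longrightarrow> f differentiable (at x)"
  unfolding smooth_on_def by (metis Ck_on.simps(2))

lemma smooth_on_has_derivative:
  "smooth_on S f \<Longrightarrow> x \<in> S \<Longrightarrow> (f has_derivative frechet_derivative f (at x)) (at x)"
  using smooth_on_differentiable differentiableE_frechet by blast

lemma smooth_on_continuous_on: "smooth_on S f \<Longrightarrow> continuous_on S f"
  unfolding smooth_on_def by (metis Ck_on.simps(1))

lemma smooth_on_frechet: "smooth_on S f \<Longrightarrow> smooth_on S (\<lambda>x. frechet_derivative f (at x) v)"
  unfolding smooth_on_def by (metis Ck_on.simps(2))

subsection \<open>Symmetry of second derivatives\<close>

lemma mean_value_line: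
  fixes f :: "'a::real_normed_vector \<Rightarrow> real"
  assumes "h > 0" "\<And>s. 0 \<le> s \<Longrightarrow> s \<le> h \<Longrightarrow> f differentiable (at (a + s *\<^sub>R u))"
  obtains s where "0 < s" "s < h" "f (a + h *\<^sub>R u) - f a = h * frechet_derivative f (at (a + s *\<^sub>R u)) u"
proof -
  have d: "((\<lambda>s. f (a + s *\<^sub>R u)) has_real_derivative frechet_derivative f (at (a + s *\<^sub>R u)) u) (at s)"
    if "0 \<le> s" "s \<le> h" for s
  proof -
    have D: "(f has_derivative frechet_derivative f (at (a + s *\<^sub>R u))) (at (a + s *\<^sub>R u))"
      using assms(2)[OF that] differentiableE_frechet by blast
    have "((\<lambda>s. f (a + s *\<^sub>R u)) has_derivative (\<lambda>r. frechet_derivative f (at (a + s *\<^sub>R u)) (r *\<^sub>R u))) (at s)"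
      by (rule has_derivative_compose[where f="\<lambda>s. a + s *\<^sub>R u" and g=f])
         (auto intro!: derivative_eq_intros D)
    moreover have "(\<lambda>r. frechet_derivative f (at (a + s *\<^sub>R u)) (r *\<^sub>R u))
        = (*) (frechet_derivative f (at (a + s *\<^sub>R u)) u)"
      using linear_scale[OF has_derivative_linear[OF D]] by (auto simp: fun_eq_iff)
    ultimately show ?thesis by (simp add: has_field_derivative_def)
  qed
  from MVT2[OF assms(1) d] that show ?thesis by auto
qed

text \<open>The mean value theorem is used twice: along \<open>u\<close> for the increment of
  \<open>f\<close> by \<open>h v\<close>, then along \<open>v\<close> for the derivative of
  \<open>f\<close> in direction \<open>u\<close>.\<close>

lemma second_difference:
  fixes f :: "'a::real_normed_vector \<Rightarrow> real"
  assumes "open S" "Ck_on 2 S f" "h > 0"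
    "\<And>s t. 0 \<le> s \<Longrightarrow> s \<le> h \<Longrightarrow> 0 \<le> t \<Longrightarrow> t \<le> h \<Longrightarrow> x + s *\<^sub>R u + t *\<^sub>R v \<in> S"
  obtains s t where "0 < s" "s < h" "0 < t" "t < h"
    "f (x + h *\<^sub>R u + h *\<^sub>R v) - f (x + h *\<^sub>R u) - f (x + h *\<^sub>R v) + f x =
       h * (h * frechet_derivative (\<lambda>y. frechet_derivative f (at y) u) (at (x + s *\<^sub>R u + t *\<^sub>R v)) v)"
proof -
  have C: "Ck_on (Suc (Suc 0)) S f" using assms(2) by (simp add: numeral_2_eq_2)
  have df: "f differentiable (at y)" if "y \<in> S" for y using C that by simp
  have ddf: "(\<lambda>y. frechet_derivative f (at y) u) differentiable (at y)" if "y \<in> S" for y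
    using C that by simp
  let ?g = "\<lambda>y. f (y + h *\<^sub>R v) - f y"
  have dg: "(?g has_derivative (\<lambda>w. frechet_derivative f (at (x + s *\<^sub>R u + h *\<^sub>R v)) w
      - frechet_derivative f (at (x + s *\<^sub>R u)) w)) (at (x + s *\<^sub>R u))"
    if "0 \<le> s" "s \<le> h" for s
  proof -
    have 1: "(f has_derivative frechet_derivative f (at (x + s *\<^sub>R u + h *\<^sub>R v))) (at (x + s *\<^sub>R u + h *\<^sub>R v))"
      using assms(3) assms(4)[of s h] that df differentiableE_frechet by auto
    have 2: "(f has_derivative frechet_derivative f (at (x + s *\<^sub>R u))) (at (x + s *\<^sub>R u))"
      using assms(3) assms(4)[of s 0] that df differentiableE_frechet by auto
    have "((\<lambda>y. f (y + h *\<^sub>R v)) has_derivative frechet_derivative f (at (x + s *\<^sub>R u + h *\<^sub>R v))) (at (x + s *\<^sub>R u))"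
      by (rule has_derivative_compose[where f="\<lambda>y. y + h *\<^sub>R v" and g=f and f'="\<lambda>w. w", simplified])
         (auto intro!: derivative_eq_intros 1)
    with 2 show ?thesis by (intro has_derivative_diff)
  qed
  have gd: "?g differentiable (at (x + s *\<^sub>R u))" if "0 \<le> s" "s \<le> h" for s
    using dg[OF that] unfolding differentiable_def by blast
  obtain s where s: "0 < s" "s < h"
    and e1: "?g (x + h *\<^sub>R u) - ?g x = h * frechet_derivative ?g (at (x + s *\<^sub>R u)) u"
    by (rule mean_value_line[of h ?g x u, OF assms(3) gd])
  have e2: "frechet_derivative ?g (at (x + s *\<^sub>R u)) u = frechet_derivative f (at (x + s *\<^sub>R u + h *\<^sub>R v)) u
      - frechet_derivative f (at (x + s *\<^sub>R u)) u"
    using frechet_derivative_eqI[OF dg] s by auto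
  have hd: "(\<lambda>y. frechet_derivative f (at y) u) differentiable (at ((x + s *\<^sub>R u) + t *\<^sub>R v))"
    if "0 \<le> t" "t \<le> h" for t
    using s that by (intro ddf assms(4)) auto
  obtain t where t: "0 < t" "t < h" and e3: "frechet_derivative f (at (x + s *\<^sub>R u + h *\<^sub>R v)) u
      - frechet_derivative f (at (x + s *\<^sub>R u)) u =
     h * frechet_derivative (\<lambda>y. frechet_derivative f (at y) u) (at (x + s *\<^sub>R u + t *\<^sub>R v)) v"
    by (rule mean_value_line[of h "\<lambda>y. frechet_derivative f (at y) u" "x + s *\<^sub>R u" v, OF assms(3) hd])
  have "?g (x + h *\<^sub>R u) - ?g x =
     h * (h * frechet_derivative (\<lambda>y. frechet_derivative f (at y) u) (at (x + s *\<^sub>R u + t *\<^sub>R v)) v)"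
    unfolding e1 e2 e3 ..
  then show ?thesis by (intro that[OF s t]) linarith
qed

text \<open>The second difference over a parallelogram is symmetric in \<open>u\<close> and
  \<open>v\<close> and equals h^2 times either mixed derivative at some point of it. Shrinking the
  parallelogram and continuity give equality at \<open>x\<close>.\<close>

lemma second_derivative_symmetric:
  fixes f :: "'a::real_normed_vector \<Rightarrow> real"
  assumes S: "open S" "Ck_on 2 S f" "x \<in> S"
  shows "frechet_derivative (\<lambda>y. frechet_derivative f (at y) u) (at x) v =
         frechet_derivative (\<lambda>y. frechet_derivative f (at y) v) (at x) u"
proof -
  define G where "G u v y = frechet_derivative (\<lambda>y. frechet_derivative f (at y) u) (at y) v" for u v y
  have C: "Ck_on (Suc (Suc 0)) S f" using assms(2) by (simp add: numeral_2_eq_2)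
  have cont: "continuous_on S (G u v)" for u v using C by (simp add: G_def)
  have "\<bar>G u v x - G v u x\<bar> \<le> e" if "e > 0" for e
  proof -
    have "isCont (G u v) x" "isCont (G v u) x" using cont S(1,3) continuous_on_eq_continuous_at by blast+
    then have c: "\<exists>d>0. \<forall>y. dist y x < d \<longrightarrow> dist (G u v y) (G u v x) < e/2"
        "\<exists>d>0. \<forall>y. dist y x < d \<longrightarrow> dist (G v u y) (G v u x) < e/2"
      unfolding continuous_at_eps_delta using half_gt_zero[OF \<open>e > 0\<close>] by blast+
    obtain d1 where d1: "d1 > 0" "\<And>y. dist y x < d1 \<Longrightarrow> dist (G u v y) (G u v x) < e/2"
      using c(1) by blast
    obtain d2 where d2: "d2 > 0" "\<And>y. dist y x < d2 \<Longrightarrow> dist (G v u y) (G v u x) < e/2"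
      using c(2) by blast
    note d = d1 d2
    obtain d3 where d3: "d3 > 0" "\<And>y. dist y x < d3 \<Longrightarrow> y \<in> S"
      using S(1,3) unfolding open_dist by blast
    define \<rho> where "\<rho> = min d1 (min d2 d3)"
    have \<rho>: "\<rho> > 0" using d d3 by (simp add: \<rho>_def)
    \<comment> \<open>With this side length every point of the parallelogram is within \<rho> of
      \<open>x\<close>, inside \<open>S\<close> and inside both continuity radii.\<close>
    define h where "h = (\<rho> / 2) / (norm u + norm v + 1)"
    have pos: "norm u + norm v + 1 > 0" using norm_ge_zero[of u] norm_ge_zero[of v] by linarith
    have h: "h > 0" using \<rho> pos by (simp add: h_def)
    have hh: "h * (norm u + norm v + 1) = \<rho> / 2" 
      unfolding h_def by (rule nonzero_eq_divide_eq[THEN iffD1, OF _ refl]) (use pos in linarith)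
    have close: "dist (x + s *\<^sub>R u + t *\<^sub>R v) x < \<rho>" if "0 \<le> s" "s \<le> h" "0 \<le> t" "t \<le> h" for s t
    proof -
      have "dist (x + s *\<^sub>R u + t *\<^sub>R v) x = norm (s *\<^sub>R u + t *\<^sub>R v)" by (simp add: dist_norm algebra_simps)
      also have "\<dots> \<le> s * norm u + t * norm v" using that by (intro order_trans[OF norm_triangle_ineq]) simp
      also have "\<dots> \<le> h * norm u + h * norm v" using that by (intro add_mono mult_right_mono) auto
      also have "\<dots> \<le> h * (norm u + norm v + 1)" using h by (simp add: algebra_simps)
      also have "\<dots> < \<rho>" using hh \<rho> by simp
      finally show ?thesis .
    qed
    have inS: "x + s *\<^sub>R u + t *\<^sub>R v \<in> S" if "0 \<le> s" "s \<le> h" "0 \<le> t" "t \<le> h" for s t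
      using close[OF that] d3 by (auto simp: \<rho>_def)
    have inS': "x + s *\<^sub>R v + t *\<^sub>R u \<in> S" if "0 \<le> s" "s \<le> h" "0 \<le> t" "t \<le> h" for s t
      using inS[of t s] that by (simp add: add.commute add.left_commute)
    obtain s t where st: "0 < s" "s < h" "0 < t" "t < h"
      "f (x + h *\<^sub>R u + h *\<^sub>R v) - f (x + h *\<^sub>R u) - f (x + h *\<^sub>R v) + f x = h * (h * G u v (x + s *\<^sub>R u + t *\<^sub>R v))"
      by (rule second_difference[OF S(1,2) h inS]) (auto simp: G_def)
    obtain s' t' where st': "0 < s'" "s' < h" "0 < t'" "t' < h"
      "f (x + h *\<^sub>R v + h *\<^sub>R u) - f (x + h *\<^sub>R v) - f (x + h *\<^sub>R u) + f x = h * (h * G v u (x + s' *\<^sub>R v + t' *\<^sub>R u))"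
      by (rule second_difference[OF S(1,2) h inS']) (auto simp: G_def)
    have xe: "x + h *\<^sub>R v + h *\<^sub>R u = x + h *\<^sub>R u + h *\<^sub>R v" by simp
    have "h * (h * G u v (x + s *\<^sub>R u + t *\<^sub>R v)) = h * (h * G v u (x + s' *\<^sub>R v + t' *\<^sub>R u))"
      using st(5) st'(5)[unfolded xe] by linarith
    then have eq: "G u v (x + s *\<^sub>R u + t *\<^sub>R v) = G v u (x + s' *\<^sub>R v + t' *\<^sub>R u)" using h by simp
    have "dist (x + s *\<^sub>R u + t *\<^sub>R v) x < d1" using close[of s t] st by (auto simp: \<rho>_def)
    moreover have "dist (x + s' *\<^sub>R v + t' *\<^sub>R u) x < d2" using close[of t' s'] st'
      by (auto simp: \<rho>_def add.commute add.left_commute)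
    ultimately have "\<bar>G u v (x + s *\<^sub>R u + t *\<^sub>R v) - G u v x\<bar> < e/2"
      "\<bar>G u v (x + s *\<^sub>R u + t *\<^sub>R v) - G v u x\<bar> < e/2"
      using d(2)[of "x + s *\<^sub>R u + t *\<^sub>R v"] d(4)[of "x + s' *\<^sub>R v + t' *\<^sub>R u"] eq
      by (simp_all add: dist_real_def)
    then show ?thesis by linarith
  qed
  then have "\<bar>G u v x - G v u x\<bar> \<le> 0" using field_le_epsilon by (metis add_0)
  then show ?thesis by (simp add: G_def)
qed

section \<open>Multi-indices and words\<close>

definition mpow :: "('n::finite \<Rightarrow> real) \<Rightarrow> ('n \<Rightarrow> nat) \<Rightarrow> real" where
  "mpow u \<alpha> = (\<Prod>j\<in>UNIV. u j ^ \<alpha> j)"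

definition mdeg :: "('n::finite \<Rightarrow> nat) \<Rightarrow> ('n \<Rightarrow> nat) \<Rightarrow> nat" where
  "mdeg v \<alpha> = (\<Sum>j\<in>UNIV. v j * \<alpha> j)"

text \<open>With all weights 1, \<open>mdeg one\<close> is the usual degree and
  \<open>order_ge one\<close> the usual order of vanishing, so both gradings share their
  lemmas.\<close>

abbreviation one :: "'n \<Rightarrow> nat" where "one \<equiv> (\<lambda>_. 1)"

abbreviation content :: "'n list \<Rightarrow> 'n \<Rightarrow> nat" where "content I \<equiv> count (mset I)"

text \<open>An arbitrary ordering of the letters of each multi-index; \<open>order_ge_words\<close>
  makes the choice harmless.\<close>

definition word :: "('n::finite \<Rightarrow> nat) \<Rightarrow> 'n list" where
  "word \<alpha> = (SOME I. content I = \<alpha>)"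

lemma content_word [simp]: "content (word \<alpha>) = \<alpha>"
proof -
  obtain I where "mset I = Abs_multiset \<alpha>" using ex_mset by blast
  then have "content I = \<alpha>" by (simp add: Abs_multiset_inverse)
  then show ?thesis unfolding word_def by (rule someI)
qed

lemma mdeg_add_single: "mdeg v (\<lambda>j. \<alpha> j + (if j = x then 1 else 0)) = v x + mdeg v \<alpha>"
proof -
  have "mdeg v (\<lambda>j. \<alpha> j + (if j = x then 1 else 0)) = (\<Sum>j\<in>UNIV. v j * \<alpha> j + (if j = x then v j else 0))"
    unfolding mdeg_def by (intro sum.cong) auto
  then show ?thesis by (simp add: sum.distrib mdeg_def)
qed

lemma sum_list_content: "sum_list (map v I) = mdeg v (content I)"
proof (induction I)
  case Nil
  then show ?case by (simp add: mdeg_def)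
next
  case (Cons x I)
  have "content (x # I) = (\<lambda>j. content I j + (if j = x then 1 else 0))" by (auto simp: fun_eq_iff)
  then show ?case using Cons mdeg_add_single[of v "content I" x] by simp
qed

lemma length_content: "length I = mdeg one (content I)"
  using sum_list_content[of one I] by (simp add: sum_list_triv)

lemma sum_list_word [simp]: "sum_list (map v (word \<alpha>)) = mdeg v \<alpha>"
  by (simp add: sum_list_content)

lemma length_word [simp]: "length (word \<alpha>) = mdeg one \<alpha>"
  by (simp add: length_content)

lemma mdeg_one_le: "(\<And>j. 1 \<le> v j) \<Longrightarrow> mdeg one \<alpha> \<le> mdeg v \<alpha>"
  unfolding mdeg_def by (intro sum_mono) simp

lemma index_le_mdeg: "(\<And>j. 1 \<le> v j) \<Longrightarrow> \<alpha> j \<le> mdeg v \<alpha>"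
proof -
  assume v: "\<And>j. 1 \<le> v j"
  have "\<alpha> j \<le> v j * \<alpha> j" using v[of j] by simp
  also have "\<dots> \<le> mdeg v \<alpha>" unfolding mdeg_def by (rule member_le_sum) auto
  finally show ?thesis .
qed

lemma weight_le_mdeg: "\<alpha> j \<noteq> 0 \<Longrightarrow> v j \<le> mdeg v \<alpha>"
proof -
  assume "\<alpha> j \<noteq> 0"
  then have "v j \<le> v j * \<alpha> j" by simp
  also have "\<dots> \<le> mdeg v \<alpha>" unfolding mdeg_def by (rule member_le_sum) auto
  finally show ?thesis .
qed

lemma finite_mdeg_le: "(\<And>j. 1 \<le> v j) \<Longrightarrow> finite {\<alpha>. mdeg v \<alpha> \<le> N}"
proof (rule finite_subset)
  assume v: "\<And>j. 1 \<le> v j"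
  show "{\<alpha>. mdeg v \<alpha> \<le> N} \<subseteq> PiE UNIV (\<lambda>_. {..N})"
    using index_le_mdeg[of v, OF v] by (auto intro: order_trans)
  show "finite (PiE (UNIV::'a set) (\<lambda>_. {..N}))" by (intro finite_PiE) auto
qed

lemma finite_mdeg_less: "(\<And>j. 1 \<le> v j) \<Longrightarrow> finite {\<alpha>. mdeg v \<alpha> < N}"
  by (rule finite_subset[OF _ finite_mdeg_le[of v N]]) auto

lemma mpow_zero [simp]: "mpow u (\<lambda>_. 0) = 1"
  by (simp add: mpow_def)

lemma mpow_cong: "(\<And>j. \<alpha> j \<noteq> 0 \<Longrightarrow> u j = u' j) \<Longrightarrow> mpow u \<alpha> = mpow u' \<alpha>"
  unfolding mpow_def by (intro prod.cong refl) (metis power_0)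

lemma mpow_weighted: "mpow (\<lambda>j. t ^ v j * u j) \<alpha> = t ^ mdeg v \<alpha> * mpow u \<alpha>"
  by (simp add: mpow_def mdeg_def power_mult_distrib prod.distrib power_sum power_mult)

section \<open>Lie derivatives\<close>

lemma lie_derivative_open_cong:
  "open U \<Longrightarrow> x \<in> U \<Longrightarrow> (\<And>y. y \<in> U \<Longrightarrow> f y = g y) \<Longrightarrow> lie_derivative V f x = lie_derivative V g x"
  unfolding lie_derivative_def by (simp add: frechet_derivative_open_cong[of U x f g])

lemma linear_vec_expand:
  fixes v :: "real^'n"
  shows "linear D \<Longrightarrow> D v = (\<Sum>k\<in>UNIV. v $ k *\<^sub>R D (axis k 1))"
proof -
  assume D: "linear D"
  have v: "(\<Sum>k\<in>UNIV. v $ k *\<^sub>R axis k 1) = v"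
    by (auto simp: vec_eq_iff axis_def if_distrib cong: if_cong)
  have "D (\<Sum>k\<in>UNIV. v $ k *\<^sub>R axis k 1) = (\<Sum>k\<in>UNIV. v $ k *\<^sub>R D (axis k 1))"
    using D by (simp add: linear_sum linear_scale)
  then show ?thesis unfolding v .
qed

lemma lie_derivative_expand:
  fixes f :: "real^'n \<Rightarrow> real"
  assumes "f differentiable (at x)"
  shows "lie_derivative V f x = (\<Sum>k\<in>UNIV. V x $ k * frechet_derivative f (at x) (axis k 1))"
  unfolding lie_derivative_def
  by (subst linear_vec_expand) (auto intro: has_derivative_linear[OF differentiableE_frechet[OF assms]])

lemma smooth_on_lie_derivative:
  fixes f :: "real^'n \<Rightarrow> real"
  assumes "open U" "smooth_on U V" "smooth_on U f"
  shows "smooth_on U (lie_derivative V f)"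
proof -
  have "smooth_on U (\<lambda>x. \<Sum>k\<in>UNIV. V x $ k * frechet_derivative f (at x) (axis k 1))"
    by (intro smooth_on_sum smooth_on_mult smooth_on_component smooth_on_frechet assms)
  moreover have "lie_derivative V f x = (\<Sum>k\<in>UNIV. V x $ k * frechet_derivative f (at x) (axis k 1))"
    if "x \<in> U" for x
    using lie_derivative_expand smooth_on_differentiable assms(3) that by blast
  ultimately show ?thesis by (subst smooth_on_cong[OF assms(1)])
qed

lemma lie_derivative_add:
  assumes "f differentiable (at x)" "g differentiable (at x)"
  shows "lie_derivative V (\<lambda>x. f x + g x) x = lie_derivative V f x + lie_derivative V g x"
  unfolding lie_derivative_def
  using frechet_derivative_eqI[OF has_derivative_add[OF assms[THEN differentiableE_frechet]]] by simp

lemma lie_derivative_mult: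
  assumes "f differentiable (at x)" "g differentiable (at x)"
  shows "lie_derivative V (\<lambda>x. f x * g x) x = f x * lie_derivative V g x + lie_derivative V f x * g x"
  unfolding lie_derivative_def
  using frechet_derivative_eqI[OF has_derivative_mult[OF assms[THEN differentiableE_frechet]]] by simp

lemma lie_derivative_const [simp]: "lie_derivative V (\<lambda>x. c) = (\<lambda>x. 0)"
  by (auto simp: lie_derivative_def)

lemma lie_derivative_coord [simp]: "lie_derivative V (\<lambda>x. x $ k) x = V x $ k"
  unfolding lie_derivative_def
  by (subst frechet_derivative_eqI[OF bounded_linear_imp_has_derivative[OF bounded_linear_vec_nth]]) simp

lemma lie_derivative_scale:
  assumes "f differentiable (at x)"
  shows "lie_derivative V (\<lambda>x. c * f x) x = c * lie_derivative V f x"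
  using lie_derivative_mult[OF _ assms, of "\<lambda>_. c"] by simp

lemma lie_derivative_sum:
  assumes "\<And>i. i \<in> A \<Longrightarrow> f i differentiable (at x)"
  shows "lie_derivative V (\<lambda>x. \<Sum>i\<in>A. f i x) x = (\<Sum>i\<in>A. lie_derivative V (f i) x)"
  unfolding lie_derivative_def
  by (subst frechet_derivative_eqI[OF has_derivative_sum[OF differentiableE_frechet[OF assms]]]) auto

lemma lie_derivative_power:
  assumes "f differentiable (at x)"
  shows "lie_derivative V (\<lambda>x. f x ^ m) x = real m * f x ^ (m - 1) * lie_derivative V f x"
  unfolding lie_derivative_def
  by (subst frechet_derivative_eqI[OF has_derivative_power[OF differentiableE_frechet[OF assms]]]) simp

lemma lie_derivative_prod:
  fixes f :: "'i \<Rightarrow> real^'n \<Rightarrow> real"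
  assumes "finite A" "\<And>i. i \<in> A \<Longrightarrow> f i differentiable (at x)"
  shows "lie_derivative V (\<lambda>x. \<Prod>i\<in>A. f i x) x =
     (\<Sum>i\<in>A. lie_derivative V (f i) x * (\<Prod>j\<in>A - {i}. f j x))"
  unfolding lie_derivative_def
  by (subst frechet_derivative_eqI[OF has_derivative_prod[OF differentiableE_frechet[OF assms(2)]]]) auto

lemma lie_derivative_mpow:
  fixes u :: "'n::finite \<Rightarrow> real^'n \<Rightarrow> real"
  assumes "\<And>k. u k differentiable (at x)"
  shows "lie_derivative V (\<lambda>x. mpow (\<lambda>k. u k x) \<alpha>) x =
     (\<Sum>k\<in>UNIV. real (\<alpha> k) * lie_derivative V (u k) x * mpow (\<lambda>k. u k x) (\<alpha>(k := \<alpha> k - 1)))"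
proof -
  have "lie_derivative V (\<lambda>x. mpow (\<lambda>k. u k x) \<alpha>) x =
    (\<Sum>k\<in>UNIV. lie_derivative V (\<lambda>x. u k x ^ \<alpha> k) x * (\<Prod>j\<in>UNIV - {k}. u j x ^ \<alpha> j))"
    unfolding mpow_def by (rule lie_derivative_prod) (auto intro!: differentiable_power assms)
  also have "\<dots> = (\<Sum>k\<in>UNIV. real (\<alpha> k) * lie_derivative V (u k) x * mpow (\<lambda>k. u k x) (\<alpha>(k := \<alpha> k - 1)))"
  proof (rule sum.cong[OF refl])
    fix k
    have "mpow (\<lambda>k. u k x) (\<alpha>(k := \<alpha> k - 1)) = u k x ^ (\<alpha> k - 1) * (\<Prod>j\<in>UNIV - {k}. u j x ^ \<alpha> j)"
      unfolding mpow_def by (subst prod.remove[of UNIV k]) auto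
    then show "lie_derivative V (\<lambda>x. u k x ^ \<alpha> k) x * (\<Prod>j\<in>UNIV - {k}. u j x ^ \<alpha> j) =
        real (\<alpha> k) * lie_derivative V (u k) x * mpow (\<lambda>k. u k x) (\<alpha>(k := \<alpha> k - 1))"
      by (simp add: lie_derivative_power assms)
  qed
  finally show ?thesis .
qed

text \<open>In coordinates the second-order terms cancel by symmetry of second derivatives; the
  first-order terms are the bracket.\<close>

lemma lie_derivative_commutator:
  fixes f :: "real^'n \<Rightarrow> real"
  assumes U: "open U" "x \<in> U" and V: "smooth_on U V" and W: "smooth_on U W" and f: "smooth_on U f"
  shows "lie_derivative V (lie_derivative W f) x - lie_derivative W (lie_derivative V f) x =
    lie_derivative (lie_bracket V W) f x"
proof -
  define d where "d k y = frechet_derivative f (at y) (axis k 1)" for k y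
  have sd: "smooth_on U (d k)" for k unfolding d_def by (rule smooth_on_frechet[OF f])
  have dd: "d k differentiable (at x)" for k using smooth_on_differentiable[OF sd U(2)] .
  have dc: "(\<lambda>y. A y $ k) differentiable (at x)" if "smooth_on U A" for A :: "real^'n \<Rightarrow> real^'n" and k
    using smooth_on_differentiable[OF smooth_on_component[OF U(1) that] U(2)] .
  have lf: "lie_derivative A f y = (\<Sum>k\<in>UNIV. A y $ k * d k y)" if "y \<in> U" for A y
    unfolding d_def by (intro lie_derivative_expand smooth_on_differentiable[OF f that])
  have comp: "lie_derivative B (\<lambda>y. A y $ k) x = frechet_derivative A (at x) (B x) $ k"
    if "smooth_on U A" for A B :: "real^'n \<Rightarrow> real^'n" and k
    unfolding lie_derivative_def
    by (subst frechet_derivative_eqI[OF bounded_linear.has_derivative[OF bounded_linear_vec_nth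
            smooth_on_has_derivative[OF that U(2)]]]) simp
  have main: "lie_derivative B (lie_derivative A f) x =
     (\<Sum>k\<in>UNIV. A x $ k * lie_derivative B (d k) x) + (\<Sum>k\<in>UNIV. frechet_derivative A (at x) (B x) $ k * d k x)"
    if A: "smooth_on U A" for A B
  proof -
    have "lie_derivative B (lie_derivative A f) x = lie_derivative B (\<lambda>y. \<Sum>k\<in>UNIV. A y $ k * d k y) x"
      by (rule lie_derivative_open_cong[OF U]) (rule lf)
    also have "\<dots> = (\<Sum>k\<in>UNIV. lie_derivative B (\<lambda>y. A y $ k * d k y) x)"
      by (intro lie_derivative_sum differentiable_mult dc A dd)
    also have "\<dots> = (\<Sum>k\<in>UNIV. A x $ k * lie_derivative B (d k) x + frechet_derivative A (at x) (B x) $ k * d k x)"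
      by (intro sum.cong refl) (simp add: lie_derivative_mult dc A dd comp)
    finally show ?thesis by (simp add: sum.distrib)
  qed
  have C2: "Ck_on 2 U f" using f by (simp add: smooth_on_def)
  have ld: "lie_derivative B (d k) x = (\<Sum>l\<in>UNIV. B x $ l * frechet_derivative (d k) (at x) (axis l 1))" for B k
    by (rule lie_derivative_expand[OF dd])
  have sym: "frechet_derivative (d k) (at x) (axis l 1) = frechet_derivative (d l) (at x) (axis k 1)" for k l
    unfolding d_def by (rule second_derivative_symmetric[OF U(1) C2 U(2)])
  have "(\<Sum>k\<in>UNIV. W x $ k * lie_derivative V (d k) x) =
      (\<Sum>k\<in>UNIV. \<Sum>l\<in>UNIV. W x $ k * (V x $ l * frechet_derivative (d k) (at x) (axis l 1)))"
    by (simp add: ld sum_distrib_left)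
  also have "\<dots> = (\<Sum>l\<in>UNIV. \<Sum>k\<in>UNIV. W x $ k * (V x $ l * frechet_derivative (d k) (at x) (axis l 1)))"
    by (rule sum.swap)
  also have "\<dots> = (\<Sum>l\<in>UNIV. V x $ l * lie_derivative W (d l) x)"
    by (simp add: ld sum_distrib_left sym mult.left_commute)
  finally have "(\<Sum>k\<in>UNIV. W x $ k * lie_derivative V (d k) x) = (\<Sum>k\<in>UNIV. V x $ k * lie_derivative W (d k) x)" .
  then show ?thesis
    using main[OF W, of V] main[OF V, of W] lf[OF U(2), of "lie_bracket V W"]
    by (simp add: lie_bracket_def sum_subtractf left_diff_distrib)
qed

lemma iterated_derivative_simps [simp]:
  "iterated_derivative X [] f = f"
  "iterated_derivative X (i # I) f = lie_derivative (X i) (iterated_derivative X I f)"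
  by (simp_all add: iterated_derivative_def)

lemma iterated_derivative_append:
  "iterated_derivative X (I @ J) f = iterated_derivative X I (iterated_derivative X J f)"
  by (induction I) auto

section \<open>Order of vanishing along a frame\<close>

definition order_ge ::
  "('n \<Rightarrow> nat) \<Rightarrow> ('n \<Rightarrow> real^'n \<Rightarrow> real^'n) \<Rightarrow> real^'n \<Rightarrow> nat \<Rightarrow> (real^'n \<Rightarrow> real) \<Rightarrow> bool" where
  "order_ge v X p N f \<longleftrightarrow> (\<forall>I. sum_list (map v I) < N \<longrightarrow> iterated_derivative X I f p = 0)"

lemma order_geD: "order_ge v X p N f \<Longrightarrow> sum_list (map v I) < N \<Longrightarrow> iterated_derivative X I f p = 0"
  by (simp add: order_ge_def)

lemma order_ge_0 [simp]: "order_ge v X p 0 f"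
  by (simp add: order_ge_def)

text \<open>Truncated subtraction is harmless: if \<open>v i\<close> exceeds \<open>N\<close>, the
  claim is order at least 0.\<close>

lemma order_ge_lie: "order_ge v X p N f \<Longrightarrow> order_ge v X p (N - v i) (lie_derivative (X i) f)"
proof -
  assume f: "order_ge v X p N f"
  have "iterated_derivative X I (lie_derivative (X i) f) p = 0" if "sum_list (map v I) < N - v i" for I
    using order_geD[OF f, of "I @ [i]"] that by (simp add: iterated_derivative_append)
  then show ?thesis by (simp add: order_ge_def)
qed

lemma order_ge_iterated:
  "order_ge v X p N f \<Longrightarrow> order_ge v X p (N - sum_list (map v I)) (iterated_derivative X I f)"
proof (induction I)
  case (Cons i I)
  from order_ge_lie[OF Cons.IH[OF Cons.prems], of i] show ?case by (simp add: add.commute)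
qed simp

section \<open>Algebras of functions\<close>

text \<open>Elements depend on a parameter \<open>s\<close>. By \<open>cong\<close> only their
  values on \<open>S\<close> matter, since inverses and definite descriptions are meaningless for
  other parameters.\<close>

locale fun_algebra =
  fixes S :: "'s set" and A :: "('s \<Rightarrow> real) set"
  assumes const: "(\<lambda>s. c) \<in> A"
    and add: "f \<in> A \<Longrightarrow> g \<in> A \<Longrightarrow> (\<lambda>s. f s + g s) \<in> A"
    and mult: "f \<in> A \<Longrightarrow> g \<in> A \<Longrightarrow> (\<lambda>s. f s * g s) \<in> A"
    and cong: "f \<in> A \<Longrightarrow> (\<And>s. s \<in> S \<Longrightarrow> f s = g s) \<Longrightarrow> g \<in> A"
begin

lemma scale: "f \<in> A \<Longrightarrow> (\<lambda>s. c * f s) \<in> A"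
  by (rule mult[OF const])

lemma uminus: "f \<in> A \<Longrightarrow> (\<lambda>s. - f s) \<in> A"
  using scale[of f "-1"] by simp

lemma diff: "f \<in> A \<Longrightarrow> g \<in> A \<Longrightarrow> (\<lambda>s. f s - g s) \<in> A"
  using add[OF _ uminus, of f g] by simp

lemma sum: "(\<And>i. i \<in> I \<Longrightarrow> f i \<in> A) \<Longrightarrow> (\<lambda>s. \<Sum>i\<in>I. f i s) \<in> A"
  by (induction I rule: infinite_finite_induct) (auto intro: const add)

lemma prod: "(\<And>i. i \<in> I \<Longrightarrow> f i \<in> A) \<Longrightarrow> (\<lambda>s. \<Prod>i\<in>I. f i s) \<in> A"
  by (induction I rule: infinite_finite_induct) (auto intro: const mult)

lemma power: "f \<in> A \<Longrightarrow> (\<lambda>s. f s ^ m) \<in> A"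
  by (induction m) (auto intro: const mult)

lemma mpow: "(\<And>j. u j \<in> A) \<Longrightarrow> (\<lambda>s. mpow (\<lambda>j. u j s) \<alpha>) \<in> A"
  unfolding mpow_def by (intro prod power)

lemma det: "(\<And>i j. (\<lambda>s. M s $ i $ j) \<in> A) \<Longrightarrow> (\<lambda>s. det (M s)) \<in> A"
  unfolding det_def by (intro sum mult const prod)

end

lemma fun_algebra_smooth: "open S \<Longrightarrow> fun_algebra S {f :: 'a::real_normed_vector \<Rightarrow> real. smooth_on S f}"
proof (unfold_locales, goal_cases)
  case (4 f g)
  then show ?case using smooth_on_cong[OF 4(1), of f g] by simp
qed (auto intro: smooth_on_const smooth_on_add smooth_on_mult)

section \<open>Frames adapted to a filtration\<close>

text \<open>Cramer's rule for the coefficients of \<open>b\<close> in the basis \<open>F\<close>.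
  The explicit quotient shows that beyond ring operations only the inverse of the determinant of
  \<open>F\<close> enters.\<close>

definition coframe :: "('n::finite \<Rightarrow> real^'n) \<Rightarrow> real^'n \<Rightarrow> 'n \<Rightarrow> real" where
  "coframe F b l = det (\<chi> i j. if j = l then b $ i else F j $ i) / det (\<chi> i j. F j $ i)"

lemma coframe_unique:
  fixes F :: "'n::finite \<Rightarrow> real^'n"
  assumes "det (\<chi> i j. F j $ i) \<noteq> 0"
  shows "b = (\<Sum>l\<in>UNIV. c l *\<^sub>R F l) \<longleftrightarrow> c = coframe F b"
proof -
  have e: "(\<chi> i j. F j $ i) *v (\<chi> l. c l) = (\<Sum>l\<in>UNIV. c l *\<^sub>R F l)"
    by (simp add: vec_eq_iff matrix_vector_mult_def mult.commute)
  have "(b = (\<Sum>l\<in>UNIV. c l *\<^sub>R F l)) \<longleftrightarrow> (\<chi> i j. F j $ i) *v (\<chi> l. c l) = b"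
    unfolding e by auto
  also have "\<dots> \<longleftrightarrow> (\<chi> l. c l) = (\<chi> l. coframe F b l)"
    unfolding cramer[OF assms] coframe_def by (simp cong: if_cong)
  also have "\<dots> \<longleftrightarrow> c = coframe F b" by (simp add: vec_eq_iff fun_eq_iff)
  finally show ?thesis .
qed

lemma coframe_expand:
  fixes F :: "'n::finite \<Rightarrow> real^'n"
  shows "det (\<chi> i j. F j $ i) \<noteq> 0 \<Longrightarrow> (\<Sum>l\<in>UNIV. coframe F b l *\<^sub>R F l) = b"
  using coframe_unique[of F b "coframe F b"] by simp

lemma smooth_on_coframe:
  fixes F :: "'n::finite \<Rightarrow> 'a::real_normed_vector \<Rightarrow> real^'n"
  assumes U: "open U" and F: "\<And>j. smooth_on U (F j)" and b: "smooth_on U b"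
    and d: "\<And>x. x \<in> U \<Longrightarrow> det (\<chi> i j. F j x $ i) \<noteq> 0"
  shows "smooth_on U (\<lambda>x. coframe (\<lambda>j. F j x) (b x) l)"
proof -
  interpret fun_algebra U "{f. smooth_on U f}" by (rule fun_algebra_smooth[OF U])
  have e: "smooth_on U (\<lambda>s. if j = l then b s $ i else F j s $ i)" for i j
    using smooth_on_component[OF U F] smooth_on_component[OF U b] by (cases "j = l") simp_all
  have "smooth_on U (\<lambda>x. det (\<chi> i j. if j = l then b x $ i else F j x $ i))"
    using det[of "\<lambda>x. \<chi> i j. if j = l then b x $ i else F j x $ i"] e by simp
  moreover have "smooth_on U (\<lambda>x. inverse (det (\<chi> i j. F j x $ i)))"
    using det[of "\<lambda>x. \<chi> i j. F j x $ i"]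
    by (intro smooth_on_inverse U d) (simp_all add: smooth_on_component[OF U F])
  ultimately show ?thesis unfolding coframe_def divide_inverse by (intro smooth_on_mult U)
qed

text \<open>An H-frame read in one chart. The structure functions belong to the data, and
  \<open>L_zero\<close> is how the filtration enters.\<close>

locale hframe =
  fixes w :: "'n::finite \<Rightarrow> nat" and U :: "(real^'n) set" and X :: "'n \<Rightarrow> real^'n \<Rightarrow> real^'n"
    and L :: "'n \<Rightarrow> 'n \<Rightarrow> 'n \<Rightarrow> real^'n \<Rightarrow> real"
  assumes w_pos: "1 \<le> w j"
    and open_U: "open U"
    and smooth_X: "smooth_on U (X j)"
    and det_X: "x \<in> U \<Longrightarrow> det (\<chi> k j. X j x $ k) \<noteq> 0"
    and smooth_L: "smooth_on U (L i j k)"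
    and bracket: "x \<in> U \<Longrightarrow> lie_bracket (X i) (X j) x = (\<Sum>k\<in>UNIV. L i j k x *\<^sub>R X k x)"
    and L_zero: "w i + w j < w k \<Longrightarrow> x \<in> U \<Longrightarrow> L i j k x = 0"
begin

section \<open>Calculus of iterated derivatives along the frame\<close>

abbreviation D :: "'n list \<Rightarrow> (real^'n \<Rightarrow> real) \<Rightarrow> real^'n \<Rightarrow> real" where
  "D \<equiv> iterated_derivative X"

lemma smooth_lie: "smooth_on U f \<Longrightarrow> smooth_on U (lie_derivative (X j) f)"
  by (rule smooth_on_lie_derivative[OF open_U smooth_X])

lemma smooth_D: "smooth_on U f \<Longrightarrow> smooth_on U (D I f)"
  by (induction I) (auto intro: smooth_lie)

lemma smooth_diff: "smooth_on U f \<Longrightarrow> x \<in> U \<Longrightarrow> f differentiable (at x)"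
  by (rule smooth_on_differentiable)

lemma D_cong: "(\<And>y. y \<in> U \<Longrightarrow> f y = g y) \<Longrightarrow> x \<in> U \<Longrightarrow> D I f x = D I g x"
  by (induction I arbitrary: x) (auto intro: lie_derivative_open_cong[OF open_U])

lemma D_add:
  "smooth_on U f \<Longrightarrow> smooth_on U g \<Longrightarrow> x \<in> U \<Longrightarrow> D I (\<lambda>y. f y + g y) x = D I f x + D I g x"
proof (induction I arbitrary: x)
  case (Cons i I)
  have "lie_derivative (X i) (D I (\<lambda>y. f y + g y)) x = lie_derivative (X i) (\<lambda>y. D I f y + D I g y) x"
    using Cons by (intro lie_derivative_open_cong[OF open_U]) auto
  also have "\<dots> = lie_derivative (X i) (D I f) x + lie_derivative (X i) (D I g) x"
    using Cons.prems by (intro lie_derivative_add smooth_diff smooth_D)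
  finally show ?case by simp
qed simp

lemma D_scale: "smooth_on U f \<Longrightarrow> x \<in> U \<Longrightarrow> D I (\<lambda>y. c * f y) x = c * D I f x"
proof (induction I arbitrary: x)
  case (Cons i I)
  have "lie_derivative (X i) (D I (\<lambda>y. c * f y)) x = lie_derivative (X i) (\<lambda>y. c * D I f y) x"
    using Cons by (intro lie_derivative_open_cong[OF open_U]) auto
  also have "\<dots> = c * lie_derivative (X i) (D I f) x"
    using Cons.prems by (intro lie_derivative_scale smooth_diff smooth_D)
  finally show ?case by simp
qed simp

lemma D_diff:
  assumes "smooth_on U f" "smooth_on U g" "x \<in> U"
  shows "D I (\<lambda>y. f y - g y) x = D I f x - D I g x"
  using D_add[OF assms(1) smooth_on_scale[OF open_U assms(2), of "-1"] assms(3)] D_scale[OF assms(2,3), of I "-1"]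
  by simp

lemma D_zero: "D I (\<lambda>y. 0) = (\<lambda>x. 0)"
  by (induction I) auto

lemma D_const: "I \<noteq> [] \<Longrightarrow> D I (\<lambda>y. c) = (\<lambda>x. 0)"
proof (induction I rule: rev_induct)
  case (snoc i I)
  show ?case unfolding iterated_derivative_append by (simp add: D_zero)
qed simp

lemma D_sum:
  assumes "\<And>i. i \<in> B \<Longrightarrow> smooth_on U (f i)" "x \<in> U"
  shows "D I (\<lambda>y. \<Sum>i\<in>B. f i y) x = (\<Sum>i\<in>B. D I (f i) x)"
  using assms(1)
proof (induction B rule: infinite_finite_induct)
  case (insert i B)
  have "D I (\<lambda>y. f i y + (\<Sum>i\<in>B. f i y)) x = D I (f i) x + D I (\<lambda>y. \<Sum>i\<in>B. f i y) x"
    using insert.prems by (intro D_add smooth_on_sum open_U assms(2)) auto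
  then show ?case using insert by simp
qed (simp_all add: D_zero)

text \<open>Leibniz rule for the innermost field. Peeling words from the right keeps a product of
  two functions at every stage, in place of a sum over pairs of subwords.\<close>

lemma D_snoc_mult:
  assumes f: "smooth_on U f" and g: "smooth_on U g" and x: "x \<in> U"
  shows "D (I @ [a]) (\<lambda>y. f y * g y) x =
    D I (\<lambda>y. f y * lie_derivative (X a) g y) x + D I (\<lambda>y. lie_derivative (X a) f y * g y) x"
proof -
  have "D (I @ [a]) (\<lambda>y. f y * g y) x = D I (lie_derivative (X a) (\<lambda>y. f y * g y)) x"
    by (simp add: iterated_derivative_append)
  also have "\<dots> = D I (\<lambda>y. f y * lie_derivative (X a) g y + lie_derivative (X a) f y * g y) x"
    by (rule D_cong[OF _ x]) (intro lie_derivative_mult smooth_diff f g)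
  also have "\<dots> = D I (\<lambda>y. f y * lie_derivative (X a) g y) x + D I (\<lambda>y. lie_derivative (X a) f y * g y) x"
    by (intro D_add smooth_on_mult smooth_lie open_U f g x)
  finally show ?thesis .
qed

lemma D_snoc: "D (I @ [a]) f = D I (lie_derivative (X a) f)"
  by (simp add: iterated_derivative_append)

text \<open>Each letter falls on one of the factors and lowers its order by at most its own weight;
  a word lighter than N + M cannot exhaust both.\<close>

lemma D_mult_vanish:
  assumes p: "p \<in> U"
  shows "smooth_on U f \<Longrightarrow> smooth_on U g \<Longrightarrow> order_ge v X p N f \<Longrightarrow> order_ge v X p M g \<Longrightarrow>
    sum_list (map v I) < N + M \<Longrightarrow> D I (\<lambda>x. f x * g x) p = 0"
proof (induction I arbitrary: f g N M rule: rev_induct)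
  case Nil
  then have "0 < N \<or> 0 < M" by auto
  then show ?case using order_geD[of v X p N f "[]"] order_geD[of v X p M g "[]"] Nil by auto
next
  case (snoc a I)
  have 1: "D I (\<lambda>y. f y * lie_derivative (X a) g y) p = 0"
    by (rule snoc.IH[OF snoc.prems(1) smooth_lie[OF snoc.prems(2)] snoc.prems(3) order_ge_lie[OF snoc.prems(4)]])
      (use snoc.prems(5) in simp)
  have 2: "D I (\<lambda>y. lie_derivative (X a) f y * g y) p = 0"
    by (rule snoc.IH[OF smooth_lie[OF snoc.prems(1)] snoc.prems(2) order_ge_lie[OF snoc.prems(3)] snoc.prems(4)])
      (use snoc.prems(5) in simp)
  show ?case unfolding D_snoc_mult[OF snoc.prems(1,2) p] 1 2 by simp
qed

lemma order_ge_mult: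
  "p \<in> U \<Longrightarrow> smooth_on U f \<Longrightarrow> smooth_on U g \<Longrightarrow> order_ge v X p N f \<Longrightarrow> order_ge v X p M g \<Longrightarrow>
    order_ge v X p (N + M) (\<lambda>x. f x * g x)"
  unfolding order_ge_def[of v X p "N + M"] by (intro allI impI) (rule D_mult_vanish)

lemma order_ge_power:
  assumes "p \<in> U" "smooth_on U f" "order_ge v X p N f"
  shows "order_ge v X p (N * m) (\<lambda>x. f x ^ m)"
proof (induction m)
  case (Suc m)
  then show ?case
    using order_ge_mult[OF assms(1,2) smooth_on_power[OF open_U assms(2)] assms(3) Suc.IH] by simp
qed simp

lemma order_ge_prod:
  assumes "p \<in> U" "\<And>i. i \<in> B \<Longrightarrow> smooth_on U (f i)" "\<And>i. i \<in> B \<Longrightarrow> order_ge v X p (N i) (f i)"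
  shows "order_ge v X p (\<Sum>i\<in>B. N i) (\<lambda>x. \<Prod>i\<in>B. f i x)"
  using assms(2,3)
proof (induction B rule: infinite_finite_induct)
  case (insert i B)
  have "order_ge v X p (N i + (\<Sum>i\<in>B. N i)) (\<lambda>x. f i x * (\<Prod>i\<in>B. f i x))"
    using insert by (intro order_ge_mult assms(1) smooth_on_prod open_U) auto
  then show ?case using insert by simp
qed simp_all

lemma smooth_mpow: "(\<And>k. smooth_on U (u k)) \<Longrightarrow> smooth_on U (\<lambda>x. mpow (\<lambda>k. u k x) \<alpha>)"
  unfolding mpow_def by (intro smooth_on_prod smooth_on_power open_U)

lemma order_ge_mpow:
  assumes "p \<in> U" "\<And>k. smooth_on U (u k)" "\<And>k. order_ge v X p (c k) (u k)"
  shows "order_ge v X p (mdeg c \<alpha>) (\<lambda>x. mpow (\<lambda>k. u k x) \<alpha>)"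
  unfolding mpow_def mdeg_def
  by (intro order_ge_prod order_ge_power smooth_on_power open_U assms)

lemma order_ge_one_1: "f p = 0 \<Longrightarrow> order_ge one X p 1 f"
  unfolding order_ge_def by (auto simp: sum_list_triv)

text \<open>The function \<open>h - h p\<close> vanishes at \<open>p\<close>, so its product with
  \<open>g\<close> has order beyond the length of \<open>I\<close>; \<open>h\<close> may be frozen
  at its value.\<close>

lemma D_mult_top:
  assumes p: "p \<in> U" and h: "smooth_on U h" and g: "smooth_on U g" "order_ge one X p (length I) g"
  shows "D I (\<lambda>x. h x * g x) p = h p * D I g p"
proof -
  have s: "smooth_on U (\<lambda>x. h x - h p)" by (intro smooth_on_minus open_U h smooth_on_const)
  have "D I (\<lambda>x. (h x - h p) * g x) p = 0"
    by (rule D_mult_vanish[OF p s g(1) order_ge_one_1 g(2)]) (auto simp: sum_list_triv)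
  moreover have "D I (\<lambda>x. (h x - h p) * g x) p = D I (\<lambda>x. h x * g x) p - h p * D I g p"
    unfolding left_diff_distrib
    using D_diff[OF smooth_on_mult[OF open_U h g(1)] smooth_on_scale[OF open_U g(1)] p] D_scale[OF g(1) p]
    by simp
  ultimately show ?thesis by simp
qed

lemma mdeg_decr: "\<alpha> k \<noteq> 0 \<Longrightarrow> mdeg v \<alpha> = v k + mdeg v (\<alpha>(k := \<alpha> k - 1))"
proof -
  assume "\<alpha> k \<noteq> 0"
  then have "\<alpha> = (\<lambda>j. (\<alpha>(k := \<alpha> k - 1)) j + (if j = k then 1 else 0))" by auto
  then show ?thesis using mdeg_add_single[of v "\<alpha>(k := \<alpha> k - 1)" k] by simp
qed

text \<open>The triangularity on which all determinations of coefficients rest.\<close>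

lemma D_mpow_short:
  assumes "p \<in> U" "\<And>k. smooth_on U (u k)" "\<And>k. u k p = 0" "length I < mdeg one \<alpha>"
  shows "D I (\<lambda>x. mpow (\<lambda>k. u k x) \<alpha>) p = 0"
  using order_geD[OF order_ge_mpow[of p u one one \<alpha>], of I] assms order_ge_one_1
  by (auto simp: sum_list_triv)

text \<open>At top length the factors X_b u_k can be frozen at \<open>p\<close>, where they are
  Kronecker deltas. The word then acts on u^\<alpha> like the constant-coefficient derivative with
  the same letters.\<close>

lemma D_mpow_equal:
  assumes p: "p \<in> U" and u: "\<And>k. smooth_on U (u k)" "\<And>k. u k p = 0"
    "\<And>j k. lie_derivative (X j) (u k) p = (if j = k then 1 else 0)"
  shows "length I = mdeg one \<alpha> \<Longrightarrow>
    D I (\<lambda>x. mpow (\<lambda>k. u k x) \<alpha>) p = (if content I = \<alpha> then \<Prod>j\<in>UNIV. fact (\<alpha> j) else 0)"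
proof (induction I arbitrary: \<alpha> rule: rev_induct)
  case Nil
  then have "\<alpha> = (\<lambda>_. 0)" by (auto simp: mdeg_def fun_eq_iff)
  then show ?case by (auto simp: fun_eq_iff)
next
  case (snoc b I)
  let ?m = "\<lambda>k x. mpow (\<lambda>k. u k x) (\<alpha>(k := \<alpha> k - 1))"
  let ?h = "\<lambda>k. lie_derivative (X b) (u k)"
  have sm: "smooth_on U (?m k)" for k by (rule smooth_mpow[OF u(1)])
  have len: "length I = mdeg one (\<alpha>(k := \<alpha> k - 1))" if "\<alpha> k \<noteq> 0" for k
    using snoc.prems mdeg_decr[of \<alpha> k one] that by simp
  have t: "D I (\<lambda>x. ?h k x * ?m k x) p = (if b = k then D I (?m k) p else 0)" if "\<alpha> k \<noteq> 0" for k
  proof -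
    have "order_ge one X p (mdeg one (\<alpha>(k := \<alpha> k - 1))) (?m k)"
      by (rule order_ge_mpow[where c=one and u=u, OF p u(1)]) (rule order_ge_one_1, rule u(2))
    then show ?thesis using D_mult_top[OF p smooth_lie[OF u(1)] sm] u(3) len[OF that] by auto
  qed
  have "D (I @ [b]) (\<lambda>x. mpow (\<lambda>k. u k x) \<alpha>) p =
    D I (\<lambda>x. \<Sum>k\<in>UNIV. real (\<alpha> k) * (?h k x * ?m k x)) p"
    unfolding D_snoc mult.assoc[symmetric]
    by (rule D_cong[OF _ p]) (intro lie_derivative_mpow smooth_diff u(1))
  also have "\<dots> = (\<Sum>k\<in>UNIV. D I (\<lambda>x. real (\<alpha> k) * (?h k x * ?m k x)) p)"
    by (intro D_sum smooth_on_scale open_U smooth_on_mult smooth_lie sm u(1) p)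
  also have "\<dots> = (\<Sum>k\<in>UNIV. real (\<alpha> k) * D I (\<lambda>x. ?h k x * ?m k x) p)"
    by (intro sum.cong refl D_scale smooth_on_mult open_U smooth_lie sm u(1) p)
  also have "\<dots> = (\<Sum>k\<in>UNIV. if b = k then real (\<alpha> k) * D I (?m k) p else 0)"
    by (intro sum.cong refl) (use t in force)
  also have "\<dots> = real (\<alpha> b) * D I (?m b) p" by simp
  finally have e: "D (I @ [b]) (\<lambda>x. mpow (\<lambda>k. u k x) \<alpha>) p = real (\<alpha> b) * D I (?m b) p" .
  show ?case
  proof (cases "\<alpha> b = 0")
    case True
    then have "content (I @ [b]) b \<noteq> \<alpha> b" by simp
    then have "content (I @ [b]) \<noteq> \<alpha>" by metis
    then show ?thesis unfolding e True by (simp only: if_False of_nat_0 mult_zero_left)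
  next
    case False
    have c: "content (I @ [b]) = \<alpha> \<longleftrightarrow> content I = \<alpha>(b := \<alpha> b - 1)"
      using False by (auto simp: fun_eq_iff split: if_splits)
    have "(\<Prod>j\<in>UNIV. fact (\<alpha> j)) = fact (\<alpha> b) * (\<Prod>j\<in>UNIV - {b}. fact (\<alpha> j) :: real)"
      by (subst prod.remove[of UNIV b]) auto
    moreover have "(\<Prod>j\<in>UNIV. fact ((\<alpha>(b := \<alpha> b - 1)) j)) = fact (\<alpha> b - 1) * (\<Prod>j\<in>UNIV - {b}. fact (\<alpha> j) :: real)"
      by (subst prod.remove[of UNIV b]) auto
    moreover have "fact (\<alpha> b) = real (\<alpha> b) * fact (\<alpha> b - 1)" using False by (simp add: fact_reduce)
    ultimately show ?thesis unfolding e snoc.IH[OF len[OF False]] c by simp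
  qed
qed

text \<open>Whichever letters fall on \<open>l\<close>, the others form a word on \<open>g\<close>
  that is no longer and no heavier than \<open>I\<close>. Quantifying over all such words makes the
  hypothesis stable under transferring the last letter to \<open>g\<close>.\<close>

lemma D_mult_lower:
  fixes v :: "'n \<Rightarrow> nat"
  assumes p: "p \<in> U"
  shows "smooth_on U l \<Longrightarrow> smooth_on U g \<Longrightarrow>
    (\<And>J. length J \<le> length I \<Longrightarrow> sum_list (map v J) \<le> sum_list (map v I) \<Longrightarrow> D J g p = 0) \<Longrightarrow>
    D I (\<lambda>x. l x * g x) p = 0"
proof (induction I arbitrary: l g rule: rev_induct)
  case Nil
  have "D [] g p = 0" by (rule Nil.prems(3)) auto
  then show ?case by simp
next
  case (snoc a I)
  have "D I (\<lambda>y. l y * lie_derivative (X a) g y) p = 0"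
  proof (rule snoc.IH[OF snoc.prems(1) smooth_lie[OF snoc.prems(2)]])
    fix J assume "length J \<le> length I" "sum_list (map v J) \<le> sum_list (map v I)"
    then show "D J (lie_derivative (X a) g) p = 0" using snoc.prems(3)[of "J @ [a]"] by (simp add: D_snoc)
  qed
  moreover have "D I (\<lambda>y. lie_derivative (X a) l y * g y) p = 0"
  proof (rule snoc.IH[OF smooth_lie[OF snoc.prems(1)] snoc.prems(2)])
    fix J assume "length J \<le> length I" "sum_list (map v J) \<le> sum_list (map v I)"
    then show "D J g p = 0" by (intro snoc.prems(3)) auto
  qed
  ultimately show ?case unfolding D_snoc_mult[OF snoc.prems(1,2) p] by simp
qed

section \<open>Reordering words of vector fields\<close>

lemma lie_commute:
  assumes f: "smooth_on U f" and x: "x \<in> U"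
  shows "lie_derivative (X i) (lie_derivative (X j) f) x =
    lie_derivative (X j) (lie_derivative (X i) f) x + (\<Sum>k\<in>UNIV. L i j k x * lie_derivative (X k) f x)"
proof -
  have "lie_derivative (lie_bracket (X i) (X j)) f x = (\<Sum>k\<in>UNIV. L i j k x * lie_derivative (X k) f x)"
    unfolding lie_derivative_def bracket[OF x]
    using has_derivative_linear[OF smooth_on_has_derivative[OF f x]] by (simp add: linear_sum linear_scale)
  then show ?thesis using lie_derivative_commutator[OF open_U x smooth_X smooth_X f, of i j] by simp
qed

text \<open>The commutator replaces \<open>i\<close>, \<open>j\<close> by single letters
  \<open>k\<close> with \<open>v k\<close> at most \<open>v i + v j\<close>. These words are shorter
  and no heavier, so \<open>low\<close> annihilates them.\<close>

lemma D_swap: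
  fixes v :: "'n \<Rightarrow> nat"
  assumes p: "p \<in> U" and f: "smooth_on U f"
    and v: "\<And>i j k x. v i + v j < v k \<Longrightarrow> x \<in> U \<Longrightarrow> L i j k x = 0"
    and low: "\<And>J. length J < length (C @ i # j # B) \<Longrightarrow> sum_list (map v J) < N \<Longrightarrow> D J f p = 0"
    and N: "sum_list (map v (C @ i # j # B)) < N"
  shows "D (C @ i # j # B) f p = D (C @ j # i # B) f p"
proof -
  let ?g = "D B f"
  have g: "smooth_on U ?g" by (rule smooth_D[OF f])
  have "D (C @ i # j # B) f p = D C (\<lambda>x. lie_derivative (X j) (lie_derivative (X i) ?g) x +
      (\<Sum>k\<in>UNIV. L i j k x * lie_derivative (X k) ?g x)) p"
    unfolding iterated_derivative_append iterated_derivative_simps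
    by (rule D_cong[OF _ p]) (rule lie_commute[OF g])
  also have "\<dots> = D (C @ j # i # B) f p + D C (\<lambda>x. \<Sum>k\<in>UNIV. L i j k x * lie_derivative (X k) ?g x) p"
    unfolding iterated_derivative_append iterated_derivative_simps
    by (intro D_add smooth_lie g p smooth_on_sum open_U smooth_on_mult smooth_L)
  also have "D C (\<lambda>x. \<Sum>k\<in>UNIV. L i j k x * lie_derivative (X k) ?g x) p =
      (\<Sum>k\<in>UNIV. D C (\<lambda>x. L i j k x * lie_derivative (X k) ?g x) p)"
    by (intro D_sum smooth_on_mult open_U smooth_L smooth_lie g p)
  also have "\<dots> = 0"
  proof (rule sum.neutral, rule ballI)
    fix k
    show "D C (\<lambda>x. L i j k x * lie_derivative (X k) ?g x) p = 0"
    proof (cases "v i + v j < v k")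
      case True
      then have "D C (\<lambda>x. L i j k x * lie_derivative (X k) ?g x) p = D C (\<lambda>x. 0) p"
        by (intro D_cong[OF _ p]) (simp add: v)
      then show ?thesis by (simp add: D_zero)
    next
      case False
      show ?thesis
      proof (rule D_mult_lower[OF p smooth_L smooth_lie[OF g]])
        fix J assume "length J \<le> length C" "sum_list (map v J) \<le> sum_list (map v C)"
        then have "sum_list (map v (J @ k # B)) \<le> sum_list (map v (C @ i # j # B))"
            "length (J @ k # B) < length (C @ i # j # B)"
          using False by simp_all
        then have "D (J @ k # B) f p = 0" using N by (intro low) auto
        then show "D J (lie_derivative (X k) ?g) p = 0" by (simp add: iterated_derivative_append)
      qed
    qed
  qed
  finally show ?thesis by simp
qed

lemma D_move:
  fixes v :: "'n \<Rightarrow> nat"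
  assumes p: "p \<in> U" and f: "smooth_on U f"
    and v: "\<And>i j k x. v i + v j < v k \<Longrightarrow> x \<in> U \<Longrightarrow> L i j k x = 0"
    and low: "\<And>J. length J < n \<Longrightarrow> sum_list (map v J) < N \<Longrightarrow> D J f p = 0"
  shows "length (C @ i # B @ E) = n \<Longrightarrow> sum_list (map v (C @ i # B @ E)) < N \<Longrightarrow>
    D (C @ i # B @ E) f p = D (C @ B @ i # E) f p"
proof (induction B arbitrary: C)
  case (Cons b B)
  have "D (C @ i # b # (B @ E)) f p = D (C @ b # i # (B @ E)) f p"
    by (rule D_swap[OF p f v, where v=v and N=N]) (use Cons.prems low in auto)
  also have "\<dots> = D ((C @ [b]) @ i # B @ E) f p" by simp
  also have "\<dots> = D ((C @ [b]) @ B @ i # E) f p"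
    by (rule Cons.IH) (use Cons.prems in \<open>auto simp: ac_simps\<close>)
  finally show ?case by simp
qed simp

text \<open>The first letter of \<open>I\<close> is joined to the prefix \<open>C\<close>, the rest
  is permuted, and the letter then travels to its place in \<open>I'\<close>.\<close>

lemma D_permute:
  fixes v :: "'n \<Rightarrow> nat"
  assumes p: "p \<in> U" and f: "smooth_on U f"
    and v: "\<And>i j k x. v i + v j < v k \<Longrightarrow> x \<in> U \<Longrightarrow> L i j k x = 0"
    and low: "\<And>J. length J < n \<Longrightarrow> sum_list (map v J) < N \<Longrightarrow> D J f p = 0"
  shows "mset I = mset I' \<Longrightarrow> length (C @ I) = n \<Longrightarrow> sum_list (map v (C @ I)) < N \<Longrightarrow>
    D (C @ I) f p = D (C @ I') f p"
proof (induction I arbitrary: C I')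
  case (Cons i I)
  have "i \<in> set I'" using Cons.prems(1) by (metis list.set_intros(1) set_mset_mset)
  then obtain B E where I': "I' = B @ i # E" by (meson split_list)
  have m: "mset I = mset (B @ E)" using Cons.prems(1) by (simp add: I')
  have l: "length I = length (B @ E)" using m by (metis size_mset)
  have s: "sum_list (map v I) = sum_list (map v (B @ E))" using m by (metis sum_list_content)
  have "D (C @ i # I) f p = D ((C @ [i]) @ I) f p" by simp
  also have "\<dots> = D ((C @ [i]) @ B @ E) f p"
    by (rule Cons.IH[OF m]) (use Cons.prems in auto)
  also have "\<dots> = D (C @ i # B @ E) f p" by simp
  also have "\<dots> = D (C @ B @ i # E) f p"
    by (rule D_move[OF p f v low, where v=v and N=N and n=n]) (use Cons.prems l s in auto)
  finally show ?case by (simp add: I')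
qed simp

text \<open>A weak form of the Poincar\'e--Birkhoff--Witt theorem: reordering a word changes
  \<open>X\<^sub>I f(p)\<close> only by terms with shorter words of no larger weight.\<close>

lemma order_ge_words:
  assumes p: "p \<in> U" and f: "smooth_on U f"
    and v: "\<And>i j k x. v i + v j < v k \<Longrightarrow> x \<in> U \<Longrightarrow> L i j k x = 0"
    and words: "\<And>\<alpha>. mdeg v \<alpha> < N \<Longrightarrow> D (word \<alpha>) f p = 0"
  shows "order_ge v X p N f"
proof -
  have "D I f p = 0" if "sum_list (map v I) < N" for I
    using that
  proof (induction "length I" arbitrary: I rule: less_induct)
    case less
    have m: "mset I = mset (word (content I))" by (simp add: multiset_eq_iff)
    have "D ([] @ I) f p = D ([] @ word (content I)) f p"
      by (rule D_permute[OF p f v _ m, where v=v and N=N and n="length I"]) (use less in auto)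
    also have "\<dots> = 0" using words[of "content I"] less.prems by (simp add: sum_list_content)
    finally show ?case by simp
  qed
  then show ?thesis by (simp add: order_ge_def)
qed

text \<open>For constant weight 1 the condition on the structure functions is vacuous, as 1 + 1 < 1
  is false.\<close>

lemma order_ge_one_words:
  assumes "p \<in> U" "smooth_on U f" "\<And>\<alpha>. mdeg one \<alpha> < N \<Longrightarrow> D (word \<alpha>) f p = 0"
  shows "order_ge one X p N f"
  by (rule order_ge_words[OF assms(1,2) _ assms(3)]) auto

lemma order_ge_w_words:
  assumes "p \<in> U" "smooth_on U f" "\<And>\<alpha>. mdeg w \<alpha> < N \<Longrightarrow> D (word \<alpha>) f p = 0"
  shows "order_ge w X p N f"
  by (rule order_ge_words[OF assms(1,2) L_zero assms(3)])

section \<open>Growth of a function near a zero of given unweighted order\<close>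

lemma smooth_coframe: "smooth_on U (\<lambda>x. coframe (\<lambda>j. X j x) b l)"
  by (rule smooth_on_coframe[OF open_U smooth_X smooth_on_const det_X])

lemma derivative_coframe:
  assumes "smooth_on U f" "x \<in> U"
  shows "frechet_derivative f (at x) b = (\<Sum>l\<in>UNIV. coframe (\<lambda>j. X j x) b l * lie_derivative (X l) f x)"
proof -
  have l: "linear (frechet_derivative f (at x))"
    by (rule has_derivative_linear[OF smooth_on_has_derivative[OF assms]])
  have "frechet_derivative f (at x) (\<Sum>l\<in>UNIV. coframe (\<lambda>j. X j x) b l *\<^sub>R X l x) =
      (\<Sum>l\<in>UNIV. coframe (\<lambda>j. X j x) b l * lie_derivative (X l) f x)"
    using l by (simp add: linear_sum linear_scale lie_derivative_def)
  then show ?thesis by (simp add: coframe_expand[OF det_X[OF assms(2)]])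
qed

text \<open>A Taylor estimate by induction. The derivatives along the frame have order
  \<open>M\<close>; the coframe, bounded on the compact ball, turns this into a bound on the full
  derivative, and the mean value inequality gains the last power.\<close>

lemma order_ge_one_bound:
  assumes \<rho>: "cball p \<rho> \<subseteq> U"
  shows "smooth_on U f \<Longrightarrow> order_ge one X p M f \<Longrightarrow> \<exists>C\<ge>0. \<forall>x\<in>cball p \<rho>. \<bar>f x\<bar> \<le> C * norm (x - p) ^ M"
proof (induction M arbitrary: f)
  case 0
  have "continuous_on (cball p \<rho>) f"
    using smooth_on_continuous_on[OF 0(1)] \<rho> continuous_on_subset by blast
  then have "bounded (f ` cball p \<rho>)" by (intro compact_imp_bounded compact_continuous_image compact_cball)
  then obtain C where "C > 0" "\<forall>x\<in>cball p \<rho>. \<bar>f x\<bar> \<le> C" unfolding bounded_pos by auto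
  then show ?case by (intro exI[of _ C]) auto
next
  case (Suc M)
  have "\<exists>K>0. \<forall>x\<in>cball p \<rho>. \<bar>coframe (\<lambda>j. X j x) (axis k 1) l\<bar> \<le> K" for k l
  proof -
    have "continuous_on (cball p \<rho>) (\<lambda>x. coframe (\<lambda>j. X j x) (axis k 1) l)"
      using smooth_on_continuous_on[OF smooth_coframe] \<rho> continuous_on_subset by blast
    then have "bounded ((\<lambda>x. coframe (\<lambda>j. X j x) (axis k 1) l) ` cball p \<rho>)"
      by (intro compact_imp_bounded compact_continuous_image compact_cball)
    then show ?thesis unfolding bounded_pos by auto
  qed
  then obtain K where K: "\<And>k l. K k l > 0"
      "\<And>k l x. x \<in> cball p \<rho> \<Longrightarrow> \<bar>coframe (\<lambda>j. X j x) (axis k 1) l\<bar> \<le> K k l" by metis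
  have "\<exists>C\<ge>0. \<forall>x\<in>cball p \<rho>. \<bar>lie_derivative (X l) f x\<bar> \<le> C * norm (x - p) ^ M" for l
    using Suc.IH[OF smooth_lie[OF Suc.prems(1)]] order_ge_lie[OF Suc.prems(2), of l] by simp
  then obtain C where C: "\<And>l. C l \<ge> 0"
      "\<And>l x. x \<in> cball p \<rho> \<Longrightarrow> \<bar>lie_derivative (X l) f x\<bar> \<le> C l * norm (x - p) ^ M" by metis
  define B where "B = (\<Sum>k\<in>UNIV. \<Sum>l\<in>UNIV. K k l * C l)"
  have B0: "B \<ge> 0" unfolding B_def using K(1) C(1) by (intro sum_nonneg mult_nonneg_nonneg) (auto intro: less_imp_le)
  have d: "\<bar>frechet_derivative f (at z) h\<bar> \<le> B * norm (z - p) ^ M * norm h" if z: "z \<in> cball p \<rho>" for z h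
  proof -
    have zU: "z \<in> U" using z \<rho> by blast
    have "frechet_derivative f (at z) h = (\<Sum>k\<in>UNIV. h $ k *\<^sub>R frechet_derivative f (at z) (axis k 1))"
      by (rule linear_vec_expand[OF has_derivative_linear[OF smooth_on_has_derivative[OF Suc.prems(1) zU]]])
    also have "\<bar>\<dots>\<bar> \<le> (\<Sum>k\<in>UNIV. \<Sum>l\<in>UNIV. norm h * (K k l * (C l * norm (z - p) ^ M)))"
    proof (rule sum_abs[THEN order_trans], rule sum_mono)
      fix k
      have "\<bar>h $ k *\<^sub>R frechet_derivative f (at z) (axis k 1)\<bar> \<le> norm h * \<bar>frechet_derivative f (at z) (axis k 1)\<bar>"
        by (simp add: abs_mult mult_right_mono component_le_norm_cart)
      also have "\<bar>frechet_derivative f (at z) (axis k 1)\<bar> \<le> (\<Sum>l\<in>UNIV. K k l * (C l * norm (z - p) ^ M))"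
        unfolding derivative_coframe[OF Suc.prems(1) zU]
        by (rule sum_abs[THEN order_trans], rule sum_mono)
          (auto simp: abs_mult intro!: mult_mono K(2) C(2) z less_imp_le[OF K(1)])
      finally show "\<bar>h $ k *\<^sub>R frechet_derivative f (at z) (axis k 1)\<bar> \<le>
          (\<Sum>l\<in>UNIV. norm h * (K k l * (C l * norm (z - p) ^ M)))"
        by (simp add: sum_distrib_left mult_left_mono)
    qed
    also have "\<dots> = B * norm (z - p) ^ M * norm h"
      unfolding B_def by (simp add: sum_distrib_left sum_distrib_right mult_ac)
    finally show ?thesis .
  qed
  have "\<bar>f x\<bar> \<le> B * norm (x - p) ^ Suc M" if x: "x \<in> cball p \<rho>" for x
  proof -
    \<comment> \<open>On this smaller ball the derivative is bounded by the value of the estimate at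
      the distance of \<open>x\<close> itself.\<close>
    have sub: "cball p (norm (x - p)) \<subseteq> cball p \<rho>" using x by (auto simp: dist_norm norm_minus_commute)
    have "norm (f x - f p) \<le> B * norm (x - p) ^ M * norm (x - p)"
    proof (rule differentiable_bound[of "cball p (norm (x - p))" f "\<lambda>z. frechet_derivative f (at z)"])
      fix z assume z: "z \<in> cball p (norm (x - p))"
      then have zU: "z \<in> U" using sub \<rho> by blast
      show "(f has_derivative frechet_derivative f (at z)) (at z within cball p (norm (x - p)))"
        using smooth_on_has_derivative[OF Suc.prems(1) zU] has_derivative_at_withinI by blast
      show "onorm (frechet_derivative f (at z)) \<le> B * norm (x - p) ^ M"
      proof (rule onorm_le)
        fix h
        have "norm (frechet_derivative f (at z) h) \<le> B * norm (z - p) ^ M * norm h"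
          using d[of z h] z sub by auto
        also have "\<dots> \<le> B * norm (x - p) ^ M * norm h"
          using z B0 by (intro mult_right_mono mult_left_mono power_mono) (auto simp: dist_norm norm_minus_commute)
        finally show "norm (frechet_derivative f (at z) h) \<le> B * norm (x - p) ^ M * norm h" .
      qed
    qed (auto simp: dist_norm norm_minus_commute)
    moreover have "f p = 0" using order_geD[OF Suc.prems(2), of "[]"] by simp
    ultimately show ?thesis by (simp add: mult_ac)
  qed
  then show ?case using B0 by blast
qed

end

section \<open>Triangular systems with coefficients in an algebra of functions\<close>

context fun_algebra
begin

text \<open>Forward substitution in increasing rank. The diagonal entries do not depend on
  \<open>s\<close>, so dividing by them stays in the algebra.\<close>

lemma triangular_solve:
  fixes M :: "'i \<Rightarrow> 'i \<Rightarrow> 's \<Rightarrow> real" and rank :: "'i \<Rightarrow> nat"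
  assumes Q: "finite Q" and F: "\<And>\<beta>. F \<beta> \<in> A" and M: "\<And>\<beta> \<alpha>. M \<beta> \<alpha> \<in> A"
    and tri: "\<And>\<beta> \<alpha> s. s \<in> S \<Longrightarrow> rank \<beta> \<le> rank \<alpha> \<Longrightarrow> \<alpha> \<noteq> \<beta> \<Longrightarrow> M \<beta> \<alpha> s = 0"
    and diag: "\<And>\<beta> s. s \<in> S \<Longrightarrow> M \<beta> \<beta> s = \<kappa> \<beta>" and \<kappa>: "\<And>\<beta>. \<kappa> \<beta> \<noteq> 0"
  obtains c where "\<And>\<alpha>. c \<alpha> \<in> A" "\<And>s \<beta>. s \<in> S \<Longrightarrow> \<beta> \<in> Q \<Longrightarrow> (\<Sum>\<alpha>\<in>Q. c \<alpha> s * M \<beta> \<alpha> s) = F \<beta> s"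
proof -
  have "\<exists>c. (\<forall>\<alpha>. c \<alpha> \<in> A) \<and> (\<forall>s\<in>S. \<forall>\<beta>\<in>Q. rank \<beta> < n \<longrightarrow> (\<Sum>\<alpha>\<in>Q. c \<alpha> s * M \<beta> \<alpha> s) = F \<beta> s)" for n
  proof (induction n)
    case 0
    show ?case by (intro exI[of _ "\<lambda>_ _. 0"]) (simp add: const)
  next
    case (Suc n)
    then obtain c where c: "\<And>\<alpha>. c \<alpha> \<in> A"
      and e: "\<And>s \<beta>. s \<in> S \<Longrightarrow> \<beta> \<in> Q \<Longrightarrow> rank \<beta> < n \<Longrightarrow> (\<Sum>\<alpha>\<in>Q. c \<alpha> s * M \<beta> \<alpha> s) = F \<beta> s" by blast
    \<comment> \<open>The value forced on the unknown of index \<alpha> by its own equation once the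
      unknowns of rank below \<open>n\<close> are known.\<close>
    define d where "d \<alpha> s = (1 / \<kappa> \<alpha>) * (F \<alpha> s - (\<Sum>\<gamma>\<in>{\<gamma>\<in>Q. rank \<gamma> < n}. c \<gamma> s * M \<alpha> \<gamma> s))" for \<alpha> s
    define c' where "c' \<alpha> = (if rank \<alpha> = n then d \<alpha> else c \<alpha>)" for \<alpha>
    have "d \<alpha> \<in> A" for \<alpha> unfolding d_def by (intro scale diff F sum mult c M)
    then have c': "c' \<alpha> \<in> A" for \<alpha> using c by (simp add: c'_def)
    have "(\<Sum>\<alpha>\<in>Q. c' \<alpha> s * M \<beta> \<alpha> s) = F \<beta> s" if s: "s \<in> S" and \<beta>: "\<beta> \<in> Q" "rank \<beta> < Suc n" for s \<beta>
    proof (cases "rank \<beta> < n")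
      case True
      have "(\<Sum>\<alpha>\<in>Q. c' \<alpha> s * M \<beta> \<alpha> s) = (\<Sum>\<alpha>\<in>Q. c \<alpha> s * M \<beta> \<alpha> s)"
      proof (intro sum.cong refl)
        fix \<alpha>
        show "c' \<alpha> s * M \<beta> \<alpha> s = c \<alpha> s * M \<beta> \<alpha> s"
        proof (cases "rank \<alpha> = n")
          case r: True
          then have "M \<beta> \<alpha> s = 0" using True by (intro tri[OF s]) auto
          then show ?thesis by simp
        qed (simp add: c'_def)
      qed
      then show ?thesis using e[OF s \<beta>(1) True] by simp
    next
      case False
      then have r: "rank \<beta> = n" using \<beta> by simp
      have "(\<Sum>\<alpha>\<in>Q. c' \<alpha> s * M \<beta> \<alpha> s) = c' \<beta> s * M \<beta> \<beta> s + (\<Sum>\<alpha>\<in>Q - {\<beta>}. c' \<alpha> s * M \<beta> \<alpha> s)"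
        by (rule sum.remove[OF Q \<beta>(1)])
      also have "(\<Sum>\<alpha>\<in>Q - {\<beta>}. c' \<alpha> s * M \<beta> \<alpha> s) = (\<Sum>\<gamma>\<in>{\<gamma>\<in>Q. rank \<gamma> < n}. c \<gamma> s * M \<beta> \<gamma> s)"
      proof (rule sum.mono_neutral_cong_right)
        show "\<forall>\<gamma>\<in>Q - {\<beta>} - {\<gamma> \<in> Q. rank \<gamma> < n}. c' \<gamma> s * M \<beta> \<gamma> s = 0"
        proof
          fix \<gamma> assume "\<gamma> \<in> Q - {\<beta>} - {\<gamma> \<in> Q. rank \<gamma> < n}"
          then have "M \<beta> \<gamma> s = 0" using r by (intro tri[OF s]) auto
          then show "c' \<gamma> s * M \<beta> \<gamma> s = 0" by simp
        qed
      qed (use Q r in \<open>auto simp: c'_def\<close>)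
      finally show ?thesis using r \<kappa>[of \<beta>] by (simp add: c'_def d_def diag[OF s])
    qed
    then show ?case using c' by (intro exI[of _ c']) blast
  qed
  note main = this
  have "finite (rank ` Q)" using Q by simp
  then obtain n where "\<And>\<beta>. \<beta> \<in> Q \<Longrightarrow> rank \<beta> < n"
    by (meson finite_nat_set_iff_bounded image_eqI)
  then show ?thesis using main[of n] that by blast
qed

end

lemma triangular_unique:
  fixes M :: "'i \<Rightarrow> 'i \<Rightarrow> real" and rank :: "'i \<Rightarrow> nat"
  assumes Q: "finite Q" and tri: "\<And>\<beta> \<alpha>. rank \<beta> \<le> rank \<alpha> \<Longrightarrow> \<alpha> \<noteq> \<beta> \<Longrightarrow> M \<beta> \<alpha> = 0"
    and diag: "\<And>\<beta>. M \<beta> \<beta> \<noteq> 0" and eq: "\<And>\<beta>. \<beta> \<in> Q \<Longrightarrow> (\<Sum>\<alpha>\<in>Q. d \<alpha> * M \<beta> \<alpha>) = 0"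
  shows "\<beta> \<in> Q \<Longrightarrow> d \<beta> = 0"
proof (induction "rank \<beta>" arbitrary: \<beta> rule: less_induct)
  case less
  have "(\<Sum>\<alpha>\<in>Q. d \<alpha> * M \<beta> \<alpha>) = d \<beta> * M \<beta> \<beta> + (\<Sum>\<alpha>\<in>Q - {\<beta>}. d \<alpha> * M \<beta> \<alpha>)"
    by (rule sum.remove[OF Q less.prems])
  also have "(\<Sum>\<alpha>\<in>Q - {\<beta>}. d \<alpha> * M \<beta> \<alpha>) = 0"
  proof (rule sum.neutral, rule ballI)
    fix \<alpha> assume "\<alpha> \<in> Q - {\<beta>}"
    then show "d \<alpha> * M \<beta> \<alpha> = 0" using less.hyps[of \<alpha>] tri[of \<beta> \<alpha>] by (cases "rank \<alpha> < rank \<beta>") auto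
  qed
  finally show ?case using eq[OF less.prems] diag[of \<beta>] by simp
qed

section \<open>Expansions in powers of coordinates\<close>

text \<open>The componentwise form of \<open>linearly_adapted\<close>;
  \<open>linearly_adapted_iff\<close> links the two.\<close>

definition adapted :: "('n::finite \<Rightarrow> real^'n \<Rightarrow> real^'n) \<Rightarrow> real^'n \<Rightarrow> ('n \<Rightarrow> real^'n \<Rightarrow> real) \<Rightarrow> bool" where
  "adapted X p u \<longleftrightarrow> (\<forall>k. u k p = 0) \<and> (\<forall>j k. lie_derivative (X j) (u k) p = (if j = k then 1 else 0))"

context hframe
begin

lemma D_mpow_tri:
  assumes "p \<in> U" "\<And>k. smooth_on U (u k)" "adapted X p u" "mdeg one \<beta> \<le> mdeg one \<alpha>" "\<alpha> \<noteq> \<beta>"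
  shows "D (word \<beta>) (\<lambda>x. mpow (\<lambda>k. u k x) \<alpha>) p = 0"
proof (cases "mdeg one \<beta> < mdeg one \<alpha>")
  case True
  then show ?thesis using assms by (intro D_mpow_short) (auto simp: adapted_def)
next
  case False
  then show ?thesis using assms by (subst D_mpow_equal) (auto simp: adapted_def)
qed

lemma D_mpow_diag:
  assumes "p \<in> U" "\<And>k. smooth_on U (u k)" "adapted X p u"
  shows "D (word \<alpha>) (\<lambda>x. mpow (\<lambda>k. u k x) \<alpha>) p = (\<Prod>j\<in>UNIV. fact (\<alpha> j))"
  using assms by (subst D_mpow_equal) (auto simp: adapted_def)

lemma prod_fact_nonzero: "(\<Prod>j\<in>(UNIV::'n set). fact (\<alpha> j) :: real) \<noteq> 0"
  by simp

lemma D_minus_sum: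
  assumes "p \<in> U" "smooth_on U f" "\<And>\<alpha>. smooth_on U (g \<alpha>)"
  shows "D I (\<lambda>x. f x - (\<Sum>\<alpha>\<in>Q. c \<alpha> * g \<alpha> x)) p = D I f p - (\<Sum>\<alpha>\<in>Q. c \<alpha> * D I (g \<alpha>) p)"
proof -
  have s: "smooth_on U (\<lambda>x. c \<alpha> * g \<alpha> x)" for \<alpha> by (rule smooth_on_scale[OF open_U assms(3)])
  have "D I (\<lambda>x. f x - (\<Sum>\<alpha>\<in>Q. c \<alpha> * g \<alpha> x)) p = D I f p - D I (\<lambda>x. \<Sum>\<alpha>\<in>Q. c \<alpha> * g \<alpha> x) p"
    by (intro D_diff assms smooth_on_sum open_U s)
  also have "D I (\<lambda>x. \<Sum>\<alpha>\<in>Q. c \<alpha> * g \<alpha> x) p = (\<Sum>\<alpha>\<in>Q. D I (\<lambda>x. c \<alpha> * g \<alpha> x) p)"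
    by (intro D_sum s assms)
  also have "\<dots> = (\<Sum>\<alpha>\<in>Q. c \<alpha> * D I (g \<alpha>) p)"
    by (intro sum.cong refl D_scale assms)
  finally show ?thesis .
qed

section \<open>Expansions and their weighted leading parts\<close>

abbreviation remainder :: "nat \<Rightarrow> (real^'n \<Rightarrow> real) \<Rightarrow> ('n \<Rightarrow> real^'n \<Rightarrow> real) \<Rightarrow> (('n \<Rightarrow> nat) \<Rightarrow> real) \<Rightarrow> real^'n \<Rightarrow> real" where
  "remainder M f u c \<equiv> \<lambda>x. f x - (\<Sum>\<alpha>\<in>{\<alpha>. mdeg one \<alpha> < M}. c \<alpha> * mpow (\<lambda>k. u k x) \<alpha>)"

lemma smooth_remainder:
  "smooth_on U f \<Longrightarrow> (\<And>k. smooth_on U (u k)) \<Longrightarrow> smooth_on U (remainder M f u c)"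
  by (intro smooth_on_minus smooth_on_sum smooth_on_scale smooth_mpow open_U)

text \<open>Apply the word of \<beta> to the remainder. Terms with |\<alpha>| at least |\<beta>| and
  \<alpha> \<noteq> \<beta> vanish by triangularity; shorter ones vanish by induction if their
  weight is below \<open>N\<close>, and otherwise because their order exceeds the weight of the
  word. Only c_\<beta> times \<beta>! remains.\<close>

lemma expansion_low:
  assumes p: "p \<in> U" and f: "smooth_on U f" "order_ge w X p N f"
    and u: "\<And>k. smooth_on U (u k)" "adapted X p u" "\<And>k. order_ge w X p (w k) (u k)"
    and R: "order_ge one X p M (remainder M f u c)" and NM: "N \<le> M"
  shows "mdeg w \<beta> < N \<Longrightarrow> c \<beta> = 0"
proof (induction "mdeg one \<beta>" arbitrary: \<beta> rule: less_induct)
  case less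
  have \<beta>M: "mdeg one \<beta> < M" using less.prems NM mdeg_one_le[of w \<beta>] w_pos by (meson le_less_trans less_le_trans)
  have fin: "finite {\<alpha>::'n \<Rightarrow> nat. mdeg one \<alpha> < M}" by (rule finite_mdeg_less) simp
  have "0 = D (word \<beta>) (remainder M f u c) p"
    using order_geD[OF R, of "word \<beta>"] \<beta>M by (metis sum_list_word)
  also have "\<dots> = D (word \<beta>) f p - (\<Sum>\<alpha>\<in>{\<alpha>. mdeg one \<alpha> < M}. c \<alpha> * D (word \<beta>) (\<lambda>x. mpow (\<lambda>k. u k x) \<alpha>) p)"
    by (intro D_minus_sum p f smooth_mpow u)
  also have "D (word \<beta>) f p = 0" using order_geD[OF f(2), of "word \<beta>"] less.prems by simp
  also have "(\<Sum>\<alpha>\<in>{\<alpha>. mdeg one \<alpha> < M}. c \<alpha> * D (word \<beta>) (\<lambda>x. mpow (\<lambda>k. u k x) \<alpha>) p) =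
      c \<beta> * D (word \<beta>) (\<lambda>x. mpow (\<lambda>k. u k x) \<beta>) p +
      (\<Sum>\<alpha>\<in>{\<alpha>. mdeg one \<alpha> < M} - {\<beta>}. c \<alpha> * D (word \<beta>) (\<lambda>x. mpow (\<lambda>k. u k x) \<alpha>) p)"
    using \<beta>M by (intro sum.remove fin) simp
  also have "(\<Sum>\<alpha>\<in>{\<alpha>. mdeg one \<alpha> < M} - {\<beta>}. c \<alpha> * D (word \<beta>) (\<lambda>x. mpow (\<lambda>k. u k x) \<alpha>) p) = 0"
  proof (rule sum.neutral, rule ballI)
    fix \<alpha> assume \<alpha>: "\<alpha> \<in> {\<alpha>. mdeg one \<alpha> < M} - {\<beta>}"
    show "c \<alpha> * D (word \<beta>) (\<lambda>x. mpow (\<lambda>k. u k x) \<alpha>) p = 0"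
    proof (cases "mdeg one \<beta> \<le> mdeg one \<alpha>")
      case True
      then show ?thesis using D_mpow_tri[OF p u(1,2) True] \<alpha> by auto
    next
      case False
      show ?thesis
      proof (cases "mdeg w \<alpha> < N")
        case True
        then show ?thesis using less.hyps[of \<alpha>] False by simp
      next
        case F: False
        have "order_ge w X p (mdeg w \<alpha>) (\<lambda>x. mpow (\<lambda>k. u k x) \<alpha>)" by (rule order_ge_mpow[OF p u(1,3)])
        then show ?thesis using order_geD[of w X p "mdeg w \<alpha>" _ "word \<beta>"] F less.prems by simp
      qed
    qed
  qed
  finally show ?case using prod_fact_nonzero by (simp add: D_mpow_diag[OF p u(1,2)])
qed

text \<open>The rescaled function \<open>t\<^sup>b\<^sup>-\<^sup>a f\<close> converges to the homogeneous part of its expansion; the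
  exponents are kept apart because \<open>b - a\<close> may have either sign.\<close>

lemma expansion_limit:
  fixes P :: "(real \<times> (real^'n)) set" and x :: "real \<Rightarrow> real^'n \<Rightarrow> real^'n"
  assumes \<rho>: "cball p \<rho> \<subseteq> U" and f: "smooth_on U f" and u: "\<And>k. smooth_on U (u k)"
    and R: "order_ge one X p M (remainder M f u c)" and M: "a < M + b"
    and low: "\<And>\<alpha>. mdeg w \<alpha> + b < a \<Longrightarrow> c \<alpha> = 0"
    and P: "\<And>t z. (t, z) \<in> P \<Longrightarrow> t \<noteq> 0 \<and> \<bar>t\<bar> \<le> 1 \<and> norm z \<le> B \<and> x t z \<in> cball p \<rho> \<and>
        norm (x t z - p) \<le> K * \<bar>t\<bar> \<and> (\<forall>k. u k (x t z) = t ^ w k * z $ k)"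
  obtains C where "\<And>t z. (t, z) \<in> P \<Longrightarrow>
    \<bar>t ^ b * f (x t z) / t ^ a - (\<Sum>\<alpha>\<in>{\<alpha>. mdeg w \<alpha> + b = a}. c \<alpha> * mpow (($) z) \<alpha>)\<bar> \<le> C * \<bar>t\<bar>"
proof -
  let ?Q = "{\<alpha>::'n \<Rightarrow> nat. mdeg one \<alpha> < M}"
  have fin: "finite ?Q" by (rule finite_mdeg_less) simp
  obtain C0 where C0: "C0 \<ge> 0" "\<And>y. y \<in> cball p \<rho> \<Longrightarrow> \<bar>remainder M f u c y\<bar> \<le> C0 * norm (y - p) ^ M"
    using order_ge_one_bound[OF \<rho> smooth_remainder[OF f u] R] by blast
  \<comment> \<open>The first summand controls the remainder, the second the monomials that keep a
    positive power of t.\<close>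
  define C where "C = C0 * \<bar>K\<bar> ^ M + (\<Sum>\<alpha>\<in>?Q. \<bar>c \<alpha>\<bar> * mpow (\<lambda>_. \<bar>B\<bar>) \<alpha>)"
  have "\<bar>t ^ b * f (x t z) / t ^ a - (\<Sum>\<alpha>\<in>{\<alpha>. mdeg w \<alpha> + b = a}. c \<alpha> * mpow (($) z) \<alpha>)\<bar> \<le> C * \<bar>t\<bar>"
    if tz: "(t, z) \<in> P" for t z
  proof -
    note Ptz = P[OF tz]
    have t: "t \<noteq> 0" "\<bar>t\<bar> \<le> 1" using Ptz by auto
    have tp: "\<bar>t\<bar> ^ m \<le> \<bar>t\<bar>" if "m \<ge> 1" for m
      using that t power_decreasing[of 1 m "\<bar>t\<bar>"] by simp
    define r where "r = remainder M f u c (x t z)"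
    have fx: "f (x t z) = r + (\<Sum>\<alpha>\<in>?Q. c \<alpha> * (t ^ mdeg w \<alpha> * mpow (($) z) \<alpha>))"
      using Ptz by (simp add: r_def mpow_weighted)
    define e where "e \<alpha> = c \<alpha> * mpow (($) z) \<alpha> * (t ^ (mdeg w \<alpha> + b) / t ^ a - (if mdeg w \<alpha> + b = a then 1 else 0))" for \<alpha>
    have sub: "{\<alpha>. mdeg w \<alpha> + b = a} \<subseteq> ?Q"
    proof
      fix \<alpha> assume "\<alpha> \<in> {\<alpha>. mdeg w \<alpha> + b = a}"
      moreover have "mdeg one \<alpha> \<le> mdeg w \<alpha>" by (rule mdeg_one_le[OF w_pos])
      ultimately show "\<alpha> \<in> ?Q" using M by simp
    qed
    have "(\<Sum>\<alpha>\<in>{\<alpha>. mdeg w \<alpha> + b = a}. c \<alpha> * mpow (($) z) \<alpha>) =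
        (\<Sum>\<alpha>\<in>?Q. c \<alpha> * mpow (($) z) \<alpha> * (if mdeg w \<alpha> + b = a then 1 else 0))"
      using sub by (intro sum.mono_neutral_cong_left fin) auto
    moreover have "t ^ b * f (x t z) / t ^ a =
        t ^ b * r / t ^ a + (\<Sum>\<alpha>\<in>?Q. c \<alpha> * mpow (($) z) \<alpha> * (t ^ (mdeg w \<alpha> + b) / t ^ a))"
      unfolding fx distrib_left add_divide_distrib sum_distrib_left sum_divide_distrib
      by (intro arg_cong2[where f="(+)"] refl sum.cong) (simp add: power_add mult_ac)
    ultimately have eq: "t ^ b * f (x t z) / t ^ a - (\<Sum>\<alpha>\<in>{\<alpha>. mdeg w \<alpha> + b = a}. c \<alpha> * mpow (($) z) \<alpha>) =
        t ^ b * r / t ^ a + (\<Sum>\<alpha>\<in>?Q. e \<alpha>)"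
      by (simp add: e_def sum_subtractf right_diff_distrib)
    \<comment> \<open>A strictly positive exponent difference leaves at least one factor |t|. The
      condition \<open>a < M + b\<close> provides it for the remainder.\<close>
    have pw: "\<bar>t\<bar> ^ m / \<bar>t\<bar> ^ a \<le> \<bar>t\<bar>" if "a < m" for m
    proof -
      have "\<bar>t\<bar> ^ m / \<bar>t\<bar> ^ a = \<bar>t\<bar> ^ (m - a)" using that t by (simp add: power_diff)
      then show ?thesis using tp[of "m - a"] that by simp
    qed
    have "\<bar>r\<bar> \<le> C0 * (\<bar>K\<bar> * \<bar>t\<bar>) ^ M"
    proof -
      have "\<bar>r\<bar> \<le> C0 * norm (x t z - p) ^ M" unfolding r_def using C0(2) Ptz by blast
      also have "\<dots> \<le> C0 * (\<bar>K\<bar> * \<bar>t\<bar>) ^ M"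
        using Ptz C0(1) by (intro mult_left_mono power_mono) (auto intro: order_trans mult_right_mono)
      finally show ?thesis .
    qed
    then have "\<bar>t ^ b * r / t ^ a\<bar> \<le> \<bar>t\<bar> ^ b * (C0 * (\<bar>K\<bar> * \<bar>t\<bar>) ^ M) / \<bar>t\<bar> ^ a"
      by (simp only: abs_divide abs_mult power_abs) (intro divide_right_mono mult_left_mono; simp)
    also have "\<dots> = C0 * \<bar>K\<bar> ^ M * (\<bar>t\<bar> ^ (M + b) / \<bar>t\<bar> ^ a)"
      by (simp add: power_add power_mult_distrib mult_ac)
    also have "\<dots> \<le> C0 * \<bar>K\<bar> ^ M * \<bar>t\<bar>" using C0(1) by (intro mult_left_mono pw M) auto
    finally have 1: "\<bar>t ^ b * r / t ^ a\<bar> \<le> C0 * \<bar>K\<bar> ^ M * \<bar>t\<bar>" .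
    have 2: "\<bar>e \<alpha>\<bar> \<le> (\<bar>c \<alpha>\<bar> * mpow (\<lambda>_. \<bar>B\<bar>) \<alpha>) * \<bar>t\<bar>" for \<alpha>
    proof -
      have m1: "\<bar>mpow (($) z) \<alpha>\<bar> \<le> mpow (\<lambda>_. \<bar>B\<bar>) \<alpha>"
      proof -
        have "\<bar>z $ j\<bar> \<le> \<bar>B\<bar>" for j using component_le_norm_cart[of z j] Ptz by linarith
        then show ?thesis unfolding mpow_def abs_prod power_abs
          by (intro prod_mono) (auto intro: power_mono)
      qed
      \<comment> \<open>Below the critical weight the coefficient is zero, at it the power of t
        cancels exactly, above it a factor t is gained.\<close>
      consider "mdeg w \<alpha> + b < a" | "mdeg w \<alpha> + b = a" | "mdeg w \<alpha> + b > a" by linarith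
      then have m2: "\<bar>c \<alpha>\<bar> * \<bar>t ^ (mdeg w \<alpha> + b) / t ^ a - (if mdeg w \<alpha> + b = a then 1 else 0)\<bar> \<le> \<bar>c \<alpha>\<bar> * \<bar>t\<bar>"
      proof cases
        case 1
        then show ?thesis using low by simp
      next
        case 2
        then show ?thesis using t by simp
      next
        case 3
        then show ?thesis using pw[OF 3] by (intro mult_left_mono) (auto simp: power_abs)
      qed
      have "\<bar>mpow (($) z) \<alpha>\<bar> * (\<bar>c \<alpha>\<bar> * \<bar>t ^ (mdeg w \<alpha> + b) / t ^ a - (if mdeg w \<alpha> + b = a then 1 else 0)\<bar>) \<le>
          mpow (\<lambda>_. \<bar>B\<bar>) \<alpha> * (\<bar>c \<alpha>\<bar> * \<bar>t\<bar>)"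
        by (rule mult_mono[OF m1 m2]) (auto simp: mpow_def prod_nonneg)
      then show ?thesis unfolding e_def abs_mult by (simp only: mult_ac)
    qed
    have "\<bar>\<Sum>\<alpha>\<in>?Q. e \<alpha>\<bar> \<le> (\<Sum>\<alpha>\<in>?Q. \<bar>c \<alpha>\<bar> * mpow (\<lambda>_. \<bar>B\<bar>) \<alpha>) * \<bar>t\<bar>"
      unfolding sum_distrib_right by (rule sum_abs[THEN order_trans], rule sum_mono, rule 2)
    then show ?thesis unfolding eq C_def distrib_right using 1 by linarith
  qed
  then show ?thesis by (rule that)
qed

end

section \<open>Affine and privileged coordinates\<close>

lemma frechet_derivative_component:
  fixes F :: "'a::real_normed_vector \<Rightarrow> real^'n"
  assumes "F differentiable (at p)"
  shows "frechet_derivative (\<lambda>x. F x $ k) (at p) v = frechet_derivative F (at p) v $ k"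
  using frechet_derivative_eqI[OF bounded_linear.has_derivative[OF bounded_linear_vec_nth
        differentiableE_frechet[OF assms]]] by simp

lemma linearly_adapted_iff:
  fixes F :: "real^'n \<Rightarrow> real^'n"
  assumes "F differentiable (at p)"
  shows "linearly_adapted X p F \<longleftrightarrow> adapted X p (\<lambda>k x. F x $ k)"
  unfolding linearly_adapted_def adapted_def lie_derivative_def frechet_derivative_component[OF assms]
  by (auto simp: vec_eq_iff axis_def)

lemma coframe_linear:
  fixes F :: "'n::finite \<Rightarrow> real^'n"
  assumes d: "det (\<chi> i j. F j $ i) \<noteq> 0"
  shows "linear (\<lambda>b. \<chi> l. coframe F b l)"
proof (rule linearI)
  fix b c
  have "b + c = (\<Sum>l\<in>UNIV. (coframe F b l + coframe F c l) *\<^sub>R F l)"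
    by (simp add: scaleR_add_left sum.distrib coframe_expand[OF d])
  from coframe_unique[OF d, THEN iffD1, OF this]
  show "(\<chi> l. coframe F (b + c) l) = (\<chi> l. coframe F b l) + (\<chi> l. coframe F c l)"
    by (simp add: vec_eq_iff fun_eq_iff)
next
  fix r b
  have "r *\<^sub>R b = (\<Sum>l\<in>UNIV. (r * coframe F b l) *\<^sub>R F l)"
    by (simp add: scaleR_scaleR[symmetric] scaleR_sum_right[symmetric] coframe_expand[OF d] del: scaleR_scaleR)
  from coframe_unique[OF d, THEN iffD1, OF this]
  show "(\<chi> l. coframe F (r *\<^sub>R b) l) = r *\<^sub>R (\<chi> l. coframe F b l)"
    by (simp add: vec_eq_iff fun_eq_iff)
qed

lemma coframe_basis:
  fixes F :: "'n::finite \<Rightarrow> real^'n"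
  assumes d: "det (\<chi> i j. F j $ i) \<noteq> 0"
  shows "coframe F (F j) = (\<lambda>l. if l = j then 1 else 0)"
proof -
  have "F j = (\<Sum>l\<in>UNIV. (if l = j then 1 else 0) *\<^sub>R F l)"
    by (simp add: if_distrib[of "\<lambda>r. r *\<^sub>R _"] cong: if_cong)
  then show ?thesis by (simp add: coframe_unique[OF d])
qed

text \<open>The nonvanishing half of the order condition is automatic: the one-letter word
  \<open>[k]\<close> has weight \<open>w k\<close> and gives the value 1 by adaptedness.\<close>

lemma privilegedI:
  assumes F: "F differentiable (at p)" and a: "adapted X p (\<lambda>k x. F x $ k)"
    and o: "\<And>k. order_ge w X p (w k) (\<lambda>x. F x $ k)"
  shows "privileged w X p F"
proof -
  have "has_order w X p (w k) (\<lambda>x. F x $ k)" for k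
    unfolding has_order_def
  proof (intro conjI)
    show "\<forall>I. sum_list (map w I) < w k \<longrightarrow> iterated_derivative X I (\<lambda>x. F x $ k) p = 0"
      using o unfolding order_ge_def .
    show "\<exists>I. sum_list (map w I) = w k \<and> iterated_derivative X I (\<lambda>x. F x $ k) p \<noteq> 0"
      using a unfolding adapted_def by (intro exI[of _ "[k]"]) simp
  qed
  then show ?thesis using a by (simp add: privileged_def linearly_adapted_iff[OF F])
qed

lemma privileged_adapted:
  "privileged w X p F \<Longrightarrow> F differentiable (at p) \<Longrightarrow> adapted X p (\<lambda>k x. F x $ k)"
  by (simp add: privileged_def linearly_adapted_iff)

lemma privileged_order: "privileged w X p F \<Longrightarrow> order_ge w X p (w k) (\<lambda>x. F x $ k)"
  unfolding privileged_def has_order_def order_ge_def by blast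

definition low_index :: "('n::finite \<Rightarrow> nat) \<Rightarrow> 'n \<Rightarrow> ('n \<Rightarrow> nat) set" where
  "low_index w k = {\<alpha>. mdeg w \<alpha> < w k \<and> 2 \<le> mdeg one \<alpha>}"

lemma lower_order_polynomial_iff:
  "lower_order_polynomial w g \<longleftrightarrow>
    (\<exists>a. \<forall>z k. g z $ k = z $ k + (\<Sum>\<alpha>\<in>low_index w k. a k \<alpha> * mpow (($) z) \<alpha>))"
  by (simp add: lower_order_polynomial_def low_index_def mdeg_def mpow_def)

lemma smooth_on_mpow:
  fixes u :: "'n::finite \<Rightarrow> 'a::real_normed_vector \<Rightarrow> real"
  shows "open V \<Longrightarrow> (\<And>k. smooth_on V (u k)) \<Longrightarrow> smooth_on V (\<lambda>x. mpow (\<lambda>k. u k x) \<alpha>)"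
  unfolding mpow_def by (intro smooth_on_prod smooth_on_power)

context hframe
begin

lemma finite_low_index: "finite (low_index w k)"
  by (rule finite_subset[OF _ finite_mdeg_less[of w "w k", OF w_pos]]) (auto simp: low_index_def)

section \<open>Affine coordinates adapted to the frame at a point\<close>

lemma affine_coords_eq:
  assumes p: "p \<in> U"
  shows "affine_coords X p = (\<lambda>x. \<chi> l. coframe (\<lambda>j. X j p) (x - p) l)" (is "_ = ?T")
proof -
  let ?C = "\<lambda>b. \<chi> l. coframe (\<lambda>j. X j p) b l"
  have lin: "linear ?C" by (rule coframe_linear[OF det_X[OF p]])
  have T: "?T = (\<lambda>x. ?C x + ?C (- p))"
    using linear_add[OF lin, of _ "- p"] by (simp add: fun_eq_iff)
  have ax: "?C (X j p) = axis j 1" for j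
    by (simp add: coframe_basis[OF det_X[OF p]] vec_eq_iff axis_def)
  have D: "(?T has_derivative ?C) (at p)"
    unfolding T using linear_imp_has_derivative[OF lin] by (intro derivative_eq_intros) auto
  show ?thesis
    unfolding affine_coords_def
  proof (rule the_equality, intro conjI)
    show "\<exists>L b. linear L \<and> ?T = (\<lambda>x. L x + b)" using lin T by blast
    show "linearly_adapted X p ?T"
      using linear_0[OF lin] unfolding linearly_adapted_def frechet_derivative_eqI[OF D] by (simp add: ax)
  next
    fix T' assume "(\<exists>L b. linear L \<and> T' = (\<lambda>x. L x + b)) \<and> linearly_adapted X p T'"
    then obtain L b where L: "linear L" "T' = (\<lambda>x. L x + b)" and la: "linearly_adapted X p T'" by blast
    have D': "(T' has_derivative L) (at p)"
      unfolding L(2) using linear_imp_has_derivative[OF L(1)] by (intro derivative_eq_intros) auto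
    have LX: "L (X j p) = axis j 1" for j
      using la unfolding linearly_adapted_def frechet_derivative_eqI[OF D'] by simp
    have "L v = ?C v" for v
    proof -
      have "L (\<Sum>l\<in>UNIV. coframe (\<lambda>j. X j p) v l *\<^sub>R X l p) = ?C (\<Sum>l\<in>UNIV. coframe (\<lambda>j. X j p) v l *\<^sub>R X l p)"
        unfolding linear_sum[OF L(1)] linear_sum[OF lin] linear_scale[OF L(1)] linear_scale[OF lin] LX ax ..
      then show ?thesis unfolding coframe_expand[OF det_X[OF p]] .
    qed
    moreover have "b = - L p" using la L(2) by (simp add: linearly_adapted_def eq_neg_iff_add_eq_0 add.commute)
    ultimately show "T' = ?T" unfolding L(2) using linear_diff[OF lin, of _ p] by (auto simp: fun_eq_iff)
  qed
qed

lemma affine_coords_component: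
  assumes p: "p \<in> U"
  shows "affine_coords X p x $ k = (\<Sum>i\<in>UNIV. (x $ i - p $ i) * coframe (\<lambda>j. X j p) (axis i 1) k)"
proof -
  let ?C = "\<lambda>b. \<chi> l. coframe (\<lambda>j. X j p) b l"
  have "?C (x - p) = (\<Sum>i\<in>UNIV. (x - p) $ i *\<^sub>R ?C (axis i 1))"
    by (rule linear_vec_expand[OF coframe_linear[OF det_X[OF p]]])
  then show ?thesis by (simp add: affine_coords_eq[OF p] vec_eq_iff)
qed

lemma smooth_affine_coords: "p \<in> U \<Longrightarrow> open V \<Longrightarrow> smooth_on V (\<lambda>x. affine_coords X p x $ k)"
  unfolding affine_coords_component
  by (intro smooth_on_sum smooth_on_mult smooth_on_minus smooth_on_coord smooth_on_const)

lemma affine_coords_inverse: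
  assumes p: "p \<in> U"
  shows "affine_coords X p (p + (\<Sum>j\<in>UNIV. x $ j *\<^sub>R X j p)) = x"
    and "p + (\<Sum>j\<in>UNIV. affine_coords X p x $ j *\<^sub>R X j p) = x"
  using coframe_unique[OF det_X[OF p], of "\<Sum>j\<in>UNIV. x $ j *\<^sub>R X j p" "($) x"]
    coframe_expand[OF det_X[OF p], of "x - p"]
  by (simp_all add: affine_coords_eq[OF p] vec_eq_iff)

lemma bij_affine_coords: "p \<in> U \<Longrightarrow> bij (affine_coords X p)"
  by (rule o_bij[of "\<lambda>x. p + (\<Sum>j\<in>UNIV. x $ j *\<^sub>R X j p)"]) (auto simp: affine_coords_inverse fun_eq_iff)

lemma inv_affine_coords: "p \<in> U \<Longrightarrow> inv (affine_coords X p) x = p + (\<Sum>j\<in>UNIV. x $ j *\<^sub>R X j p)"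
  by (rule inv_f_eq) (simp_all add: bij_is_inj[OF bij_affine_coords] affine_coords_inverse)

lemma adapted_affine_coords:
  assumes p: "p \<in> U" shows "adapted X p (\<lambda>k x. affine_coords X p x $ k)"
proof -
  have "smooth_on UNIV (affine_coords X p)" by (intro smooth_on_vec smooth_affine_coords p) auto
  then have d: "affine_coords X p differentiable (at p)" by (rule smooth_on_differentiable) simp
  have lin: "linear (\<lambda>b. \<chi> l. coframe (\<lambda>j. X j p) b l)" by (rule coframe_linear[OF det_X[OF p]])
  have "affine_coords X p = (\<lambda>x. (\<chi> l. coframe (\<lambda>j. X j p) x l) + (\<chi> l. coframe (\<lambda>j. X j p) (- p) l))"
    using linear_add[OF lin, of _ "- p"] by (simp add: affine_coords_eq[OF p] fun_eq_iff)
  then have D: "(affine_coords X p has_derivative (\<lambda>b. \<chi> l. coframe (\<lambda>j. X j p) b l)) (at p)"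
    using has_derivative_add[OF linear_imp_has_derivative[OF lin] has_derivative_const] by simp
  have "linearly_adapted X p (affine_coords X p)"
    unfolding linearly_adapted_def frechet_derivative_eqI[OF D]
    using linear_0[OF lin] by (simp add: affine_coords_eq[OF p] coframe_basis[OF det_X[OF p]] vec_eq_iff axis_def)
  then show ?thesis using linearly_adapted_iff[OF d] by blast
qed

text \<open>Privilege is a square linear system for the coefficients. Words of length at most 1 do
  not see terms of degree at least 2 and satisfy their conditions through the affine coordinates;
  longer words reduce to the chosen ones by reordering.\<close>

lemma privileged_low_iff:
  assumes p: "p \<in> U"
    and g: "\<And>z k. g z $ k = z $ k + (\<Sum>\<alpha>\<in>low_index w k. a k \<alpha> * mpow (($) z) \<alpha>)"
  defines "T \<equiv> \<lambda>k x. affine_coords X p x $ k"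
  shows "privileged w X p (g \<circ> affine_coords X p) \<longleftrightarrow>
    (\<forall>k. \<forall>\<beta>\<in>low_index w k. D (word \<beta>) (T k) p +
      (\<Sum>\<alpha>\<in>low_index w k. a k \<alpha> * D (word \<beta>) (\<lambda>x. mpow (\<lambda>k. T k x) \<alpha>) p) = 0)"
proof -
  have T: "smooth_on V (T k)" if "open V" for k V unfolding T_def by (rule smooth_affine_coords[OF p that])
  have ad: "adapted X p T" unfolding T_def by (rule adapted_affine_coords[OF p])
  \<comment> \<open>The double sign brings the sum into the shape of a remainder, to which
    \<open>D_minus_sum\<close> applies.\<close>
  define F where "F k x = T k x - (\<Sum>\<alpha>\<in>low_index w k. - a k \<alpha> * mpow (\<lambda>k. T k x) \<alpha>)" for k x
  have F: "(g \<circ> affine_coords X p) x $ k = F k x" for x k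
    by (simp add: F_def T_def g sum_negf)
  have sF: "smooth_on V (F k)" if "open V" for k V unfolding F_def
    by (intro smooth_on_minus smooth_on_sum smooth_on_mult smooth_on_const smooth_on_mpow T that)
  have DF: "D I (F k) p = D I (T k) p + (\<Sum>\<alpha>\<in>low_index w k. a k \<alpha> * D I (\<lambda>x. mpow (\<lambda>k. T k x) \<alpha>) p)" for I k
    unfolding F_def
    by (subst D_minus_sum[OF p T[OF open_U] smooth_mpow[OF T[OF open_U]]]) (simp add: sum_negf)
  have short: "D I (F k) p = D I (T k) p" if "length I < 2" for I k
  proof -
    have "D I (\<lambda>x. mpow (\<lambda>k. T k x) \<alpha>) p = 0" if "\<alpha> \<in> low_index w k" for \<alpha>
      using that \<open>length I < 2\<close> ad by (intro D_mpow_short[OF p T[OF open_U]]) (auto simp: low_index_def adapted_def)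
    then show ?thesis by (simp add: DF)
  qed
  have "smooth_on UNIV (g \<circ> affine_coords X p)" by (rule smooth_on_vec) (simp_all only: F sF open_UNIV)
  then have dg: "(g \<circ> affine_coords X p) differentiable (at p)" by (rule smooth_on_differentiable) simp
  have adF: "adapted X p (\<lambda>k x. (g \<circ> affine_coords X p) x $ k)"
    unfolding F adapted_def using short[of "[]"] short[of "[j]" for j] ad by (auto simp: adapted_def)
  show ?thesis
  proof
    assume "privileged w X p (g \<circ> affine_coords X p)"
    then have o: "order_ge w X p (w k) (F k)" for k using privileged_order[of w X p "g \<circ> affine_coords X p" k] by (simp only: F)
    have "D (word \<beta>) (F k) p = 0" if "\<beta> \<in> low_index w k" for k \<beta>
      using that order_geD[OF o, of "word \<beta>"] by (simp add: low_index_def)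
    then show "\<forall>k. \<forall>\<beta>\<in>low_index w k. D (word \<beta>) (T k) p +
      (\<Sum>\<alpha>\<in>low_index w k. a k \<alpha> * D (word \<beta>) (\<lambda>x. mpow (\<lambda>k. T k x) \<alpha>) p) = 0"
      unfolding DF by blast
  next
    assume H: "\<forall>k. \<forall>\<beta>\<in>low_index w k. D (word \<beta>) (T k) p +
      (\<Sum>\<alpha>\<in>low_index w k. a k \<alpha> * D (word \<beta>) (\<lambda>x. mpow (\<lambda>k. T k x) \<alpha>) p) = 0"
    have "order_ge w X p (w k) (F k)" for k
    proof (rule order_ge_w_words[OF p sF[OF open_U]])
      fix \<alpha> assume \<alpha>: "mdeg w \<alpha> < w k"
      show "D (word \<alpha>) (F k) p = 0"
      proof (cases "2 \<le> mdeg one \<alpha>")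
        case True
        then show ?thesis using H \<alpha> unfolding DF by (simp add: low_index_def)
      next
        case False
        then have l: "length (word \<alpha>) < 2" by simp
        have "D (word \<alpha>) (T k) p = 0"
        proof (cases "word \<alpha>")
          case Nil
          then show ?thesis using ad by (simp add: adapted_def)
        next
          case (Cons j I)
          then have wj: "word \<alpha> = [j]" using l by simp
          then have "mdeg w \<alpha> = w j" using sum_list_word[of w \<alpha>] by simp
          \<comment> \<open>The letter is lighter than \<open>w k\<close>, so adaptedness gives the
            off-diagonal value 0.\<close>
          then have "j \<noteq> k" using \<alpha> by auto
          then show ?thesis unfolding wj using ad by (simp add: adapted_def)
        qed
        then show ?thesis using short[OF l] by simp
      qed
    qed
    then show "privileged w X p (g \<circ> affine_coords X p)" by (intro privilegedI[OF dg adF]) (simp only: F)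
  qed
qed

text \<open>The coefficients of two candidates differ by a solution of the homogeneous triangular
  system, hence agree. This resolves the definite description in \<open>psi_hat\<close>.\<close>

lemma psi_hat_eqI:
  assumes p: "p \<in> U" and g: "lower_order_polynomial w g" "privileged w X p (g \<circ> affine_coords X p)"
  shows "psi_hat w X p = g"
  unfolding psi_hat_def
proof (rule the_equality)
  fix h assume "lower_order_polynomial w h \<and> privileged w X p (h \<circ> affine_coords X p)"
  then have h: "lower_order_polynomial w h" "privileged w X p (h \<circ> affine_coords X p)" by auto
  from g(1) obtain a where a: "\<And>z k. g z $ k = z $ k + (\<Sum>\<alpha>\<in>low_index w k. a k \<alpha> * mpow (($) z) \<alpha>)"
    unfolding lower_order_polynomial_iff by blast
  from h(1) obtain b where b: "\<And>z k. h z $ k = z $ k + (\<Sum>\<alpha>\<in>low_index w k. b k \<alpha> * mpow (($) z) \<alpha>)"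
    unfolding lower_order_polynomial_iff by blast
  let ?T = "\<lambda>k x. affine_coords X p x $ k"
  let ?M = "\<lambda>\<beta> \<alpha>. D (word \<beta>) (\<lambda>x. mpow (\<lambda>k. ?T k x) \<alpha>) p"
  have sm: "smooth_on U (?T k)" for k by (rule smooth_affine_coords[OF p open_U])
  have ad: "adapted X p ?T" by (rule adapted_affine_coords[OF p])
  have "a k \<beta> - b k \<beta> = 0" if "\<beta> \<in> low_index w k" for k \<beta>
  proof (rule triangular_unique[where M="?M" and Q="low_index w k" and d="\<lambda>\<alpha>. a k \<alpha> - b k \<alpha>" and rank="mdeg one"])
    show "(\<Sum>\<alpha>\<in>low_index w k. (a k \<alpha> - b k \<alpha>) * ?M \<beta> \<alpha>) = 0" if "\<beta> \<in> low_index w k" for \<beta>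
    proof -
      have "D (word \<beta>) (?T k) p + (\<Sum>\<alpha>\<in>low_index w k. a k \<alpha> * ?M \<beta> \<alpha>) = 0"
        using g(2) that unfolding privileged_low_iff[OF p a] by blast
      moreover have "D (word \<beta>) (?T k) p + (\<Sum>\<alpha>\<in>low_index w k. b k \<alpha> * ?M \<beta> \<alpha>) = 0"
        using h(2) that unfolding privileged_low_iff[OF p b] by blast
      ultimately show ?thesis by (simp add: left_diff_distrib sum_subtractf)
    qed
    show "?M \<beta> \<alpha> = 0" if "mdeg one \<beta> \<le> mdeg one \<alpha>" "\<alpha> \<noteq> \<beta>" for \<beta> \<alpha>
      by (rule D_mpow_tri[OF p sm ad that])
    show "?M \<beta> \<beta> \<noteq> 0" for \<beta> unfolding D_mpow_diag[OF p sm ad] by (rule prod_fact_nonzero)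
  qed (use that finite_low_index in auto)
  then have "h z $ k = g z $ k" for z k unfolding a b by simp
  then show "h = g" by (simp add: fun_eq_iff vec_eq_iff)
qed (use g in blast)

end

section \<open>Triangular maps and triangular differential equations\<close>

text \<open>The shape shared by the polynomial coordinate changes, the exponential maps of model
  frames and the left translations; such maps are inverted by finitely many substitutions.\<close>

definition triangular :: "('n::finite \<Rightarrow> nat) \<Rightarrow> (real^'n \<Rightarrow> real^'n) \<Rightarrow> bool" where
  "triangular w g \<longleftrightarrow> (\<forall>k z z'. (\<forall>l. w l < w k \<longrightarrow> z $ l = z' $ l) \<longrightarrow> g z $ k - z $ k = g z' $ k - z' $ k)"

lemma triangularD:
  "triangular w g \<Longrightarrow> (\<And>l. w l < w k \<Longrightarrow> z $ l = z' $ l) \<Longrightarrow> g z $ k - z $ k = g z' $ k - z' $ k"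
  unfolding triangular_def by blast

text \<open>The iteration of z to y - (g z - z), whose fixed points solve g z = y. After
  \<open>m\<close> steps the components of weight at most \<open>m\<close> are final.\<close>

primrec tri_iter :: "(real^'n \<Rightarrow> real^'n) \<Rightarrow> real^'n \<Rightarrow> nat \<Rightarrow> real^'n" where
  "tri_iter g y 0 = 0"
| "tri_iter g y (Suc m) = (\<chi> k. y $ k - (g (tri_iter g y m) $ k - tri_iter g y m $ k))"

lemma tri_iter_stable:
  assumes g: "triangular w g" and w: "\<And>j. 1 \<le> w j"
  shows "w k \<le> m \<Longrightarrow> tri_iter g y (Suc m) $ k = tri_iter g y m $ k"
proof (induction m arbitrary: k)
  case 0
  then show ?case using w[of k] by simp
next
  case (Suc m)
  have "g (tri_iter g y (Suc m)) $ k - tri_iter g y (Suc m) $ k = g (tri_iter g y m) $ k - tri_iter g y m $ k"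
    by (rule triangularD[OF g]) (use Suc in auto)
  then show ?case by (simp only: tri_iter.simps(2)[of g y "Suc m"] tri_iter.simps(2)[of g y m] vec_lambda_beta)
qed

lemma triangular_inj:
  assumes g: "triangular w g" shows "inj g"
proof (rule injI)
  fix z z' assume e: "g z = g z'"
  have "z $ k = z' $ k" for k
  proof (induction "w k" arbitrary: k rule: less_induct)
    case less
    then show ?case using triangularD[OF g, of k z z'] e by simp
  qed
  then show "z = z'" by (simp add: vec_eq_iff)
qed

lemma triangular_right_inverse:
  fixes g :: "real^'n \<Rightarrow> real^'n"
  assumes g: "triangular w g" and w: "\<And>j. 1 \<le> w j"
  shows "g (tri_iter g y (\<Sum>j\<in>UNIV. w j)) = y"
proof -
  \<comment> \<open>The sum of all weights dominates each of them, so by this step every component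
    is final.\<close>
  let ?m = "\<Sum>j\<in>UNIV. w j"
  have "w k \<le> ?m" for k by (rule member_le_sum) auto
  then have "tri_iter g y (Suc ?m) $ k = tri_iter g y ?m $ k" for k by (rule tri_iter_stable[OF g w])
  then show ?thesis by (simp add: vec_eq_iff)
qed

lemma triangular_bij:
  assumes "triangular w g" "\<And>j. 1 \<le> w j" shows "bij g"
  using triangular_inj[OF assms(1)] triangular_right_inverse[OF assms] unfolding bij_def surj_def by metis

lemma triangular_inv:
  fixes g :: "real^'n \<Rightarrow> real^'n"
  assumes "triangular w g" "\<And>j. 1 \<le> w j"
  shows "inv g y = tri_iter g y (\<Sum>j\<in>UNIV. w j)"
  by (rule inv_f_eq[OF triangular_inj[OF assms(1)] triangular_right_inverse[OF assms]])

lemma lower_order_triangular: "lower_order_polynomial w g \<Longrightarrow> triangular w g"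
proof -
  assume "lower_order_polynomial w g"
  then obtain a where g: "\<And>z k. g z $ k = z $ k + (\<Sum>\<alpha>\<in>low_index w k. a k \<alpha> * mpow (($) z) \<alpha>)"
    unfolding lower_order_polynomial_iff by blast
  have "mpow (($) z) \<alpha> = mpow (($) z') \<alpha>"
    if "\<forall>l. w l < w k \<longrightarrow> z $ l = z' $ l" "\<alpha> \<in> low_index w k" for k z z' \<alpha>
    using that weight_le_mdeg[of \<alpha> _ w] by (intro mpow_cong) (auto simp: low_index_def intro: le_less_trans)
  then show ?thesis unfolding triangular_def by (simp add: g cong: sum.cong)
qed

text \<open>Polynomials in the time t with coefficients in \<open>A\<close>, a class closed under
  integration in t and, at each fixed time, mapped into \<open>A\<close>.\<close>

inductive tpoly :: "('s \<Rightarrow> real) set \<Rightarrow> ('s \<Rightarrow> real \<Rightarrow> real) \<Rightarrow> bool" for A where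
  monom: "c \<in> A \<Longrightarrow> tpoly A (\<lambda>s t. c s * t ^ i)"
| add: "tpoly A f \<Longrightarrow> tpoly A g \<Longrightarrow> tpoly A (\<lambda>s t. f s t + g s t)"

context fun_algebra
begin

text \<open>The iteration that computes the inverse uses only evaluations of \<open>g s\<close> and
  subtraction.\<close>

lemma inv_triangular:
  fixes g :: "'s \<Rightarrow> real^'n \<Rightarrow> real^'n"
  assumes g: "\<And>s. s \<in> S \<Longrightarrow> triangular w (g s)" and w: "\<And>j. 1 \<le> w j"
    and gA: "\<And>\<eta> k. (\<And>l. (\<lambda>s. \<eta> s $ l) \<in> A) \<Longrightarrow> (\<lambda>s. g s (\<eta> s) $ k) \<in> A"
    and \<xi>: "\<And>k. (\<lambda>s. \<xi> s $ k) \<in> A"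
  shows "(\<lambda>s. inv (g s) (\<xi> s) $ k) \<in> A"
proof -
  have "(\<lambda>s. tri_iter (g s) (\<xi> s) m $ k) \<in> A" for m k
  proof (induction m arbitrary: k)
    case 0
    show ?case by (simp add: const)
  next
    case (Suc m)
    show ?case by (simp only: tri_iter.simps vec_lambda_beta) (intro diff \<xi> gA Suc.IH)
  qed
  then show ?thesis by (rule cong) (simp add: triangular_inv[OF g w])
qed

lemma tpoly_coeff: "c \<in> A \<Longrightarrow> tpoly A (\<lambda>s t. c s)"
  using tpoly.monom[of c A 0] by simp

lemma tpoly_mult: "tpoly A f \<Longrightarrow> tpoly A g \<Longrightarrow> tpoly A (\<lambda>s t. f s t * g s t)"
proof (induction rule: tpoly.induct)
  case (monom c i)
  from monom(2) show ?case
  proof (induction rule: tpoly.induct)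
    case (monom d j)
    then show ?case using tpoly.monom[OF mult[OF \<open>c \<in> A\<close> monom], of "i + j"]
      by (simp add: power_add mult_ac)
  next
    case (add f g)
    then show ?case using tpoly.add[OF add.IH] by (simp add: distrib_left)
  qed
next
  case (add f g)
  then show ?case using tpoly.add[OF add.IH] by (simp add: distrib_right)
qed

lemma tpoly_sum: "(\<And>i. i \<in> I \<Longrightarrow> tpoly A (f i)) \<Longrightarrow> tpoly A (\<lambda>s t. \<Sum>i\<in>I. f i s t)"
  by (induction I rule: infinite_finite_induct) (auto intro: tpoly_coeff const tpoly.add)

lemma tpoly_prod: "(\<And>i. i \<in> I \<Longrightarrow> tpoly A (f i)) \<Longrightarrow> tpoly A (\<lambda>s t. \<Prod>i\<in>I. f i s t)"
  by (induction I rule: infinite_finite_induct) (auto intro: tpoly_coeff const tpoly_mult)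

lemma tpoly_mpow: "(\<And>j. tpoly A (u j)) \<Longrightarrow> tpoly A (\<lambda>s t. mpow (\<lambda>j. u j s t) \<alpha>)"
proof -
  assume u: "\<And>j. tpoly A (u j)"
  have "tpoly A (\<lambda>s t. u j s t ^ m)" for j m
    by (induction m) (auto intro: tpoly_coeff const tpoly_mult u)
  then show ?thesis unfolding mpow_def by (rule tpoly_prod)
qed

lemma tpoly_eval: "tpoly A f \<Longrightarrow> (\<lambda>s. f s t) \<in> A"
  by (induction rule: tpoly.induct) (auto intro: add mult const)

lemma tpoly_antiderivative:
  "tpoly A f \<Longrightarrow> \<exists>G. tpoly A G \<and> (\<forall>s. G s 0 = 0 \<and> (\<forall>t. (G s has_real_derivative f s t) (at t)))"
proof (induction rule: tpoly.induct)
  case (monom c i)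
  have "tpoly A (\<lambda>s t. (1 / real (Suc i) * c s) * t ^ Suc i)" by (intro tpoly.monom scale monom)
  moreover have "((\<lambda>t. (1 / real (Suc i) * c s) * t ^ Suc i) has_real_derivative c s * t ^ i) (at t)" for s t
    by (rule derivative_eq_intros refl | simp)+
  ultimately show ?case by (intro exI[of _ "\<lambda>s t. (1 / real (Suc i) * c s) * t ^ Suc i"]) auto
next
  case (add f g)
  then obtain F G where "tpoly A F" "\<forall>s. F s 0 = 0 \<and> (\<forall>t. (F s has_real_derivative f s t) (at t))"
    "tpoly A G" "\<forall>s. G s 0 = 0 \<and> (\<forall>t. (G s has_real_derivative g s t) (at t))" by blast
  then show ?case
    by (intro exI[of _ "\<lambda>s t. F s t + G s t"]) (auto intro: tpoly.add DERIV_add)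
qed

text \<open>Components are integrated in increasing weight: the right-hand side of each involves
  only components already known as polynomials in t.\<close>

lemma triangular_ode:
  fixes W :: "'s \<Rightarrow> real^'n \<Rightarrow> real^'n" and w :: "'n \<Rightarrow> nat"
  assumes W: "\<And>\<gamma> k. (\<And>l. tpoly A (\<lambda>s t. \<gamma> s t $ l)) \<Longrightarrow> tpoly A (\<lambda>s t. W s (\<gamma> s t) $ k)"
    and dep: "\<And>s k z z'. (\<And>l. w l < w k \<Longrightarrow> z $ l = z' $ l) \<Longrightarrow> W s z $ k = W s z' $ k"
  obtains \<gamma> where "\<And>k. tpoly A (\<lambda>s t. \<gamma> s t $ k)" "\<And>s. \<gamma> s 0 = 0"
    "\<And>s t. (\<gamma> s has_vector_derivative W s (\<gamma> s t)) (at t)"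
proof -
  have "\<exists>\<gamma>. (\<forall>k. tpoly A (\<lambda>s t. \<gamma> s t $ k)) \<and> (\<forall>s. \<gamma> s 0 = 0) \<and>
    (\<forall>k s t. w k < m \<longrightarrow> ((\<lambda>t. \<gamma> s t $ k) has_real_derivative W s (\<gamma> s t) $ k) (at t))" for m
  proof (induction m)
    case 0
    show ?case by (intro exI[of _ "\<lambda>s t. 0"]) (auto intro: tpoly_coeff const)
  next
    case (Suc m)
    then obtain \<gamma> where \<gamma>: "\<And>k. tpoly A (\<lambda>s t. \<gamma> s t $ k)" "\<And>s. \<gamma> s 0 = 0"
      "\<And>k s t. w k < m \<Longrightarrow> ((\<lambda>t. \<gamma> s t $ k) has_real_derivative W s (\<gamma> s t) $ k) (at t)" by blast
    have "\<exists>G. tpoly A G \<and> (\<forall>s. G s 0 = 0 \<and> (\<forall>t. (G s has_real_derivative W s (\<gamma> s t) $ k) (at t)))" for k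
      by (rule tpoly_antiderivative[OF W[OF \<gamma>(1)]])
    then obtain G where G: "\<And>k. tpoly A (G k)" "\<And>k s. G k s 0 = 0"
      "\<And>k s t. (G k s has_real_derivative W s (\<gamma> s t) $ k) (at t)" by metis
    \<comment> \<open>Components of weight below \<open>m\<close> are kept; those of weight exactly
      \<open>m\<close> become correct, because their right-hand side involves only the kept
      ones.\<close>
    define \<gamma>' where "\<gamma>' s t = (\<chi> k. if w k < m then \<gamma> s t $ k else G k s t)" for s t
    have W': "W s (\<gamma>' s t) $ k = W s (\<gamma> s t) $ k" if "w k < Suc m" for s t k
      using that by (intro dep) (simp add: \<gamma>'_def)
    have "tpoly A (\<lambda>s t. \<gamma>' s t $ k)" for k using \<gamma>(1) G(1) by (cases "w k < m") (simp_all add: \<gamma>'_def)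
    moreover have "\<gamma>' s 0 = 0" for s using \<gamma>(2) G(2) by (simp add: \<gamma>'_def vec_eq_iff)
    moreover have "((\<lambda>t. \<gamma>' s t $ k) has_real_derivative W s (\<gamma>' s t) $ k) (at t)" if "w k < Suc m" for k s t
      unfolding W'[OF that] using \<gamma>(3) G(3) by (cases "w k < m") (simp_all add: \<gamma>'_def)
    ultimately show ?case by blast
  qed
  from this[of "Suc (\<Sum>j\<in>UNIV. w j)"] obtain \<gamma> where \<gamma>: "\<And>k. tpoly A (\<lambda>s t. \<gamma> s t $ k)" "\<And>s. \<gamma> s 0 = 0"
    "\<And>k s t. w k < Suc (\<Sum>j\<in>UNIV. w j) \<Longrightarrow> ((\<lambda>t. \<gamma> s t $ k) has_real_derivative W s (\<gamma> s t) $ k) (at t)" by blast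
  have "w k < Suc (\<Sum>j\<in>UNIV. w j)" for k by (simp add: less_Suc_eq_le member_le_sum)
  then have "(\<gamma> s has_vector_derivative W s (\<gamma> s t)) (at t)" for s t
    using \<gamma>(3) unfolding has_vector_derivative_def
    by (subst has_derivative_componentwise_within)
      (auto simp: Basis_vec_def inner_axis has_field_derivative_def mult_commute_abs cong: if_cong)
  then show ?thesis using \<gamma> that by blast
qed

end

section \<open>Flow lines of triangular vector fields\<close>

definition flow_line :: "(real^'n \<Rightarrow> real^'n) \<Rightarrow> real^'n \<Rightarrow> (real \<Rightarrow> real^'n) \<Rightarrow> bool" where
  "flow_line V x0 \<gamma> \<longleftrightarrow> \<gamma> 0 = x0 \<and>
     (\<forall>t\<in>{0..1}. (\<gamma> has_vector_derivative V (\<gamma> t)) (at t within {0..1}))"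

text \<open>By induction on the weight, the difference of the two sides has derivative zero.
  Admitting two parameters \<open>x\<close> and \<open>x'\<close> serves both uniqueness of flow
  lines (both zero) and triangularity of the exponential map.\<close>

lemma flow_line_compare:
  fixes V V' :: "real^'n \<Rightarrow> real^'n" and w :: "'n \<Rightarrow> nat"
  assumes \<gamma>: "flow_line V x0 \<gamma>" "flow_line V' x0 \<gamma>'"
    and dep: "\<And>k z z'. (\<And>l. w l < w k \<Longrightarrow> x $ l = x' $ l) \<Longrightarrow> (\<And>l. w l < w k \<Longrightarrow> z $ l = z' $ l) \<Longrightarrow>
      V z $ k - x $ k = V' z' $ k - x' $ k"
  shows "(\<And>l. w l < w k \<Longrightarrow> x $ l = x' $ l) \<Longrightarrow> t \<in> {0..1} \<Longrightarrow> \<gamma> t $ k - t * x $ k = \<gamma>' t $ k - t * x' $ k"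
proof (induction "w k" arbitrary: k t rule: less_induct)
  case less
  have lower: "\<gamma> s $ l = \<gamma>' s $ l" if "w l < w k" "s \<in> {0..1}" for l s
    using less.hyps[OF that(1) _ that(2)] less.prems(1) that(1) by (simp add: order_less_trans)
  let ?h = "\<lambda>t. (\<gamma> t $ k - t * x $ k) - (\<gamma>' t $ k - t * x' $ k)"
  have "(?h has_vector_derivative 0) (at s within {0..1})" if s: "s \<in> {0..1}" for s
  proof -
    have c: "((\<lambda>t. \<gamma> t $ k) has_vector_derivative V (\<gamma> s) $ k) (at s within {0..1})"
      "((\<lambda>t. \<gamma>' t $ k) has_vector_derivative V' (\<gamma>' s) $ k) (at s within {0..1})"
      using \<gamma> s bounded_linear.has_vector_derivative[OF bounded_linear_vec_nth] unfolding flow_line_def by blast+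
    have m: "((\<lambda>t. t * y) has_vector_derivative y) (at s within {0..1})" for y :: real
      by (auto intro!: derivative_eq_intros simp: has_real_derivative_iff_has_vector_derivative[symmetric])
    have "V (\<gamma> s) $ k - x $ k = V' (\<gamma>' s) $ k - x' $ k"
      by (rule dep[OF less.prems(1) lower[OF _ s]])
    then show ?thesis
      using has_vector_derivative_diff[OF has_vector_derivative_diff[OF c(1) m[of "x $ k"]]
          has_vector_derivative_diff[OF c(2) m[of "x' $ k"]]]
      by simp
  qed
  note z = this
  have "\<exists>c. \<forall>s\<in>{0..1}. ?h s = c"
  proof (rule has_vector_derivative_zero_constant[of "{0..1}" ?h])
    show "\<exists>c. \<forall>s\<in>{0..1}. ?h s = c" if "\<And>s. s \<in> {0..1} \<Longrightarrow> ?h s = c" for c using that by blast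
  qed (use z in auto)
  then obtain c where c: "\<And>s. s \<in> {0..1} \<Longrightarrow> ?h s = c" by blast
  have "?h 0 = 0" using \<gamma> by (simp add: flow_line_def)
  then show ?case using c[of 0] c[OF less.prems(2)] by simp
qed

lemma flow_line_unique:
  fixes V :: "real^'n \<Rightarrow> real^'n" and w :: "'n \<Rightarrow> nat"
  assumes "flow_line V x0 \<gamma>" "flow_line V x0 \<gamma>'" "t \<in> {0..1}"
    and "\<And>k z z'. (\<And>l. w l < w k \<Longrightarrow> z $ l = z' $ l) \<Longrightarrow> V z $ k = V z' $ k"
  shows "\<gamma> t = \<gamma>' t"
proof -
  have dep: "V z $ k - (0::real^'n) $ k = V z' $ k - (0::real^'n) $ k"
    if "\<And>l. w l < w k \<Longrightarrow> z $ l = z' $ l" for k z z'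
    using assms(4)[of k z z', OF that] by simp
  have "\<gamma> t $ k - t * (0::real^'n) $ k = \<gamma>' t $ k - t * (0::real^'n) $ k" for k
    by (rule flow_line_compare[where w=w and x=0 and x'=0, OF assms(1,2) dep _ assms(3)]) simp_all
  then show ?thesis by (simp add: vec_eq_iff)
qed

lemma time_one_flow_eq:
  fixes V :: "real^'n \<Rightarrow> real^'n" and w :: "'n \<Rightarrow> nat"
  assumes "flow_line V x0 \<gamma>"
    and "\<And>k z z'. (\<And>l. w l < w k \<Longrightarrow> z $ l = z' $ l) \<Longrightarrow> V z $ k = V z' $ k"
  shows "time_one_flow V x0 = \<gamma> 1"
  unfolding time_one_flow_def
proof (rule the_equality)
  show "\<exists>\<gamma>'. \<gamma>' 0 = x0 \<and> \<gamma>' 1 = \<gamma> 1 \<and>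
      (\<forall>t\<in>{0..1}. (\<gamma>' has_vector_derivative V (\<gamma>' t)) (at t within {0..1}))"
    using assms(1) unfolding flow_line_def by blast
next
  fix y assume "\<exists>\<gamma>'. \<gamma>' 0 = x0 \<and> \<gamma>' 1 = y \<and>
      (\<forall>t\<in>{0..1}. (\<gamma>' has_vector_derivative V (\<gamma>' t)) (at t within {0..1}))"
  then obtain \<gamma>' where \<gamma>': "flow_line V x0 \<gamma>'" "\<gamma>' 1 = y" unfolding flow_line_def by blast
  have "\<gamma>' 1 = \<gamma> 1"
    by (rule flow_line_unique[where w=w, OF \<gamma>'(1) assms(1)]) (simp, erule assms(2))
  then show "y = \<gamma> 1" using \<gamma>'(2) by simp
qed

section \<open>Families of frames\<close>

text \<open>The data from which the Carnot maps are built algebraically: jets of the coordinate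
  functions at the base point and the inverse determinant. The instances are a single frame, smooth
  dependence on (x, y), and first-order dependence on t at 0.\<close>

locale frame_family = fun_algebra S A
  for S :: "'s set" and A :: "('s \<Rightarrow> real) set" +
  fixes w :: "'n::finite \<Rightarrow> nat" and U :: "'s \<Rightarrow> (real^'n) set" and X :: "'s \<Rightarrow> 'n \<Rightarrow> real^'n \<Rightarrow> real^'n"
    and L :: "'s \<Rightarrow> 'n \<Rightarrow> 'n \<Rightarrow> 'n \<Rightarrow> real^'n \<Rightarrow> real" and p :: "'s \<Rightarrow> real^'n"
  assumes w_pos: "1 \<le> w j"
    and frame: "s \<in> S \<Longrightarrow> hframe w (U s) (X s) (L s)"
    and p_in: "s \<in> S \<Longrightarrow> p s \<in> U s"
    and jets: "(\<lambda>s. iterated_derivative (X s) I (\<lambda>x. x $ k) (p s)) \<in> A"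
    and det_inverse: "(\<lambda>s. inverse (det (\<chi> i j. X s j (p s) $ i))) \<in> A"
begin

section \<open>Families of functions with jets in the algebra\<close>

definition admissible :: "('s \<Rightarrow> real^'n \<Rightarrow> real) \<Rightarrow> bool" where
  "admissible f \<longleftrightarrow> (\<forall>s\<in>S. smooth_on (U s) (f s)) \<and>
     (\<forall>I. (\<lambda>s. iterated_derivative (X s) I (f s) (p s)) \<in> A)"

lemma admissible_smooth: "admissible f \<Longrightarrow> s \<in> S \<Longrightarrow> smooth_on (U s) (f s)"
  by (simp add: admissible_def)

lemma admissible_jets: "admissible f \<Longrightarrow> (\<lambda>s. iterated_derivative (X s) I (f s) (p s)) \<in> A"
  by (simp add: admissible_def)

lemma open_U: "s \<in> S \<Longrightarrow> open (U s)"
  by (rule hframe.open_U[OF frame])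

lemma admissible_coord: "admissible (\<lambda>s x. x $ k)"
  unfolding admissible_def by (auto intro: jets smooth_on_coord open_U)

lemma admissible_const: "c \<in> A \<Longrightarrow> admissible (\<lambda>s x. c s)"
proof -
  assume c: "c \<in> A"
  have "(\<lambda>s. iterated_derivative (X s) I (\<lambda>x. c s) (p s)) \<in> A" for I
  proof (cases "I = []")
    case False
    show ?thesis by (rule cong[OF const[of 0]]) (simp add: hframe.D_const[OF frame False])
  qed (use c in simp)
  then show ?thesis by (simp add: admissible_def smooth_on_const)
qed

lemma admissible_add:
  assumes f: "admissible f" and g: "admissible g"
  shows "admissible (\<lambda>s x. f s x + g s x)"
  unfolding admissible_def
proof (intro conjI ballI allI)
  fix s assume s: "s \<in> S"
  show "smooth_on (U s) (\<lambda>x. f s x + g s x)"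
    by (intro smooth_on_add open_U admissible_smooth f g s)
next
  fix I
  show "(\<lambda>s. iterated_derivative (X s) I (\<lambda>x. f s x + g s x) (p s)) \<in> A"
    by (rule cong[OF add[OF admissible_jets[OF f, of I] admissible_jets[OF g, of I]]])
      (rule hframe.D_add[OF frame admissible_smooth[OF f] admissible_smooth[OF g] p_in, symmetric])
qed

lemma admissible_cong:
  assumes f: "admissible f" and eq: "\<And>s x. s \<in> S \<Longrightarrow> x \<in> U s \<Longrightarrow> f s x = g s x"
  shows "admissible g"
  unfolding admissible_def
proof (intro conjI ballI allI)
  fix s assume s: "s \<in> S"
  show "smooth_on (U s) (g s)"
    using smooth_on_cong[OF open_U[OF s], of "f s" "g s"] eq[OF s] admissible_smooth[OF f s] by blast
next
  fix I
  show "(\<lambda>s. iterated_derivative (X s) I (g s) (p s)) \<in> A"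
    by (rule cong[OF admissible_jets[OF f, of I]]) (rule hframe.D_cong[OF frame eq p_in])
qed

lemma admissible_lie:
  assumes f: "admissible f"
  shows "admissible (\<lambda>s. lie_derivative (X s j) (f s))"
  unfolding admissible_def
proof (intro conjI ballI allI)
  fix s assume s: "s \<in> S"
  show "smooth_on (U s) (lie_derivative (X s j) (f s))"
    by (rule hframe.smooth_lie[OF frame[OF s] admissible_smooth[OF f s]])
next
  fix I
  show "(\<lambda>s. iterated_derivative (X s) I (lie_derivative (X s j) (f s)) (p s)) \<in> A"
    using admissible_jets[OF f, of "I @ [j]"] by (simp add: iterated_derivative_append)
qed

lemma admissible_mult:
  assumes "admissible f" "admissible g"
  shows "admissible (\<lambda>s x. f s x * g s x)"
  unfolding admissible_def
proof (intro conjI ballI allI)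
  fix s assume s: "s \<in> S"
  show "smooth_on (U s) (\<lambda>x. f s x * g s x)"
    by (intro smooth_on_mult open_U admissible_smooth assms s)
next
  fix I
  show "(\<lambda>s. iterated_derivative (X s) I (\<lambda>x. f s x * g s x) (p s)) \<in> A"
    using assms
  proof (induction I arbitrary: f g rule: rev_induct)
    case Nil
    then show ?case using mult admissible_jets[of _ "[]"] by simp
  next
    case (snoc a I)
    have 1: "(\<lambda>s. iterated_derivative (X s) I (\<lambda>x. f s x * lie_derivative (X s a) (g s) x) (p s)) \<in> A"
      by (rule snoc.IH[OF snoc.prems(1) admissible_lie[OF snoc.prems(2)]])
    have 2: "(\<lambda>s. iterated_derivative (X s) I (\<lambda>x. lie_derivative (X s a) (f s) x * g s x) (p s)) \<in> A"
      by (rule snoc.IH[OF admissible_lie[OF snoc.prems(1)] snoc.prems(2)])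
    show ?case
    proof (rule cong[OF add[OF 1 2]])
      fix s assume s: "s \<in> S"
      show "iterated_derivative (X s) I (\<lambda>x. f s x * lie_derivative (X s a) (g s) x) (p s) +
          iterated_derivative (X s) I (\<lambda>x. lie_derivative (X s a) (f s) x * g s x) (p s) =
          iterated_derivative (X s) (I @ [a]) (\<lambda>x. f s x * g s x) (p s)"
        by (rule hframe.D_snoc_mult[OF frame[OF s] admissible_smooth[OF snoc.prems(1) s]
              admissible_smooth[OF snoc.prems(2) s] p_in[OF s], symmetric])
    qed
  qed
qed

lemma admissible_sum: "(\<And>i. i \<in> I \<Longrightarrow> admissible (f i)) \<Longrightarrow> admissible (\<lambda>s x. \<Sum>i\<in>I. f i s x)"
  by (induction I rule: infinite_finite_induct) (auto intro: admissible_const const admissible_add)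

lemma admissible_prod: "(\<And>i. i \<in> I \<Longrightarrow> admissible (f i)) \<Longrightarrow> admissible (\<lambda>s x. \<Prod>i\<in>I. f i s x)"
  by (induction I rule: infinite_finite_induct) (auto intro: admissible_const const admissible_mult)

lemma admissible_mpow: "(\<And>j. admissible (u j)) \<Longrightarrow> admissible (\<lambda>s x. mpow (\<lambda>j. u j s x) \<alpha>)"
proof -
  assume u: "\<And>j. admissible (u j)"
  have "admissible (\<lambda>s x. u j s x ^ m)" for j m
    by (induction m) (auto intro: admissible_const const admissible_mult u)
  then show ?thesis unfolding mpow_def by (rule admissible_prod)
qed

lemma base_point: "(\<lambda>s. p s $ k) \<in> A"
  using jets[of "[]" k] by simp

lemma frame_at_base: "(\<lambda>s. X s j (p s) $ k) \<in> A"
  using jets[of "[j]" k] by simp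

lemma admissible_affine: "admissible (\<lambda>s x. affine_coords (X s) (p s) x $ k)"
proof -
  define T where "T s x = (\<Sum>i\<in>UNIV. (x $ i + - p s $ i) * coframe (\<lambda>j. X s j (p s)) (axis i 1) k)" for s x
  have "(\<lambda>s. if j = l then axis i 1 $ m else X s j (p s) $ m) \<in> A" for i j l m
    by (cases "j = l") (simp_all add: const frame_at_base)
  then have "(\<lambda>s. coframe (\<lambda>j. X s j (p s)) (axis i 1) l) \<in> A" for i l
    unfolding coframe_def divide_inverse by (intro mult det_inverse det) simp
  then have T: "admissible T" unfolding T_def
    by (intro admissible_sum admissible_mult admissible_add admissible_coord admissible_const uminus base_point)
  have "affine_coords (X s) (p s) x $ k = T s x" if "s \<in> S" for s x
    using hframe.affine_coords_component[OF frame[OF that] p_in[OF that], of x k] by (simp add: T_def)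
  then show ?thesis by (intro admissible_cong[OF T]) simp
qed

text \<open>Chosen words applied to monomials in adapted functions form a matrix that is triangular
  for the degree, with constant diagonal \<alpha>!.\<close>

lemma admissible_solve:
  assumes Q: "finite Q" and f: "admissible f" and u: "\<And>k. admissible (u k)"
    and ad: "\<And>s. s \<in> S \<Longrightarrow> adapted (X s) (p s) (\<lambda>k. u k s)"
  shows "\<exists>c. (\<forall>\<alpha>. c \<alpha> \<in> A) \<and> (\<forall>s\<in>S. \<forall>\<beta>\<in>Q.
      (\<Sum>\<alpha>\<in>Q. c \<alpha> s * iterated_derivative (X s) (word \<beta>) (\<lambda>x. mpow (\<lambda>k. u k s x) \<alpha>) (p s)) =
      iterated_derivative (X s) (word \<beta>) (f s) (p s))"
proof -
  show ?thesis (is "\<exists>c. ?P c")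
  proof (rule triangular_solve[where Q=Q and rank="mdeg one" and \<kappa>="\<lambda>\<alpha>. \<Prod>j\<in>UNIV. fact (\<alpha> j)"
        and F="\<lambda>\<beta> s. iterated_derivative (X s) (word \<beta>) (f s) (p s)"
        and M="\<lambda>\<beta> \<alpha> s. iterated_derivative (X s) (word \<beta>) (\<lambda>x. mpow (\<lambda>k. u k s x) \<alpha>) (p s)"])
    show "\<exists>c. ?P c" if "\<And>\<alpha>. c \<alpha> \<in> A" "\<And>s \<beta>. s \<in> S \<Longrightarrow> \<beta> \<in> Q \<Longrightarrow>
      (\<Sum>\<alpha>\<in>Q. c \<alpha> s * iterated_derivative (X s) (word \<beta>) (\<lambda>x. mpow (\<lambda>k. u k s x) \<alpha>) (p s)) =
      iterated_derivative (X s) (word \<beta>) (f s) (p s)" for c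
      using that by blast
    show "iterated_derivative (X s) (word \<beta>) (\<lambda>x. mpow (\<lambda>k. u k s x) \<alpha>) (p s) = 0"
      if "s \<in> S" "mdeg one \<beta> \<le> mdeg one \<alpha>" "\<alpha> \<noteq> \<beta>" for \<beta> \<alpha> s
      by (rule hframe.D_mpow_tri[OF frame p_in admissible_smooth[OF u] ad]) (use that in auto)
    show "iterated_derivative (X s) (word \<beta>) (\<lambda>x. mpow (\<lambda>k. u k s x) \<beta>) (p s) = (\<Prod>j\<in>UNIV. fact (\<beta> j))"
      if "s \<in> S" for \<beta> s
      by (rule hframe.D_mpow_diag[OF frame p_in admissible_smooth[OF u] ad]) (use that in auto)
    show "(\<lambda>s. iterated_derivative (X s) (word \<beta>) (\<lambda>x. mpow (\<lambda>k. u k s x) \<alpha>) (p s)) \<in> A" for \<beta> \<alpha>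
      by (rule admissible_jets[OF admissible_mpow[OF u]])
  qed (auto intro: Q admissible_jets f)
qed

text \<open>The coefficients are chosen to annihilate one word per multi-index;
  \<open>order_ge_one_words\<close> extends this to all words shorter than \<open>M\<close>.\<close>

lemma expansion:
  assumes f: "admissible f" and u: "\<And>k. admissible (u k)"
    and ad: "\<And>s. s \<in> S \<Longrightarrow> adapted (X s) (p s) (\<lambda>k. u k s)"
  shows "\<exists>c. (\<forall>\<alpha>. c \<alpha> \<in> A) \<and> (\<forall>s\<in>S. order_ge one (X s) (p s) M
      (\<lambda>x. f s x - (\<Sum>\<alpha>\<in>{\<alpha>. mdeg one \<alpha> < M}. c \<alpha> s * mpow (\<lambda>k. u k s x) \<alpha>)))"
proof -
  have fin: "finite {\<alpha>::'n \<Rightarrow> nat. mdeg one \<alpha> < M}" by (rule finite_mdeg_less) simp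
  obtain c where c: "\<And>\<alpha>. c \<alpha> \<in> A"
    and e: "\<And>s \<beta>. s \<in> S \<Longrightarrow> \<beta> \<in> {\<alpha>. mdeg one \<alpha> < M} \<Longrightarrow>
      (\<Sum>\<alpha>\<in>{\<alpha>. mdeg one \<alpha> < M}. c \<alpha> s * iterated_derivative (X s) (word \<beta>) (\<lambda>x. mpow (\<lambda>k. u k s x) \<alpha>) (p s)) =
      iterated_derivative (X s) (word \<beta>) (f s) (p s)"
    using admissible_solve[OF fin f u ad] by blast
  have "order_ge one (X s) (p s) M
      (\<lambda>x. f s x - (\<Sum>\<alpha>\<in>{\<alpha>. mdeg one \<alpha> < M}. c \<alpha> s * mpow (\<lambda>k. u k s x) \<alpha>))" if s: "s \<in> S" for s
  proof -
    interpret h: hframe w "U s" "X s" "L s" by (rule frame[OF s])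
    show ?thesis
    proof (rule h.order_ge_one_words[OF p_in[OF s]])
      show "smooth_on (U s) (\<lambda>x. f s x - (\<Sum>\<alpha>\<in>{\<alpha>. mdeg one \<alpha> < M}. c \<alpha> s * mpow (\<lambda>k. u k s x) \<alpha>))"
        by (rule h.smooth_remainder) (intro admissible_smooth f u s)+
      fix \<beta> :: "'n \<Rightarrow> nat" assume "mdeg one \<beta> < M"
      then show "iterated_derivative (X s) (word \<beta>)
          (\<lambda>x. f s x - (\<Sum>\<alpha>\<in>{\<alpha>. mdeg one \<alpha> < M}. c \<alpha> s * mpow (\<lambda>k. u k s x) \<alpha>)) (p s) = 0"
        using e[OF s, of \<beta>]
        by (subst h.D_minus_sum[OF p_in[OF s] admissible_smooth[OF f s] h.smooth_mpow[OF admissible_smooth[OF u s]]]) simp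
    qed
  qed
  then show ?thesis using c by blast
qed

lemma psi_hat_exists:
  "\<exists>a. (\<forall>k \<alpha>. a k \<alpha> \<in> A) \<and>
    (\<forall>s\<in>S. \<forall>z k. psi_hat w (X s) (p s) z $ k = z $ k + (\<Sum>\<alpha>\<in>low_index w k. a k \<alpha> s * mpow (($) z) \<alpha>)) \<and>
    (\<forall>s\<in>S. privileged w (X s) (p s) (psi w (X s) (p s)))"
proof -
  let ?T = "\<lambda>k s x. affine_coords (X s) (p s) x $ k"
  have ad: "adapted (X s) (p s) (\<lambda>k. ?T k s)" if "s \<in> S" for s
    by (rule hframe.adapted_affine_coords[OF frame[OF that] p_in[OF that]])
  have fin: "finite (low_index w k)" for k
    by (rule finite_subset[OF _ finite_mdeg_less[of w "w k", OF w_pos]]) (auto simp: low_index_def)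
  let ?P = "\<lambda>k c. (\<forall>\<alpha>. c \<alpha> \<in> A) \<and> (\<forall>s\<in>S. \<forall>\<beta>\<in>low_index w k.
      (\<Sum>\<alpha>\<in>low_index w k. c \<alpha> s * iterated_derivative (X s) (word \<beta>) (\<lambda>x. mpow (\<lambda>k. ?T k s x) \<alpha>) (p s)) =
      iterated_derivative (X s) (word \<beta>) (?T k s) (p s))"
  have "\<exists>c. \<forall>k. ?P k (c k)"
    by (rule choice, rule allI, rule admissible_solve[OF fin admissible_affine admissible_affine ad])
  then obtain c where "\<And>k. ?P k (c k)" by blast
  then have c: "\<And>k \<alpha>. c k \<alpha> \<in> A" and e: "\<And>k s \<beta>. s \<in> S \<Longrightarrow> \<beta> \<in> low_index w k \<Longrightarrow>
      (\<Sum>\<alpha>\<in>low_index w k. c k \<alpha> s * iterated_derivative (X s) (word \<beta>) (\<lambda>x. mpow (\<lambda>k. ?T k s x) \<alpha>) (p s)) =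
      iterated_derivative (X s) (word \<beta>) (?T k s) (p s)" by blast+
  \<comment> \<open>The system requires the correction terms to cancel the derivatives of the affine
    coordinates, whence the sign.\<close>
  define a where "a k \<alpha> s = - c k \<alpha> s" for k \<alpha> s
  define g where "g s z = (\<chi> k. z $ k + (\<Sum>\<alpha>\<in>low_index w k. a k \<alpha> s * mpow (($) z) \<alpha>))" for s and z :: "real^'n"
  have g: "g s z $ k = z $ k + (\<Sum>\<alpha>\<in>low_index w k. a k \<alpha> s * mpow (($) z) \<alpha>)" for s z k
    by (simp add: g_def)
  have pr: "privileged w (X s) (p s) (g s \<circ> affine_coords (X s) (p s))" if s: "s \<in> S" for s
    by (subst hframe.privileged_low_iff[OF frame[OF s] p_in[OF s] g]) (simp add: a_def sum_negf e[OF s])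
  have lo: "lower_order_polynomial w (g s)" for s
    unfolding lower_order_polynomial_iff by (rule exI[of _ "\<lambda>k \<alpha>. a k \<alpha> s"]) (simp add: g)
  have ph: "psi_hat w (X s) (p s) = g s" if "s \<in> S" for s
    by (rule hframe.psi_hat_eqI[OF frame[OF that] p_in[OF that] lo pr[OF that]])
  have "a k \<alpha> \<in> A" for k \<alpha> unfolding a_def by (rule uminus[OF c])
  then show ?thesis
    by (intro exI[of _ a] conjI allI ballI) (simp_all add: ph g psi_def pr)
qed

end

text \<open>With a one-point parameter space and all functions on it, membership is void and the
  lemmas on families become existence statements for one frame.\<close>

lemma (in hframe) single_family:
  "p \<in> U \<Longrightarrow> frame_family (UNIV :: unit set) UNIV w (\<lambda>_. U) (\<lambda>_. X) (\<lambda>_. L) (\<lambda>_. p)"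
  by unfold_locales (auto simp: hframe_axioms intro: w_pos[simplified])

section \<open>The maps of the Carnot coordinate construction\<close>

context hframe
begin

lemma psi_properties:
  assumes p: "p \<in> U"
  shows "lower_order_polynomial w (psi_hat w X p)" "privileged w X p (psi w X p)"
proof -
  interpret f: frame_family "UNIV :: unit set" UNIV w "\<lambda>_. U" "\<lambda>_. X" "\<lambda>_. L" "\<lambda>_. p"
    by (rule single_family[OF p])
  obtain a where "\<forall>z k. psi_hat w X p z $ k = z $ k + (\<Sum>\<alpha>\<in>low_index w k. a k \<alpha> () * mpow (($) z) \<alpha>)"
    and pr: "privileged w X p (psi w X p)"
    using f.psi_hat_exists by blast
  then show "lower_order_polynomial w (psi_hat w X p)" unfolding lower_order_polynomial_iff
    by (intro exI[of _ "\<lambda>k \<alpha>. a k \<alpha> ()"])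
  show "privileged w X p (psi w X p)" by (rule pr)
qed

lemma triangular_psi_hat: "p \<in> U \<Longrightarrow> triangular w (psi_hat w X p)"
  by (rule lower_order_triangular[OF psi_properties(1)])

lemma bij_psi_hat: "p \<in> U \<Longrightarrow> bij (psi_hat w X p)"
  by (rule triangular_bij[OF triangular_psi_hat w_pos])

lemma bij_psi: "p \<in> U \<Longrightarrow> bij (psi w X p)"
  unfolding psi_def by (intro bij_comp bij_affine_coords bij_psi_hat)

lemma smooth_psi_hat:
  assumes p: "p \<in> U" and V: "open V" and \<eta>: "\<And>l. smooth_on V (\<lambda>s. \<eta> s $ l)"
  shows "smooth_on V (\<lambda>s. psi_hat w X p (\<eta> s) $ k)"
proof -
  obtain a where a: "\<And>z k. psi_hat w X p z $ k = z $ k + (\<Sum>\<alpha>\<in>low_index w k. a k \<alpha> * mpow (($) z) \<alpha>)"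
    using psi_properties(1)[OF p] unfolding lower_order_polynomial_iff by blast
  show ?thesis unfolding a
    by (intro smooth_on_add smooth_on_sum smooth_on_mult smooth_on_const smooth_on_mpow V \<eta>)
qed

lemma smooth_psi: "p \<in> U \<Longrightarrow> open V \<Longrightarrow> smooth_on V (\<lambda>x. psi w X p x $ k)"
  unfolding psi_def comp_def by (intro smooth_psi_hat smooth_affine_coords)

lemma differentiable_psi: "p \<in> U \<Longrightarrow> psi w X p differentiable (at x)"
  by (rule smooth_on_differentiable[of UNIV], rule smooth_on_vec) (auto intro: smooth_psi)

lemma adapted_psi: "p \<in> U \<Longrightarrow> adapted X p (\<lambda>k x. psi w X p x $ k)"
  by (rule privileged_adapted[OF psi_properties(2) differentiable_psi])

lemma psi_base: "p \<in> U \<Longrightarrow> psi w X p p = 0"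
  using adapted_psi[of p] by (simp add: adapted_def vec_eq_iff)

lemma order_psi: "p \<in> U \<Longrightarrow> order_ge w X p (w k) (\<lambda>x. psi w X p x $ k)"
  by (rule privileged_order[OF psi_properties(2)])

lemma inv_psi: "p \<in> U \<Longrightarrow> inv (psi w X p) z =
    p + (\<Sum>j\<in>UNIV. inv (psi_hat w X p) z $ j *\<^sub>R X j p)"
  unfolding psi_def by (simp add: o_inv_distrib bij_psi_hat bij_affine_coords inv_affine_coords)

lemma smooth_inv_psi:
  assumes p: "p \<in> U" shows "smooth_on UNIV (\<lambda>z. inv (psi w X p) z $ k)"
proof -
  interpret a: fun_algebra "UNIV :: (real^'n) set" "{f. smooth_on UNIV f}"
    by (rule fun_algebra_smooth) simp
  have "(\<lambda>z. inv (psi_hat w X p) z $ j) \<in> {f. smooth_on UNIV f}" for j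
    by (rule a.inv_triangular[OF triangular_psi_hat[OF p] w_pos])
      (auto intro: smooth_psi_hat[OF p] smooth_on_coord)
  then show ?thesis unfolding inv_psi[OF p]
    by (auto intro!: smooth_on_add smooth_on_const smooth_on_sum smooth_on_mult)
qed

text \<open>The curve has value \<open>p\<close> and is differentiable at t = 0, which bounds its
  distance from \<open>p\<close> linearly in t; this is the control that
  \<open>expansion_limit\<close> asks of its curves.\<close>

lemma inv_psi_curve:
  assumes p: "p \<in> U" and \<rho>: "\<rho> > 0"
  obtains K \<tau> where "\<tau> > 0" "\<tau> \<le> 1"
    "\<And>t. \<bar>t\<bar> < \<tau> \<Longrightarrow> inv (psi w X p) (dil w t z) \<in> cball p \<rho> \<and>
      norm (inv (psi w X p) (dil w t z) - p) \<le> K * \<bar>t\<bar>"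
proof -
  have "smooth_on UNIV (inv (psi w X p))" by (rule smooth_on_vec) (auto intro: smooth_inv_psi[OF p])
  then have d1: "inv (psi w X p) differentiable (at y)" for y by (rule smooth_on_differentiable) simp
  have "smooth_on UNIV (\<lambda>t::real. dil w t z)" unfolding dil_def
    by (rule smooth_on_vec)
      (auto intro!: smooth_on_mult smooth_on_const smooth_on_power smooth_on_ident)
  then have "(\<lambda>t. dil w t z) differentiable (at 0)" by (rule smooth_on_differentiable) simp
  then have "(inv (psi w X p) \<circ> (\<lambda>t. dil w t z)) differentiable (at 0)"
    by (rule differentiable_chain_at[OF _ d1])
  then obtain h' where h': "((\<lambda>t. inv (psi w X p) (dil w t z)) has_derivative h') (at 0)"
    unfolding differentiable_def comp_def by blast
  have h0: "inv (psi w X p) (dil w 0 z) = p"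
  proof -
    have "0 < w j" for j using w_pos[of j] by simp
    then have "dil w 0 z = 0" by (simp add: dil_def vec_eq_iff zero_power)
    then show ?thesis using psi_base[OF p] bij_psi[OF p] by (simp add: inv_f_eq bij_is_inj)
  qed
  obtain d where d: "d > 0" "\<And>t. norm t < d \<Longrightarrow>
      norm (inv (psi w X p) (dil w t z) - p - h' t) \<le> norm t"
    using h' unfolding has_derivative_at_alt h0 by (auto dest: spec[of _ 1])
  obtain B where B: "B > 0" "\<And>t. norm (h' t) \<le> norm t * B"
    using bounded_linear.pos_bounded[OF has_derivative_bounded_linear[OF h']] by blast
  \<comment> \<open>The 1 comes from the error of the linear approximation, \<open>B\<close> from
    the derivative.\<close>
  define K where "K = 1 + B"
  have K: "norm (inv (psi w X p) (dil w t z) - p) \<le> K * \<bar>t\<bar>" if "\<bar>t\<bar> < d" for t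
  proof -
    have "norm (inv (psi w X p) (dil w t z) - p) \<le>
        norm (inv (psi w X p) (dil w t z) - p - h' t) + norm (h' t)"
      by (metis diff_add_cancel norm_triangle_ineq)
    also have "\<dots> \<le> \<bar>t\<bar> + \<bar>t\<bar> * B" using d(2)[of t] B(2)[of t] that by simp
    finally show ?thesis by (simp add: K_def algebra_simps)
  qed
  define \<tau> where "\<tau> = min 1 (min d (\<rho> / K))"
  show ?thesis
  proof (rule that[of \<tau> K])
    have "K > 0" using B by (simp add: K_def)
    then show "\<tau> > 0" using d \<rho> by (simp add: \<tau>_def)
    show "\<tau> \<le> 1" by (simp add: \<tau>_def)
    fix t assume t: "\<bar>t\<bar> < \<tau>"
    then have 1: "norm (inv (psi w X p) (dil w t z) - p) \<le> K * \<bar>t\<bar>" by (intro K) (simp add: \<tau>_def)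
    also have "K * \<bar>t\<bar> \<le> \<rho>" using t \<open>K > 0\<close> by (simp add: \<tau>_def field_simps)
    finally show "inv (psi w X p) (dil w t z) \<in> cball p \<rho> \<and>
        norm (inv (psi w X p) (dil w t z) - p) \<le> K * \<bar>t\<bar>"
      using 1 by (simp add: dist_norm norm_minus_commute)
  qed
qed

text \<open>In the coordinates \<psi> the components of X_j are the functions X_j \<psi>_k, whose
  expansion in \<psi> starts at weight w_k - w_j; the limit keeps exactly the monomials of that
  weight.\<close>

lemma model_limit:
  assumes p: "p \<in> U"
    and R: "\<And>j k. order_ge one X p (w k + 1)
      (remainder (w k + 1) (lie_derivative (X j) (\<lambda>x. psi w X p x $ k)) (\<lambda>k x. psi w X p x $ k) (c j k))"
  shows "model_field_at w X p j z $ k = (\<Sum>\<alpha>\<in>{\<alpha>. mdeg w \<alpha> + w j = w k}. c j k \<alpha> * mpow (($) z) \<alpha>)"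
proof -
  let ?u = "\<lambda>k x. psi w X p x $ k"
  obtain \<rho> where \<rho>: "\<rho> > 0" "cball p \<rho> \<subseteq> U" using open_U p open_contains_cball by blast
  obtain K \<tau> where \<tau>: "\<tau> > 0" "\<tau> \<le> 1"
    "\<And>t. \<bar>t\<bar> < \<tau> \<Longrightarrow> inv (psi w X p) (dil w t z) \<in> cball p \<rho> \<and>
      norm (inv (psi w X p) (dil w t z) - p) \<le> K * \<bar>t\<bar>"
    by (rule inv_psi_curve[OF p \<rho>(1)]) blast
  define P where "P = {(t, z'). z' = z \<and> t \<noteq> 0 \<and> \<bar>t\<bar> < \<tau>}"
  let ?V = "\<lambda>t. t ^ w j *\<^sub>R dil_pullback w t (pushforward (psi w X p) (X j)) z"
  have "((\<lambda>t. ?V t $ k) \<longlongrightarrow> (\<Sum>\<alpha>\<in>{\<alpha>. mdeg w \<alpha> + w j = w k}. c j k \<alpha> * mpow (($) z) \<alpha>)) (at 0)" for k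
  proof -
    let ?f = "lie_derivative (X j) (?u k)"
    let ?m = "\<Sum>\<alpha>\<in>{\<alpha>. mdeg w \<alpha> + w j = w k}. c j k \<alpha> * mpow (($) z) \<alpha>"
    have su: "smooth_on U (?u k)" for k by (rule smooth_psi[OF p open_U])
    have o: "order_ge w X p (w k - w j) ?f" by (rule order_ge_lie[OF order_psi[OF p]])
    obtain C where C: "\<And>t z'. (t, z') \<in> P \<Longrightarrow>
      \<bar>t ^ w j * ?f (inv (psi w X p) (dil w t z')) / t ^ w k -
        (\<Sum>\<alpha>\<in>{\<alpha>. mdeg w \<alpha> + w j = w k}. c j k \<alpha> * mpow (($) z') \<alpha>)\<bar> \<le> C * \<bar>t\<bar>"
    proof (rule expansion_limit[OF \<rho>(2) smooth_lie[OF su] su R[where j=j and k=k], where P=P and a="w k" and b="w j" and B="norm z" and K=K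
          and x="\<lambda>t z. inv (psi w X p) (dil w t z)"])
      show "c j k \<alpha> = 0" if "mdeg w \<alpha> + w j < w k" for \<alpha>
        by (rule expansion_low[OF p smooth_lie[OF su] o su adapted_psi[OF p] order_psi[OF p] R])
          (use that in auto)
    next
      fix t z' assume "(t, z') \<in> P"
      moreover have "psi w X p (inv (psi w X p) y) = y" for y
        by (rule surj_f_inv_f[OF bij_is_surj[OF bij_psi[OF p]]])
      ultimately show "t \<noteq> 0 \<and> \<bar>t\<bar> \<le> 1 \<and> norm z' \<le> norm z \<and> inv (psi w X p) (dil w t z') \<in> cball p \<rho> \<and>
          norm (inv (psi w X p) (dil w t z') - p) \<le> K * \<bar>t\<bar> \<and>
          (\<forall>k. psi w X p (inv (psi w X p) (dil w t z')) $ k = t ^ w k * z' $ k)"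
        using \<tau> by (auto simp: P_def dil_def)
    qed auto
    have V: "?V t $ k = t ^ w j * ?f (inv (psi w X p) (dil w t z)) / t ^ w k" for t
      by (simp add: dil_pullback_def pushforward_def lie_derivative_def frechet_derivative_component[OF differentiable_psi[OF p]])
    have "((\<lambda>t. C * \<bar>t\<bar>) \<longlongrightarrow> C * \<bar>0\<bar>) (at 0)" by (intro tendsto_intros)
    then have l0: "((\<lambda>t. C * \<bar>t\<bar>) \<longlongrightarrow> 0) (at 0)" by simp
    have "norm (?V t $ k - ?m) \<le> C * \<bar>t\<bar>" if "t \<noteq> 0" "\<bar>t\<bar> < \<tau>" for t
      unfolding V real_norm_def by (rule C) (simp add: P_def that)
    then have "\<forall>\<^sub>F t in at 0. norm (?V t $ k - ?m) \<le> C * \<bar>t\<bar>"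
      unfolding eventually_at using \<tau>(1) by (intro exI[of _ \<tau>]) auto
    then show ?thesis by (intro Lim_null_comparison[OF _ l0, THEN LIM_zero_cancel])
  qed
  then have "(?V \<longlongrightarrow> (\<chi> k. \<Sum>\<alpha>\<in>{\<alpha>. mdeg w \<alpha> + w j = w k}. c j k \<alpha> * mpow (($) z) \<alpha>)) (at 0)"
    by (intro vec_tendstoI) simp
  then have "Lim (at 0) ?V = (\<chi> k. \<Sum>\<alpha>\<in>{\<alpha>. mdeg w \<alpha> + w j = w k}. c j k \<alpha> * mpow (($) z) \<alpha>)"
    by (intro tendsto_Lim) auto
  then show ?thesis by (simp add: model_field_at_def model_field_def)
qed

end

section \<open>Model fields and exponential maps of a family\<close>

lemma mpow_of_zero: "mpow (\<lambda>k. 0) \<alpha> = (if \<alpha> = (\<lambda>_. 0) then 1 else 0)"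
proof (cases "\<alpha> = (\<lambda>_. 0)")
  case False
  then obtain j where "\<alpha> j \<noteq> 0" by auto
  then have "(\<Prod>j\<in>UNIV. (0::real) ^ \<alpha> j) = 0" by (intro prod_zero) (auto intro!: bexI[of _ j])
  then show ?thesis using False by (simp add: mpow_def)
qed simp

lemma dil_component [simp]: "dil w t x $ k = t ^ w k * x $ k"
  by (simp add: dil_def)

lemma mpow_dil: "mpow (($) (dil w t z)) \<alpha> = t ^ mdeg w \<alpha> * mpow (($) z) \<alpha>"
proof -
  have "($) (dil w t z) = (\<lambda>j. t ^ w j * z $ j)" by (simp add: fun_eq_iff dil_def)
  then show ?thesis by (simp add: mpow_weighted)
qed

context frame_family
begin

lemma admissible_psi: "admissible (\<lambda>s x. psi w (X s) (p s) x $ k)"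
proof -
  obtain a where a: "\<And>k \<alpha>. a k \<alpha> \<in> A"
    "\<And>s z k. s \<in> S \<Longrightarrow> psi_hat w (X s) (p s) z $ k = z $ k + (\<Sum>\<alpha>\<in>low_index w k. a k \<alpha> s * mpow (($) z) \<alpha>)"
    using psi_hat_exists by blast
  have "admissible (\<lambda>s x. affine_coords (X s) (p s) x $ k +
      (\<Sum>\<alpha>\<in>low_index w k. a k \<alpha> s * mpow (\<lambda>j. affine_coords (X s) (p s) x $ j) \<alpha>))"
    by (intro admissible_add admissible_sum admissible_mult admissible_const a admissible_affine admissible_mpow)
  then show ?thesis by (rule admissible_cong) (simp add: psi_def a(2))
qed

text \<open>The coefficients come from expanding X_j \<psi>_k. Their constant terms are the values
  at the base point, Kronecker deltas, and these make the exponential map triangular.\<close>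

lemma model_exists:
  "\<exists>c. (\<forall>j k \<alpha>. c j k \<alpha> \<in> A) \<and>
    (\<forall>s\<in>S. \<forall>j k z. model_field_at w (X s) (p s) j z $ k =
      (\<Sum>\<alpha>\<in>{\<alpha>. mdeg w \<alpha> + w j = w k}. c j k \<alpha> s * mpow (($) z) \<alpha>)) \<and>
    (\<forall>s\<in>S. \<forall>j k. c j k (\<lambda>_. 0) s = (if j = k then 1 else 0))"
proof -
  let ?u = "\<lambda>k s x. psi w (X s) (p s) x $ k"
  let ?f = "\<lambda>j k s. lie_derivative (X s j) (?u k s)"
  have ad: "adapted (X s) (p s) (\<lambda>k. ?u k s)" if "s \<in> S" for s
    by (rule hframe.adapted_psi[OF frame[OF that] p_in[OF that]])
  let ?P = "\<lambda>jk c. (\<forall>\<alpha>. c \<alpha> \<in> A) \<and> (\<forall>s\<in>S. order_ge one (X s) (p s) (w (snd jk) + 1)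
      (\<lambda>x. ?f (fst jk) (snd jk) s x -
        (\<Sum>\<alpha>\<in>{\<alpha>. mdeg one \<alpha> < w (snd jk) + 1}. c \<alpha> s * mpow (\<lambda>k. ?u k s x) \<alpha>)))"
  have "\<exists>c. \<forall>jk. ?P jk (c jk)"
    by (rule choice, rule allI, rule expansion[OF admissible_lie[OF admissible_psi] admissible_psi ad])
  then obtain c where c: "\<And>jk. ?P jk (c jk)" by blast
  have R: "order_ge one (X s) (p s) (w k + 1)
      (\<lambda>x. ?f j k s x - (\<Sum>\<alpha>\<in>{\<alpha>. mdeg one \<alpha> < w k + 1}. c (j, k) \<alpha> s * mpow (\<lambda>k. ?u k s x) \<alpha>))"
    if "s \<in> S" for s j k using c[of "(j, k)"] that by simp
  have "model_field_at w (X s) (p s) j z $ k =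
      (\<Sum>\<alpha>\<in>{\<alpha>. mdeg w \<alpha> + w j = w k}. c (j, k) \<alpha> s * mpow (($) z) \<alpha>)" if "s \<in> S" for s j k z
    by (rule hframe.model_limit[OF frame[OF that] p_in[OF that], where c="\<lambda>j k \<alpha>. c (j, k) \<alpha> s"])
      (rule R[OF that])
  moreover have "c (j, k) (\<lambda>_. 0) s = (if j = k then 1 else 0)" if s: "s \<in> S" for s j k
  proof -
    have z: "mpow (\<lambda>k. ?u k s (p s)) \<alpha> = (if \<alpha> = (\<lambda>_. 0) then 1 else 0)" for \<alpha>
      using ad[OF s] by (simp add: adapted_def mpow_of_zero)
    have fin: "finite {\<alpha>::'n \<Rightarrow> nat. mdeg one \<alpha> < w k + 1}" by (rule finite_mdeg_less) simp
    have "(\<Sum>\<alpha>\<in>{\<alpha>. mdeg one \<alpha> < w k + 1}. c (j, k) \<alpha> s * mpow (\<lambda>k. ?u k s (p s)) \<alpha>) =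
        (\<Sum>\<alpha>\<in>{\<alpha>. mdeg one \<alpha> < w k + 1}. if (\<lambda>_. 0) = \<alpha> then c (j, k) \<alpha> s else 0)"
      unfolding z by (intro sum.cong) auto
    also have "\<dots> = c (j, k) (\<lambda>_. 0) s" using fin by (subst sum.delta'[OF fin]) (simp add: mdeg_def)
    finally have "?f j k s (p s) - c (j, k) (\<lambda>_. 0) s = 0"
      using order_geD[OF R[OF s], of "[]" k j] by simp
    then show ?thesis using ad[OF s] by (simp add: adapted_def)
  qed
  ultimately show ?thesis using c by (intro exI[of _ "\<lambda>j k. c (j, k)"]) simp
qed

text \<open>A monomial in component k of the j-th model field has weight w_k - w_j < w_k, so it
  involves only lighter coordinates and the flow is found by integrating polynomials in t. The four
  claims share this explicit form of the field.\<close>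

lemma exp_model_structure:
  shows exp_model_in: "(\<And>k. (\<lambda>s. \<xi> s $ k) \<in> A) \<Longrightarrow> (\<lambda>s. exp_model w (X s) (p s) (\<xi> s) $ k) \<in> A"
    and exp_model_triangular: "s \<in> S \<Longrightarrow> triangular w (exp_model w (X s) (p s))"
    and model_field_dep: "s \<in> S \<Longrightarrow> (\<And>l. w l < w k \<Longrightarrow> z $ l = z' $ l) \<Longrightarrow>
      (\<Sum>j\<in>UNIV. x $ j *\<^sub>R model_field_at w (X s) (p s) j z) $ k =
      (\<Sum>j\<in>UNIV. x $ j *\<^sub>R model_field_at w (X s) (p s) j z') $ k"
    and exp_model_flow: "s \<in> S \<Longrightarrow> \<exists>\<gamma>. flow_line (\<lambda>z. \<Sum>j\<in>UNIV. x $ j *\<^sub>R model_field_at w (X s) (p s) j z) 0 \<gamma> \<and>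
      exp_model w (X s) (p s) x = \<gamma> 1"
proof -
  let ?Q = "\<lambda>j k. {\<alpha>. mdeg w \<alpha> + w j = w k}"
  obtain c where c: "\<And>j k \<alpha>. c j k \<alpha> \<in> A"
    and m: "\<And>s j k z. s \<in> S \<Longrightarrow> model_field_at w (X s) (p s) j z $ k = (\<Sum>\<alpha>\<in>?Q j k. c j k \<alpha> s * mpow (($) z) \<alpha>)"
    and c0: "\<And>s j k. s \<in> S \<Longrightarrow> c j k (\<lambda>_. 0) s = (if j = k then 1 else 0)"
    using model_exists by blast
  define F where "F s x z = (\<chi> k. \<Sum>j\<in>UNIV. x $ j * (\<Sum>\<alpha>\<in>?Q j k. c j k \<alpha> s * mpow (($) z) \<alpha>))" for s and x z :: "real^'n"
  have F: "F s x z $ k = (\<Sum>j\<in>UNIV. x $ j * (\<Sum>\<alpha>\<in>?Q j k. c j k \<alpha> s * mpow (($) z) \<alpha>))" for s x z k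
    by (simp add: F_def)
  have mF: "(\<lambda>z. \<Sum>j\<in>UNIV. x $ j *\<^sub>R model_field_at w (X s) (p s) j z) = F s x" if "s \<in> S" for s x
    by (simp add: fun_eq_iff vec_eq_iff F m[OF that])
  have mono: "mpow (($) z) \<alpha> = mpow (($) z') \<alpha>"
    if "\<And>l. w l < w k \<Longrightarrow> z $ l = z' $ l" "\<alpha> \<in> ?Q j k" for z z' :: "real^'n" and \<alpha> j k
  proof (rule mpow_cong)
    fix l assume "\<alpha> l \<noteq> 0"
    then have "w l \<le> mdeg w \<alpha>" by (rule weight_le_mdeg)
    then have "w l < w k" using that(2) w_pos[of j] by simp
    then show "z $ l = z' $ l" by (rule that(1))
  qed
  have mono_sum: "(\<Sum>\<alpha>\<in>?Q j k. c j k \<alpha> s * mpow (($) z) \<alpha>) = (\<Sum>\<alpha>\<in>?Q j k. c j k \<alpha> s * mpow (($) z') \<alpha>)"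
    if "\<And>l. w l < w k \<Longrightarrow> z $ l = z' $ l" for s z z' j k
  proof (rule sum.cong[OF refl])
    fix \<alpha> assume "\<alpha> \<in> ?Q j k"
    then have "mpow (($) z) \<alpha> = mpow (($) z') \<alpha>" using mono that by blast
    then show "c j k \<alpha> s * mpow (($) z) \<alpha> = c j k \<alpha> s * mpow (($) z') \<alpha>" by simp
  qed
  have dep: "F s x z $ k = F s x z' $ k" if "\<And>l. w l < w k \<Longrightarrow> z $ l = z' $ l" for s x z z' k
    unfolding F by (intro sum.cong arg_cong2[where f="(*)"] refl mono_sum that)
  \<comment> \<open>Fields heavier than w_k do not contribute to component k, and those of weight
    w_k contribute only their constant terms, that is \<open>x $ k\<close>; the rest involves only
    lighter coordinates of \<open>x\<close>.\<close>
  have split: "F s x z $ k - x $ k = (\<Sum>j\<in>UNIV. if w j < w k then x $ j * (\<Sum>\<alpha>\<in>?Q j k. c j k \<alpha> s * mpow (($) z) \<alpha>) else 0)"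
    if s: "s \<in> S" for s x z k
  proof -
    have "x $ j * (\<Sum>\<alpha>\<in>?Q j k. c j k \<alpha> s * mpow (($) z) \<alpha>) =
        (if w j < w k then x $ j * (\<Sum>\<alpha>\<in>?Q j k. c j k \<alpha> s * mpow (($) z) \<alpha>) else 0) + (if j = k then x $ k else 0)" for j
    proof -
      consider "w j < w k" | "w j = w k" | "w j > w k" by linarith
      then show ?thesis
      proof cases
        case 2
        have "mdeg w \<alpha> = 0 \<longleftrightarrow> \<alpha> = (\<lambda>_. 0)" for \<alpha>
        proof
          assume "mdeg w \<alpha> = 0"
          then show "\<alpha> = (\<lambda>_. 0)" using index_le_mdeg[of w \<alpha>, OF w_pos] by (simp add: fun_eq_iff)
        qed (simp add: mdeg_def)
        then have "?Q j k = {\<lambda>_. 0}" using 2 by auto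
        then show ?thesis using 2 by (auto simp: c0[OF s])
      next
        case 3
        then have "?Q j k = {}" by auto
        then show ?thesis using 3 by auto
      qed auto
    qed
    note t = this
    have "F s x z $ k = (\<Sum>j\<in>UNIV. (if w j < w k then x $ j * (\<Sum>\<alpha>\<in>?Q j k. c j k \<alpha> s * mpow (($) z) \<alpha>) else 0) +
        (if j = k then x $ k else 0))"
      unfolding F by (rule sum.cong[OF refl t])
    then show ?thesis by (simp add: sum.distrib)
  qed
  have dep2: "F s x z $ k - x $ k = F s x' z' $ k - x' $ k"
    if s: "s \<in> S" and x: "\<And>l. w l < w k \<Longrightarrow> x $ l = x' $ l" and z: "\<And>l. w l < w k \<Longrightarrow> z $ l = z' $ l" for s x x' z z' k
    unfolding split[OF s] by (intro sum.cong if_cong arg_cong2[where f="(*)"] refl mono_sum x z)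
  have flow: "\<exists>\<gamma>. (\<forall>k. tpoly A (\<lambda>s t. \<gamma> s t $ k)) \<and> (\<forall>s. flow_line (F s (\<xi> s)) 0 (\<gamma> s))"
    if \<xi>: "\<And>k. (\<lambda>s. \<xi> s $ k) \<in> A" for \<xi>
  proof -
    have "tpoly A (\<lambda>s t. F s (\<xi> s) (\<gamma> s t) $ k)" if "\<And>l. tpoly A (\<lambda>s t. \<gamma> s t $ l)" for \<gamma> k
      unfolding F by (intro tpoly_sum tpoly_mult tpoly_coeff \<xi> c tpoly_mpow that)
    then obtain \<gamma> where "\<And>k. tpoly A (\<lambda>s t. \<gamma> s t $ k)" "\<And>s. \<gamma> s 0 = 0"
      "\<And>s t. (\<gamma> s has_vector_derivative F s (\<xi> s) (\<gamma> s t)) (at t)"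
      using triangular_ode[where W="\<lambda>s. F s (\<xi> s)" and w=w] dep by blast
    then show ?thesis unfolding flow_line_def
      by (intro exI[of _ \<gamma>]) (auto intro: has_vector_derivative_at_within)
  qed
  have ex: "exp_model w (X s) (p s) x = \<gamma> 1" if "s \<in> S" "flow_line (F s x) 0 \<gamma>" for s x \<gamma>
    unfolding exp_model_def mF[OF that(1)] by (rule time_one_flow_eq[where w=w, OF that(2)]) (erule dep)
  show "(\<lambda>s. exp_model w (X s) (p s) (\<xi> s) $ k) \<in> A" if \<xi>: "\<And>k. (\<lambda>s. \<xi> s $ k) \<in> A"
  proof -
    obtain \<gamma> where \<gamma>: "\<And>k. tpoly A (\<lambda>s t. \<gamma> s t $ k)" "\<And>s. flow_line (F s (\<xi> s)) 0 (\<gamma> s)"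
      using flow[OF \<xi>] by blast
    show ?thesis by (rule cong[OF tpoly_eval[OF \<gamma>(1), of 1]]) (simp add: ex[OF _ \<gamma>(2)])
  qed
  show "triangular w (exp_model w (X s) (p s))" if s: "s \<in> S"
    unfolding triangular_def
  proof (intro allI impI)
    fix k and x x' :: "real^'n" assume x: "\<forall>l. w l < w k \<longrightarrow> x $ l = x' $ l"
    obtain \<gamma> where \<gamma>: "flow_line (F s x) 0 \<gamma>" using flow[of "\<lambda>_. x"] const by blast
    obtain \<gamma>' where \<gamma>': "flow_line (F s x') 0 \<gamma>'" using flow[of "\<lambda>_. x'"] const by blast
    have "\<gamma> 1 $ k - 1 * x $ k = \<gamma>' 1 $ k - 1 * x' $ k"
      by (rule flow_line_compare[where w=w, OF \<gamma> \<gamma>' dep2[OF s]]) (use x in auto)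
    then show "exp_model w (X s) (p s) x $ k - x $ k = exp_model w (X s) (p s) x' $ k - x' $ k"
      by (simp add: ex[OF s \<gamma>] ex[OF s \<gamma>'])
  qed
  show "(\<Sum>j\<in>UNIV. x $ j *\<^sub>R model_field_at w (X s) (p s) j z) $ k =
      (\<Sum>j\<in>UNIV. x $ j *\<^sub>R model_field_at w (X s) (p s) j z') $ k"
    if "s \<in> S" "\<And>l. w l < w k \<Longrightarrow> z $ l = z' $ l"
    using dep[OF that(2)] mF[OF that(1), of x] by (metis (no_types, lifting))
  show "\<exists>\<gamma>. flow_line (\<lambda>z. \<Sum>j\<in>UNIV. x $ j *\<^sub>R model_field_at w (X s) (p s) j z) 0 \<gamma> \<and>
      exp_model w (X s) (p s) x = \<gamma> 1" if s: "s \<in> S"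
  proof -
    obtain \<gamma> where \<gamma>: "\<And>s. flow_line (F s x) 0 (\<gamma> s)" using flow[of "\<lambda>_. x"] const by blast
    show ?thesis unfolding mF[OF s] using \<gamma> ex[OF s \<gamma>] by blast
  qed
qed

lemma model_field_homogeneous:
  assumes s: "s \<in> S"
  shows "t ^ w j *\<^sub>R model_field_at w (X s) (p s) j (dil w t z) = dil w t (model_field_at w (X s) (p s) j z)"
proof -
  obtain c where m: "\<And>j k z. model_field_at w (X s) (p s) j z $ k =
      (\<Sum>\<alpha>\<in>{\<alpha>. mdeg w \<alpha> + w j = w k}. c j k \<alpha> s * mpow (($) z) \<alpha>)"
    using model_exists s by blast
  have "t ^ w j * (c j k \<alpha> s * mpow (($) (dil w t z)) \<alpha>) = t ^ w k * (c j k \<alpha> s * mpow (($) z) \<alpha>)"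
    if "mdeg w \<alpha> + w j = w k" for k \<alpha>
    by (simp add: mpow_dil that[symmetric] power_add)
  then have "(\<Sum>\<alpha>\<in>{\<alpha>. mdeg w \<alpha> + w j = w k}. t ^ w j * (c j k \<alpha> s * mpow (($) (dil w t z)) \<alpha>)) =
      (\<Sum>\<alpha>\<in>{\<alpha>. mdeg w \<alpha> + w j = w k}. t ^ w k * (c j k \<alpha> s * mpow (($) z) \<alpha>))" for k
    by (intro sum.cong) auto
  then show ?thesis by (simp add: vec_eq_iff m sum_distrib_left)
qed

lemma bij_exp_model: "s \<in> S \<Longrightarrow> bij (exp_model w (X s) (p s))"
  by (rule triangular_bij[OF exp_model_triangular w_pos])

lemma psi_in:
  assumes \<xi>: "\<And>k. (\<lambda>s. \<xi> s $ k) \<in> A"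
  shows "(\<lambda>s. psi w (X s) (p s) (\<xi> s) $ k) \<in> A" "(\<lambda>s. inv (psi w (X s) (p s)) (\<xi> s) $ k) \<in> A"
proof -
  obtain a where a: "\<And>k \<alpha>. a k \<alpha> \<in> A"
    "\<And>s z k. s \<in> S \<Longrightarrow> psi_hat w (X s) (p s) z $ k = z $ k + (\<Sum>\<alpha>\<in>low_index w k. a k \<alpha> s * mpow (($) z) \<alpha>)"
    using psi_hat_exists by blast
  have ph: "(\<lambda>s. psi_hat w (X s) (p s) (\<eta> s) $ k) \<in> A" if "\<And>l. (\<lambda>s. \<eta> s $ l) \<in> A" for \<eta> k
  proof -
    have "(\<lambda>s. \<eta> s $ k + (\<Sum>\<alpha>\<in>low_index w k. a k \<alpha> s * mpow (($) (\<eta> s)) \<alpha>)) \<in> A"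
      by (intro add that sum mult a mpow)
    then show ?thesis by (rule cong) (simp add: a)
  qed
  have co: "(\<lambda>s. coframe (\<lambda>j. X s j (p s)) (axis i 1) l) \<in> A" for i l
  proof -
    have "(\<lambda>s. if j = l then axis i 1 $ m else X s j (p s) $ m) \<in> A" for j m
      by (cases "j = l") (simp_all add: const frame_at_base)
    then show ?thesis unfolding coframe_def divide_inverse by (intro mult det_inverse det) simp
  qed
  have "(\<lambda>s. affine_coords (X s) (p s) (\<xi> s) $ k) \<in> A" for k
  proof -
    have "(\<lambda>s. \<Sum>i\<in>UNIV. (\<xi> s $ i - p s $ i) * coframe (\<lambda>j. X s j (p s)) (axis i 1) k) \<in> A"
      by (intro sum mult diff \<xi> base_point co)
    then show ?thesis by (rule cong) (simp add: hframe.affine_coords_component[OF frame p_in])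
  qed
  then show "(\<lambda>s. psi w (X s) (p s) (\<xi> s) $ k) \<in> A" unfolding psi_def comp_def by (rule ph)
  have "(\<lambda>s. inv (psi_hat w (X s) (p s)) (\<xi> s) $ j) \<in> A" for j
    by (rule inv_triangular[OF hframe.triangular_psi_hat[OF frame p_in] w_pos ph \<xi>])
  then have "(\<lambda>s. p s $ k + (\<Sum>j\<in>UNIV. inv (psi_hat w (X s) (p s)) (\<xi> s) $ j * X s j (p s) $ k)) \<in> A"
    by (intro add base_point sum mult frame_at_base)
  then show "(\<lambda>s. inv (psi w (X s) (p s)) (\<xi> s) $ k) \<in> A"
    by (rule cong) (simp add: hframe.inv_psi[OF frame p_in])
qed

text \<open>The transfer principle: each factor of the map and of its inverse sends vectors of
  members of \<open>A\<close> to vectors of members of \<open>A\<close>.\<close>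

theorem carnot_eps_in:
  assumes \<xi>: "\<And>k. (\<lambda>s. \<xi> s $ k) \<in> A"
  shows "(\<lambda>s. carnot_eps w (X s) (p s) (\<xi> s) $ k) \<in> A" "(\<lambda>s. inv (carnot_eps w (X s) (p s)) (\<xi> s) $ k) \<in> A"
proof -
  show "(\<lambda>s. carnot_eps w (X s) (p s) (\<xi> s) $ k) \<in> A" unfolding carnot_eps_def comp_def
    by (rule inv_triangular[OF exp_model_triangular w_pos exp_model_in psi_in(1)[OF \<xi>]])
  have "(\<lambda>s. inv (psi w (X s) (p s)) (exp_model w (X s) (p s) (\<xi> s)) $ k) \<in> A"
    by (rule psi_in(2)[OF exp_model_in[OF \<xi>]])
  moreover have "inv (psi w (X s) (p s)) (exp_model w (X s) (p s) (\<xi> s)) = inv (carnot_eps w (X s) (p s)) (\<xi> s)"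
    if s: "s \<in> S" for s
    unfolding carnot_eps_def
    by (simp add: o_inv_distrib bij_imp_bij_inv bij_exp_model[OF s] hframe.bij_psi[OF frame[OF s] p_in[OF s]] inv_inv_eq)
  ultimately show "(\<lambda>s. inv (carnot_eps w (X s) (p s)) (\<xi> s) $ k) \<in> A" using cong by auto
qed

lemma bij_carnot_eps: "s \<in> S \<Longrightarrow> bij (carnot_eps w (X s) (p s))"
  unfolding carnot_eps_def
  by (intro bij_comp bij_imp_bij_inv bij_exp_model hframe.bij_psi[OF frame p_in])

end

section \<open>Dilations\<close>

text \<open>For t \<noteq> 0 its differential image under \<open>dil w t\<close> is the frame with
  \<open>X j\<close> multiplied by \<open>t ^ w j\<close>.\<close>

definition scaled_frame :: "('n::finite \<Rightarrow> nat) \<Rightarrow> real \<Rightarrow> ('n \<Rightarrow> real^'n \<Rightarrow> real^'n) \<Rightarrow> 'n \<Rightarrow> real^'n \<Rightarrow> real^'n" where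
  "scaled_frame w t X j x = t ^ w j *\<^sub>R dil_pullback w t (X j) x"

lemma linear_dil: "linear (dil w t)"
  by (rule linearI) (simp_all add: vec_eq_iff distrib_left)

lemma bounded_linear_dil: "bounded_linear (dil w t :: real^'n \<Rightarrow> real^'n)"
  using linear_dil linear_conv_bounded_linear by blast

lemma dil_dil: "dil w s (dil w t x) = dil w (s * t) x"
  by (simp add: vec_eq_iff power_mult_distrib)

lemma dil_1 [simp]: "dil w 1 x = x"
  by (simp add: vec_eq_iff)

lemma dil_inverse [simp]: "t \<noteq> 0 \<Longrightarrow> dil w t (dil w (inverse t) x) = x" "t \<noteq> 0 \<Longrightarrow> dil w (inverse t) (dil w t x) = x"
  by (simp_all add: dil_dil)

lemma bij_dil: "t \<noteq> 0 \<Longrightarrow> bij (dil w t)"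
  by (rule o_bij[of "dil w (inverse t)"]) (auto simp: fun_eq_iff)

lemma inv_dil: "t \<noteq> 0 \<Longrightarrow> inv (dil w t) = dil w (inverse t)"
  by (rule inv_unique_comp) (auto simp: fun_eq_iff)

lemma dil_pullback_eq: "dil_pullback w t V x = dil w (inverse t) (V (dil w t x))"
  by (simp add: dil_pullback_def vec_eq_iff divide_inverse mult.commute power_inverse)

lemma scaled_frame_component: "scaled_frame w t X j x $ k = t ^ w j * X j (dil w t x) $ k / t ^ w k"
  by (simp add: scaled_frame_def dil_pullback_def)

lemma dil_scaled_frame: "t \<noteq> 0 \<Longrightarrow> dil w t (scaled_frame w t X j x) = t ^ w j *\<^sub>R X j (dil w t x)"
  by (simp add: vec_eq_iff scaled_frame_component)

lemma det_weighted:
  fixes M :: "real^'n^'n" and a b :: "'n \<Rightarrow> real"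
  shows "det (\<chi> i j. a i * (M $ i $ j * b j)) = (\<Prod>i\<in>UNIV. a i) * ((\<Prod>j\<in>UNIV. b j) * det M)"
proof -
  have "det (\<chi> i j. a i * (M $ i $ j * b j)) = det (\<chi> i. a i *s (\<chi> j. M $ i $ j * b j))"
    by (intro arg_cong[where f=det]) (simp add: vec_eq_iff)
  also have "\<dots> = (\<Prod>i\<in>UNIV. a i) * det (\<chi> i j. M $ i $ j * b j)"
    by (rule det_rows_mul)
  also have "det (\<chi> i j. M $ i $ j * b j) = det (transpose (\<chi> i j. M $ i $ j * b j))"
    by (simp add: det_transpose)
  also have "transpose (\<chi> i j. M $ i $ j * b j) = (\<chi> j. b j *s transpose M $ j)"
    by (simp add: vec_eq_iff transpose_def mult.commute)
  also have "det \<dots> = (\<Prod>j\<in>UNIV. b j) * det (\<chi> j. transpose M $ j)"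
    by (rule det_rows_mul)
  also have "(\<chi> j. transpose M $ j) = transpose M" by (simp add: vec_eq_iff)
  finally show ?thesis by (simp add: det_transpose)
qed

text \<open>The factors \<open>1 / t ^ w i\<close> of the rows and \<open>t ^ w j\<close> of the
  columns have product 1.\<close>

lemma det_scaled_frame:
  assumes t: "t \<noteq> 0"
  shows "det (\<chi> i j. scaled_frame w t X j x $ i) = det (\<chi> i j. X j (dil w t x) $ i)"
proof -
  have "det (\<chi> i j. scaled_frame w t X j x $ i) =
      det (\<chi> i j. (1 / t ^ w i) * ((\<chi> i j. X j (dil w t x) $ i) $ i $ j * t ^ w j))"
    by (intro arg_cong[where f=det]) (simp add: vec_eq_iff scaled_frame_component)
  also have "\<dots> = (\<Prod>i\<in>UNIV. 1 / t ^ w i) * (\<Prod>i\<in>UNIV. t ^ w i) * det (\<chi> i j. X j (dil w t x) $ i)"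
    by (simp only: det_weighted mult.assoc)
  also have "(\<Prod>i\<in>UNIV. 1 / t ^ w i) * (\<Prod>i\<in>UNIV. t ^ w i) = 1"
    using t by (simp add: prod.distrib[symmetric])
  finally show ?thesis by simp
qed

lemma has_derivative_dil_compose:
  assumes "(f has_derivative f') (at (dil w t x))"
  shows "((\<lambda>x. f (dil w t x)) has_derivative (\<lambda>v. f' (dil w t v))) (at x)"
  by (rule has_derivative_compose[OF bounded_linear_imp_has_derivative[OF bounded_linear_dil] assms])

lemma frechet_scaled_frame:
  assumes "X j differentiable (at (dil w t x))"
  shows "frechet_derivative (scaled_frame w t X j) (at x) v =
    t ^ w j *\<^sub>R dil w (inverse t) (frechet_derivative (X j) (at (dil w t x)) (dil w t v))"
proof -
  have "(scaled_frame w t X j has_derivative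
      (\<lambda>v. t ^ w j *\<^sub>R dil w (inverse t) (frechet_derivative (X j) (at (dil w t x)) (dil w t v)))) (at x)"
    unfolding scaled_frame_def[abs_def] dil_pullback_eq
    by (intro has_derivative_scaleR_right bounded_linear.has_derivative[OF bounded_linear_dil]
        has_derivative_dil_compose differentiableE_frechet assms)
  then show ?thesis by (simp add: frechet_derivative_eqI)
qed

lemma filterlim_scale_at_0: "(c::real) \<noteq> 0 \<Longrightarrow> filterlim (\<lambda>s. s * c) (at 0) (at 0)"
  unfolding filterlim_at
  by (auto simp: eventually_at_filter intro!: tendsto_eq_intros)

text \<open>Convergence to each \<open>l\<close> is shown to be equivalent on both sides, so the
  definite descriptions agree whether or not a limit exists.\<close>

lemma Lim_at_0_scale:
  fixes G :: "real \<Rightarrow> 'b::t2_space"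
  assumes c: "c \<noteq> 0" shows "Lim (at 0) (\<lambda>s. G (s * c)) = Lim (at 0) G"
proof -
  have "((\<lambda>s. G (s * c)) \<longlongrightarrow> l) (at 0) \<longleftrightarrow> (G \<longlongrightarrow> l) (at 0)" for l
  proof
    assume "((\<lambda>s. G (s * c)) \<longlongrightarrow> l) (at 0)"
    then have "((\<lambda>s. G (s * inverse c * c)) \<longlongrightarrow> l) (at 0)"
      by (rule filterlim_compose[OF _ filterlim_scale_at_0]) (use c in simp)
    moreover have "(\<lambda>s. G (s * inverse c * c)) = G" using c by (simp add: fun_eq_iff mult.assoc)
    ultimately show "(G \<longlongrightarrow> l) (at 0)" by metis
  next
    assume "(G \<longlongrightarrow> l) (at 0)"
    then show "((\<lambda>s. G (s * c)) \<longlongrightarrow> l) (at 0)"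
      by (rule filterlim_compose[OF _ filterlim_scale_at_0[OF c]])
  qed
  then show ?thesis by (simp add: Topological_Spaces.Lim_def)
qed

section \<open>Behaviour of the construction under dilation of the frame\<close>

context hframe
begin

lemma lie_scaled_frame:
  assumes "f differentiable (at (dil w t x))" "t \<noteq> 0"
  shows "lie_derivative (scaled_frame w t X j) (\<lambda>x. f (dil w t x)) x =
    t ^ w j * lie_derivative (X j) f (dil w t x)"
  unfolding lie_derivative_def
    frechet_derivative_eqI[OF has_derivative_dil_compose[OF differentiableE_frechet[OF assms(1)]]]
  by (simp add: dil_scaled_frame[OF assms(2)]
      linear_scale[OF has_derivative_linear[OF differentiableE_frechet[OF assms(1)]]])

lemma open_dil_vimage: "open (dil w t -` U)"
  using continuous_open_vimage[OF open_U, of "dil w t"] linear_continuous_at[OF bounded_linear_dil] by auto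

text \<open>The structure functions acquire the exponent w_i + w_j - w_k, written as a quotient
  because it may be negative; precisely there \<open>L\<close> vanishes.\<close>

lemma scaled_hframe:
  assumes t: "t \<noteq> 0"
  shows "hframe w (dil w t -` U) (scaled_frame w t X)
    (\<lambda>i j k x. t ^ (w i + w j) / t ^ w k * L i j k (dil w t x))"
proof (unfold_locales, goal_cases)
  case (1 j) show ?case by (rule w_pos)
next
  case 2 show ?case by (rule open_dil_vimage)
next
  case (3 j)
  have "smooth_on (dil w t -` U) (\<lambda>x. X j (dil w t x))"
    by (rule smooth_on_bounded_linear_right[OF bounded_linear_dil open_U smooth_X])
  then have "smooth_on (dil w t -` U) (\<lambda>x. t ^ w j / t ^ w k * X j (dil w t x) $ k)" for k
    by (intro smooth_on_scale smooth_on_component open_dil_vimage)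
  then show ?case by (intro smooth_on_vec open_dil_vimage) (simp add: scaled_frame_component)
next
  case (4 x)
  then have "dil w t x \<in> U" by simp
  then show ?case unfolding det_scaled_frame[OF t] by (rule det_X)
next
  case (5 i j k)
  show ?case
    by (intro smooth_on_scale open_dil_vimage smooth_on_bounded_linear_right[OF bounded_linear_dil open_U smooth_L])
next
  case (6 x i j)
  let ?y = "dil w t x" and ?D = "\<lambda>i. frechet_derivative (X i) (at (dil w t x))"
  have y: "?y \<in> U" using 6 by simp
  have d: "X i differentiable (at ?y)" for i by (rule smooth_on_differentiable[OF smooth_X y])
  have lin: "linear (?D i)" for i by (rule has_derivative_linear[OF differentiableE_frechet[OF d]])
  have "lie_bracket (scaled_frame w t X i) (scaled_frame w t X j) x =
      t ^ w j *\<^sub>R dil w (inverse t) (?D j (t ^ w i *\<^sub>R X i ?y)) - t ^ w i *\<^sub>R dil w (inverse t) (?D i (t ^ w j *\<^sub>R X j ?y))"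
    by (simp add: lie_bracket_def frechet_scaled_frame[OF d] dil_scaled_frame[OF t])
  also have "\<dots> = t ^ (w i + w j) *\<^sub>R dil w (inverse t) (lie_bracket (X i) (X j) ?y)"
    by (simp add: lie_bracket_def linear_scale[OF lin] linear_scale[OF linear_dil] linear_diff[OF linear_dil]
        scaleR_diff_right power_add mult.commute)
  also have "\<dots> = (\<Sum>k\<in>UNIV. (t ^ (w i + w j) * L i j k ?y) *\<^sub>R dil w (inverse t) (X k ?y))"
    by (simp add: bracket[OF y] linear_sum[OF linear_dil] linear_scale[OF linear_dil] scaleR_sum_right)
  also have "\<dots> = (\<Sum>k\<in>UNIV. (t ^ (w i + w j) / t ^ w k * L i j k ?y) *\<^sub>R scaled_frame w t X k x)"
    using t by (intro sum.cong refl) (simp add: scaled_frame_def dil_pullback_eq)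
  finally show ?case .
next
  case (7 i j k x)
  then show ?case using L_zero by simp
qed

lemma D_scaled:
  assumes f: "smooth_on U f" and t: "t \<noteq> 0"
  shows "dil w t x \<in> U \<Longrightarrow> iterated_derivative (scaled_frame w t X) I (\<lambda>x. f (dil w t x)) x =
    t ^ sum_list (map w I) * D I f (dil w t x)"
proof (induction I arbitrary: x)
  case (Cons i I)
  interpret s: hframe w "dil w t -` U" "scaled_frame w t X" "\<lambda>i j k x. t ^ (w i + w j) / t ^ w k * L i j k (dil w t x)"
    by (rule scaled_hframe[OF t])
  have sD: "smooth_on U (D I f)" by (rule smooth_D[OF f])
  have d: "D I f differentiable (at (dil w t x))" by (rule smooth_on_differentiable[OF sD Cons.prems])
  have "iterated_derivative (scaled_frame w t X) (i # I) (\<lambda>x. f (dil w t x)) x =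
      lie_derivative (scaled_frame w t X i) (\<lambda>x. t ^ sum_list (map w I) * D I f (dil w t x)) x"
    unfolding iterated_derivative_simps
    by (rule lie_derivative_open_cong[OF s.open_U]) (use Cons in auto)
  also have "\<dots> = t ^ sum_list (map w I) * lie_derivative (scaled_frame w t X i) (\<lambda>x. D I f (dil w t x)) x"
    by (rule lie_derivative_scale)
      (use has_derivative_dil_compose[OF differentiableE_frechet[OF d]] in \<open>auto simp: differentiable_def\<close>)
  also have "\<dots> = t ^ sum_list (map w I) * (t ^ w i * lie_derivative (X i) (D I f) (dil w t x))"
    by (simp add: lie_scaled_frame[OF d t])
  finally show ?case by (simp add: power_add mult_ac)
qed simp

context
  fixes t :: real and y :: "real^'n"
  assumes t: "t \<noteq> 0" and y: "dil w t y \<in> U"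
begin

lemma affine_coords_scaled:
  "affine_coords (scaled_frame w t X) y = dil w (inverse t) \<circ> affine_coords X (dil w t y) \<circ> dil w t"
proof
  fix x
  interpret s: hframe w "dil w t -` U" "scaled_frame w t X" "\<lambda>i j k x. t ^ (w i + w j) / t ^ w k * L i j k (dil w t x)"
    by (rule scaled_hframe[OF t])
  have yU: "y \<in> dil w t -` U" using y by simp
  let ?c = "coframe (\<lambda>j. X j (dil w t y)) (dil w t (x - y))"
  have "x - y = dil w (inverse t) (\<Sum>l\<in>UNIV. ?c l *\<^sub>R X l (dil w t y))"
    by (simp add: coframe_expand[OF det_X[OF y]] t)
  also have "\<dots> = (\<Sum>l\<in>UNIV. (?c l / t ^ w l) *\<^sub>R scaled_frame w t X l y)"
    using t by (simp add: linear_sum[OF linear_dil] linear_scale[OF linear_dil] scaled_frame_def dil_pullback_eq)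
  finally have "(\<lambda>l. ?c l / t ^ w l) = coframe (\<lambda>j. scaled_frame w t X j y) (x - y)"
    by (rule coframe_unique[OF s.det_X[OF yU], THEN iffD1])
  then show "affine_coords (scaled_frame w t X) y x = (dil w (inverse t) \<circ> affine_coords X (dil w t y) \<circ> dil w t) x"
    unfolding s.affine_coords_eq[OF yU] affine_coords_eq[OF y] comp_def
    by (auto simp: vec_eq_iff fun_eq_iff linear_diff[OF linear_dil] power_inverse divide_inverse mult.commute)
qed

text \<open>Conjugation by the dilation multiplies the coefficient of z^\<alpha> in component k by t
  to the power \<langle>\<alpha>\<rangle> - w_k, so the polynomial shape persists; the scaling of
  jets preserves privilege, and uniqueness identifies the maps.\<close>

lemma psi_hat_psi_scaled:
  "psi_hat w (scaled_frame w t X) y = dil w (inverse t) \<circ> psi_hat w X (dil w t y) \<circ> dil w t"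
  "psi w (scaled_frame w t X) y = dil w (inverse t) \<circ> psi w X (dil w t y) \<circ> dil w t"
proof -
  interpret s: hframe w "dil w t -` U" "scaled_frame w t X" "\<lambda>i j k x. t ^ (w i + w j) / t ^ w k * L i j k (dil w t x)"
    by (rule scaled_hframe[OF t])
  have yU: "y \<in> dil w t -` U" using y by simp
  let ?g = "dil w (inverse t) \<circ> psi_hat w X (dil w t y) \<circ> dil w t"
  let ?\<psi> = "dil w (inverse t) \<circ> psi w X (dil w t y) \<circ> dil w t"
  have comp: "?g \<circ> affine_coords (scaled_frame w t X) y = ?\<psi>"
    by (simp add: affine_coords_scaled psi_def fun_eq_iff t)
  obtain a where a: "\<And>z k. psi_hat w X (dil w t y) z $ k = z $ k + (\<Sum>\<alpha>\<in>low_index w k. a k \<alpha> * mpow (($) z) \<alpha>)"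
    using psi_properties(1)[OF y] unfolding lower_order_polynomial_iff by blast
  have "?g z $ k = z $ k + (\<Sum>\<alpha>\<in>low_index w k. (a k \<alpha> * t ^ mdeg w \<alpha> / t ^ w k) * mpow (($) z) \<alpha>)" for z k
    using t by (simp add: a mpow_dil distrib_left sum_distrib_left power_inverse divide_inverse mult_ac)
  then have lo: "lower_order_polynomial w ?g" unfolding lower_order_polynomial_iff
    by (intro exI[of _ "\<lambda>k \<alpha>. a k \<alpha> * t ^ mdeg w \<alpha> / t ^ w k"] allI)
  have k: "(\<lambda>x. ?\<psi> x $ k) = (\<lambda>x. (inverse t) ^ w k * psi w X (dil w t y) (dil w t x) $ k)" for k
    by simp
  have sm: "smooth_on U (\<lambda>x. psi w X (dil w t y) x $ k)" for k by (rule smooth_psi[OF y open_U])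
  have sm': "smooth_on (dil w t -` U) (\<lambda>x. psi w X (dil w t y) (dil w t x) $ k)" for k
    by (rule smooth_on_bounded_linear_right[OF bounded_linear_dil open_U sm])
  have DI: "iterated_derivative (scaled_frame w t X) I (\<lambda>x. ?\<psi> x $ k) y =
      (inverse t) ^ w k * (t ^ sum_list (map w I) * D I (\<lambda>x. psi w X (dil w t y) x $ k) (dil w t y))" for I k
    unfolding k s.D_scale[OF sm' yU] D_scaled[OF sm t y] ..
  have pr: "privileged w (scaled_frame w t X) y ?\<psi>"
  proof (rule privilegedI)
    have "smooth_on (dil w t -` U) ?\<psi>"
      by (rule smooth_on_vec[OF open_dil_vimage]) (unfold k, intro smooth_on_scale open_dil_vimage sm')
    then show "?\<psi> differentiable (at y)" by (rule smooth_on_differentiable[OF _ yU])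
    show "adapted (scaled_frame w t X) y (\<lambda>k x. ?\<psi> x $ k)"
      unfolding adapted_def using DI[of "[]"] DI[of "[j]" for j] adapted_psi[OF y] t
      by (auto simp: adapted_def power_inverse)
    show "order_ge w (scaled_frame w t X) y (w k) (\<lambda>x. ?\<psi> x $ k)" for k
      unfolding order_ge_def DI using order_geD[OF order_psi[OF y]] by simp
  qed
  show "psi_hat w (scaled_frame w t X) y = ?g"
    by (rule s.psi_hat_eqI[OF yU lo]) (simp only: comp pr)
  then show "psi w (scaled_frame w t X) y = ?\<psi>" unfolding psi_def[of _ "scaled_frame w t X"] using comp by simp
qed

lemma inv_psi_scaled:
  "inv (psi w (scaled_frame w t X) y) z = dil w (inverse t) (inv (psi w X (dil w t y)) (dil w t z))"
  unfolding psi_hat_psi_scaled(2)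
  by (simp add: o_inv_distrib bij_comp bij_dil bij_psi[OF y] t inv_dil)

text \<open>Dilating the frame by t merely replaces the parameter s of the defining limit by s
  t.\<close>

lemma model_field_scaled: "model_field_at w (scaled_frame w t X) y j = model_field_at w X (dil w t y) j"
proof
  fix z
  let ?\<psi> = "psi w X (dil w t y)" and ?\<phi> = "psi w (scaled_frame w t X) y"
  define G where "G s = s ^ w j *\<^sub>R dil_pullback w s (pushforward ?\<psi> (X j)) z" for s
  have d: "frechet_derivative ?\<phi> (at x) v = dil w (inverse t) (frechet_derivative ?\<psi> (at (dil w t x)) (dil w t v))" for x v
  proof -
    have "((\<lambda>x. dil w (inverse t) (?\<psi> (dil w t x))) has_derivative
        (\<lambda>v. dil w (inverse t) (frechet_derivative ?\<psi> (at (dil w t x)) (dil w t v)))) (at x)"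
      by (intro bounded_linear.has_derivative[OF bounded_linear_dil] has_derivative_dil_compose
          differentiableE_frechet differentiable_psi y)
    then show ?thesis unfolding psi_hat_psi_scaled(2) comp_def by (simp add: frechet_derivative_eqI)
  qed
  have lin: "linear (frechet_derivative ?\<psi> (at x))" for x
    by (rule has_derivative_linear[OF differentiableE_frechet[OF differentiable_psi[OF y]]])
  have pf: "pushforward ?\<phi> (scaled_frame w t X j) z = t ^ w j *\<^sub>R dil w (inverse t) (pushforward ?\<psi> (X j) (dil w t z))" for z
    unfolding pushforward_def d inv_psi_scaled
    by (simp add: dil_scaled_frame t linear_scale[OF lin] linear_scale[OF linear_dil])
  have e: "s ^ w j *\<^sub>R dil_pullback w s (pushforward ?\<phi> (scaled_frame w t X j)) z = G (s * t)" for s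
    unfolding G_def dil_pullback_eq pf dil_dil
    by (simp add: linear_scale[OF linear_dil] dil_dil power_mult_distrib mult.commute)
  show "model_field_at w (scaled_frame w t X) y j z = model_field_at w X (dil w t y) j z"
    unfolding model_field_at_def model_field_def e Lim_at_0_scale[OF t, of G] by (simp only: G_def[abs_def])
qed

text \<open>Model fields are homogeneous, so the dilation carries the flow line with coefficients
  \<open>x\<close> to the one with coefficients \<open>dil w t x\<close>.\<close>

lemma exp_model_scaled: "exp_model w (scaled_frame w t X) y = dil w (inverse t) \<circ> exp_model w X (dil w t y) \<circ> dil w t"
proof
  fix x
  interpret f: frame_family "UNIV :: unit set" UNIV w "\<lambda>_. U" "\<lambda>_. X" "\<lambda>_. L" "\<lambda>_. dil w t y"
    by (rule single_family[OF y])
  let ?M = "\<lambda>x z. \<Sum>j\<in>UNIV. x $ j *\<^sub>R model_field_at w X (dil w t y) j z"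
  obtain \<gamma> where \<gamma>: "flow_line (?M x) 0 \<gamma>" "exp_model w X (dil w t y) x = \<gamma> 1"
    using f.exp_model_flow by blast
  have M: "dil w t (?M x z) = ?M (dil w t x) (dil w t z)" for z
    by (simp add: linear_sum[OF linear_dil] linear_scale[OF linear_dil]
        f.model_field_homogeneous[OF UNIV_I, symmetric] mult.commute)
  have "flow_line (?M (dil w t x)) 0 (\<lambda>s. dil w t (\<gamma> s))"
    unfolding flow_line_def
  proof (intro conjI ballI)
    show "dil w t (\<gamma> 0) = 0" using \<gamma>(1) by (simp add: flow_line_def linear_0[OF linear_dil])
    fix s :: real assume "s \<in> {0..1}"
    then have "(\<gamma> has_vector_derivative ?M x (\<gamma> s)) (at s within {0..1})"
      using \<gamma>(1) by (simp add: flow_line_def)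
    then show "((\<lambda>s. dil w t (\<gamma> s)) has_vector_derivative ?M (dil w t x) (dil w t (\<gamma> s))) (at s within {0..1})"
      unfolding M[symmetric] by (rule bounded_linear.has_vector_derivative[OF bounded_linear_dil])
  qed
  then have "exp_model w X (dil w t y) (dil w t x) = dil w t (\<gamma> 1)"
    unfolding exp_model_def
    by (rule time_one_flow_eq[where w=w]) (rule f.model_field_dep[OF UNIV_I])
  moreover have "exp_model w (scaled_frame w t X) y x = \<gamma> 1"
    using \<gamma>(2) unfolding exp_model_def model_field_scaled .
  ultimately show "exp_model w (scaled_frame w t X) y x = (dil w (inverse t) \<circ> exp_model w X (dil w t y) \<circ> dil w t) x"
    by (simp add: t)
qed

theorem carnot_eps_scaled:
  "carnot_eps w (scaled_frame w t X) y x = dil w (inverse t) (carnot_eps w X (dil w t y) (dil w t x))"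
  "inv (carnot_eps w (scaled_frame w t X) y) x = dil w (inverse t) (inv (carnot_eps w X (dil w t y)) (dil w t x))"
proof -
  interpret f: frame_family "UNIV :: unit set" UNIV w "\<lambda>_. U" "\<lambda>_. X" "\<lambda>_. L" "\<lambda>_. dil w t y"
    by (rule single_family[OF y])
  have b: "bij (exp_model w X (dil w t y))" "bij (carnot_eps w X (dil w t y))"
    using f.bij_exp_model f.bij_carnot_eps by blast+
  have e: "carnot_eps w (scaled_frame w t X) y = dil w (inverse t) \<circ> carnot_eps w X (dil w t y) \<circ> dil w t"
    unfolding carnot_eps_def exp_model_scaled psi_hat_psi_scaled(2)
    by (simp add: o_inv_distrib bij_comp bij_dil b t inv_dil fun_eq_iff)
  then show "carnot_eps w (scaled_frame w t X) y x = dil w (inverse t) (carnot_eps w X (dil w t y) (dil w t x))"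
    by simp
  show "inv (carnot_eps w (scaled_frame w t X) y) x = dil w (inverse t) (inv (carnot_eps w X (dil w t y)) (dil w t x))"
    unfolding e by (simp add: o_inv_distrib bij_comp bij_dil b t inv_dil)
qed

end

end

section \<open>Rescaling at a point with privileged coordinates\<close>

context hframe
begin

lemma norm_dil_le:
  assumes "\<bar>t\<bar> \<le> 1" shows "norm (dil w t z) \<le> norm z * \<bar>t\<bar>"
proof -
  have "\<bar>t\<bar> ^ w k \<le> \<bar>t\<bar>" for k using power_decreasing[of 1 "w k" "\<bar>t\<bar>"] w_pos[of k] assms by simp
  then have "norm (dil w t z $ k) \<le> norm ((t *\<^sub>R z) $ k)" for k
    by (simp add: abs_mult power_abs mult_right_mono)
  then have "norm (dil w t z) \<le> norm (t *\<^sub>R z)" by (rule norm_le_componentwise_cart)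
  then show ?thesis by (simp add: mult.commute)
qed

text \<open>The coordinates themselves are privileged at 0 here, so the dilation is the rescaling
  curve. The coefficients are fixed before \<rho> and \<open>B\<close>, and the bound is uniform
  over bounded \<open>z\<close>.\<close>

lemma rescaling:
  assumes 0: "0 \<in> U" and ad: "adapted X 0 (\<lambda>k x. x $ k)" and pr: "\<And>k. order_ge w X 0 (w k) (\<lambda>x. x $ k)"
    and f: "smooth_on U f" and o: "order_ge w X 0 (a - b) f"
  shows "\<exists>c. (\<forall>\<alpha>. mdeg w \<alpha> + b < a \<longrightarrow> c \<alpha> = 0) \<and>
    order_ge one X 0 (a + 1) (remainder (a + 1) f (\<lambda>k x. x $ k) c) \<and>
    (\<forall>\<rho> B. cball 0 \<rho> \<subseteq> U \<longrightarrow> (\<exists>C. \<forall>t z. t \<noteq> 0 \<longrightarrow> \<bar>t\<bar> \<le> 1 \<longrightarrow> norm z \<le> B \<longrightarrow> dil w t z \<in> cball 0 \<rho> \<longrightarrow>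
      \<bar>t ^ b * f (dil w t z) / t ^ a - (\<Sum>\<alpha>\<in>{\<alpha>. mdeg w \<alpha> + b = a}. c \<alpha> * mpow (($) z) \<alpha>)\<bar> \<le> C * \<bar>t\<bar>))"
proof -
  let ?u = "\<lambda>k x. x $ k"
  have su: "smooth_on U (?u k)" for k by (rule smooth_on_coord[OF open_U])
  interpret f: frame_family "UNIV :: unit set" UNIV w "\<lambda>_. U" "\<lambda>_. X" "\<lambda>_. L" "\<lambda>_. 0"
    by (rule single_family[OF 0])
  have adm: "f.admissible (\<lambda>_. g)" if "smooth_on U g" for g using that by (simp add: f.admissible_def)
  obtain c0 where "\<forall>s\<in>(UNIV :: unit set). order_ge one X 0 (a + 1)
      (\<lambda>x. f x - (\<Sum>\<alpha>\<in>{\<alpha>. mdeg one \<alpha> < a + 1}. c0 \<alpha> s * mpow (\<lambda>k. x $ k) \<alpha>))"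
    using f.expansion[OF adm[OF f] adm[OF su] ad, where M="a + 1"] by blast
  then have R: "order_ge one X 0 (a + 1) (remainder (a + 1) f ?u (\<lambda>\<alpha>. c0 \<alpha> ()))" by simp
  have low: "c0 \<alpha> () = 0" if "mdeg w \<alpha> + b < a" for \<alpha>
    by (rule expansion_low[OF 0 f o su ad pr R]) (use that in auto)
  have "\<exists>C. \<forall>t z. t \<noteq> 0 \<longrightarrow> \<bar>t\<bar> \<le> 1 \<longrightarrow> norm z \<le> B \<longrightarrow> dil w t z \<in> cball 0 \<rho> \<longrightarrow>
      \<bar>t ^ b * f (dil w t z) / t ^ a - (\<Sum>\<alpha>\<in>{\<alpha>. mdeg w \<alpha> + b = a}. c0 \<alpha> () * mpow (($) z) \<alpha>)\<bar> \<le> C * \<bar>t\<bar>"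
    if \<rho>: "cball 0 \<rho> \<subseteq> U" for \<rho> B
  proof -
    define P where "P = {(t, z). t \<noteq> 0 \<and> \<bar>t\<bar> \<le> 1 \<and> norm z \<le> B \<and> dil w t z \<in> cball 0 \<rho>}"
    obtain C where "\<And>t z. (t, z) \<in> P \<Longrightarrow>
        \<bar>t ^ b * f (dil w t z) / t ^ a - (\<Sum>\<alpha>\<in>{\<alpha>. mdeg w \<alpha> + b = a}. c0 \<alpha> () * mpow (($) z) \<alpha>)\<bar> \<le> C * \<bar>t\<bar>"
    proof (rule expansion_limit[where f=f and u="?u" and c="\<lambda>\<alpha>. c0 \<alpha> ()" and M="a + 1" and P=P and a=a and b=b and B=B and K=B
          and x="dil w", OF \<rho> f su R])
      fix t z assume tz: "(t, z) \<in> P"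
      then have "norm (dil w t z) \<le> norm z * \<bar>t\<bar>" by (intro norm_dil_le) (simp add: P_def)
      also have "\<dots> \<le> B * \<bar>t\<bar>" using tz by (intro mult_right_mono) (simp_all add: P_def)
      finally show "t \<noteq> 0 \<and> \<bar>t\<bar> \<le> 1 \<and> norm z \<le> B \<and> dil w t z \<in> cball 0 \<rho> \<and>
          norm (dil w t z - 0) \<le> B * \<bar>t\<bar> \<and> (\<forall>k. dil w t z $ k = t ^ w k * z $ k)"
        using tz by (simp add: P_def)
    qed (use low in auto)
    then show ?thesis unfolding P_def by blast
  qed
  note main = this
  show ?thesis
    by (intro exI[of _ "\<lambda>\<alpha>. c0 \<alpha> ()"] conjI allI impI) (rule low, assumption, rule R, rule main)
qed

end

text \<open>Degree at most m and order at least m leave only a multiple of s^m: a finite limit of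
  the quotient kills the constant term, and dividing by s lowers the degree.\<close>

lemma polynomial_order_degree:
  fixes h :: "real \<Rightarrow> real"
  assumes "\<And>s. h s = (\<Sum>i\<le>m. c i * s ^ i)" and "((\<lambda>s. h s / s ^ m) \<longlongrightarrow> l) (at 0)"
  shows "h s = s ^ m * h 1"
  using assms
proof (induction m arbitrary: h c s)
  case 0
  then show ?case by simp
next
  case (Suc m)
  let ?g = "\<lambda>s. \<Sum>i\<le>m. c (Suc i) * s ^ i"
  have hg: "h s = c 0 + s * ?g s" for s
    unfolding Suc.prems(1) by (subst sum.atMost_Suc_shift) (simp add: sum_distrib_left mult_ac)
  have "((\<lambda>s. h s / s ^ Suc m * s ^ Suc m) \<longlongrightarrow> l * 0 ^ Suc m) (at 0)"
    by (intro tendsto_intros Suc.prems(2))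
  then have "((\<lambda>s. h s / s ^ Suc m * s ^ Suc m) \<longlongrightarrow> 0) (at 0)" by simp
  then have "(h \<longlongrightarrow> 0) (at 0)"
    by (rule Lim_transform_eventually) (auto simp: eventually_at_filter)
  moreover have "(h \<longlongrightarrow> h 0) (at 0)" unfolding Suc.prems(1) by (intro tendsto_intros)
  ultimately have "h 0 = 0" using tendsto_unique trivial_limit_at by blast
  then have c0: "c 0 = 0" using hg[of 0] by simp
  have "((\<lambda>s. ?g s / s ^ m) \<longlongrightarrow> l) (at 0)"
    by (rule Lim_transform_eventually[OF Suc.prems(2)]) (auto simp: eventually_at_filter hg c0)
  then have g: "?g s = s ^ m * ?g 1" for s by (rule Suc.IH[rotated]) simp
  have "h s = s * (s ^ m * ?g 1)" using hg[of s] c0 g[of s] by simp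
  moreover have "h 1 = ?g 1" using hg[of 1] c0 by simp
  ultimately show ?case by simp
qed

section \<open>Polynomial growth under dilations\<close>

text \<open>Polynomials in the dilation parameter; degrees add under products, so weighted
  homogeneity can be tracked through brackets and monomials.\<close>

inductive degree_le :: "nat \<Rightarrow> (real \<Rightarrow> real) \<Rightarrow> bool" where
  monom: "i \<le> m \<Longrightarrow> degree_le m (\<lambda>s. c * s ^ i)"
| add: "degree_le m f \<Longrightarrow> degree_le m g \<Longrightarrow> degree_le m (\<lambda>s. f s + g s)"

lemma degree_le_const: "degree_le m (\<lambda>s. c)"
  using degree_le.monom[of 0 m c] by simp

lemma degree_le_mult: "degree_le m f \<Longrightarrow> degree_le l g \<Longrightarrow> degree_le (m + l) (\<lambda>s. f s * g s)"
proof (induction rule: degree_le.induct)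
  case (monom i m c)
  from monom(2) show ?case
  proof (induction rule: degree_le.induct)
    case (monom j l d)
    then show ?case using degree_le.monom[of "i + j" "m + l" "c * d"] \<open>i \<le> m\<close> by (simp add: power_add mult_ac)
  next
    case (add l f g)
    then show ?case using degree_le.add[OF add.IH] by (simp add: distrib_left)
  qed
next
  case (add m f g)
  then show ?case using degree_le.add[OF add.IH(1)[OF add.prems] add.IH(2)[OF add.prems]] by (simp add: distrib_right)
qed

lemma degree_le_mono: "degree_le m f \<Longrightarrow> m \<le> l \<Longrightarrow> degree_le l f"
  using degree_le_mult[of m f "l - m" "\<lambda>_. 1"] degree_le_const by simp

lemma degree_le_sum: "(\<And>i. i \<in> I \<Longrightarrow> degree_le m (f i)) \<Longrightarrow> degree_le m (\<lambda>s. \<Sum>i\<in>I. f i s)"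
  by (induction I rule: infinite_finite_induct) (auto intro: degree_le_const degree_le.add)

lemma degree_le_power: "degree_le m f \<Longrightarrow> degree_le (m * n) (\<lambda>s. f s ^ n)"
proof (induction n)
  case (Suc n)
  then show ?case using degree_le_mult[of m f "m * n"] by simp
qed (simp add: degree_le_const)

lemma degree_le_mpow:
  assumes "\<And>j. degree_le (w j) (u j)"
  shows "degree_le (mdeg w \<alpha>) (\<lambda>s. mpow (\<lambda>j. u j s) \<alpha>)"
proof -
  have "degree_le (\<Sum>j\<in>B. w j * \<alpha> j) (\<lambda>s. \<Prod>j\<in>B. u j s ^ \<alpha> j)" for B
    by (induction B rule: infinite_finite_induct)
      (auto intro!: degree_le_mult degree_le_power assms intro: degree_le_const)
  then show ?thesis by (simp add: mdeg_def mpow_def)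
qed

lemma degree_le_expand: "degree_le m f \<Longrightarrow> \<exists>c. \<forall>s. f s = (\<Sum>i\<le>m. c i * s ^ i)"
proof (induction rule: degree_le.induct)
  case (monom i m c)
  then have "c * s ^ i = (\<Sum>j\<le>m. (if j = i then c else 0) * s ^ j)" for s
    by (simp add: if_distrib[of "\<lambda>x. x * _"] cong: if_cong)
  then show ?case by (intro exI[of _ "\<lambda>j. if j = i then c else 0"]) simp
next
  case (add m f g)
  then obtain c d where "\<forall>s. f s = (\<Sum>i\<le>m. c i * s ^ i)" "\<forall>s. g s = (\<Sum>i\<le>m. d i * s ^ i)" by blast
  then show ?case by (intro exI[of _ "\<lambda>i. c i + d i"]) (simp add: sum.distrib distrib_right)
qed

section \<open>Left-invariant frames\<close>

text \<open>The law \<open>mul\<close> enters through its lines being one-parameter subgroups, its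
  triangular polynomial form and the invariance of \<open>Z\<close>. That left translations by y and
  -y are inverse to each other is derived from these.\<close>

locale left_invariant_frame = hframe w UNIV Z L for w :: "'n::finite \<Rightarrow> nat" and Z L +
  fixes mul :: "real^'n \<Rightarrow> real^'n \<Rightarrow> real^'n" and c :: "'n \<Rightarrow> 'n \<Rightarrow> ('n \<Rightarrow> nat) \<Rightarrow> real"
  assumes mul_line: "mul (a *\<^sub>R u) (b *\<^sub>R u) = (a + b) *\<^sub>R u"
    and triangular_mul: "triangular w (mul y)"
    and smooth_mul: "smooth_on UNIV (mul y)"
    and degree_mul: "degree_le (w k) (\<lambda>s. mul y (dil w s v) $ k)"
    and invariant: "left_invariant mul (Z j)"
    and Z_0: "Z j 0 = axis j 1"
    and Z_form: "Z j z $ k = (\<Sum>\<alpha>\<in>{\<alpha>. mdeg w \<alpha> + w j = w k}. c j k \<alpha> * mpow (($) z) \<alpha>)"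
    and privileged_0: "order_ge w Z 0 (w k) (\<lambda>x. x $ k)"
begin

lemma mul_0_right: "mul y 0 = y" and mul_neg: "mul (- y) y = 0" and mul_0_left: "mul 0 y = y"
  using mul_line[of 1 y 0] mul_line[of "-1" y 1] mul_line[of 0 y 1] by simp_all

lemma Z_homogeneous: "t ^ w j *\<^sub>R Z j (dil w t z) = dil w t (Z j z)"
proof -
  have "t ^ w j * (c j k \<alpha> * mpow (($) (dil w t z)) \<alpha>) = t ^ w k * (c j k \<alpha> * mpow (($) z) \<alpha>)"
    if "mdeg w \<alpha> + w j = w k" for k \<alpha>
    by (simp add: mpow_dil that[symmetric] power_add)
  then have "(\<Sum>\<alpha>\<in>{\<alpha>. mdeg w \<alpha> + w j = w k}. t ^ w j * (c j k \<alpha> * mpow (($) (dil w t z)) \<alpha>)) =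
      (\<Sum>\<alpha>\<in>{\<alpha>. mdeg w \<alpha> + w j = w k}. t ^ w k * (c j k \<alpha> * mpow (($) z) \<alpha>))" for k
    by (intro sum.cong) auto
  then show ?thesis by (simp add: vec_eq_iff Z_form sum_distrib_left)
qed

abbreviation V :: "real^'n \<Rightarrow> real^'n \<Rightarrow> real^'n" where "V x z \<equiv> \<Sum>j\<in>UNIV. x $ j *\<^sub>R Z j z"

lemma V_dep: "(\<And>l. w l < w k \<Longrightarrow> z $ l = z' $ l) \<Longrightarrow> V x z $ k = V x z' $ k"
proof -
  assume z: "\<And>l. w l < w k \<Longrightarrow> z $ l = z' $ l"
  have "mpow (($) z) \<alpha> = mpow (($) z') \<alpha>" if "mdeg w \<alpha> + w j = w k" for j \<alpha>
  proof (rule mpow_cong)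
    fix l assume "\<alpha> l \<noteq> 0"
    then have "w l \<le> mdeg w \<alpha>" by (rule weight_le_mdeg)
    then show "z $ l = z' $ l" using that w_pos[of j] by (intro z) simp
  qed
  then have "Z j z $ k = Z j z' $ k" for j unfolding Z_form by (intro sum.cong) auto
  then show ?thesis by simp
qed

lemma derivative_mul: "(mul y has_derivative frechet_derivative (mul y) (at x)) (at x)"
  by (rule smooth_on_has_derivative[OF smooth_mul]) simp

lemma linear_derivative_mul: "linear (frechet_derivative (mul y) (at x))"
  by (rule has_derivative_linear[OF derivative_mul])

lemma Z_mul: "Z j (mul y x) = frechet_derivative (mul y) (at x) (Z j x)"
  using invariant unfolding left_invariant_def by blast

lemma V_mul: "V u (mul y x) = frechet_derivative (mul y) (at x) (V u x)"
  by (simp add: Z_mul linear_sum[OF linear_derivative_mul] linear_scale[OF linear_derivative_mul])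

lemma line_vector_derivative: "((\<lambda>s. (a + s) *\<^sub>R x) has_vector_derivative x) (at t within T)"
  for x :: "'a::real_normed_vector"
  by (auto intro!: derivative_eq_intros)

text \<open>Differentiating \<open>mul (t *\<^sub>R x) (s *\<^sub>R x) = (t + s) *\<^sub>R x\<close>
  at s = 0 shows that left translation by \<open>t *\<^sub>R x\<close> maps the vector
  \<open>x\<close> at 0 to itself; by invariance the field with value \<open>x\<close> at 0 is
  \<open>x\<close> all along the ray, which is thus its flow line.\<close>

lemma V_line: "V x (t *\<^sub>R x) = x"
proof -
  have "((\<lambda>s. mul (t *\<^sub>R x) ((0 + s) *\<^sub>R x)) has_vector_derivative
      frechet_derivative (mul (t *\<^sub>R x)) (at ((0 + 0) *\<^sub>R x)) x) (at 0)"
    using vector_derivative_diff_chain_within[OF line_vector_derivative[of 0 x 0 UNIV]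
        has_derivative_at_withinI[OF derivative_mul]] by (simp add: comp_def)
  then have "((\<lambda>s. (t + s) *\<^sub>R x) has_vector_derivative frechet_derivative (mul (t *\<^sub>R x)) (at 0) x) (at 0)"
    by (simp add: mul_line)
  then have "frechet_derivative (mul (t *\<^sub>R x)) (at 0) x = x"
    using vector_derivative_unique_at line_vector_derivative by blast
  moreover have "V x 0 = x" by (simp add: Z_0 vec_eq_iff axis_def if_distrib cong: if_cong)
  ultimately show ?thesis using V_mul[of x "t *\<^sub>R x" 0] by (simp add: mul_0_right)
qed

lemma flow_line_compose:
  assumes \<gamma>: "flow_line V1 x0 \<gamma>" and F: "\<And>x. F differentiable (at x)"
    and V2: "\<And>x. V2 (F x) = frechet_derivative F (at x) (V1 x)"
  shows "flow_line V2 (F x0) (\<lambda>t. F (\<gamma> t))"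
  unfolding flow_line_def
proof (intro conjI ballI)
  show "F (\<gamma> 0) = F x0" using \<gamma> by (simp add: flow_line_def)
  fix t :: real assume "t \<in> {0..1}"
  then have "(\<gamma> has_vector_derivative V1 (\<gamma> t)) (at t within {0..1})" using \<gamma> by (simp add: flow_line_def)
  from vector_derivative_diff_chain_within[OF this has_derivative_at_withinI[OF differentiableE_frechet[OF F]]]
  show "((\<lambda>t. F (\<gamma> t)) has_vector_derivative V2 (F (\<gamma> t))) (at t within {0..1})"
    by (simp add: comp_def V2)
qed

lemma flow_line_ray: "flow_line (V x) 0 (\<lambda>t. t *\<^sub>R x)"
  using line_vector_derivative[of 0 x] by (simp add: flow_line_def V_line)

text \<open>Left translations preserve the field \<open>V x\<close>. Translating the ray by y and
  then by -y gives a flow line starting at \<open>mul (- y) y = 0\<close>, which is the ray again by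
  uniqueness; evaluate at time 1.\<close>

lemma mul_cancel: "mul (- y) (mul y x) = x"
proof -
  have d: "mul y differentiable (at x)" for y x using derivative_mul differentiable_def by blast
  have "flow_line (V x) (mul y 0) (\<lambda>t. mul y (t *\<^sub>R x))"
    by (rule flow_line_compose[OF flow_line_ray d V_mul])
  then have "flow_line (V x) (mul (- y) (mul y 0)) (\<lambda>t. mul (- y) (mul y (t *\<^sub>R x)))"
    by (rule flow_line_compose[OF _ d V_mul])
  then have f: "flow_line (V x) 0 (\<lambda>t. mul (- y) (mul y (t *\<^sub>R x)))" by (simp add: mul_0_right mul_neg)
  have "mul (- y) (mul y (1 *\<^sub>R x)) = 1 *\<^sub>R x"
    by (rule flow_line_unique[where w=w, OF f flow_line_ray]) (simp, erule V_dep)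
  then show ?thesis by simp
qed

lemma mul_cancel': "mul y (mul (- y) x) = x"
  using mul_cancel[of "- y" x] by simp

lemma bij_mul: "bij (mul y)"
  by (rule o_bij[of "mul (- y)"]) (auto simp: fun_eq_iff mul_cancel mul_cancel')

lemma inv_mul: "inv (mul (- y)) = mul y"
  by (rule inv_unique_comp) (auto simp: fun_eq_iff mul_cancel mul_cancel')

lemma D_mul: "smooth_on UNIV f \<Longrightarrow> D I (\<lambda>x. f (mul y x)) x = D I f (mul y x)"
proof (induction I arbitrary: x)
  case (Cons i I)
  have df: "(D I f has_derivative frechet_derivative (D I f) (at (mul y x))) (at (mul y x))"
    by (rule smooth_on_has_derivative[OF smooth_D[OF Cons.prems]]) simp
  have "D I (\<lambda>x. f (mul y x)) = (\<lambda>x. D I f (mul y x))"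
    using Cons.IH[OF Cons.prems] by (simp add: fun_eq_iff)
  then have "D (i # I) (\<lambda>x. f (mul y x)) x = lie_derivative (Z i) (\<lambda>x. D I f (mul y x)) x"
    by simp
  also have "\<dots> = lie_derivative (Z i) (D I f) (mul y x)"
    unfolding lie_derivative_def frechet_derivative_eqI[OF has_derivative_compose[OF derivative_mul df]]
    by (simp add: Z_mul)
  finally show ?case by simp
qed simp

section \<open>Privileged coordinates after left translation\<close>

lemma adapted_coords_0: "adapted Z 0 (\<lambda>k x. x $ k)"
  by (simp add: adapted_def Z_0 axis_def)

text \<open>The coframe at \<open>y\<close> is the differential of left translation by
  \<open>- y\<close>, since that sends \<open>Z j y\<close> to the j-th basis vector. By
  triangularity, moving in a direction heavier than \<open>w k\<close> leaves component k of this
  translation fixed.\<close>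

lemma coframe_lower:
  assumes "w k < w l" shows "coframe (\<lambda>j. Z j y) (axis l 1) k = 0"
proof -
  let ?F = "frechet_derivative (mul (- y)) (at y)"
  have F: "?F b $ k = coframe (\<lambda>j. Z j y) b k" for b
  proof -
    have "?F (\<Sum>j\<in>UNIV. coframe (\<lambda>j. Z j y) b j *\<^sub>R Z j y) = (\<Sum>j\<in>UNIV. coframe (\<lambda>j. Z j y) b j *\<^sub>R axis j 1)"
      using Z_mul[of _ "- y" y]
      by (simp add: linear_sum[OF linear_derivative_mul] linear_scale[OF linear_derivative_mul] mul_neg Z_0)
    then have "?F b = (\<Sum>j\<in>UNIV. coframe (\<lambda>j. Z j y) b j *\<^sub>R axis j 1)"
      by (simp add: coframe_expand[OF det_X])
    then show ?thesis by (simp add: axis_def if_distrib cong: if_cong)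
  qed
  have "mul (- y) (y + s *\<^sub>R axis l 1) $ k - (y + s *\<^sub>R axis l 1) $ k = mul (- y) y $ k - y $ k" for s
    using assms by (intro triangularD[OF triangular_mul]) (auto simp: axis_def)
  moreover have "k \<noteq> l" using assms by auto
  ultimately have e: "mul (- y) (y + s *\<^sub>R axis l 1) $ k = mul (- y) y $ k" for s
    by (simp add: axis_def)
  have "((\<lambda>s. y + s *\<^sub>R axis l 1) has_vector_derivative axis l 1) (at 0)"
    by (auto intro!: derivative_eq_intros)
  moreover have "(mul (- y) has_derivative ?F) (at (y + 0 *\<^sub>R axis l 1) within range (\<lambda>s. y + s *\<^sub>R axis l 1))"
    using has_derivative_at_withinI[OF derivative_mul] by simp
  ultimately have "((\<lambda>s. mul (- y) (y + s *\<^sub>R axis l 1)) has_vector_derivative ?F (axis l 1)) (at 0)"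
    using vector_derivative_diff_chain_within[of _ _ 0 UNIV "mul (- y)" ?F] by (simp add: comp_def)
  from bounded_linear.has_vector_derivative[OF bounded_linear_vec_nth this, of k]
  have "((\<lambda>s. mul (- y) y $ k) has_vector_derivative ?F (axis l 1) $ k) (at 0)" unfolding e .
  then have "?F (axis l 1) $ k = 0"
    using vector_derivative_unique_at has_vector_derivative_const by blast
  then show ?thesis using F by simp
qed

text \<open>The privileged coordinates at \<open>y\<close> seen from the origin;
  \<open>exp_model_Q\<close> identifies them with the exponential map.\<close>

definition Q :: "real^'n \<Rightarrow> real^'n \<Rightarrow> real^'n" where
  "Q y v = psi w Z y (mul y v)"

text \<open>Component k of the affine coordinates mixes only components of weight at most w_k, by
  \<open>coframe_lower\<close>, and the polynomial correction adds monomials of weight below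
  w_k.\<close>

lemma degree_Q: "degree_le (w k) (\<lambda>s. Q y (dil w s v) $ k)"
proof -
  have T: "degree_le (w k) (\<lambda>s. affine_coords Z y (mul y (dil w s v)) $ k)" for k
    unfolding affine_coords_component[OF UNIV_I]
  proof (rule degree_le_sum)
    fix i
    show "degree_le (w k) (\<lambda>s. (mul y (dil w s v) $ i - y $ i) * coframe (\<lambda>j. Z j y) (axis i 1) k)"
    proof (cases "w k < w i")
      case True
      then show ?thesis by (simp add: coframe_lower degree_le_const)
    next
      case False
      have "degree_le (w i + 0) (\<lambda>s. (mul y (dil w s v) $ i + - y $ i) * coframe (\<lambda>j. Z j y) (axis i 1) k)"
        by (intro degree_le_mult degree_le.add degree_mul degree_le_const)
      then show ?thesis using degree_le_mono[of "w i" _ "w k"] False by simp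
    qed
  qed
  obtain a where a: "\<And>z k. psi_hat w Z y z $ k = z $ k + (\<Sum>\<alpha>\<in>low_index w k. a k \<alpha> * mpow (($) z) \<alpha>)"
    using psi_properties(1)[of y] unfolding lower_order_polynomial_iff by blast
  have "degree_le (w k) (\<lambda>s. a k \<alpha> * mpow (($) (affine_coords Z y (mul y (dil w s v)))) \<alpha>)"
    if "\<alpha> \<in> low_index w k" for \<alpha>
  proof -
    have "degree_le (0 + mdeg w \<alpha>) (\<lambda>s. a k \<alpha> * mpow (($) (affine_coords Z y (mul y (dil w s v)))) \<alpha>)"
      by (intro degree_le_mult degree_le_const degree_le_mpow T)
    then show ?thesis using degree_le_mono[of "mdeg w \<alpha>" _ "w k"] that by (simp add: low_index_def)
  qed
  then show ?thesis unfolding Q_def psi_def comp_def a by (intro degree_le.add degree_le_sum T)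
qed

lemma smooth_Q: "smooth_on UNIV (\<lambda>v. Q y v $ k)"
proof -
  have c: "smooth_on UNIV (\<lambda>v. affine_coords Z y (mul y v) $ l)" for l
    unfolding affine_coords_component[OF UNIV_I]
    by (intro smooth_on_sum smooth_on_mult smooth_on_minus smooth_on_component smooth_mul smooth_on_const) auto
  show ?thesis unfolding Q_def psi_def comp_def by (rule smooth_psi_hat[OF UNIV_I _ c]) simp
qed

text \<open>The upper bound w_k on the degree in t meets the lower bound w_k on the order at 0, so
  component k is a multiple of t^w_k.\<close>

lemma Q_homogeneous: "Q y (dil w t v) = dil w t (Q y v)"
proof -
  have "Q y (dil w t v) $ k = t ^ w k * Q y v $ k" for k
  proof -
    have sp: "smooth_on UNIV (\<lambda>x. psi w Z y x $ k)" by (rule smooth_psi) auto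
    \<comment> \<open>Left-invariant fields commute with left translation, so the order of \<psi> at
      \<open>y\<close> becomes the order of \<open>Q y\<close> at 0.\<close>
    have "order_ge w Z 0 (w k) (\<lambda>v. Q y v $ k)"
      unfolding order_ge_def Q_def D_mul[OF sp] mul_0_right
      using order_geD[OF order_psi[OF UNIV_I]] by blast
    then have "order_ge w Z 0 (w k - 0) (\<lambda>v. Q y v $ k)" by simp
    from rescaling[OF UNIV_I adapted_coords_0 privileged_0 smooth_Q this]
    obtain c where "\<And>\<rho> B. cball 0 \<rho> \<subseteq> (UNIV::(real^'n) set) \<Longrightarrow> \<exists>C. \<forall>t z. t \<noteq> 0 \<longrightarrow> \<bar>t\<bar> \<le> 1 \<longrightarrow> norm z \<le> B \<longrightarrow>
      dil w t z \<in> cball 0 \<rho> \<longrightarrow>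
      \<bar>t ^ 0 * Q y (dil w t z) $ k / t ^ w k - (\<Sum>\<alpha>\<in>{\<alpha>. mdeg w \<alpha> + 0 = w k}. c \<alpha> * mpow (($) z) \<alpha>)\<bar> \<le> C * \<bar>t\<bar>"
      by blast
    \<comment> \<open>For |t| at most 1 the dilates of \<open>v\<close> stay in the ball of radius
      \<open>norm v\<close>.\<close>
    from this[of "norm v" "norm v"] obtain C where C: "\<And>t. t \<noteq> 0 \<Longrightarrow> \<bar>t\<bar> \<le> 1 \<Longrightarrow> dil w t v \<in> cball 0 (norm v) \<Longrightarrow>
      \<bar>Q y (dil w t v) $ k / t ^ w k - (\<Sum>\<alpha>\<in>{\<alpha>. mdeg w \<alpha> = w k}. c \<alpha> * mpow (($) v) \<alpha>)\<bar> \<le> C * \<bar>t\<bar>"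
      by auto
    let ?l = "\<Sum>\<alpha>\<in>{\<alpha>. mdeg w \<alpha> = w k}. c \<alpha> * mpow (($) v) \<alpha>"
    have "\<bar>Q y (dil w t v) $ k / t ^ w k - ?l\<bar> \<le> C * \<bar>t\<bar>" if "t \<noteq> 0" "\<bar>t\<bar> < 1" for t
    proof (rule C)
      have "norm v * \<bar>t\<bar> \<le> norm v * 1" using that by (intro mult_left_mono) auto
      then show "dil w t v \<in> cball 0 (norm v)" using norm_dil_le[of t v] that by simp
    qed (use that in auto)
    then have ev: "\<forall>\<^sub>F t in at 0. norm (Q y (dil w t v) $ k / t ^ w k - ?l) \<le> C * \<bar>t\<bar>"
      unfolding eventually_at by (intro exI[of _ 1]) auto
    have "((\<lambda>t. C * \<bar>t\<bar>) \<longlongrightarrow> C * \<bar>0\<bar>) (at 0)" by (intro tendsto_intros)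
    then have "((\<lambda>t. C * \<bar>t\<bar>) \<longlongrightarrow> 0) (at 0)" by simp
    from Lim_null_comparison[OF ev this]
    have lim: "((\<lambda>t. Q y (dil w t v) $ k / t ^ w k) \<longlongrightarrow> ?l) (at 0)" by (rule LIM_zero_cancel)
    obtain d where "\<And>s. Q y (dil w s v) $ k = (\<Sum>i\<le>w k. d i * s ^ i)"
      using degree_le_expand[OF degree_Q] by blast
    from polynomial_order_degree[OF this lim] show ?thesis by simp
  qed
  then show ?thesis by (simp add: vec_eq_iff)
qed

lemma bij_Q: "bij (Q y)"
proof -
  have "Q y = psi w Z y \<circ> mul y" by (simp add: fun_eq_iff Q_def)
  then show ?thesis using bij_comp[OF bij_mul bij_psi[OF UNIV_I]] by simp
qed

lemma psi_Q: "psi w Z y x = Q y (mul (- y) x)"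
  by (simp add: Q_def mul_cancel')

lemma derivative_Q: "(Q y has_derivative frechet_derivative (Q y) (at v)) (at v)"
  by (rule smooth_on_has_derivative[of UNIV]) (auto intro: smooth_on_vec smooth_Q)

lemma linear_derivative_Q: "linear (frechet_derivative (Q y) (at v))"
  by (rule has_derivative_linear[OF derivative_Q])

lemma derivative_Q_dil:
  assumes "t \<noteq> 0"
  shows "frechet_derivative (Q y) (at (dil w t v)) (dil w t h) = dil w t (frechet_derivative (Q y) (at v) h)"
proof -
  have "((\<lambda>v. Q y (dil w t v)) has_derivative (\<lambda>h. frechet_derivative (Q y) (at (dil w t v)) (dil w t h))) (at v)"
    by (rule has_derivative_dil_compose[OF derivative_Q])
  moreover have "((\<lambda>v. dil w t (Q y v)) has_derivative (\<lambda>h. dil w t (frechet_derivative (Q y) (at v) h))) (at v)"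
    by (rule bounded_linear.has_derivative[OF bounded_linear_dil derivative_Q])
  ultimately show ?thesis unfolding Q_homogeneous using has_derivative_unique by (metis (no_types, lifting))
qed

lemma pushforward_psi: "pushforward (psi w Z y) (Z j) (Q y v) = frechet_derivative (Q y) (at v) (Z j v)"
proof -
  have i: "inv (psi w Z y) (Q y v) = mul y v"
    unfolding Q_def using bij_psi[of y] by (simp add: bij_is_inj)
  have "(psi w Z y has_derivative frechet_derivative (psi w Z y) (at (mul y v))) (at (mul y v))"
    by (rule differentiableE_frechet[OF differentiable_psi]) simp
  from has_derivative_compose[OF derivative_mul this]
  have "frechet_derivative (Q y) (at v) = (\<lambda>h. frechet_derivative (psi w Z y) (at (mul y v)) (frechet_derivative (mul y) (at v) h))"
    unfolding Q_def[abs_def] by (rule frechet_derivative_eqI)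
  then show ?thesis by (simp add: pushforward_def i Z_mul)
qed

text \<open>Both \<open>Q y\<close> and \<open>Z j\<close> are homogeneous, so the expression under
  the limit is constant for s \<noteq> 0.\<close>

lemma model_field_Q: "model_field_at w Z y j (Q y v) = frechet_derivative (Q y) (at v) (Z j v)"
proof -
  let ?G = "\<lambda>s. s ^ w j *\<^sub>R dil_pullback w s (pushforward (psi w Z y) (Z j)) (Q y v)"
  have "?G s = frechet_derivative (Q y) (at v) (Z j v)" if "s \<noteq> 0" for s
  proof -
    have "?G s = dil w (inverse s) (s ^ w j *\<^sub>R frechet_derivative (Q y) (at (dil w s v)) (Z j (dil w s v)))"
      by (simp add: dil_pullback_eq Q_homogeneous[symmetric] pushforward_psi linear_scale[OF linear_dil])
    also have "s ^ w j *\<^sub>R frechet_derivative (Q y) (at (dil w s v)) (Z j (dil w s v)) =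
        dil w s (frechet_derivative (Q y) (at v) (Z j v))"
      by (simp add: linear_scale[OF linear_derivative_Q, symmetric] Z_homogeneous derivative_Q_dil[OF that])
    finally show ?thesis by (simp add: that)
  qed
  then have "\<forall>\<^sub>F s in at 0. frechet_derivative (Q y) (at v) (Z j v) = ?G s"
    by (auto simp: eventually_at_filter)
  from Lim_transform_eventually[OF tendsto_const this]
  have "(?G \<longlongrightarrow> frechet_derivative (Q y) (at v) (Z j v)) (at 0)" .
  then have "Lim (at 0) ?G = frechet_derivative (Q y) (at v) (Z j v)" by (intro tendsto_Lim) auto
  then show ?thesis by (simp add: model_field_at_def model_field_def)
qed

text \<open>\<open>Q y\<close> carries \<open>V x\<close> to the combination of model fields with
  coefficients \<open>x\<close>, hence the ray through \<open>x\<close> to the flow line that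
  defines the exponential.\<close>

lemma exp_model_Q: "exp_model w Z y x = Q y x"
proof -
  interpret f: frame_family "UNIV :: unit set" UNIV w "\<lambda>_. UNIV" "\<lambda>_. Z" "\<lambda>_. L" "\<lambda>_. y"
    by (rule single_family[OF UNIV_I])
  let ?M = "\<lambda>z. \<Sum>j\<in>UNIV. x $ j *\<^sub>R model_field_at w Z y j z"
  have "?M (Q y v) = frechet_derivative (Q y) (at v) (V x v)" for v
    by (simp add: model_field_Q linear_sum[OF linear_derivative_Q] linear_scale[OF linear_derivative_Q])
  then have "flow_line ?M (Q y 0) (\<lambda>t. Q y (t *\<^sub>R x))"
    using flow_line_compose[OF flow_line_ray, of "Q y" ?M x] derivative_Q unfolding differentiable_def by blast
  moreover have "Q y 0 = 0" by (simp add: Q_def mul_0_right psi_base)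
  ultimately have fl: "flow_line ?M 0 (\<lambda>t. Q y (t *\<^sub>R x))" by simp
  have "time_one_flow ?M 0 = Q y (1 *\<^sub>R x)"
    by (rule time_one_flow_eq[where w=w, OF fl]) (rule f.model_field_dep[OF UNIV_I])
  then show ?thesis by (simp add: exp_model_def)
qed

text \<open>The map \<psi>_y is \<open>Q y\<close> after left translation by -y, and the exponential
  map is \<open>Q y\<close>; the two copies of \<open>Q y\<close> cancel.\<close>

theorem carnot_eps_left_invariant: "carnot_eps w Z y = mul (- y)" "inv (carnot_eps w Z y) = mul y"
proof -
  have e: "exp_model w Z y = Q y" by (simp add: fun_eq_iff exp_model_Q)
  show "carnot_eps w Z y = mul (- y)"
    unfolding carnot_eps_def e using bij_Q[of y] by (simp add: fun_eq_iff psi_Q bij_is_inj)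
  then show "inv (carnot_eps w Z y) = mul y" by (simp add: inv_mul)
qed

end

section \<open>The Dynkin product of a graded bracket\<close>

abbreviation dynkin_degree :: "(nat \<times> nat) list \<Rightarrow> nat" where
  "dynkin_degree ps \<equiv> (\<Sum>(k, l)\<leftarrow>ps. k + l)"

definition dynkin_word :: "(nat \<times> nat) list \<Rightarrow> 'a \<Rightarrow> 'a \<Rightarrow> 'a list" where
  "dynkin_word ps x y = concat (map (\<lambda>(k, l). replicate k x @ replicate l y) ps)"

definition dynkin_coeff :: "(nat \<times> nat) list \<Rightarrow> real" where
  "dynkin_coeff ps = (-1) ^ (length ps - 1) / real (length ps) /
     (real (dynkin_degree ps) * (\<Prod>(k, l)\<leftarrow>ps. fact k * fact l))"

text \<open>The genuine brackets of Dynkin's formula; the two terms of degree 1 are split off as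
  \<open>x + y\<close>.\<close>

definition dynkin_index :: "nat \<Rightarrow> (nat \<times> nat) list set" where
  "dynkin_index r = {ps. ps \<noteq> [] \<and> (0, 0) \<notin> set ps \<and> 2 \<le> dynkin_degree ps \<and> dynkin_degree ps \<le> r}"

lemma dynkin_word_Nil: "dynkin_word [] x y = []"
  by (simp add: dynkin_word_def)

lemma dynkin_word_Cons: "dynkin_word ((k, l) # ps) x y = (replicate k x @ replicate l y) @ dynkin_word ps x y"
  by (simp add: dynkin_word_def)

lemma length_dynkin_word: "length (dynkin_word ps x y) = dynkin_degree ps"
  by (induction ps) (auto simp: dynkin_word_Nil dynkin_word_Cons)

lemma set_dynkin_word: "set (dynkin_word ps x y) \<subseteq> {x, y}"
  by (induction ps) (auto simp: dynkin_word_Nil dynkin_word_Cons)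

lemma map_dynkin_word: "map f (dynkin_word ps x y) = dynkin_word ps (f x) (f y)"
  by (induction ps) (auto simp: dynkin_word_Nil dynkin_word_Cons)

lemma length_le_dynkin_degree: "(0, 0) \<notin> set ps \<Longrightarrow> length ps \<le> dynkin_degree ps"
  by (induction ps) (auto simp: Suc_le_eq)

lemma entry_le_dynkin_degree: "(k, l) \<in> set ps \<Longrightarrow> k + l \<le> dynkin_degree ps"
  by (induction ps) auto

text \<open>Without pairs (0, 0) both the length of the list and its entries are bounded by the
  degree.\<close>

lemma finite_dynkin_index: "finite {ps. (0, 0) \<notin> set ps \<and> dynkin_degree ps \<le> r}"
proof (rule finite_subset)
  show "{ps. (0, 0) \<notin> set ps \<and> dynkin_degree ps \<le> r} \<subseteq>
      {ps. set ps \<subseteq> {..r} \<times> {..r} \<and> length ps \<le> r}"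
    using length_le_dynkin_degree entry_le_dynkin_degree by (fastforce intro: order_trans)
  show "finite {ps. set ps \<subseteq> {..r} \<times> {..r} \<and> length ps \<le> r}"
    by (intro finite_lists_length_le) auto
qed

lemma dynkin_degree_1:
  assumes "(0, 0) \<notin> set ps" "dynkin_degree ps = 1"
  shows "ps = [(1, 0)] \<or> ps = [(0, 1)]"
proof -
  have "length ps \<le> 1" using length_le_dynkin_degree[OF assms(1)] assms(2) by simp
  then obtain p where p: "ps = [p]" using assms(2) by (cases ps) auto
  obtain k l where "p = (k, l)" by fastforce
  then show ?thesis using assms(2) p by (auto simp: add_is_1)
qed

lemma dynkin_product_expand:
  assumes r: "1 \<le> r"
  shows "dynkin_product r br x y =
    x + y + (\<Sum>ps\<in>dynkin_index r. dynkin_coeff ps *\<^sub>R nested_bracket br (dynkin_word ps x y))"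
proof -
  let ?I = "{ps. ps \<noteq> [] \<and> (0, 0) \<notin> set ps \<and> dynkin_degree ps \<le> r}"
  let ?t = "\<lambda>ps. dynkin_coeff ps *\<^sub>R nested_bracket br (dynkin_word ps x y)"
  have fin: "finite ?I" by (rule finite_subset[OF _ finite_dynkin_index[of r]]) auto
  have I: "?I = {[(1, 0)], [(0, 1)]} \<union> dynkin_index r"
  proof
    show "?I \<subseteq> {[(1, 0)], [(0, 1)]} \<union> dynkin_index r"
    proof
      fix ps assume ps: "ps \<in> ?I"
      then have "1 \<le> length ps" by (cases ps) auto
      then have "1 \<le> dynkin_degree ps" using length_le_dynkin_degree[of ps] ps by auto
      then consider "dynkin_degree ps = 1" | "2 \<le> dynkin_degree ps" by linarith
      then show "ps \<in> {[(1, 0)], [(0, 1)]} \<union> dynkin_index r"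
        using ps dynkin_degree_1[of ps] by cases (auto simp: dynkin_index_def)
    qed
    show "{[(1, 0)], [(0, 1)]} \<union> dynkin_index r \<subseteq> ?I" using r by (auto simp: dynkin_index_def)
  qed
  have "dynkin_product r br x y = (\<Sum>ps\<in>?I. ?t ps)"
    unfolding dynkin_product_def dynkin_coeff_def dynkin_word_def ..
  also have "\<dots> = (\<Sum>ps\<in>{[(1, 0)], [(0, 1)]}. ?t ps) + (\<Sum>ps\<in>dynkin_index r. ?t ps)"
    unfolding I by (rule sum.union_disjoint) (use fin I in \<open>auto simp: dynkin_index_def\<close>)
  also have "(\<Sum>ps\<in>{[(1, 0)], [(0, 1)]}. ?t ps) = x + y"
    by (simp add: dynkin_coeff_def dynkin_word_def)
  finally show ?thesis .
qed

text \<open>Antisymmetry collapses brackets of multiples of one vector; the grading yields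
  triangularity, homogeneity and the degree bound of the product.\<close>

locale graded_antisymmetric =
  fixes w :: "'n::finite \<Rightarrow> nat" and br :: "real^'n \<Rightarrow> real^'n \<Rightarrow> real^'n" and \<sigma> :: "'n \<Rightarrow> 'n \<Rightarrow> 'n \<Rightarrow> real"
    and r :: nat
  assumes w_pos: "1 \<le> w j" and r_pos: "1 \<le> r"
    and br: "br u v $ k = (\<Sum>i\<in>UNIV. \<Sum>j\<in>UNIV. if w i + w j = w k then \<sigma> i j k * u $ i * v $ j else 0)"
    and antisym: "\<sigma> j i k = - \<sigma> i j k"
begin

abbreviation mul :: "real^'n \<Rightarrow> real^'n \<Rightarrow> real^'n" where "mul \<equiv> dynkin_product r br"

lemma br_multiples: "br (a *\<^sub>R u) (b *\<^sub>R u) = 0"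
proof -
  let ?t = "\<lambda>k i j. if w i + w j = w k then \<sigma> i j k * (a * u $ i) * (b * u $ j) else 0"
  have "br (a *\<^sub>R u) (b *\<^sub>R u) $ k = 0" for k
  proof -
    have "(\<Sum>i\<in>UNIV. \<Sum>j\<in>UNIV. ?t k i j) = (\<Sum>j\<in>UNIV. \<Sum>i\<in>UNIV. ?t k i j)"
      by (rule sum.swap)
    also have "\<dots> = (\<Sum>j\<in>UNIV. \<Sum>i\<in>UNIV. - ?t k j i)"
      by (intro sum.cong refl) (subst antisym, simp add: add.commute)
    finally show ?thesis by (simp add: br sum_negf cong: if_cong)
  qed
  then show ?thesis by (simp add: vec_eq_iff)
qed

text \<open>The innermost bracket vanishes, and 0 is again a multiple of \<open>u\<close>.\<close>

lemma nested_bracket_multiples: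
  "set us \<subseteq> range (\<lambda>a. a *\<^sub>R u) \<Longrightarrow> 2 \<le> length us \<Longrightarrow> nested_bracket br us = 0"
proof (induction us)
  case (Cons x us)
  have IH: "2 \<le> length us \<Longrightarrow> nested_bracket br us = 0" using Cons.IH Cons.prems(1) by simp
  obtain y vs where us: "us = y # vs" using Cons.prems(2) by (cases us) auto
  obtain a where x: "x = a *\<^sub>R u" using Cons.prems(1) by auto
  show ?case
  proof (cases vs)
    case Nil
    obtain b where "y = b *\<^sub>R u" using Cons.prems(1) us by auto
    then show ?thesis using br_multiples[of a u b] by (simp add: us Nil x)
  next
    case (Cons z zs)
    then have "nested_bracket br us = 0" using IH us by simp
    then show ?thesis using br_multiples[of a u 0] us by (simp add: x)
  qed
qed simp

lemma mul_line: "mul (a *\<^sub>R u) (b *\<^sub>R u) = (a + b) *\<^sub>R u"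
proof -
  have "nested_bracket br (dynkin_word ps (a *\<^sub>R u) (b *\<^sub>R u)) = 0" if "ps \<in> dynkin_index r" for ps
    using that set_dynkin_word[of ps "a *\<^sub>R u" "b *\<^sub>R u"]
    by (intro nested_bracket_multiples[where u=u]) (auto simp: length_dynkin_word dynkin_index_def)
  then show ?thesis by (simp add: dynkin_product_expand[OF r_pos] scaleR_add_left)
qed

text \<open>Both arguments of a bracket contribute positive weight, so a component of weight at most
  \<open>K\<close> of a genuine bracket uses only components of weight below \<open>K\<close>. A
  single vector has no such gain, which explains the two alternatives.\<close>

lemma nested_bracket_dep:
  "list_all2 (\<lambda>u u'. \<forall>l. w l < K \<longrightarrow> u $ l = u' $ l) us us' \<Longrightarrow>
    (w k < K \<or> 2 \<le> length us \<and> w k \<le> K) \<Longrightarrow> nested_bracket br us $ k = nested_bracket br us' $ k"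
proof (induction us arbitrary: us' k)
  case (Cons u us)
  then obtain u' vs' where us': "us' = u' # vs'" by (auto simp: list_all2_Cons1)
  have u: "\<And>l. w l < K \<Longrightarrow> u $ l = u' $ l" and l: "list_all2 (\<lambda>u u'. \<forall>l. w l < K \<longrightarrow> u $ l = u' $ l) us vs'"
    using Cons.prems(1) by (auto simp: us')
  show ?case
  proof (cases us)
    case Nil
    then show ?thesis using l u Cons.prems(2) by (simp add: us')
  next
    case (Cons v vs)
    then obtain v' ws' where vs': "vs' = v' # ws'" using l by (auto simp: list_all2_Cons1)
    have IH: "nested_bracket br us $ j = nested_bracket br vs' $ j" if "w j < K" for j
      using Cons.IH[OF l] that by blast
    have lt: "w i < K \<and> w j < K" if "w i + w j = w k" for i j
      using that w_pos[of i] w_pos[of j] Cons.prems(2) by auto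
    have "br u (nested_bracket br us) $ k = br u' (nested_bracket br vs') $ k"
      unfolding br using lt IH u by (intro sum.cong refl) auto
    then show ?thesis by (simp add: us' vs' Cons)
  qed
qed simp

lemma dynkin_word_list_all2: "P x x' \<Longrightarrow> P y y' \<Longrightarrow> list_all2 P (dynkin_word ps x y) (dynkin_word ps x' y')"
proof (induction ps)
  case (Cons p ps)
  obtain k l where p: "p = (k, l)" by fastforce
  show ?case unfolding p dynkin_word_Cons
    by (intro list_all2_appendI Cons) (auto simp: list_all2_conv_all_nth Cons.prems)
qed (simp add: dynkin_word_def)

lemma triangular_mul: "triangular w (mul y)"
  unfolding triangular_def
proof (intro allI impI)
  fix k and z z' :: "real^'n" assume z: "\<forall>l. w l < w k \<longrightarrow> z $ l = z' $ l"
  have "nested_bracket br (dynkin_word ps y z) $ k = nested_bracket br (dynkin_word ps y z') $ k"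
    if "ps \<in> dynkin_index r" for ps
    using that z by (intro nested_bracket_dep[where K="w k"] dynkin_word_list_all2)
      (auto simp: length_dynkin_word dynkin_index_def)
  then show "mul y z $ k - z $ k = mul y z' $ k - z' $ k"
    by (simp add: dynkin_product_expand[OF r_pos])
qed

lemma br_dil: "br (dil w t u) (dil w t v) = dil w t (br u v)"
proof -
  have e: "t ^ w k = t ^ w i * t ^ w j" if "w i + w j = w k" for i j k
    using that by (metis power_add)
  have "(\<Sum>i\<in>UNIV. \<Sum>j\<in>UNIV. if w i + w j = w k then \<sigma> i j k * (t ^ w i * u $ i) * (t ^ w j * v $ j) else 0) =
    (\<Sum>i\<in>UNIV. \<Sum>j\<in>UNIV. t ^ w k * (if w i + w j = w k then \<sigma> i j k * u $ i * v $ j else 0))" for k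
    by (intro sum.cong refl) (simp add: e)
  then show ?thesis by (simp add: vec_eq_iff br sum_distrib_left cong: if_cong)
qed

lemma nested_bracket_dil: "nested_bracket br (map (dil w t) us) = dil w t (nested_bracket br us)"
proof (induction us)
  case (Cons u us)
  then show ?case by (cases us) (simp_all add: br_dil)
qed (simp add: linear_0[OF linear_dil])

lemma mul_dil: "mul (dil w t x) (dil w t y) = dil w t (mul x y)"
  unfolding dynkin_product_expand[OF r_pos]
  by (simp add: linear_add[OF linear_dil] linear_sum[OF linear_dil] linear_scale[OF linear_dil]
      map_dynkin_word[symmetric] nested_bracket_dil)

text \<open>Stated for lists of curves, since the words mix the constant \<open>y\<close> with the
  dilates of \<open>v\<close>; the grading matches the addition of degrees.\<close>

lemma degree_nested:
  "(\<And>u k. u \<in> set us \<Longrightarrow> degree_le (w k) (\<lambda>s. u s $ k)) \<Longrightarrow>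
    degree_le (w k) (\<lambda>s. nested_bracket br (map (\<lambda>u. u s) us) $ k)"
proof (induction us arbitrary: k)
  case (Cons u us)
  show ?case
  proof (cases us)
    case Nil
    then show ?thesis using Cons.prems by simp
  next
    case (Cons v vs)
    have "degree_le (w k) (\<lambda>s. if w i + w j = w k then \<sigma> i j k * u s $ i * nested_bracket br (map (\<lambda>u. u s) us) $ j else 0)"
      for i j
    proof (cases "w i + w j = w k")
      case True
      have "degree_le (0 + w i + w j) (\<lambda>s. \<sigma> i j k * u s $ i * nested_bracket br (map (\<lambda>u. u s) us) $ j)"
        using Cons.IH Cons.prems by (intro degree_le_mult degree_le_const) auto
      then show ?thesis using True by simp
    qed (simp add: degree_le_const)
    then have "degree_le (w k) (\<lambda>s. br (u s) (nested_bracket br (map (\<lambda>u. u s) us)) $ k)"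
      unfolding br by (intro degree_le_sum)
    then show ?thesis by (simp add: Cons)
  qed
qed (simp add: degree_le_const)

lemma degree_mul: "degree_le (w k) (\<lambda>s. mul y (dil w s v) $ k)"
proof -
  have dv: "degree_le (w k) (\<lambda>s. dil w s v $ k)" for k
    using degree_le.monom[of "w k" "w k" "v $ k"] by (simp add: mult.commute)
  have w: "dynkin_word ps y (dil w s v) = map (\<lambda>u. u s) (dynkin_word ps (\<lambda>_. y) (\<lambda>s. dil w s v))" for ps s
    by (simp add: map_dynkin_word)
  have n: "degree_le (w k) (\<lambda>s. nested_bracket br (dynkin_word ps y (dil w s v)) $ k)" for ps
    unfolding w using set_dynkin_word[of ps "\<lambda>_. y" "\<lambda>s. dil w s v"] dv
    by (intro degree_nested) (auto intro: degree_le_const)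
  have "degree_le (w k) (\<lambda>s. dynkin_coeff ps * nested_bracket br (dynkin_word ps y (dil w s v)) $ k)" for ps
    using degree_le_mult[OF degree_le_const[of 0] n] by simp
  then show ?thesis unfolding dynkin_product_expand[OF r_pos]
    by (simp only: vector_add_component sum_component vector_scaleR_component real_scaleR_def)
      (intro degree_le.add degree_le_sum degree_le_const dv)
qed

lemma mul_in:
  assumes A: "fun_algebra S A" and x: "\<And>k. (\<lambda>s. x s $ k) \<in> A" and y: "\<And>k. (\<lambda>s. y s $ k) \<in> A"
  shows "(\<lambda>s. mul (x s) (y s) $ k) \<in> A"
proof -
  interpret fun_algebra S A by (rule A)
  have nb: "(\<And>u k. u \<in> set us \<Longrightarrow> (\<lambda>s. u s $ k) \<in> A) \<Longrightarrow>
      (\<lambda>s. nested_bracket br (map (\<lambda>u. u s) us) $ k) \<in> A" for us k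
  proof (induction us arbitrary: k)
    case (Cons u us)
    show ?case
    proof (cases us)
      case Nil
      then show ?thesis using Cons.prems by simp
    next
      case (Cons v vs)
      have "(\<lambda>s. if w i + w j = w k then \<sigma> i j k * u s $ i * nested_bracket br (map (\<lambda>u. u s) us) $ j else 0) \<in> A"
        for i j
        using Cons.IH Cons.prems by (cases "w i + w j = w k") (auto intro!: mult const)
      then have "(\<lambda>s. br (u s) (nested_bracket br (map (\<lambda>u. u s) us)) $ k) \<in> A"
        unfolding br by (intro sum)
      then show ?thesis by (simp add: Cons)
    qed
  qed (simp add: const)
  have w: "dynkin_word ps (x s) (y s) = map (\<lambda>u. u s) (dynkin_word ps x y)" for ps s
    by (simp add: map_dynkin_word)
  have n: "(\<lambda>s. nested_bracket br (dynkin_word ps (x s) (y s)) $ k) \<in> A" for ps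
    unfolding w using set_dynkin_word[of ps x y] x y by (intro nb) auto
  show ?thesis unfolding dynkin_product_expand[OF r_pos]
    by (simp only: vector_add_component sum_component vector_scaleR_component real_scaleR_def)
      (intro add sum mult const x y n)
qed

lemma smooth_mul: "smooth_on UNIV (mul y)"
proof (rule smooth_on_vec)
  fix k
  have "(\<lambda>z. mul y z $ k) \<in> {f. smooth_on UNIV f}"
    by (rule mul_in[OF fun_algebra_smooth[OF open_UNIV]]) (auto intro: smooth_on_const smooth_on_coord)
  then show "smooth_on UNIV (\<lambda>z. mul y z $ k)" by simp
qed simp

end

lemma graded_antisymmetric_bracket:
  assumes "\<And>j. 1 \<le> w j" "1 \<le> r" and d: "det (\<chi> i j. X j p $ i) \<noteq> 0"
  shows "graded_antisymmetric w (graded_bracket w X p) (structure_fun X p) r"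
proof
  have s: "structure_fun X p i j = coframe (\<lambda>j. X j p) (lie_bracket (X i) (X j) p)" for i j
    unfolding structure_fun_def by (simp add: coframe_unique[OF d])
  show "structure_fun X p j i k = - structure_fun X p i j k" for i j k
  proof -
    have lb: "lie_bracket (X j) (X i) p = - lie_bracket (X i) (X j) p" by (simp add: lie_bracket_def)
    have "(\<chi> k. structure_fun X p j i k) = - (\<chi> k. structure_fun X p i j k)"
      unfolding s lb by (simp only: linear_neg[OF coframe_linear[OF d]])
    from arg_cong[where f="\<lambda>v. v $ k", OF this] show ?thesis by simp
  qed
qed (use assms in \<open>auto simp: graded_bracket_def\<close>)

section \<open>Carnot coordinates\<close>

lemma lie_bracket_component:
  assumes "V differentiable (at x)" "W differentiable (at x)"
  shows "lie_bracket V W x $ k = lie_derivative V (\<lambda>y. W y $ k) x - lie_derivative W (\<lambda>y. V y $ k) x"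
  by (simp add: lie_bracket_def lie_derivative_def frechet_derivative_component assms)

locale carnot_frame = hframe w U Y L for w :: "'n::finite \<Rightarrow> nat" and U Y L +
  fixes r :: nat
  assumes zero_in: "0 \<in> U" and r_pos: "1 \<le> r"
    and privileged_id: "privileged w Y 0 (\<lambda>x. x)"
    and model_invariant: "left_invariant (group_law r w Y 0) (model_field w j (Y j))"
    and model_at_0: "model_field w j (Y j) 0 = axis j 1"
begin

section \<open>Rescaled jets of the coordinate functions and their limits\<close>

abbreviation Z :: "'n \<Rightarrow> real^'n \<Rightarrow> real^'n" where "Z j \<equiv> model_field w j (Y j)"

lemma adapted_coords: "adapted Y 0 (\<lambda>k x. x $ k)"
  by (rule privileged_adapted[OF privileged_id]) simp

lemma order_coords: "order_ge w Y 0 (w k) (\<lambda>x. x $ k)"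
  by (rule privileged_order[OF privileged_id])

lemma order_D_coord: "order_ge w Y 0 (w k - sum_list (map w I)) (D I (\<lambda>x. x $ k))"
  by (rule order_ge_iterated[OF order_coords])

lemma smooth_coord: "smooth_on U (\<lambda>x. x $ k)"
  by (rule smooth_on_coord[OF open_U])

lemma smooth_D_coord: "smooth_on U (D I (\<lambda>x. x $ k))"
  by (rule smooth_D[OF smooth_coord])

text \<open>For t \<noteq> 0 and \<open>dil w t z\<close> in \<open>U\<close> this is the iterated
  derivative of the k-th coordinate along \<open>scaled_frame w t Y\<close> at \<open>z\<close>, by
  \<open>D_scaled\<close>.\<close>

definition scaled_jet :: "'n list \<Rightarrow> 'n \<Rightarrow> real^'n \<Rightarrow> real \<Rightarrow> real" where
  "scaled_jet I k z t = t ^ sum_list (map w I) * D I (\<lambda>x. x $ k) (dil w t z) / t ^ w k"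

text \<open>The coefficients provided by \<open>rescaling\<close>, chosen once for each
  \<open>I\<close> and \<open>k\<close>, so that a single limit serves all radii and bounds.\<close>

definition jet_coeff :: "'n list \<Rightarrow> 'n \<Rightarrow> ('n \<Rightarrow> nat) \<Rightarrow> real" where
  "jet_coeff I k = (SOME c. (\<forall>\<alpha>. mdeg w \<alpha> + sum_list (map w I) < w k \<longrightarrow> c \<alpha> = 0) \<and>
    order_ge one Y 0 (w k + 1) (remainder (w k + 1) (D I (\<lambda>x. x $ k)) (\<lambda>k x. x $ k) c) \<and>
    (\<forall>\<rho> B. cball 0 \<rho> \<subseteq> U \<longrightarrow> (\<exists>C. \<forall>t z. t \<noteq> 0 \<longrightarrow> \<bar>t\<bar> \<le> 1 \<longrightarrow> norm z \<le> B \<longrightarrow> dil w t z \<in> cball 0 \<rho> \<longrightarrow>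
      \<bar>t ^ sum_list (map w I) * D I (\<lambda>x. x $ k) (dil w t z) / t ^ w k -
        (\<Sum>\<alpha>\<in>{\<alpha>. mdeg w \<alpha> + sum_list (map w I) = w k}. c \<alpha> * mpow (($) z) \<alpha>)\<bar> \<le> C * \<bar>t\<bar>)))"

definition jet_limit :: "'n list \<Rightarrow> 'n \<Rightarrow> real^'n \<Rightarrow> real" where
  "jet_limit I k z = (\<Sum>\<alpha>\<in>{\<alpha>. mdeg w \<alpha> + sum_list (map w I) = w k}. jet_coeff I k \<alpha> * mpow (($) z) \<alpha>)"

lemma jet_coeff_properties:
  shows jet_coeff_low: "mdeg w \<alpha> + sum_list (map w I) < w k \<Longrightarrow> jet_coeff I k \<alpha> = 0"
    and jet_remainder: "order_ge one Y 0 (w k + 1) (remainder (w k + 1) (D I (\<lambda>x. x $ k)) (\<lambda>k x. x $ k) (jet_coeff I k))"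
    and jet_bound: "cball 0 \<rho> \<subseteq> U \<Longrightarrow> \<exists>C. \<forall>t z. t \<noteq> 0 \<longrightarrow> \<bar>t\<bar> \<le> 1 \<longrightarrow> norm z \<le> B \<longrightarrow> dil w t z \<in> cball 0 \<rho> \<longrightarrow>
      \<bar>scaled_jet I k z t - jet_limit I k z\<bar> \<le> C * \<bar>t\<bar>"
proof -
  note * = someI_ex[OF rescaling[OF zero_in adapted_coords order_coords smooth_D_coord order_D_coord, of I k], folded jet_coeff_def]
  show "mdeg w \<alpha> + sum_list (map w I) < w k \<Longrightarrow> jet_coeff I k \<alpha> = 0" using * by blast
  show "order_ge one Y 0 (w k + 1) (remainder (w k + 1) (D I (\<lambda>x. x $ k)) (\<lambda>k x. x $ k) (jet_coeff I k))" using * by blast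
  show "cball 0 \<rho> \<subseteq> U \<Longrightarrow> \<exists>C. \<forall>t z. t \<noteq> 0 \<longrightarrow> \<bar>t\<bar> \<le> 1 \<longrightarrow> norm z \<le> B \<longrightarrow> dil w t z \<in> cball 0 \<rho> \<longrightarrow>
      \<bar>scaled_jet I k z t - jet_limit I k z\<bar> \<le> C * \<bar>t\<bar>"
    unfolding scaled_jet_def jet_limit_def using * by blast
qed

lemma ball_in_U: obtains \<rho> where "\<rho> > 0" "cball 0 \<rho> \<subseteq> U"
  using open_U zero_in open_contains_cball by blast

lemma eventually_dil_in:
  assumes "\<rho> > 0" shows "\<forall>\<^sub>F t in at 0. t \<noteq> 0 \<and> \<bar>t\<bar> \<le> 1 \<and> dil w t z \<in> cball 0 \<rho>"
proof -
  define d where "d = min 1 (\<rho> / (norm z + 1))"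
  have d: "d > 0" using assms by (auto simp: d_def intro!: divide_pos_pos add_nonneg_pos)
  have "dil w t z \<in> cball 0 \<rho>" if "\<bar>t\<bar> < d" for t
  proof -
    have "norm (dil w t z) \<le> norm z * \<bar>t\<bar>" using that by (intro norm_dil_le) (simp add: d_def)
    also have "\<dots> \<le> (norm z + 1) * \<bar>t\<bar>" by (intro mult_right_mono) auto
    also have "\<dots> \<le> (norm z + 1) * (\<rho> / (norm z + 1))"
      using that by (intro mult_left_mono) (auto simp: d_def)
    also have "\<dots> = \<rho>" using norm_ge_zero[of z] by (simp add: add_nonneg_eq_0_iff)
    finally show ?thesis by simp
  qed
  then show ?thesis unfolding eventually_at using d by (intro exI[of _ d]) (auto simp: d_def)
qed

lemma jet_tendsto: "(scaled_jet I k z \<longlongrightarrow> jet_limit I k z) (at 0)"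
proof -
  obtain \<rho> where \<rho>: "\<rho> > 0" "cball 0 \<rho> \<subseteq> U" by (rule ball_in_U)
  obtain C where C: "\<And>t. t \<noteq> 0 \<Longrightarrow> \<bar>t\<bar> \<le> 1 \<Longrightarrow> dil w t z \<in> cball 0 \<rho> \<Longrightarrow>
      \<bar>scaled_jet I k z t - jet_limit I k z\<bar> \<le> C * \<bar>t\<bar>"
    using jet_bound[OF \<rho>(2), of "norm z" I k] by blast
  have ev: "\<forall>\<^sub>F t in at 0. norm (scaled_jet I k z t - jet_limit I k z) \<le> C * \<bar>t\<bar>"
    using eventually_dil_in[OF \<rho>(1), of z] by eventually_elim (use C in auto)
  have "((\<lambda>t. C * \<bar>t\<bar>) \<longlongrightarrow> C * \<bar>0\<bar>) (at 0)" by (intro tendsto_intros)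
  then have "((\<lambda>t. C * \<bar>t\<bar>) \<longlongrightarrow> 0) (at 0)" by simp
  from Lim_null_comparison[OF ev this] show ?thesis by (rule LIM_zero_cancel)
qed

lemma scaled_jet_1: "scaled_jet [j] k z t = scaled_frame w t Y j z $ k"
  by (simp add: scaled_jet_def scaled_frame_component)

lemma Z_component: "Z j z $ k = jet_limit [j] k z"
proof -
  have "(scaled_jet [j] k z \<longlongrightarrow> (\<chi> k. jet_limit [j] k z) $ k) (at 0)" for k using jet_tendsto by simp
  then have "((\<lambda>t. scaled_frame w t Y j z) \<longlongrightarrow> (\<chi> k. jet_limit [j] k z)) (at 0)"
    unfolding scaled_jet_1[abs_def] by (rule vec_tendstoI)
  then have "Lim (at 0) (\<lambda>t. scaled_frame w t Y j z) = (\<chi> k. jet_limit [j] k z)"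
    by (intro tendsto_Lim) auto
  then show ?thesis by (simp add: model_field_def scaled_frame_def)
qed

lemma scaled_frame_tendsto: "((\<lambda>t. scaled_frame w t Y j z) \<longlongrightarrow> Z j z) (at 0)"
proof (rule vec_tendstoI)
  fix k show "((\<lambda>t. scaled_frame w t Y j z $ k) \<longlongrightarrow> Z j z $ k) (at 0)"
    using jet_tendsto[of "[j]" k z] unfolding Z_component scaled_jet_1[abs_def] .
qed

lemma Z_form: "Z j z $ k = (\<Sum>\<alpha>\<in>{\<alpha>. mdeg w \<alpha> + w j = w k}. jet_coeff [j] k \<alpha> * mpow (($) z) \<alpha>)"
  by (simp add: Z_component jet_limit_def)

lemma smooth_monomial: "open V \<Longrightarrow> smooth_on V (\<lambda>x. mpow (($) x) \<alpha>)"
  by (rule smooth_on_mpow) (auto intro: smooth_on_coord)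

lemma smooth_jet_limit: "smooth_on UNIV (jet_limit I k)"
  unfolding jet_limit_def[abs_def]
  by (intro smooth_on_sum smooth_on_mult smooth_on_const smooth_monomial) auto

lemma smooth_Z: "smooth_on UNIV (Z j)"
proof (rule smooth_on_vec)
  show "smooth_on UNIV (\<lambda>x. Z j x $ k)" for k
    using smooth_jet_limit[of "[j]" k] unfolding Z_component[abs_def] by simp
qed simp

lemma power_quotient_tendsto:
  fixes a b :: nat
  assumes "a < b" shows "((\<lambda>t::real. t ^ b / t ^ a) \<longlongrightarrow> 0) (at 0)"
proof -
  have "((\<lambda>t::real. t ^ (b - a)) \<longlongrightarrow> 0 ^ (b - a)) (at 0)" by (intro tendsto_intros)
  then have l: "((\<lambda>t::real. t ^ (b - a)) \<longlongrightarrow> 0) (at 0)" using assms by (simp add: zero_power)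
  show ?thesis
    by (rule Lim_transform_eventually[OF l]) (use assms in \<open>auto simp: eventually_at_filter power_diff\<close>)
qed

text \<open>The limit commutes with the Lie derivative: in the expansion of the jet each monomial is
  homogeneous, so its derivative along Y_i rescales to one along the dilated field, which tends to
  Z_i; the remainder is negligible.\<close>

lemma jet_limit_Cons: "jet_limit (i # I) k z = lie_derivative (Z i) (jet_limit I k) z"
proof -
  let ?b = "sum_list (map w I)" and ?f = "D I (\<lambda>x. x $ k)" and ?c = "jet_coeff I k"
  let ?m = "\<lambda>\<alpha> x. mpow (($) x) \<alpha>" and ?Q = "{\<alpha>::'n \<Rightarrow> nat. mdeg one \<alpha> < w k + 1}"
  define R where "R = remainder (w k + 1) ?f (\<lambda>k x. x $ k) ?c"
  obtain \<rho> where \<rho>: "\<rho> > 0" "cball 0 \<rho> \<subseteq> U" by (rule ball_in_U)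
  have sm: "smooth_on U (?m \<alpha>)" for \<alpha> by (rule smooth_monomial[OF open_U])
  have sR: "smooth_on U R" unfolding R_def by (rule smooth_remainder[OF smooth_D_coord smooth_coord])
  have sLR: "smooth_on U (lie_derivative (Y i) R)" by (rule smooth_lie[OF sR])
  \<comment> \<open>One derivative costs one order; the surplus 1 in \<open>w k + 1\<close> pays for
    it.\<close>
  have "order_ge one Y 0 (w k + 1 - 1) (lie_derivative (Y i) R)"
    unfolding R_def by (rule order_ge_lie[OF jet_remainder])
  then have "order_ge one Y 0 (w k) (lie_derivative (Y i) R)" by simp
  from order_ge_one_bound[OF \<rho>(2) sLR this]
  obtain C where C: "C \<ge> 0" "\<And>x. x \<in> cball 0 \<rho> \<Longrightarrow> \<bar>lie_derivative (Y i) R x\<bar> \<le> C * norm x ^ w k" by auto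
  have fin: "finite ?Q" by (rule finite_mdeg_less) simp
  have split: "lie_derivative (Y i) ?f x = lie_derivative (Y i) R x + (\<Sum>\<alpha>\<in>?Q. ?c \<alpha> * lie_derivative (Y i) (?m \<alpha>) x)"
    if x: "x \<in> U" for x
  proof -
    have d: "?m \<alpha> differentiable (at x)" for \<alpha> by (rule smooth_diff[OF sm x])
    have "?f = (\<lambda>x. R x + (\<Sum>\<alpha>\<in>?Q. ?c \<alpha> * ?m \<alpha> x))" by (simp add: R_def)
    then have "lie_derivative (Y i) ?f x = lie_derivative (Y i) (\<lambda>x. R x + (\<Sum>\<alpha>\<in>?Q. ?c \<alpha> * ?m \<alpha> x)) x" by simp
    also have "\<dots> = lie_derivative (Y i) R x + lie_derivative (Y i) (\<lambda>x. \<Sum>\<alpha>\<in>?Q. ?c \<alpha> * ?m \<alpha> x) x"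
      by (intro lie_derivative_add smooth_diff[OF sR x] differentiable_sum fin ballI differentiable_mult differentiable_const d)
    also have "lie_derivative (Y i) (\<lambda>x. \<Sum>\<alpha>\<in>?Q. ?c \<alpha> * ?m \<alpha> x) x = (\<Sum>\<alpha>\<in>?Q. lie_derivative (Y i) (\<lambda>x. ?c \<alpha> * ?m \<alpha> x) x)"
      by (intro lie_derivative_sum differentiable_mult d) simp
    also have "\<dots> = (\<Sum>\<alpha>\<in>?Q. ?c \<alpha> * lie_derivative (Y i) (?m \<alpha>) x)"
      by (intro sum.cong refl lie_derivative_scale d)
    finally show ?thesis .
  qed
  have mon: "t ^ w i * lie_derivative (Y i) (?m \<alpha>) (dil w t z) =
      t ^ mdeg w \<alpha> * lie_derivative (scaled_frame w t Y i) (?m \<alpha>) z" if "t \<noteq> 0" "dil w t z \<in> U" for t \<alpha>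
  proof -
    have "lie_derivative (scaled_frame w t Y i) (\<lambda>x. ?m \<alpha> (dil w t x)) z = t ^ w i * lie_derivative (Y i) (?m \<alpha>) (dil w t z)"
      by (rule lie_scaled_frame[OF smooth_diff[OF sm that(2)] that(1)])
    moreover have "lie_derivative (scaled_frame w t Y i) (\<lambda>x. t ^ mdeg w \<alpha> * ?m \<alpha> x) z =
        t ^ mdeg w \<alpha> * lie_derivative (scaled_frame w t Y i) (?m \<alpha>) z"
      by (rule lie_derivative_scale, rule smooth_on_differentiable[OF smooth_monomial[OF open_UNIV]]) simp
    ultimately show ?thesis by (simp add: mpow_dil)
  qed
  define T where "T \<alpha> t = ?c \<alpha> * (t ^ (mdeg w \<alpha> + ?b) / t ^ w k * lie_derivative (scaled_frame w t Y i) (?m \<alpha>) z)" for \<alpha> t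
  have T: "(T \<alpha> \<longlongrightarrow> (if mdeg w \<alpha> + ?b = w k then ?c \<alpha> * lie_derivative (Z i) (?m \<alpha>) z else 0)) (at 0)" for \<alpha>
  proof -
    have "linear (frechet_derivative (?m \<alpha>) (at z))"
      by (rule has_derivative_linear[OF smooth_on_has_derivative[OF smooth_monomial[OF open_UNIV]]]) simp
    then have "bounded_linear (frechet_derivative (?m \<alpha>) (at z))" using linear_conv_bounded_linear by blast
    then have l: "((\<lambda>t. lie_derivative (scaled_frame w t Y i) (?m \<alpha>) z) \<longlongrightarrow> lie_derivative (Z i) (?m \<alpha>) z) (at 0)"
      unfolding lie_derivative_def by (rule bounded_linear.tendsto[OF _ scaled_frame_tendsto])
    \<comment> \<open>Lighter monomials have coefficient zero, critical ones converge, heavier ones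
      carry a positive power of t.\<close>
    consider "mdeg w \<alpha> + ?b < w k" | "mdeg w \<alpha> + ?b = w k" | "w k < mdeg w \<alpha> + ?b" by linarith
    then show ?thesis
    proof cases
      case 1
      then have "T \<alpha> = (\<lambda>t. 0)" using jet_coeff_low[OF 1] by (simp add: T_def fun_eq_iff)
      then show ?thesis using 1 by simp
    next
      case 2
      have "((\<lambda>t. ?c \<alpha> * lie_derivative (scaled_frame w t Y i) (?m \<alpha>) z) \<longlongrightarrow> ?c \<alpha> * lie_derivative (Z i) (?m \<alpha>) z) (at 0)"
        by (intro tendsto_mult_left l)
      then have "(T \<alpha> \<longlongrightarrow> ?c \<alpha> * lie_derivative (Z i) (?m \<alpha>) z) (at 0)"
        by (rule Lim_transform_eventually) (auto simp: eventually_at_filter T_def 2)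
      then show ?thesis using 2 by simp
    next
      case 3
      have "(T \<alpha> \<longlongrightarrow> ?c \<alpha> * (0 * lie_derivative (Z i) (?m \<alpha>) z)) (at 0)"
        unfolding T_def by (intro tendsto_mult_left tendsto_mult power_quotient_tendsto 3 l)
      then show ?thesis using 3 by simp
    qed
  qed
  define E where "E t = t ^ (w i + ?b) / t ^ w k * lie_derivative (Y i) R (dil w t z)" for t
  have E: "(E \<longlongrightarrow> 0) (at 0)"
  proof (rule Lim_null_comparison)
    \<comment> \<open>The order \<open>w k\<close> of the differentiated remainder cancels the
      denominator; a positive power of t survives because \<open>w i\<close> is positive.\<close>
    show "\<forall>\<^sub>F t in at 0. norm (E t) \<le> C * norm z ^ w k * \<bar>t\<bar> ^ (w i + ?b)"
      using eventually_dil_in[OF \<rho>(1), of z]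
    proof eventually_elim
      case (elim t)
      have "norm (E t) = \<bar>t\<bar> ^ (w i + ?b) / \<bar>t\<bar> ^ w k * \<bar>lie_derivative (Y i) R (dil w t z)\<bar>"
        by (simp add: E_def abs_mult power_abs)
      also have "\<dots> \<le> \<bar>t\<bar> ^ (w i + ?b) / \<bar>t\<bar> ^ w k * (C * (norm z * \<bar>t\<bar>) ^ w k)"
        using elim C(1) by (intro mult_left_mono order_trans[OF C(2)] power_mono norm_dil_le) auto
      also have "\<dots> = C * norm z ^ w k * \<bar>t\<bar> ^ (w i + ?b)" using elim by (simp add: power_mult_distrib)
      finally show ?case .
    qed
    have "((\<lambda>t::real. C * norm z ^ w k * \<bar>t\<bar> ^ (w i + ?b)) \<longlongrightarrow> C * norm z ^ w k * \<bar>0\<bar> ^ (w i + ?b)) (at 0)"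
      by (intro tendsto_intros)
    moreover have "0 < w i" using w_pos[of i] by simp
    ultimately show "((\<lambda>t::real. C * norm z ^ w k * \<bar>t\<bar> ^ (w i + ?b)) \<longlongrightarrow> 0) (at 0)" by (simp add: zero_power)
  qed
  have "((\<lambda>t. E t + (\<Sum>\<alpha>\<in>?Q. T \<alpha> t)) \<longlongrightarrow>
      0 + (\<Sum>\<alpha>\<in>?Q. if mdeg w \<alpha> + ?b = w k then ?c \<alpha> * lie_derivative (Z i) (?m \<alpha>) z else 0)) (at 0)"
    by (intro tendsto_add E tendsto_sum T)
  moreover have "\<forall>\<^sub>F t in at 0. E t + (\<Sum>\<alpha>\<in>?Q. T \<alpha> t) = scaled_jet (i # I) k z t"
    using eventually_dil_in[OF \<rho>(1), of z]
  proof eventually_elim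
    case (elim t)
    then have t: "t \<noteq> 0" "dil w t z \<in> U" using \<rho>(2) by auto
    have "T \<alpha> t = t ^ (w i + ?b) * (?c \<alpha> * lie_derivative (Y i) (?m \<alpha>) (dil w t z)) / t ^ w k" for \<alpha>
      using mon[OF t, of \<alpha>] by (simp add: T_def power_add mult_ac)
    then show ?case
      by (simp add: scaled_jet_def split[OF t(2)] E_def distrib_left add_divide_distrib sum_distrib_left sum_divide_distrib)
  qed
  ultimately have "(scaled_jet (i # I) k z \<longlongrightarrow>
      (\<Sum>\<alpha>\<in>?Q. if mdeg w \<alpha> + ?b = w k then ?c \<alpha> * lie_derivative (Z i) (?m \<alpha>) z else 0)) (at 0)"
    by (simp add: Lim_transform_eventually)
  then have "jet_limit (i # I) k z =
      (\<Sum>\<alpha>\<in>?Q. if mdeg w \<alpha> + ?b = w k then ?c \<alpha> * lie_derivative (Z i) (?m \<alpha>) z else 0)"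
    using tendsto_unique[OF _ jet_tendsto] by auto
  also have "\<dots> = (\<Sum>\<alpha>\<in>{\<alpha>. mdeg w \<alpha> + ?b = w k}. ?c \<alpha> * lie_derivative (Z i) (?m \<alpha>) z)"
  proof -
    have "{\<alpha>. mdeg w \<alpha> + ?b = w k} \<subseteq> ?Q"
    proof
      fix \<alpha> assume "\<alpha> \<in> {\<alpha>. mdeg w \<alpha> + ?b = w k}"
      moreover have "mdeg one \<alpha> \<le> mdeg w \<alpha>" by (rule mdeg_one_le[OF w_pos])
      ultimately show "\<alpha> \<in> ?Q" by simp
    qed
    then show ?thesis by (intro sum.mono_neutral_cong_right fin) auto
  qed
  also have "\<dots> = lie_derivative (Z i) (jet_limit I k) z"
  proof -
    have d: "?m \<alpha> differentiable (at z)" for \<alpha>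
      by (rule smooth_on_differentiable[OF smooth_monomial[OF open_UNIV]]) simp
    have "lie_derivative (Z i) (jet_limit I k) z =
        (\<Sum>\<alpha>\<in>{\<alpha>. mdeg w \<alpha> + ?b = w k}. lie_derivative (Z i) (\<lambda>x. ?c \<alpha> * ?m \<alpha> x) z)"
      unfolding jet_limit_def[abs_def] by (intro lie_derivative_sum differentiable_mult d) simp
    then show ?thesis by (simp add: lie_derivative_scale[OF d])
  qed
  finally show ?thesis .
qed

lemma jet_limit_eq: "jet_limit I k = iterated_derivative Z I (\<lambda>x. x $ k)"
proof (induction I)
  case Nil
  have "jet_limit [] k z = z $ k" for z
  proof -
    have "((\<lambda>t. z $ k) \<longlongrightarrow> z $ k) (at (0::real))" by simp
    then have "(scaled_jet [] k z \<longlongrightarrow> z $ k) (at 0)"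
      by (rule Lim_transform_eventually) (auto simp: eventually_at_filter scaled_jet_def)
    then show ?thesis using tendsto_unique[OF _ jet_tendsto] by auto
  qed
  then show ?case by (simp add: fun_eq_iff)
next
  case (Cons i I)
  have "jet_limit (i # I) k z = lie_derivative (Z i) (jet_limit I k) z" for z by (rule jet_limit_Cons)
  then show ?case using Cons by (simp add: fun_eq_iff)
qed

section \<open>The model frame and its constant structure functions\<close>

definition L0 :: "'n \<Rightarrow> 'n \<Rightarrow> 'n \<Rightarrow> real^'n \<Rightarrow> real" where
  "L0 i j k x = (if w k = w i + w j then L i j k 0 else 0)"

lemma tendsto_dil_0: "((\<lambda>t. dil w t z) \<longlongrightarrow> 0) (at 0)"
proof (rule Lim_null_comparison)
  show "\<forall>\<^sub>F t in at 0. norm (dil w t z) \<le> norm z * \<bar>t\<bar>"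
    unfolding eventually_at by (intro exI[of _ 1]) (auto intro: norm_dil_le)
  have "((\<lambda>t. norm z * \<bar>t\<bar>) \<longlongrightarrow> norm z * \<bar>0\<bar>) (at 0)" by (intro tendsto_intros)
  then show "((\<lambda>t. norm z * \<bar>t\<bar>) \<longlongrightarrow> 0) (at 0)" by simp
qed

lemma tendsto_along_dil:
  assumes "smooth_on U f" shows "((\<lambda>t. f (dil w t z)) \<longlongrightarrow> f 0) (at 0)"
proof -
  have "isCont f 0"
    using smooth_on_continuous_on[OF assms] zero_in open_U continuous_on_eq_continuous_at by blast
  then show ?thesis using tendsto_dil_0 isCont_tendsto_compose by blast
qed

lemma det_smooth: "smooth_on U (\<lambda>x. det (\<chi> i j. Y j x $ i))"
proof -
  interpret fun_algebra U "{f. smooth_on U f}" by (rule fun_algebra_smooth[OF open_U])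
  show ?thesis using det[of "\<lambda>x. \<chi> i j. Y j x $ i"] smooth_on_component[OF open_U smooth_X] by simp
qed

text \<open>The determinant of the rescaled frame at \<open>z\<close> is that of the original frame
  at the dilated point, which tends to 0. The model fields are therefore independent
  everywhere.\<close>

lemma det_Z: "det (\<chi> i j. Z j z $ i) = det (\<chi> i j. Y j 0 $ i)"
proof -
  have "((\<lambda>t. det (\<chi> i j. scaled_frame w t Y j z $ i)) \<longlongrightarrow> det (\<chi> i j. Z j z $ i)) (at 0)"
    unfolding det_def
    by (intro tendsto_intros) (simp add: tendsto_vec_nth scaled_frame_tendsto)
  moreover have "((\<lambda>t. det (\<chi> i j. scaled_frame w t Y j z $ i)) \<longlongrightarrow> det (\<chi> i j. Y j 0 $ i)) (at 0)"
    by (rule Lim_transform_eventually[OF tendsto_along_dil[OF det_smooth, of z]])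
      (auto simp: eventually_at_filter det_scaled_frame)
  ultimately show ?thesis using tendsto_unique trivial_limit_at by blast
qed

lemma lie_bracket_jets:
  assumes "x \<in> U"
  shows "D [i, j] (\<lambda>x. x $ m) x - D [j, i] (\<lambda>x. x $ m) x = (\<Sum>k\<in>UNIV. L i j k x * D [k] (\<lambda>x. x $ m) x)"
  using lie_commute[OF smooth_coord assms, of i j m] by simp

text \<open>The bracket relations of \<open>Y\<close>, tested on coordinate functions and rescaled,
  pass to the limit; only structure functions with w_k = w_i + w_j survive, frozen at 0.\<close>

lemma Z_bracket: "lie_bracket (Z i) (Z j) z = (\<Sum>k\<in>UNIV. L0 i j k z *\<^sub>R Z k z)"
proof -
  have "lie_bracket (Z i) (Z j) z $ m = (\<Sum>k\<in>UNIV. L0 i j k z * Z k z $ m)" for m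
  proof -
    have Zd: "Z i differentiable (at z)" for i by (rule smooth_on_differentiable[OF smooth_Z]) simp
    have ZL: "(\<lambda>y. Z j y $ m) = jet_limit [j] m" for j by (simp add: Z_component fun_eq_iff)
    have "lie_bracket (Z i) (Z j) z $ m = jet_limit [i, j] m z - jet_limit [j, i] m z"
      unfolding lie_bracket_component[OF Zd Zd] ZL jet_limit_Cons[of _ "[_]"] ..
    moreover have "((\<lambda>t. scaled_jet [i, j] m z t - scaled_jet [j, i] m z t) \<longlongrightarrow>
        jet_limit [i, j] m z - jet_limit [j, i] m z) (at 0)"
      by (intro tendsto_diff jet_tendsto)
    moreover have "((\<lambda>t. scaled_jet [i, j] m z t - scaled_jet [j, i] m z t) \<longlongrightarrow>
        (\<Sum>k\<in>UNIV. L0 i j k z * jet_limit [k] m z)) (at 0)"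
    proof (rule Lim_transform_eventually)
      \<comment> \<open>The case distinction removes the terms whose power of t would blow up;
        \<open>L\<close> vanishes there.\<close>
      let ?T = "\<lambda>k t. if w i + w j < w k then 0 else
        t ^ (w i + w j) / t ^ w k * L i j k (dil w t z) * scaled_jet [k] m z t"
      have "(?T k \<longlongrightarrow> L0 i j k z * jet_limit [k] m z) (at 0)" for k
      proof -
        consider "w i + w j < w k" | "w k = w i + w j" | "w k < w i + w j" by linarith
        then show ?thesis
        proof cases
          case 2
          have "((\<lambda>t. L i j k (dil w t z) * scaled_jet [k] m z t) \<longlongrightarrow> L i j k 0 * jet_limit [k] m z) (at 0)"
            by (intro tendsto_mult tendsto_along_dil smooth_L jet_tendsto)
          then have "(?T k \<longlongrightarrow> L i j k 0 * jet_limit [k] m z) (at 0)"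
            by (rule Lim_transform_eventually) (auto simp: eventually_at_filter 2)
          then show ?thesis using 2 by (simp add: L0_def)
        next
          case 3
          then have "(?T k \<longlongrightarrow> 0 * L i j k 0 * jet_limit [k] m z) (at 0)"
            by (simp only: if_not_P[OF less_not_sym[OF 3]])
              (intro tendsto_mult tendsto_along_dil smooth_L jet_tendsto power_quotient_tendsto)
          then show ?thesis using 3 by (simp add: L0_def)
        qed (auto simp: L0_def)
      qed
      then show "((\<lambda>t. \<Sum>k\<in>UNIV. ?T k t) \<longlongrightarrow> (\<Sum>k\<in>UNIV. L0 i j k z * jet_limit [k] m z)) (at 0)"
        by (intro tendsto_sum)
      obtain \<rho> where \<rho>: "\<rho> > 0" "cball 0 \<rho> \<subseteq> U" by (rule ball_in_U)
      show "\<forall>\<^sub>F t in at 0. (\<Sum>k\<in>UNIV. ?T k t) = scaled_jet [i, j] m z t - scaled_jet [j, i] m z t"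
        using eventually_dil_in[OF \<rho>(1), of z]
      proof eventually_elim
        case (elim t)
        then have t: "t \<noteq> 0" "dil w t z \<in> U" using \<rho>(2) by auto
        have "scaled_jet [i, j] m z t - scaled_jet [j, i] m z t =
            t ^ (w i + w j) * (D [i, j] (\<lambda>x. x $ m) (dil w t z) - D [j, i] (\<lambda>x. x $ m) (dil w t z)) / t ^ w m"
          by (simp add: scaled_jet_def diff_divide_distrib right_diff_distrib add.commute)
        also have "\<dots> = (\<Sum>k\<in>UNIV. t ^ (w i + w j) * (L i j k (dil w t z) * D [k] (\<lambda>x. x $ m) (dil w t z)) / t ^ w m)"
          unfolding lie_bracket_jets[OF t(2)] sum_distrib_left sum_divide_distrib ..
        also have "\<dots> = (\<Sum>k\<in>UNIV. ?T k t)"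
          using t(1) L_zero[OF _ t(2)] by (intro sum.cong refl) (simp add: scaled_jet_def)
        finally show ?case by simp
      qed
    qed
    ultimately show ?thesis
      using tendsto_unique[OF trivial_limit_at] by (simp add: Z_component)
  qed
  then show ?thesis by (simp add: vec_eq_iff)
qed

lemma hframe_Z: "hframe w UNIV Z L0"
proof
  show "det (\<chi> k j. Z j x $ k) \<noteq> 0" for x unfolding det_Z by (rule det_X[OF zero_in])
  show "smooth_on UNIV (L0 i j k)" for i j k unfolding L0_def[abs_def] by (rule smooth_on_const)
  show "lie_bracket (Z i) (Z j) x = (\<Sum>k\<in>UNIV. L0 i j k x *\<^sub>R Z k x)" for x i j by (rule Z_bracket)
qed (auto simp: w_pos[simplified] smooth_Z L0_def)

abbreviation mul :: "real^'n \<Rightarrow> real^'n \<Rightarrow> real^'n" where "mul \<equiv> group_law r w Y 0"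

lemma graded: "graded_antisymmetric w (graded_bracket w Y 0) (structure_fun Y 0) r"
  by (rule graded_antisymmetric_bracket[where X=Y and p=0, OF w_pos r_pos det_X[OF zero_in]])

lemma left_invariant_frame_Z: "left_invariant_frame w Z L0 mul (\<lambda>j. jet_coeff [j])"
proof -
  interpret z: hframe w UNIV Z L0 by (rule hframe_Z)
  interpret g: graded_antisymmetric w "graded_bracket w Y 0" "structure_fun Y 0" r by (rule graded)
  show ?thesis
  proof (unfold_locales, unfold group_law_def)
    show "left_invariant g.mul (Z j)" for j using model_invariant[of j] by (simp add: group_law_def)
    \<comment> \<open>Below weight \<open>w k\<close> the limiting jets contain only monomials of
      positive degree, which vanish at 0.\<close>
    show "order_ge w Z 0 (w k) (\<lambda>x. x $ k)" for k
      unfolding order_ge_def jet_limit_eq[symmetric]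
    proof (intro allI impI)
      fix I assume I: "sum_list (map w I) < w k"
      show "jet_limit I k 0 = 0" unfolding jet_limit_def
      proof (rule sum.neutral, rule ballI)
        fix \<alpha> assume "\<alpha> \<in> {\<alpha>. mdeg w \<alpha> + sum_list (map w I) = w k}"
        then have "\<alpha> \<noteq> (\<lambda>_. 0)" using I by (auto simp: mdeg_def)
        then have "mpow (($) (0::real^'n)) \<alpha> = 0" using mpow_of_zero[of \<alpha>] by (simp add: zero_vec_def vec_lambda_inverse)
        then show "jet_coeff I k \<alpha> * mpow (($) 0) \<alpha> = 0" by simp
      qed
    qed
  qed (auto simp: g.mul_line g.triangular_mul g.smooth_mul g.degree_mul model_at_0 Z_form)
qed

end

section \<open>Weighted estimates\<close>

text \<open>One constant serves both bounds; boundedness is what closes the set under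
  products.\<close>

definition lipschitz_at_0 :: "(real \<times> 'b) set \<Rightarrow> (real \<times> 'b \<Rightarrow> real) set" where
  "lipschitz_at_0 S = {h. \<exists>C. \<forall>s\<in>S. \<bar>h s\<bar> \<le> C \<and> \<bar>h s - h (0, snd s)\<bar> \<le> C * \<bar>fst s\<bar>}"

text \<open>Since |t| is at most 1, a bound at t = 0 and the first-order estimate already bound the
  function.\<close>

lemma lipschitz_at_0I:
  assumes "\<And>s. s \<in> S \<Longrightarrow> \<bar>fst s\<bar> \<le> 1" "\<And>s. s \<in> S \<Longrightarrow> \<bar>h (0, snd s)\<bar> \<le> B"
    "\<And>s. s \<in> S \<Longrightarrow> \<bar>h s - h (0, snd s)\<bar> \<le> C * \<bar>fst s\<bar>"
  shows "h \<in> lipschitz_at_0 S"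
proof -
  have "\<bar>h s\<bar> \<le> \<bar>B\<bar> + \<bar>C\<bar> \<and> \<bar>h s - h (0, snd s)\<bar> \<le> (\<bar>B\<bar> + \<bar>C\<bar>) * \<bar>fst s\<bar>" if s: "s \<in> S" for s
  proof -
    have "C * \<bar>fst s\<bar> \<le> \<bar>C\<bar> * \<bar>fst s\<bar>" by (intro mult_right_mono) auto
    moreover have "\<bar>C\<bar> * \<bar>fst s\<bar> \<le> \<bar>C\<bar> * 1" using assms(1)[OF s] by (intro mult_left_mono) auto
    moreover have "\<bar>C\<bar> * \<bar>fst s\<bar> \<le> (\<bar>B\<bar> + \<bar>C\<bar>) * \<bar>fst s\<bar>" by (intro mult_right_mono) auto
    ultimately show ?thesis using assms(2,3)[OF s] by linarith
  qed
  then show ?thesis unfolding lipschitz_at_0_def by blast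
qed

lemma lipschitz_at_0E:
  assumes "h \<in> lipschitz_at_0 S"
  obtains C where "C \<ge> 0" "\<forall>s\<in>S. \<bar>h s\<bar> \<le> C" "\<forall>s\<in>S. \<bar>h s - h (0, snd s)\<bar> \<le> C * \<bar>fst s\<bar>"
proof -
  obtain C where C: "\<And>s. s \<in> S \<Longrightarrow> \<bar>h s\<bar> \<le> C" "\<And>s. s \<in> S \<Longrightarrow> \<bar>h s - h (0, snd s)\<bar> \<le> C * \<bar>fst s\<bar>"
    using assms unfolding lipschitz_at_0_def by blast
  have "C * \<bar>fst s\<bar> \<le> \<bar>C\<bar> * \<bar>fst s\<bar>" for s :: "real \<times> 'a" by (intro mult_right_mono) auto
  then have 2: "\<bar>h s - h (0, snd s)\<bar> \<le> \<bar>C\<bar> * \<bar>fst s\<bar>" if "s \<in> S" for s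
    using C(2)[OF that] by (rule order_trans[rotated])
  have 1: "\<bar>h s\<bar> \<le> \<bar>C\<bar>" if "s \<in> S" for s using C(1)[OF that] by linarith
  show ?thesis by (rule that[of "\<bar>C\<bar>"]) (use 1 2 in auto)
qed

lemma fun_algebra_lipschitz:
  assumes small: "\<And>s. s \<in> S \<Longrightarrow> \<bar>fst s\<bar> \<le> 1" and base: "\<And>s. s \<in> S \<Longrightarrow> (0, snd s) \<in> S"
  shows "fun_algebra S (lipschitz_at_0 S)"
proof
  show "(\<lambda>s. c) \<in> lipschitz_at_0 S" for c
    by (rule lipschitz_at_0I[where B="\<bar>c\<bar>" and C=0]) (auto intro: small)
next
  fix f g :: "real \<times> 'a \<Rightarrow> real" assume "f \<in> lipschitz_at_0 S" "g \<in> lipschitz_at_0 S"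
  obtain C where C': "C \<ge> 0" "\<forall>s\<in>S. \<bar>f s\<bar> \<le> C" "\<forall>s\<in>S. \<bar>f s - f (0, snd s)\<bar> \<le> C * \<bar>fst s\<bar>"
    by (rule lipschitz_at_0E[OF \<open>f \<in> lipschitz_at_0 S\<close>])
  note C = C'(1) C'(2,3)[rule_format]
  obtain E where E': "E \<ge> 0" "\<forall>s\<in>S. \<bar>g s\<bar> \<le> E" "\<forall>s\<in>S. \<bar>g s - g (0, snd s)\<bar> \<le> E * \<bar>fst s\<bar>"
    by (rule lipschitz_at_0E[OF \<open>g \<in> lipschitz_at_0 S\<close>])
  note E = E'(1) E'(2,3)[rule_format]
  show "(\<lambda>s. f s + g s) \<in> lipschitz_at_0 S"
  proof (rule lipschitz_at_0I[where B="C + E" and C="C + E", OF small])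
    fix s assume s: "s \<in> S"
    show "\<bar>f (0, snd s) + g (0, snd s)\<bar> \<le> C + E" using C(2)[OF base[OF s]] E(2)[OF base[OF s]] by linarith
    show "\<bar>f s + g s - (f (0, snd s) + g (0, snd s))\<bar> \<le> (C + E) * \<bar>fst s\<bar>"
      using C(3)[OF s] E(3)[OF s] unfolding distrib_right by linarith
  qed
  show "(\<lambda>s. f s * g s) \<in> lipschitz_at_0 S"
  proof (rule lipschitz_at_0I[where B="C * E" and C="2 * C * E", OF small])
    fix s assume s: "s \<in> S"
    show "\<bar>f (0, snd s) * g (0, snd s)\<bar> \<le> C * E"
      unfolding abs_mult by (intro mult_mono C(2)[OF base[OF s]] E(2)[OF base[OF s]] C(1)) auto
    have "f s * g s - f (0, snd s) * g (0, snd s) = f s * (g s - g (0, snd s)) + g (0, snd s) * (f s - f (0, snd s))"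
      by (simp add: algebra_simps)
    also have "\<bar>\<dots>\<bar> \<le> \<bar>f s\<bar> * \<bar>g s - g (0, snd s)\<bar> + \<bar>g (0, snd s)\<bar> * \<bar>f s - f (0, snd s)\<bar>"
      by (rule order_trans[OF abs_triangle_ineq]) (simp add: abs_mult)
    also have "\<dots> \<le> C * (E * \<bar>fst s\<bar>) + E * (C * \<bar>fst s\<bar>)"
      by (intro add_mono mult_mono C E base s) auto
    finally show "\<bar>f s * g s - f (0, snd s) * g (0, snd s)\<bar> \<le> 2 * C * E * \<bar>fst s\<bar>" by (simp add: mult_ac)
  qed
next
  fix f g :: "real \<times> 'a \<Rightarrow> real" assume f: "f \<in> lipschitz_at_0 S" and eq: "\<And>s. s \<in> S \<Longrightarrow> f s = g s"
  obtain C where C': "C \<ge> 0" "\<forall>s\<in>S. \<bar>f s\<bar> \<le> C" "\<forall>s\<in>S. \<bar>f s - f (0, snd s)\<bar> \<le> C * \<bar>fst s\<bar>"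
    by (rule lipschitz_at_0E[OF f])
  note C = C'(1) C'(2,3)[rule_format]
  show "g \<in> lipschitz_at_0 S"
  proof (rule lipschitz_at_0I[where B=C and C=C, OF small])
    fix s assume s: "s \<in> S"
    show "\<bar>g (0, snd s)\<bar> \<le> C" "\<bar>g s - g (0, snd s)\<bar> \<le> C * \<bar>fst s\<bar>"
      using C(2)[OF base[OF s]] C(3)[OF s] unfolding eq[OF s] eq[OF base[OF s]] .
  qed
qed

section \<open>The first-order estimate at dilated points\<close>

context carnot_frame
begin

text \<open>The transfer principle is applied with parameter s = (t, x, y) and base point y. At t =
  0 the maps are left translations, so the Lipschitz bound compares the rescaled map with the group
  law; undoing the dilation multiplies component k by t^w_k and produces the exponent w_k +
  1.\<close>

lemma eps_estimate:
  assumes R: "R > 0"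
  shows "\<exists>\<tau>>0. \<forall>k. \<exists>C. \<forall>t x y. t \<noteq> 0 \<longrightarrow> \<bar>t\<bar> \<le> \<tau> \<longrightarrow> norm x \<le> R \<longrightarrow> norm y \<le> R \<longrightarrow>
    \<bar>carnot_eps w Y (dil w t y) (dil w t x) $ k - mul (- dil w t y) (dil w t x) $ k\<bar> \<le> C * \<bar>t\<bar> ^ (w k + 1) \<and>
    \<bar>inv (carnot_eps w Y (dil w t y)) (dil w t x) $ k - mul (dil w t y) (dil w t x) $ k\<bar> \<le> C * \<bar>t\<bar> ^ (w k + 1)"
proof -
  obtain \<rho> where \<rho>: "\<rho> > 0" "cball 0 \<rho> \<subseteq> U" by (rule ball_in_U)
  \<comment> \<open>This keeps |t| at most 1 and all dilated base points in the ball of radius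
    \<rho> inside \<open>U\<close>.\<close>
  define \<tau> where "\<tau> = min 1 (\<rho> / R)"
  have \<tau>: "\<tau> > 0" "\<tau> \<le> 1" using \<rho> R by (simp_all add: \<tau>_def)
  have in_ball: "dil w t y \<in> cball 0 \<rho>" if "\<bar>t\<bar> \<le> \<tau>" "norm y \<le> R" for t y
  proof -
    have "norm (dil w t y) \<le> norm y * \<bar>t\<bar>" using that \<tau> by (intro norm_dil_le) auto
    also have "\<dots> \<le> R * (\<rho> / R)" using that R by (intro mult_mono) (auto simp: \<tau>_def)
    finally show ?thesis using R by simp
  qed
  define S :: "(real \<times> (real^'n) \<times> (real^'n)) set" where "S = {(t, x, y). \<bar>t\<bar> \<le> \<tau> \<and> norm x \<le> R \<and> norm y \<le> R}"
  \<comment> \<open>The value at t = 0 must be set by hand, since the dilation degenerates there;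
    the jet limits make it the continuous extension.\<close>
  define Xs where "Xs s = (if fst s = 0 then Z else scaled_frame w (fst s) Y)" for s :: "real \<times> (real^'n) \<times> (real^'n)"
  define Us where "Us s = (if fst s = 0 then UNIV else dil w (fst s) -` U)" for s :: "real \<times> (real^'n) \<times> (real^'n)"
  define Ls where "Ls s = (if fst s = 0 then L0 else (\<lambda>i j k x. fst s ^ (w i + w j) / fst s ^ w k * L i j k (dil w (fst s) x)))"
    for s :: "real \<times> (real^'n) \<times> (real^'n)"
  define ys where "ys s = snd (snd s)" for s :: "real \<times> (real^'n) \<times> (real^'n)"
  have small: "\<bar>fst s\<bar> \<le> 1" and base: "(0, snd s) \<in> S" if "s \<in> S" for s
    using that \<tau> by (auto simp: S_def)
  have sS: "\<bar>fst s\<bar> \<le> \<tau>" "norm (fst (snd s)) \<le> R" "norm (ys s) \<le> R" if "s \<in> S" for s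
    using that by (auto simp: S_def ys_def)
  have in_U: "dil w (fst s) (ys s) \<in> U" if "s \<in> S" for s
    using in_ball[OF sS(1,3)[OF that]] \<rho>(2) by blast
  have compact_bound: "\<exists>B. \<forall>y. norm y \<le> R \<longrightarrow> \<bar>f y\<bar> \<le> B" if f: "smooth_on UNIV f" for f :: "real^'n \<Rightarrow> real"
  proof -
    have "continuous_on (cball 0 R) f" using smooth_on_continuous_on[OF f] continuous_on_subset by blast
    then have "bounded (f ` cball 0 R)" by (intro compact_imp_bounded compact_continuous_image compact_cball)
    then obtain B where "\<forall>y\<in>cball 0 R. \<bar>f y\<bar> \<le> B" unfolding bounded_real by auto
    then show ?thesis by (intro exI[of _ B]) simp
  qed
  interpret f: frame_family S "lipschitz_at_0 S" w Us Xs Ls ys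
  proof (intro frame_family.intro fun_algebra_lipschitz frame_family_axioms.intro)
    show "1 \<le> w j" for j by (rule w_pos)
    show "hframe w (Us s) (Xs s) (Ls s)" for s
      using hframe_Z scaled_hframe[of "fst s"] by (simp add: Us_def Xs_def Ls_def)
    show "ys s \<in> Us s" if "s \<in> S" for s using in_U[OF that] by (simp add: Us_def)
    \<comment> \<open>The jets are \<open>scaled_jet\<close> for t \<noteq> 0 and
      \<open>jet_limit\<close> for t = 0, so \<open>jet_bound\<close> is exactly the required
      estimate.\<close>
    show "(\<lambda>s. iterated_derivative (Xs s) I (\<lambda>x. x $ k) (ys s)) \<in> lipschitz_at_0 S" for I k
    proof -
      obtain B where B: "\<And>y. norm y \<le> R \<Longrightarrow> \<bar>jet_limit I k y\<bar> \<le> B" using compact_bound[OF smooth_jet_limit] by blast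
      obtain C where C: "\<And>t z. t \<noteq> 0 \<Longrightarrow> \<bar>t\<bar> \<le> 1 \<Longrightarrow> norm z \<le> R \<Longrightarrow> dil w t z \<in> cball 0 \<rho> \<Longrightarrow>
          \<bar>scaled_jet I k z t - jet_limit I k z\<bar> \<le> C * \<bar>t\<bar>"
        using jet_bound[OF \<rho>(2), of R I k] by blast
      have z: "iterated_derivative (Xs (0, q)) I (\<lambda>x. x $ k) (ys (0, q)) = jet_limit I k (snd q)" for q
        by (simp add: Xs_def ys_def jet_limit_eq)
      have nz: "iterated_derivative (Xs s) I (\<lambda>x. x $ k) (ys s) = scaled_jet I k (ys s) (fst s)"
        if s: "s \<in> S" "fst s \<noteq> 0" for s
      proof -
        let ?t = "fst s"
        interpret t: hframe w "dil w ?t -` U" "scaled_frame w ?t Y" "\<lambda>i j k x. ?t ^ (w i + w j) / ?t ^ w k * L i j k (dil w ?t x)"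
          by (rule scaled_hframe[OF s(2)])
        have "iterated_derivative (scaled_frame w ?t Y) I (\<lambda>x. dil w ?t x $ k) (ys s) =
            ?t ^ sum_list (map w I) * D I (\<lambda>x. x $ k) (dil w ?t (ys s))"
          by (rule D_scaled[OF smooth_coord s(2) in_U[OF s(1)]])
        moreover have "iterated_derivative (scaled_frame w ?t Y) I (\<lambda>x. dil w ?t x $ k) (ys s) =
            ?t ^ w k * iterated_derivative (scaled_frame w ?t Y) I (\<lambda>x. x $ k) (ys s)"
          unfolding dil_component
          by (rule t.D_scale[OF smooth_on_coord[OF t.open_U]]) (use in_U[OF s(1)] in simp)
        ultimately show ?thesis using s(2) by (simp add: Xs_def scaled_jet_def field_simps)
      qed
      show ?thesis
      proof (rule lipschitz_at_0I[where B=B and C=C, OF small])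
        fix s assume s: "s \<in> S"
        show "\<bar>iterated_derivative (Xs (0, snd s)) I (\<lambda>x. x $ k) (ys (0, snd s))\<bar> \<le> B"
          unfolding z using sS(3)[OF s] by (intro B) (simp add: ys_def)
        show "\<bar>iterated_derivative (Xs s) I (\<lambda>x. x $ k) (ys s) -
            iterated_derivative (Xs (0, snd s)) I (\<lambda>x. x $ k) (ys (0, snd s))\<bar> \<le> C * \<bar>fst s\<bar>"
        proof (cases "fst s = 0")
          case True
          then have "s = (0, snd s)" by (simp add: prod_eq_iff)
          then show ?thesis by (metis True abs_zero diff_self mult_zero_right order_refl)
        next
          case False
          show ?thesis unfolding z nz[OF s False]
            using C[OF False small[OF s] sS(3)[OF s] in_ball[OF sS(1,3)[OF s]]] by (simp add: ys_def)
        qed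
      qed
    qed
    show "(\<lambda>s. inverse (det (\<chi> i j. Xs s j (ys s) $ i))) \<in> lipschitz_at_0 S"
    proof -
      let ?g = "\<lambda>x. inverse (det (\<chi> i j. Y j x $ i))"
      have h: "inverse (det (\<chi> i j. Xs s j (ys s) $ i)) = ?g (dil w (fst s) (ys s))" for s
      proof (cases "fst s = 0")
        case True
        have "dil w 0 (ys s) = 0" using w_pos by (simp add: vec_eq_iff zero_power Suc_le_eq)
        then show ?thesis using True by (simp add: Xs_def det_Z)
      qed (simp add: Xs_def det_scaled_frame)
      \<comment> \<open>The inverse determinant depends on s only through the dilated base point,
        whose norm is O(t); a smooth function vanishing at 0 is then O(t) as well.\<close>
      have sg: "smooth_on U (\<lambda>x. ?g x - ?g 0)"
        by (intro smooth_on_minus smooth_on_inverse smooth_on_const det_smooth open_U det_X)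
      have "order_ge one Y 0 1 (\<lambda>x. ?g x - ?g 0)" by (rule order_ge_one_1) simp
      from order_ge_one_bound[OF \<rho>(2) sg this]
      obtain C where C: "C \<ge> 0" "\<And>x. x \<in> cball 0 \<rho> \<Longrightarrow> \<bar>?g x - ?g 0\<bar> \<le> C * norm x" by auto
      show ?thesis
      proof (rule lipschitz_at_0I[where B="\<bar>?g 0\<bar>" and C="C * R", OF small])
        fix s assume s: "s \<in> S"
        have d0: "dil w (fst (0, snd s)) (ys (0, snd s)) = 0"
          using w_pos by (simp add: vec_eq_iff zero_power Suc_le_eq)
        show "\<bar>inverse (det (\<chi> i j. Xs (0, snd s) j (ys (0, snd s)) $ i))\<bar> \<le> \<bar>?g 0\<bar>"
          unfolding h d0 ..
        have "norm (dil w (fst s) (ys s)) \<le> R * \<bar>fst s\<bar>"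
          using norm_dil_le[OF small[OF s], of "ys s"] mult_right_mono[OF sS(3)[OF s], of "\<bar>fst s\<bar>"] by simp
        then have "C * norm (dil w (fst s) (ys s)) \<le> C * (R * \<bar>fst s\<bar>)" using C(1) by (intro mult_left_mono)
        then show "\<bar>inverse (det (\<chi> i j. Xs s j (ys s) $ i)) -
            inverse (det (\<chi> i j. Xs (0, snd s) j (ys (0, snd s)) $ i))\<bar> \<le> C * R * \<bar>fst s\<bar>"
          unfolding h d0 using C(2)[OF in_ball[OF sS(1,3)[OF s]]] by simp
      qed
    qed
  qed (use small base in auto)
  interpret l: left_invariant_frame w Z L0 mul "\<lambda>j. jet_coeff [j]" by (rule left_invariant_frame_Z)
  interpret g: graded_antisymmetric w "graded_bracket w Y 0" "structure_fun Y 0" r by (rule graded)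
  have mul_dil: "mul (dil w t a) (dil w t b) = dil w t (mul a b)" for t a b
    unfolding group_law_def by (rule g.mul_dil)
  have dil_minus: "- dil w t a = dil w t (- a)" for t a by (simp add: vec_eq_iff)
  have \<xi>: "(\<lambda>s. fst (snd s) $ k) \<in> lipschitz_at_0 S" for k
    by (rule lipschitz_at_0I[where B=R and C=0, OF small])
      (auto intro: order_trans[OF component_le_norm_cart] sS(2))
  have "\<exists>C. \<forall>t x y. t \<noteq> 0 \<longrightarrow> \<bar>t\<bar> \<le> \<tau> \<longrightarrow> norm x \<le> R \<longrightarrow> norm y \<le> R \<longrightarrow>
    \<bar>carnot_eps w Y (dil w t y) (dil w t x) $ k - mul (- dil w t y) (dil w t x) $ k\<bar> \<le> C * \<bar>t\<bar> ^ (w k + 1) \<and>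
    \<bar>inv (carnot_eps w Y (dil w t y)) (dil w t x) $ k - mul (dil w t y) (dil w t x) $ k\<bar> \<le> C * \<bar>t\<bar> ^ (w k + 1)" for k
  proof -
    obtain C1 where C1': "C1 \<ge> 0" "\<forall>s\<in>S. \<bar>carnot_eps w (Xs s) (ys s) (fst (snd s)) $ k\<bar> \<le> C1" "\<forall>s\<in>S. \<bar>carnot_eps w (Xs s) (ys s) (fst (snd s)) $ k -
        carnot_eps w (Xs (0, snd s)) (ys (0, snd s)) (fst (snd (0::real, snd s))) $ k\<bar> \<le> C1 * \<bar>fst s\<bar>"
      by (rule lipschitz_at_0E[OF f.carnot_eps_in(1)[OF \<xi>, of k]])
    note C1 = C1'(1) C1'(2,3)[rule_format]
    obtain C2 where C2': "C2 \<ge> 0" "\<forall>s\<in>S. \<bar>inv (carnot_eps w (Xs s) (ys s)) (fst (snd s)) $ k\<bar> \<le> C2" "\<forall>s\<in>S. \<bar>inv (carnot_eps w (Xs s) (ys s)) (fst (snd s)) $ k -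
        inv (carnot_eps w (Xs (0, snd s)) (ys (0, snd s))) (fst (snd (0::real, snd s))) $ k\<bar> \<le> C2 * \<bar>fst s\<bar>"
      by (rule lipschitz_at_0E[OF f.carnot_eps_in(2)[OF \<xi>, of k]])
    note C2 = C2'(1) C2'(2,3)[rule_format]
    \<comment> \<open>Undoing the dilation: an error of size t for the rescaled component becomes
      t^w_k times as large.\<close>
    have scale: "\<bar>a - b'\<bar> \<le> (C1 + C2) * \<bar>t\<bar> ^ (w k + 1)"
      if t: "t \<noteq> 0" and b': "b' = t ^ w k * b" and ab: "\<bar>inverse t ^ w k * a - b\<bar> \<le> C * \<bar>t\<bar>" and C: "C \<le> C1 + C2" for a b b' t C :: real
    proof -
      have "a - b' = t ^ w k * (inverse t ^ w k * a - b)"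
        using t by (simp add: b' right_diff_distrib power_inverse)
      then have "\<bar>a - b'\<bar> = \<bar>t\<bar> ^ w k * \<bar>inverse t ^ w k * a - b\<bar>" by (simp add: abs_mult power_abs)
      also have "\<dots> \<le> \<bar>t\<bar> ^ w k * (C * \<bar>t\<bar>)" by (intro mult_left_mono ab) simp
      also have "\<dots> \<le> \<bar>t\<bar> ^ w k * ((C1 + C2) * \<bar>t\<bar>)" by (intro mult_left_mono mult_right_mono C) auto
      finally show ?thesis by (simp add: mult_ac)
    qed
    have "\<bar>carnot_eps w Y (dil w t y) (dil w t x) $ k - mul (- dil w t y) (dil w t x) $ k\<bar> \<le> (C1 + C2) * \<bar>t\<bar> ^ (w k + 1) \<and>
      \<bar>inv (carnot_eps w Y (dil w t y)) (dil w t x) $ k - mul (dil w t y) (dil w t x) $ k\<bar> \<le> (C1 + C2) * \<bar>t\<bar> ^ (w k + 1)"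
      if t: "t \<noteq> 0" "\<bar>t\<bar> \<le> \<tau>" and xy: "norm x \<le> R" "norm y \<le> R" for t x y
    proof -
      have s: "(t, x, y) \<in> S" using t xy by (simp add: S_def)
      have yU: "dil w t y \<in> U" using in_U[OF s] by (simp add: ys_def)
      have 1: "\<bar>inverse t ^ w k * carnot_eps w Y (dil w t y) (dil w t x) $ k - mul (- y) x $ k\<bar> \<le> C1 * \<bar>t\<bar>"
        using C1(3)[OF s] t(1) by (simp add: Xs_def ys_def carnot_eps_scaled[OF t(1) yU] l.carnot_eps_left_invariant l.inv_mul)
      have 2: "\<bar>inverse t ^ w k * inv (carnot_eps w Y (dil w t y)) (dil w t x) $ k - mul y x $ k\<bar> \<le> C2 * \<bar>t\<bar>"
        using C2(3)[OF s] t(1) by (simp add: Xs_def ys_def carnot_eps_scaled[OF t(1) yU] l.carnot_eps_left_invariant l.inv_mul)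
      show ?thesis
        by (intro conjI scale[OF t(1) _ 1] scale[OF t(1) _ 2])
          (use C1(1) C2(1) in \<open>simp_all add: dil_minus mul_dil\<close>)
    qed
    then show ?thesis by blast
  qed
  then show ?thesis using \<tau>(1) by blast
qed

end

section \<open>Homogeneous gauges and polar coordinates\<close>

lemma gauge_zero:
  assumes "homogeneous_gauge w N" "\<And>j. 1 \<le> w j"
  shows "N (0, 0) = 0"
proof -
  have "dil w 0 0 = 0" by (simp add: vec_eq_iff)
  moreover have "N (dil w 0 0, dil w 0 0) = \<bar>0\<bar> * N (0, 0)"
    using assms(1) unfolding homogeneous_gauge_def by blast
  ultimately show ?thesis by simp
qed

text \<open>On the Euclidean unit sphere the gauge is at least some c > 0. A point of gauge 1
  outside the unit ball is dilated onto that sphere by some t in [0, 1]; there its gauge is t, so t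
  is at least c and its k-th coordinates are at most c^-w_k.\<close>

lemma gauge_sphere_bounded:
  fixes w :: "'n::finite \<Rightarrow> nat"
  assumes N: "homogeneous_gauge w N" and w: "\<And>j. 1 \<le> w j"
  obtains R where "R > 0" "\<And>x y. N (x, y) = 1 \<Longrightarrow> norm x \<le> R \<and> norm y \<le> R"
proof -
  let ?K = "{z :: (real^'n) \<times> (real^'n). norm z = 1}"
  have K: "?K = sphere 0 1" by (simp add: set_eq_iff del: split_paired_All)
  have cN: "continuous_on A N" for A using N continuous_on_subset unfolding homogeneous_gauge_def by blast
  have comp: "compact ?K" unfolding K by (rule compact_sphere)
  obtain b :: "(real^'n) \<times> (real^'n)" where "b \<in> Basis" using nonempty_Basis by blast
  then have "b \<in> ?K" by simp
  then have ne: "?K \<noteq> {}" by blast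
  obtain z0 where z0: "z0 \<in> ?K" "\<And>z. z \<in> ?K \<Longrightarrow> N z0 \<le> N z"
    using continuous_attains_inf[OF comp ne cN] by blast
  define c where "c = min 1 (N z0)"
  have "z0 \<noteq> 0" using z0(1) by auto
  then have "N z0 > 0" using N unfolding homogeneous_gauge_def by blast
  then have c: "c > 0" "c \<le> 1" by (simp_all add: c_def)
  have cN_le: "c \<le> N z" if "norm z = 1" for z using z0(2)[of z] that by (simp add: c_def)
  \<comment> \<open>The 1 covers points in the Euclidean unit ball, the sum those outside
    it.\<close>
  define R where "R = 1 + (\<Sum>k\<in>UNIV. (1 / c) ^ w k)"
  have sum0: "0 \<le> (\<Sum>k\<in>UNIV. (1 / c) ^ w k)" using c by (intro sum_nonneg) simp
  have bound: "norm x \<le> R \<and> norm y \<le> R" if xy: "N (x, y) = 1" for x y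
  proof (cases "norm (x, y) \<le> 1")
    case True
    then show ?thesis using norm_fst_le[of x y] norm_snd_le[of y x] sum0 unfolding R_def by linarith
  next
    case False
    let ?f = "\<lambda>t. norm (dil w t x, dil w t y)"
    have "continuous_on {0..1} ?f" unfolding dil_def by (intro continuous_intros)
    moreover have "dil w 0 v = 0" for v :: "real^'n" using w by (simp add: vec_eq_iff zero_power Suc_le_eq)
    then have "?f 0 \<le> 1" by (simp add: zero_prod_def[symmetric])
    moreover have "1 \<le> ?f 1" using False by simp
    ultimately obtain t where t: "0 \<le> t" "t \<le> 1" "?f t = 1" using IVT'[of ?f 0 1 1] by auto
    have "N (dil w t x, dil w t y) = \<bar>t\<bar> * N (x, y)" using N unfolding homogeneous_gauge_def by blast
    then have "N (dil w t x, dil w t y) = t" using xy t(1) by simp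
    then have ct: "c \<le> t" using cN_le[OF t(3)] by simp
    have comp1: "\<bar>v $ k\<bar> \<le> (1 / c) ^ w k" if "norm (dil w t v) \<le> 1" for v :: "real^'n" and k
    proof -
      have "t ^ w k * \<bar>v $ k\<bar> \<le> 1"
        using component_le_norm_cart[of "dil w t v" k] that t(1) by (simp add: abs_mult)
      moreover have "c ^ w k * \<bar>v $ k\<bar> \<le> t ^ w k * \<bar>v $ k\<bar>"
        using ct c by (intro mult_right_mono power_mono) auto
      ultimately have "c ^ w k * \<bar>v $ k\<bar> \<le> 1" by linarith
      then show ?thesis using c by (simp add: power_divide field_simps)
    qed
    have "norm v \<le> R" if "norm (dil w t v) \<le> 1" for v :: "real^'n"
    proof -
      have "norm v \<le> (\<Sum>k\<in>UNIV. \<bar>v $ k\<bar>)" by (rule norm_le_l1_cart)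
      also have "\<dots> \<le> (\<Sum>k\<in>UNIV. (1 / c) ^ w k)" by (intro sum_mono comp1 that)
      finally show ?thesis by (simp add: R_def)
    qed
    moreover have "norm (dil w t x) \<le> 1" "norm (dil w t y) \<le> 1"
      using t(3) norm_fst_le[of "dil w t x" "dil w t y"] norm_snd_le[of "dil w t y" "dil w t x"] by simp_all
    ultimately show ?thesis by blast
  qed
  have "R > 0" using sum0 by (simp add: R_def)
  then show ?thesis using bound by (rule that)
qed

text \<open>Polar coordinates: a nonzero point is the dilate by t = N(z) of a point of gauge 1,
  whose components have norm at most \<open>R\<close>.\<close>

lemma O_weightedI:
  fixes w :: "'n::finite \<Rightarrow> nat" and N :: "(real^'n) \<times> (real^'n) \<Rightarrow> real"
  assumes N: "homogeneous_gauge w N" and w: "\<And>j. 1 \<le> w j"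
    and R: "\<And>x y. N (x, y) = 1 \<Longrightarrow> norm x \<le> R \<and> norm y \<le> R"
    and S: "open S" "(0, 0) \<in> S" "smooth_on S \<Theta>" and \<tau>: "\<tau> > 0" and R0: "R > 0"
    and est: "\<And>k. \<exists>C. \<forall>t x y. t \<noteq> 0 \<longrightarrow> \<bar>t\<bar> \<le> \<tau> \<longrightarrow> norm x \<le> R \<longrightarrow> norm y \<le> R \<longrightarrow>
      \<bar>\<Theta> (dil w t x, dil w t y) $ k\<bar> \<le> C * \<bar>t\<bar> ^ (w k + m)" and m: "m > 0"
  shows "O_weighted w N m \<Theta>"
  unfolding O_weighted_def
proof (intro conjI allI)
  show "\<exists>S. open S \<and> (0, 0) \<in> S \<and> smooth_on S \<Theta>" using S by blast
  fix k
  obtain C where C: "\<And>t x y. t \<noteq> 0 \<Longrightarrow> \<bar>t\<bar> \<le> \<tau> \<Longrightarrow> norm x \<le> R \<Longrightarrow> norm y \<le> R \<Longrightarrow>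
      \<bar>\<Theta> (dil w t x, dil w t y) $ k\<bar> \<le> C * \<bar>t\<bar> ^ (w k + m)" using est by blast
  have N0: "N (0, 0) = 0" by (rule gauge_zero[OF N w])
  \<comment> \<open>The neighbourhood filter includes the origin, where the gauge is 0. The estimate
    at x = y = 0, whose dilates are all the origin, forces the value 0 as t tends to 0.\<close>
  have \<Theta>0: "\<Theta> (0, 0) $ k = 0"
  proof -
    have d0: "dil w t 0 = 0" for t by (simp add: vec_eq_iff)
    have "\<forall>\<^sub>F t in at 0. norm (\<Theta> (0, 0) $ k - 0) \<le> C * \<bar>t\<bar> ^ (w k + m)"
      unfolding eventually_at
      using C[of _ 0 0] \<tau> R0 by (intro exI[of _ \<tau>]) (simp add: d0)
    moreover have "((\<lambda>t::real. C * \<bar>t\<bar> ^ (w k + m)) \<longlongrightarrow> C * \<bar>0\<bar> ^ (w k + m)) (at 0)" by (intro tendsto_intros)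
    then have "((\<lambda>t::real. C * \<bar>t\<bar> ^ (w k + m)) \<longlongrightarrow> 0) (at 0)" using m by (simp add: zero_power)
    ultimately have "((\<lambda>t::real. \<Theta> (0, 0) $ k - 0) \<longlongrightarrow> 0) (at 0)" by (rule Lim_null_comparison)
    then show ?thesis using tendsto_unique[OF trivial_limit_at, OF _ tendsto_const] by force
  qed
  have "isCont N (0, 0)" using N unfolding homogeneous_gauge_def by (simp add: continuous_on_eq_continuous_at)
  then have "(N \<longlongrightarrow> N (0, 0)) (nhds (0, 0))" unfolding isCont_def tendsto_at_iff_tendsto_nhds .
  then have "(N \<longlongrightarrow> 0) (nhds (0, 0))" using N0 by simp
  then have ev: "\<forall>\<^sub>F z in nhds (0, 0). N z < \<tau>" using \<tau> by (rule order_tendstoD)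
  show "(\<lambda>z. \<Theta> z $ k) \<in> O[nhds (0, 0)](\<lambda>z. N z ^ (w k + m))"
  proof (rule bigoI[where c="\<bar>C\<bar>"])
    show "\<forall>\<^sub>F z in nhds (0, 0). norm (\<Theta> z $ k) \<le> \<bar>C\<bar> * norm (N z ^ (w k + m))"
      using ev
    proof eventually_elim
      case (elim z)
      obtain x y where z: "z = (x, y)" by fastforce
      show ?case
      proof (cases "z = 0")
        case True
        then show ?thesis using \<Theta>0 by (simp add: zero_prod_def)
      next
        case False
        then have t: "N z > 0" using N unfolding homogeneous_gauge_def by blast
        let ?t = "N z"
        let ?x = "dil w (inverse ?t) x" and ?y = "dil w (inverse ?t) y"
        have "N (?x, ?y) = \<bar>inverse ?t\<bar> * N (x, y)" using N unfolding homogeneous_gauge_def by blast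
        then have "N (?x, ?y) = 1" using t by (simp add: z)
        then have "norm ?x \<le> R" "norm ?y \<le> R" using R by blast+
        then have "\<bar>\<Theta> (dil w ?t ?x, dil w ?t ?y) $ k\<bar> \<le> C * \<bar>?t\<bar> ^ (w k + m)"
          using t elim by (intro C) auto
        also have "\<dots> \<le> \<bar>C\<bar> * \<bar>?t\<bar> ^ (w k + m)" by (intro mult_right_mono) auto
        finally show ?thesis using t by (simp add: z power_abs)
      qed
    qed
  qed
qed

section \<open>Smoothness in both variables and the weighted estimate\<close>

context carnot_frame
begin

text \<open>The transfer principle with parameter (x, y) and base point y: the jets at y are smooth
  functions of y because the frame is smooth.\<close>

lemma smooth_eps:
  "smooth_on (snd -` U) (\<lambda>(x, y). carnot_eps w Y y x - mul (- y) x)"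
  "smooth_on (snd -` U) (\<lambda>(x, y). inv (carnot_eps w Y y) x - mul y x)"
proof -
  let ?S = "snd -` U :: ((real^'n) \<times> (real^'n)) set"
  have oS: "open ?S" using open_U by (rule open_vimage_snd)
  have sn: "smooth_on ?S (\<lambda>s. f (snd s))" if "smooth_on U f" for f :: "real^'n \<Rightarrow> real"
    by (rule smooth_on_bounded_linear_right[OF bounded_linear_snd open_U that])
  have fs: "smooth_on ?S (\<lambda>s. fst s $ k)" for k
    by (rule smooth_on_component[OF oS smooth_on_bounded_linear[OF bounded_linear_fst oS]])
  interpret f: frame_family ?S "{f. smooth_on ?S f}" w "\<lambda>_. U" "\<lambda>_. Y" "\<lambda>_. L" snd
  proof (intro frame_family.intro fun_algebra_smooth frame_family_axioms.intro oS)
    show "(\<lambda>s. iterated_derivative Y I (\<lambda>x. x $ k) (snd s)) \<in> {f. smooth_on ?S f}" for I k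
      using sn[OF smooth_D_coord] by simp
    have "smooth_on U (\<lambda>x. inverse (det (\<chi> i j. Y j x $ i)))"
      by (intro smooth_on_inverse det_smooth open_U det_X)
    from sn[OF this] show "(\<lambda>s. inverse (det (\<chi> i j. Y j (snd s) $ i))) \<in> {f. smooth_on ?S f}" by simp
  qed (auto simp: hframe_axioms intro: w_pos[simplified])
  interpret g: graded_antisymmetric w "graded_bracket w Y 0" "structure_fun Y 0" r by (rule graded)
  have \<xi>: "(\<lambda>s. fst s $ k) \<in> {f. smooth_on ?S f}" for k using fs by simp
  have y: "(\<lambda>s. snd s $ k) \<in> {f. smooth_on ?S f}" "(\<lambda>s. (- snd s) $ k) \<in> {f. smooth_on ?S f}" for k
    using sn[OF smooth_coord] smooth_on_scale[OF oS sn[OF smooth_coord], of "-1"] by simp_all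
  have mulA: "smooth_on ?S (\<lambda>s. mul (- snd s) (fst s) $ k)" "smooth_on ?S (\<lambda>s. mul (snd s) (fst s) $ k)" for k
    using g.mul_in[OF fun_algebra_smooth[OF oS] y(2) \<xi>, of k] g.mul_in[OF fun_algebra_smooth[OF oS] y(1) \<xi>, of k]
    by (simp_all add: group_law_def)
  have eps: "smooth_on ?S (\<lambda>s. carnot_eps w Y (snd s) (fst s) $ k)" "smooth_on ?S (\<lambda>s. inv (carnot_eps w Y (snd s)) (fst s) $ k)" for k
    using f.carnot_eps_in[OF \<xi>, of k] by simp_all
  show "smooth_on ?S (\<lambda>(x, y). carnot_eps w Y y x - mul (- y) x)"
    by (rule smooth_on_vec[OF oS])
      (simp add: case_prod_unfold smooth_on_minus[OF oS eps(1) mulA(1)])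
  show "smooth_on ?S (\<lambda>(x, y). inv (carnot_eps w Y y) x - mul y x)"
    by (rule smooth_on_vec[OF oS])
      (simp add: case_prod_unfold smooth_on_minus[OF oS eps(2) mulA(2)])
qed

theorem carnot_eps_asymptotics:
  assumes N: "homogeneous_gauge w N"
  shows "O_weighted w N 1 (\<lambda>(x, y). carnot_eps w Y y x - mul (- y) x)"
    "O_weighted w N 1 (\<lambda>(x, y). inv (carnot_eps w Y y) x - mul y x)"
proof -
  obtain R where R: "R > 0" "\<And>x y. N (x, y) = 1 \<Longrightarrow> norm x \<le> R \<and> norm y \<le> R"
    using gauge_sphere_bounded[OF N w_pos] by metis
  obtain \<tau> where \<tau>: "\<tau> > 0" and est: "\<And>k. \<exists>C. \<forall>t x y. t \<noteq> 0 \<longrightarrow> \<bar>t\<bar> \<le> \<tau> \<longrightarrow> norm x \<le> R \<longrightarrow> norm y \<le> R \<longrightarrow>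
    \<bar>carnot_eps w Y (dil w t y) (dil w t x) $ k - mul (- dil w t y) (dil w t x) $ k\<bar> \<le> C * \<bar>t\<bar> ^ (w k + 1) \<and>
    \<bar>inv (carnot_eps w Y (dil w t y)) (dil w t x) $ k - mul (dil w t y) (dil w t x) $ k\<bar> \<le> C * \<bar>t\<bar> ^ (w k + 1)"
    using eps_estimate[OF R(1)] by blast
  have S: "open (snd -` U :: ((real^'n) \<times> (real^'n)) set)" "(0, 0) \<in> (snd -` U :: ((real^'n) \<times> (real^'n)) set)"
    using open_vimage_snd[OF open_U] zero_in by auto
  show "O_weighted w N 1 (\<lambda>(x, y). carnot_eps w Y y x - mul (- y) x)"
  proof (rule O_weightedI[OF N w_pos R(2) S smooth_eps(1) \<tau> R(1)])
    fix k
    show "\<exists>C. \<forall>t x y. t \<noteq> 0 \<longrightarrow> \<bar>t\<bar> \<le> \<tau> \<longrightarrow> norm x \<le> R \<longrightarrow> norm y \<le> R \<longrightarrow>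
      \<bar>(case (dil w t x, dil w t y) of (x, y) \<Rightarrow> carnot_eps w Y y x - mul (- y) x) $ k\<bar> \<le> C * \<bar>t\<bar> ^ (w k + 1)"
      unfolding prod.case vector_minus_component using est[of k] by blast
  qed (assumption, simp)
  show "O_weighted w N 1 (\<lambda>(x, y). inv (carnot_eps w Y y) x - mul y x)"
  proof (rule O_weightedI[OF N w_pos R(2) S smooth_eps(2) \<tau> R(1)])
    fix k
    show "\<exists>C. \<forall>t x y. t \<noteq> 0 \<longrightarrow> \<bar>t\<bar> \<le> \<tau> \<longrightarrow> norm x \<le> R \<longrightarrow> norm y \<le> R \<longrightarrow>
      \<bar>(case (dil w t x, dil w t y) of (x, y) \<Rightarrow> inv (carnot_eps w Y y) x - mul y x) $ k\<bar> \<le> C * \<bar>t\<bar> ^ (w k + 1)"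
      unfolding prod.case vector_minus_component using est[of k] by blast
  qed (assumption, simp)
qed

end

section \<open>Carnot manifolds\<close>

lemma smooth_on_lie_bracket:
  assumes U: "open U" and V: "smooth_on U V" and W: "smooth_on U W"
  shows "smooth_on U (lie_bracket V W)"
proof (rule smooth_on_vec[OF U])
  fix k
  have "smooth_on U (\<lambda>x. lie_derivative V (\<lambda>y. W y $ k) x - lie_derivative W (\<lambda>y. V y $ k) x)"
    by (intro smooth_on_minus smooth_on_lie_derivative smooth_on_component U V W)
  then show "smooth_on U (\<lambda>x. lie_bracket V W x $ k)"
    by (subst smooth_on_cong[OF U])
      (rule lie_bracket_component[OF smooth_on_differentiable[OF V] smooth_on_differentiable[OF W]])
qed

lemma det_independent:
  fixes F :: "'n::finite \<Rightarrow> real^'n"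
  assumes inj: "inj F" and ind: "independent (range F)"
  shows "det (\<chi> i j. F j $ i) \<noteq> 0"
proof -
  let ?M = "\<chi> i j. F j $ i"
  have "c i = 0" if "(\<Sum>i\<in>UNIV. c i *s column i ?M) = 0" for c i
  proof -
    have "(\<Sum>v\<in>range F. c (inv F v) *\<^sub>R v) = (\<Sum>i\<in>UNIV. c i *\<^sub>R F i)"
      by (subst sum.reindex[OF inj]) (simp add: inj)
    also have "\<dots> = (\<Sum>i\<in>UNIV. c i *s column i ?M)"
      by (simp add: vec_eq_iff column_def)
    finally have "(\<Sum>v\<in>range F. c (inv F v) *\<^sub>R v) = 0" using that by simp
    from independentD[OF ind _ _ this, of "F i"] show ?thesis using inj by simp
  qed
  then have "\<exists>B. B ** ?M = mat 1" unfolding matrix_left_invertible_independent_columns by blast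
  then have "invertible ?M" using invertible_left_inverse by blast
  then show ?thesis using invertible_det_nz by blast
qed

lemma coframe_span:
  fixes F :: "'n::finite \<Rightarrow> real^'n"
  assumes d: "det (\<chi> i j. F j $ i) \<noteq> 0" and v: "v \<in> span (F ` B)" and k: "k \<notin> B"
  shows "coframe F v k = 0"
proof -
  have l: "linear (\<lambda>b. coframe F b k)"
    using linear_compose[OF coframe_linear[OF d] bounded_linear.linear[OF bounded_linear_vec_nth[of k]]]
    by (simp add: comp_def)
  have "span (F ` B) \<subseteq> {v. coframe F v k = 0}"
  proof (rule span_minimal)
    show "F ` B \<subseteq> {v. coframe F v k = 0}" using k by (auto simp: coframe_basis[OF d])
    show "subspace {v. coframe F v k = 0}" using linear_subspace_kernel[OF l] .
  qed
  then show ?thesis using v by blast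
qed

text \<open>The position \<open>card {..j}\<close> is the order isomorphism of the index type onto
  1, ..., n.\<close>

lemma card_positions:
  fixes k :: nat
  assumes "k \<le> CARD('n::{finite,linorder})"
  shows "card {j::'n. card {..j} \<le> k} = k"
proof -
  let ?f = "\<lambda>j::'n. card {..j}"
  have "?f i < ?f j" if "i < j" for i j using that by (intro psubset_card_mono) auto
  then have inj: "inj ?f" by (intro linorder_injI) (metis less_irrefl)
  have sub: "range ?f \<subseteq> {1..CARD('n)}"
  proof
    fix m assume "m \<in> range ?f"
    then obtain j where m: "m = ?f j" by blast
    have "j \<in> {..j}" by simp
    then have "0 < ?f j" unfolding card_gt_0_iff by auto
    moreover have "?f j \<le> CARD('n)" by (intro card_mono) auto
    ultimately show "m \<in> {1..CARD('n)}" unfolding m by (simp only: atLeastAtMost_iff One_nat_def Suc_le_eq simp_thms)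
  qed
  have "card (range ?f) = CARD('n)" by (rule card_image[OF inj])
  then have r: "range ?f = {1..CARD('n)}" using sub by (intro card_subset_eq) auto
  have "?f ` {j. ?f j \<le> k} = {1..k}"
  proof
    show "?f ` {j. ?f j \<le> k} \<subseteq> {1..k}"
    proof (rule image_subsetI)
      fix j assume "j \<in> {j. ?f j \<le> k}"
      moreover have "?f j \<in> {1..CARD('n)}" using sub by blast
      ultimately show "?f j \<in> {1..k}" by simp
    qed
    show "{1..k} \<subseteq> ?f ` {j. ?f j \<le> k}"
    proof
      fix m assume m: "m \<in> {1..k}"
      then have "m \<in> range ?f" unfolding r using assms by auto
      then show "m \<in> ?f ` {j. ?f j \<le> k}" using m by auto
    qed
  qed
  then show ?thesis using card_image[OF inj_on_subset[OF inj subset_UNIV], of "{j. ?f j \<le> k}"] by simp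
qed

text \<open>Any admissible rank equals the dimension of one and the same fibre, which resolves the
  definite description.\<close>

lemma bundle_rank_dim:
  assumes "subbundle A k E" "c \<in> A" "q \<in> fst c"
  shows "bundle_rank A E = dim (E c q)"
proof -
  have "k' = dim (E c q)" if "subbundle A k' E" for k'
  proof -
    have "\<forall>c\<in>A. \<forall>p\<in>fst c. subspace (E c p) \<and> dim (E c p) = k'"
      using that unfolding subbundle_def by (rule conjunct1)
    then show ?thesis using assms(2,3) by simp
  qed
  then show ?thesis unfolding bundle_rank_def using assms(1) by (intro the_equality) auto
qed

section \<open>An H-frame read in a chart of a Carnot manifold\<close>

locale carnot_chart =
  fixes A :: "('m::topological_space, 'n::{finite,linorder}) chart set" and r :: nat
    and H :: "nat \<Rightarrow> ('m, 'n) distribution" and V :: "'m set" and X :: "'n \<Rightarrow> ('m, 'n) vfield"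
    and c :: "('m, 'n) chart" and a :: 'm
  assumes manifold: "carnot_manifold A r H" and V: "open V" "a \<in> V" and frame: "H_frame A H V X"
    and c: "c \<in> A" "a \<in> fst c"
begin

abbreviation w :: "'n \<Rightarrow> nat" where "w \<equiv> weight A H"

abbreviation Y :: "'n \<Rightarrow> real^('n::{finite,linorder}) \<Rightarrow> real^('n::{finite,linorder})" where "Y j \<equiv> in_chart c (X j)"

definition U :: "(real^('n::{finite,linorder})) set" where "U = snd c ` (V \<inter> fst c)"

lemma manifold_facts:
  shows charts: "smooth_structure A" and r_pos: "1 \<le> r"
    and subbundle_H: "\<forall>w\<in>{1..r}. \<exists>k. subbundle A k (H w)"
    and filtration_step: "\<forall>w\<in>{1..<r}. \<forall>c\<in>A. \<forall>p\<in>fst c. H w c p \<subseteq> H (Suc w) c p"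
    and top_fibre: "\<forall>c\<in>A. \<forall>p\<in>fst c. H r c p = UNIV"
    and bracket_section: "\<forall>w\<ge>1. \<forall>w'\<ge>1. \<forall>V Y Z. w + w' \<le> r \<and> open V \<and>
        smooth_section A (H w) V Y \<and> smooth_section A (H w') V Z \<longrightarrow>
        smooth_section A (H (w + w')) V (vfield_bracket Y Z)"
proof -
  note m = manifold[unfolded carnot_manifold_def]
  show "smooth_structure A" using m by (elim conjE)
  show "1 \<le> r" using m by (elim conjE)
  show "\<forall>w\<in>{1..r}. \<exists>k. subbundle A k (H w)" using m by (elim conjE)
  show "\<forall>w\<in>{1..<r}. \<forall>c\<in>A. \<forall>p\<in>fst c. H w c p \<subseteq> H (Suc w) c p" using m by (elim conjE)
  show "\<forall>c\<in>A. \<forall>p\<in>fst c. H r c p = UNIV" using m by (elim conjE)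
  show "\<forall>w\<ge>1. \<forall>w'\<ge>1. \<forall>V Y Z. w + w' \<le> r \<and> open V \<and>
        smooth_section A (H w) V Y \<and> smooth_section A (H w') V Z \<longrightarrow>
        smooth_section A (H (w + w')) V (vfield_bracket Y Z)" using m by (elim conjE)
qed

lemma homeo: "homeomorphism (fst c) (snd c ` fst c) (snd c) (chart_inv c)" "open (fst c)" "open (snd c ` fst c)"
proof -
  have "\<forall>c\<in>A. is_chart c" using charts unfolding smooth_structure_def by (rule conjunct1)
  then have "is_chart c" using c(1) by (rule bspec)
  then show "homeomorphism (fst c) (snd c ` fst c) (snd c) (chart_inv c)" "open (fst c)" "open (snd c ` fst c)"
    unfolding is_chart_def by simp_all
qed

lemma chart_inv [simp]: "q \<in> fst c \<Longrightarrow> chart_inv c (snd c q) = q"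
  using homeo(1) by (rule homeomorphism_apply1)

lemma open_U: "open U"
proof -
  have "openin (top_of_set (fst c)) (V \<inter> fst c)" 
    using openin_open_Int[OF V(1), of "fst c"] by (simp add: Int_commute)
  then have "openin (top_of_set (snd c ` fst c)) U"
    unfolding U_def by (rule homeomorphism_imp_open_map[OF homeo(1)])
  then show ?thesis using homeo(3) by (meson openin_open_trans)
qed

lemma in_U: assumes "x \<in> U" obtains q where "q \<in> V" "q \<in> fst c" "x = snd c q" "\<And>j. Y j x = X j c q"
  using assms that by (auto simp: U_def in_chart_def)

lemma bundle_rank: "w0 \<in> {1..r} \<Longrightarrow> q \<in> fst c \<Longrightarrow> bundle_rank A (H w0) = dim (H w0 c q)"
  using bspec[OF subbundle_H] bundle_rank_dim[OF _ c(1)] by metis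

lemma weight_bounds: "1 \<le> w j" "w j \<le> r"
proof -
  have "H r c a = UNIV" using top_fibre c by simp
  then have "bundle_rank A (H r) = CARD('n)" using bundle_rank[of r a] r_pos c(2) by simp
  moreover have "card {..j} \<le> CARD('n)" by (intro card_mono) auto
  ultimately have P: "1 \<le> r \<and> card {..j} \<le> bundle_rank A (H r)" using r_pos by simp
  show "1 \<le> w j" unfolding weight_def using LeastI[of "\<lambda>w. 1 \<le> w \<and> card {..j} \<le> bundle_rank A (H w)", OF P] by blast
  show "w j \<le> r" unfolding weight_def using P by (rule Least_le)
qed

lemma filtration: "1 \<le> w1 \<Longrightarrow> w1 \<le> w2 \<Longrightarrow> w2 \<le> r \<Longrightarrow> q \<in> fst c \<Longrightarrow> H w1 c q \<subseteq> H w2 c q"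
proof (induction w2)
  case (Suc n)
  show ?case
  proof (cases "w1 = Suc n")
    case False
    then have "H n c q \<subseteq> H (Suc n) c q" using filtration_step c(1) Suc.prems by simp
    then show ?thesis using Suc False by auto
  qed simp
qed simp

lemma section_frame: "smooth_section A (H (w j)) V (X j)"
  using frame by (simp add: H_frame_def)

lemma frame_independent: "q \<in> V \<Longrightarrow> q \<in> fst c \<Longrightarrow> inj (\<lambda>j. X j c q)" "q \<in> V \<Longrightarrow> q \<in> fst c \<Longrightarrow> independent (range (\<lambda>j. X j c q))"
  using frame c(1) by (auto simp: H_frame_def)

text \<open>The frame vectors in positions up to the rank lie in the fibre by the filtration, are
  independent, and are as many as its dimension; hence they span it.\<close>

lemma fibre_span:
  assumes q: "q \<in> V" "q \<in> fst c" and w0: "w0 \<in> {1..r}"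
  shows "H w0 c q \<subseteq> span ((\<lambda>j. X j c q) ` {j. w j \<le> w0})"
proof -
  let ?F = "\<lambda>j. X j c q" and ?B = "{j::'n. card {..j} \<le> bundle_rank A (H w0)}"
  have rk: "bundle_rank A (H w0) = dim (H w0 c q)" by (rule bundle_rank[OF w0 q(2)])
  also have "\<dots> \<le> CARD('n)" using dim_subset_UNIV[of "H w0 c q"] by simp
  finally have card: "card ?B = dim (H w0 c q)" using card_positions rk by metis
  have B: "w j \<le> w0" if "j \<in> ?B" for j
    unfolding weight_def using that w0 by (intro Least_le) simp
  have sub: "?F ` ?B \<subseteq> H w0 c q"
  proof (rule image_subsetI)
    fix j assume j: "j \<in> ?B"
    have "?F j \<in> H (w j) c q" using section_frame[of j] c(1) q by (simp add: smooth_section_def)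
    then show "?F j \<in> H w0 c q" using filtration[OF weight_bounds(1) B[OF j] _ q(2)] w0 by auto
  qed
  have ind: "independent (?F ` ?B)" 
    by (rule independent_mono[OF frame_independent(2)[OF q] image_mono[OF subset_UNIV]])
  have "card (?F ` ?B) = card ?B"
    by (rule card_image[OF inj_on_subset[OF frame_independent(1)[OF q] subset_UNIV]])
  then have "dim (H w0 c q) \<le> card (?F ` ?B)" using card by simp
  from card_ge_dim_independent[OF sub ind this] have "H w0 c q \<subseteq> span (?F ` ?B)" .
  also have "\<dots> \<subseteq> span (?F ` {j. w j \<le> w0})" using B by (intro span_mono) auto
  finally show ?thesis .
qed

lemma det_Y: "x \<in> U \<Longrightarrow> det (\<chi> i j. Y j x $ i) \<noteq> 0"
  by (erule in_U) (simp add: det_independent frame_independent)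

lemma smooth_Y: "smooth_on U (Y j)"
  using section_frame[of j] c(1) by (simp add: smooth_section_def smooth_vfield_def U_def)

definition L :: "'n \<Rightarrow> 'n \<Rightarrow> 'n \<Rightarrow> real^('n::{finite,linorder}) \<Rightarrow> real" where
  "L i j k x = coframe (\<lambda>l. Y l x) (lie_bracket (Y i) (Y j) x) k"

lemma bracket_in_fibre:
  assumes "w i + w j \<le> r" "q \<in> V" "q \<in> fst c"
  shows "lie_bracket (Y i) (Y j) (snd c q) \<in> H (w i + w j) c q"
proof -
  have "smooth_section A (H (w i + w j)) V (vfield_bracket (X i) (X j))"
    using bracket_section[rule_format, OF weight_bounds(1) weight_bounds(1)] assms(1) V(1) section_frame by simp
  then show ?thesis using c(1) assms(2,3) by (simp add: smooth_section_def vfield_bracket_def)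
qed

lemma hframe_chart: "hframe w U Y L"
proof
  \<comment> \<open>As \<open>w k\<close> is at most \<open>r\<close>, so is w_i + w_j, and the
    bracket is a section of that step of the filtration. The fibre is spanned by frame vectors of
    weight at most w_i + w_j, among which k does not occur.\<close>
  show "w i + w j < w k \<Longrightarrow> x \<in> U \<Longrightarrow> L i j k x = 0" for i j k x
  proof -
    assume lt: "w i + w j < w k" and x: "x \<in> U"
    obtain q where q: "q \<in> V" "q \<in> fst c" "x = snd c q" "\<And>j. Y j x = X j c q" by (rule in_U[OF x]) blast
    have wr: "w i + w j \<le> r" using lt weight_bounds(2)[of k] by simp
    have w1: "w i + w j \<in> {1..r}" using wr weight_bounds(1)[of i] by simp
    have "lie_bracket (Y i) (Y j) x \<in> H (w i + w j) c q" unfolding q(3) by (rule bracket_in_fibre[OF wr q(1,2)])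
    then have "lie_bracket (Y i) (Y j) x \<in> span ((\<lambda>l. Y l x) ` {l. w l \<le> w i + w j})"
      using fibre_span[OF q(1,2) w1] unfolding q(4) by blast
    then show "L i j k x = 0" unfolding L_def by (rule coframe_span[OF det_Y[OF x]]) (use lt in simp)
  qed
  show "smooth_on U (L i j k)" for i j k
    unfolding L_def[abs_def]
    by (rule smooth_on_coframe[OF open_U smooth_Y smooth_on_lie_bracket[OF open_U smooth_Y smooth_Y] det_Y])
  show "lie_bracket (Y i) (Y j) x = (\<Sum>k\<in>UNIV. L i j k x *\<^sub>R Y k x)" if "x \<in> U" for x i j
    unfolding L_def by (rule coframe_expand[OF det_Y[OF that], symmetric])
qed (use weight_bounds(1) open_U smooth_Y det_Y in auto)

end

theorem proposition8p7:
  fixes A :: "('m::{t2_space,second_countable_topology}, 'n::{finite,linorder}) chart set"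
    and r :: nat
    and H :: "nat \<Rightarrow> ('m, 'n) distribution"
    and X :: "'n \<Rightarrow> ('m, 'n) vfield"
    and V :: "'m set" and a :: 'm
    and c :: "('m, 'n) chart"
    and N :: "(real^('n::{finite,linorder})) \<times> (real^('n::{finite,linorder})) \<Rightarrow> real"
    and w :: "'n \<Rightarrow> nat"
    and Y :: "'n \<Rightarrow> real^('n::{finite,linorder}) \<Rightarrow> real^('n::{finite,linorder})"
  assumes "carnot_manifold A r H"
    and "open V" and "a \<in> V" and "H_frame A H V X"
    and "carnot_coordinates A r H X a c"
    and "w = weight A H"
    and "Y = (\<lambda>j. in_chart c (X j))"
    and "homogeneous_gauge w N"
  shows "O_weighted w N 1 (\<lambda>(x, y). carnot_eps w Y y x - group_law r w Y 0 (- y) x) \<and>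
    O_weighted w N 1 (\<lambda>(x, y). inv (carnot_eps w Y y) x - group_law r w Y 0 y x)"
proof -
  have c: "c \<in> A" "a \<in> fst c" "snd c a = 0" "privileged w Y 0 (\<lambda>x. x)"
    "\<And>j. left_invariant (group_law r w Y 0) (model_field w j (Y j))" "\<And>j. model_field w j (Y j) 0 = axis j 1"
    using assms(5) by (auto simp: carnot_coordinates_def Let_def assms(6,7))
  interpret ch: carnot_chart A r H V X c a
    by unfold_locales (use assms c in auto)
  have "hframe w ch.U Y ch.L" using ch.hframe_chart by (simp add: assms(6,7))
  then interpret hframe w ch.U Y ch.L .
  interpret carnot_frame w ch.U Y ch.L r
  proof
    show "0 \<in> ch.U" using c(2,3) assms(3) unfolding ch.U_def by force
  qed (use c ch.r_pos in auto)
  show ?thesis using carnot_eps_asymptotics[OF assms(8)] by blast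
qed

end
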